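(* Let $n\ge 5$. Then the Dehn function of $\mathrm{SL}(n,\mathbb{Z})$ satisfies $$\delta_{\mathrm{SL}(n,\mathbb{Z})}(\ell)\lesssim \ell^4 .$$
   Context: Let $H=\langle h_1,\dots,h_d\mid r_1,\dots,r_s\rangle$ be a finitely presented group. For a word $w$ in the generators $h_i$ and their formal inverses (words need not be reduced) that represents the identity of $H$, the filling area $\delta_H(w)$ is the minimal number of applications of relators (insertion or deletion of some $r_i$) in a sequence of steps transforming $w$ into the empty word, where each step is a free expansion, a free reduction, or the application of a relator. The Dehn function of $H$ is $\delta_H(n)=\max\{\delta_H(w)\mid w \text{ represents the identity and has length } \ell(w)\le n\}$. For functions $f,g:\mathbb{N}\to\mathbb{N}$, $f\lesssim g$ means that there is a constant $c$ such that $f(n)\le c\,g(cn+c)+c$ for all $n$. The Dehn function depends on the finite presentation only up to the equivalence "$f\lesssim g$ and $g\lesssim f$", so the claim does not depend on the choice of a finite presentation of $\mathrm{SL}(n,\mathbb{Z})$. *)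

theory Defs
  imports "Jordan_Normal_Form.Determinant" "HOL-Algebra.Generated_Groups"
begin

text \<open>
  Words over the generators \<open>h\<^sub>0, \<dots>, h\<^sub>d\<^sub>-\<^sub>1\<close> and their formal inverses.  The generators are
  represented by their indices, so that words are not tied to a particular group.
\<close>

datatype letter = Gen (index: nat) | GenInv (index: nat)

type_synonym word = "letter list"

fun inv_letter :: "letter \<Rightarrow> letter" where
  "inv_letter (Gen i) = GenInv i"
| "inv_letter (GenInv i) = Gen i"

definition words :: "nat \<Rightarrow> word set" where
  "words d = {w. \<forall>x \<in> set w. index x < d}"


section \<open>Free groups\<close>

text \<open>
  The free group of rank \<open>d\<close> consists of the reduced words; \<open>reduced_cons x w\<close> is the reduced
  form of \<open>x # w\<close> whenever \<open>w\<close> is reduced, and \<open>reduced_form w\<close> is the unique reduced word that is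
  freely equal to \<open>w\<close>.
\<close>

fun reduced :: "word \<Rightarrow> bool" where
  "reduced (x # y # w) \<longleftrightarrow> y \<noteq> inv_letter x \<and> reduced (y # w)"
| "reduced _ \<longleftrightarrow> True"

fun reduced_cons :: "letter \<Rightarrow> word \<Rightarrow> word" where
  "reduced_cons x [] = [x]"
| "reduced_cons x (y # w) = (if y = inv_letter x then w else x # y # w)"

definition reduced_form :: "word \<Rightarrow> word" where
  "reduced_form w = foldr reduced_cons w []"

definition free_group :: "nat \<Rightarrow> word monoid" where
  "free_group d = \<lparr>carrier = {w \<in> words d. reduced w}, 
                   monoid.mult = (\<lambda>u v. reduced_form (u @ v)), one = []\<rparr>"

lemma inv_letter_inv_letter [simp]: "inv_letter (inv_letter x) = x"
  by (cases x) auto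

lemma index_inv_letter [simp]: "index (inv_letter x) = index x"
  by (cases x) auto

lemma inv_letter_eq_iff: "inv_letter x = y \<longleftrightarrow> x = inv_letter y"
  by auto

lemma words_simps [simp]:
  "[] \<in> words d" 
  "x # w \<in> words d \<longleftrightarrow> index x < d \<and> w \<in> words d"
  "u @ v \<in> words d \<longleftrightarrow> u \<in> words d \<and> v \<in> words d"
  by (auto simp: words_def)

lemma reduced_ConsD: "reduced (x # w) \<Longrightarrow> reduced w"
  by (cases w) auto

lemma reduced_reduced_cons: "reduced w \<Longrightarrow> reduced (reduced_cons x w)"
  by (cases w) (auto dest: reduced_ConsD)

lemma reduced_cons_cancel: "reduced w \<Longrightarrow> reduced_cons x (reduced_cons (inv_letter x) w) = w"
  by (cases w rule: reduced.cases) auto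

lemma reduced_foldr: "reduced v \<Longrightarrow> reduced (foldr reduced_cons u v)"
  by (induction u) (auto intro: reduced_reduced_cons)

lemma reduced_reduced_form: "reduced (reduced_form w)"
  unfolding reduced_form_def by (rule reduced_foldr) simp

lemma reduced_form_reduced: "reduced w \<Longrightarrow> reduced_form w = w"
proof (induction w)
  case (Cons x w)
  hence "reduced_form w = w" by (auto dest: reduced_ConsD)
  thus ?case using Cons.prems by (cases w) (auto simp: reduced_form_def)
qed (simp add: reduced_form_def)

lemma reduced_cons_words: "w \<in> words d \<Longrightarrow> index x < d \<Longrightarrow> reduced_cons x w \<in> words d"
  by (cases w) auto

lemma reduced_form_words: "w \<in> words d \<Longrightarrow> reduced_form w \<in> words d"
  by (induction w) (auto simp: reduced_form_def intro: reduced_cons_words)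

lemma foldr_reduced_form:
  assumes "reduced v"
  shows "foldr reduced_cons (reduced_form u) v = foldr reduced_cons u v"
proof (induction u)
  case (Cons x u)
  have "foldr reduced_cons (reduced_cons x (reduced_form u)) v =
          reduced_cons x (foldr reduced_cons (reduced_form u) v)"
    by (cases "reduced_form u")
       (auto simp: reduced_cons_cancel reduced_foldr assms)
  thus ?case using Cons by (simp add: reduced_form_def)
qed (simp add: reduced_form_def)

lemma reduced_form_append: 
  "reduced_form (reduced_form u @ v) = reduced_form (u @ v)"
  "reduced_form (u @ reduced_form v) = reduced_form (u @ v)"
  using foldr_reduced_form[OF reduced_reduced_form, of u v]
  by (auto simp: reduced_form_def[of "_ @ _"] simp flip: reduced_form_def)
     (simp add: reduced_form_reduced reduced_reduced_form)

definition inv_word :: "word \<Rightarrow> word" where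
  "inv_word w = rev (map inv_letter w)"

lemma inv_word_cancel: "reduced_form (inv_word w @ w) = []"
proof (induction w)
  case (Cons x w)
  have "foldr reduced_cons [inv_letter x, x] (reduced_form w) = reduced_form w"
    using reduced_cons_cancel[OF reduced_reduced_form, of "inv_letter x" w] by simp
  thus ?case using Cons by (simp add: inv_word_def reduced_form_def)
qed (simp add: reduced_form_def inv_word_def)

lemma inv_word_words: "w \<in> words d \<Longrightarrow> inv_word w \<in> words d"
  by (auto simp: words_def inv_word_def)

lemma group_free_group: "group (free_group d)"
proof (rule groupI)
  fix w assume "w \<in> carrier (free_group d)"
  thus "\<exists>v \<in> carrier (free_group d). v \<otimes>\<^bsub>free_group d\<^esub> w = \<one>\<^bsub>free_group d\<^esub>"
    by (intro bexI[of _ "reduced_form (inv_word w)"])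
       (auto simp: free_group_def reduced_form_append inv_word_cancel 
          reduced_reduced_form inv_word_words reduced_form_words)
qed (auto simp: free_group_def reduced_form_append reduced_reduced_form 
       reduced_form_words reduced_form_reduced)


section \<open>Finite presentations\<close>

definition normal_closure :: "('a, 'b) monoid_scheme \<Rightarrow> 'a set \<Rightarrow> 'a set" where
  "normal_closure G S = 
     generate G {g \<otimes>\<^bsub>G\<^esub> s \<otimes>\<^bsub>G\<^esub> inv\<^bsub>G\<^esub> g | g s. g \<in> carrier G \<and> s \<in> S}"

fun letter_value :: "('a, 'b) monoid_scheme \<Rightarrow> (nat \<Rightarrow> 'a) \<Rightarrow> letter \<Rightarrow> 'a" where
  "letter_value H h (Gen i) = h i"
| "letter_value H h (GenInv i) = inv\<^bsub>H\<^esub> (h i)"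

fun word_value :: "('a, 'b) monoid_scheme \<Rightarrow> (nat \<Rightarrow> 'a) \<Rightarrow> word \<Rightarrow> 'a" where
  "word_value H h [] = \<one>\<^bsub>H\<^esub>"
| "word_value H h (x # w) = letter_value H h x \<otimes>\<^bsub>H\<^esub> word_value H h w"

text \<open>
  \<open>H = \<langle>h\<^sub>0, \<dots>, h\<^sub>d\<^sub>-\<^sub>1 | R\<rangle>\<close>: the canonical homomorphism from the free group of rank \<open>d\<close> to \<open>H\<close> is
  onto, and its kernel is the normal closure of the relators.  Relators need not be reduced words.
\<close>

definition finite_presentation ::
    "('a, 'b) monoid_scheme \<Rightarrow> nat \<Rightarrow> (nat \<Rightarrow> 'a) \<Rightarrow> word set \<Rightarrow> bool" where
  "finite_presentation H d h R \<longleftrightarrow>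
     group H \<and> (\<forall>i<d. h i \<in> carrier H) \<and> finite R \<and> R \<subseteq> words d \<and>
     word_value H h ` carrier (free_group d) = carrier H \<and>
     {w \<in> carrier (free_group d). word_value H h w = \<one>\<^bsub>H\<^esub>} =
       normal_closure (free_group d) (reduced_form ` R)"


section \<open>Dehn functions\<close>

text \<open>
  \<open>transforms d R v w k\<close>: some sequence of free expansions, free reductions and exactly \<open>k\<close>
  applications of relators transforms \<open>v\<close> into \<open>w\<close>.
\<close>

inductive transforms :: "nat \<Rightarrow> word set \<Rightarrow> word \<Rightarrow> word \<Rightarrow> nat \<Rightarrow> bool"
  for d R v where
  refl: "transforms d R v v 0"
| expansion: "transforms d R v (u @ w) k \<Longrightarrow> index x < d \<Longrightarrow> 
                transforms d R v (u @ [x, inv_letter x] @ w) k"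
| reduction: "transforms d R v (u @ [x, inv_letter x] @ w) k \<Longrightarrow> transforms d R v (u @ w) k"
| insertion: "transforms d R v (u @ w) k \<Longrightarrow> r \<in> R \<Longrightarrow> transforms d R v (u @ r @ w) (Suc k)"
| deletion: "transforms d R v (u @ r @ w) k \<Longrightarrow> r \<in> R \<Longrightarrow> transforms d R v (u @ w) (Suc k)"

definition filling_area :: "nat \<Rightarrow> word set \<Rightarrow> word \<Rightarrow> nat" where
  "filling_area d R w = (LEAST k. transforms d R w [] k)"

definition dehn_function ::
    "('a, 'b) monoid_scheme \<Rightarrow> nat \<Rightarrow> (nat \<Rightarrow> 'a) \<Rightarrow> word set \<Rightarrow> nat \<Rightarrow> nat" where
  "dehn_function H d h R n =
     Max {filling_area d R w | w. w \<in> words d \<and> word_value H h w = \<one>\<^bsub>H\<^esub> \<and> length w \<le> n}"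

definition coarsely_le :: "(nat \<Rightarrow> nat) \<Rightarrow> (nat \<Rightarrow> nat) \<Rightarrow> bool" where
  "coarsely_le f g \<longleftrightarrow> (\<exists>c. \<forall>n. f n \<le> c * g (c * n + c) + c)"

lemma transforms_trans:
  "transforms d R v w l \<Longrightarrow> transforms d R u v k \<Longrightarrow> transforms d R u w (k + l)"
  by (induction rule: transforms.induct) (auto intro: transforms.intros simp del: append.simps)

lemma transforms_context: 
  "transforms d R v w k \<Longrightarrow> transforms d R (a @ v @ b) (a @ w @ b) k"
proof (induction rule: transforms.induct)
  case (expansion u w k x)
  thus ?case using transforms.expansion[of d R "a @ v @ b" "a @ u" "w @ b" k x] by simp
next
  case (reduction u x w k)
  thus ?case using transforms.reduction[of d R "a @ v @ b" "a @ u" x "w @ b" k] by simp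
next
  case (insertion u w k r)
  thus ?case using transforms.insertion[of d R "a @ v @ b" "a @ u" "w @ b" k r] by simp
next
  case (deletion u r w k)
  thus ?case using transforms.deletion[of d R "a @ v @ b" "a @ u" r "w @ b" k] by simp
qed (rule transforms.refl)

lemma transforms_sym:
  assumes "transforms d R v w k" "v \<in> words d" "R \<subseteq> words d"
  shows "w \<in> words d \<and> transforms d R w v k"
  using assms(1)
proof (induction rule: transforms.induct)
  case refl
  thus ?case using assms by (auto intro: transforms.refl)
next
  case (expansion u w k x)
  hence "transforms d R (u @ [x, inv_letter x] @ w) (u @ w) 0"
    by (intro transforms.reduction[OF transforms.refl])
  thus ?case using transforms_trans[of d R "u @ w" v k _ 0] expansion by auto
next
  case (reduction u x w k)
  hence "transforms d R (u @ w) (u @ [x, inv_letter x] @ w) 0"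
    by (intro transforms.expansion[OF transforms.refl]) auto
  thus ?case using transforms_trans[of d R "u @ [x, inv_letter x] @ w" v k _ 0] reduction by auto
next
  case (insertion u w k r)
  hence "transforms d R (u @ r @ w) (u @ w) 1"
    using transforms.deletion[OF transforms.refl] by simp
  thus ?case using transforms_trans[of d R "u @ w" v k _ 1] insertion assms(3) by auto
next
  case (deletion u r w k)
  hence "transforms d R (u @ w) (u @ r @ w) 1"
    using transforms.insertion[OF transforms.refl] by simp
  thus ?case using transforms_trans[of d R "u @ r @ w" v k _ 1] deletion by auto
qed

lemma transforms_reduced_form: "transforms d R w (reduced_form w) 0"
proof (induction w)
  case (Cons x w)
  have 1: "transforms d R (x # w) (x # reduced_form w) 0"
    using transforms_context[OF Cons, of "[x]" "[]"] by simp
  have "transforms d R (x # reduced_form w) (reduced_cons x (reduced_form w)) 0"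
    using transforms.reduction[OF transforms.refl, of d R "[]" x]
    by (cases "reduced_form w") (auto intro: transforms.refl)
  from transforms_trans[OF this 1] show ?case by (simp add: reduced_form_def)
qed (simp add: reduced_form_def transforms.refl)

lemma inv_free_group:
  assumes "w \<in> carrier (free_group d)"
  shows "inv\<^bsub>free_group d\<^esub> w = reduced_form (inv_word w)"
proof -
  have "reduced_form (inv_word w) \<otimes>\<^bsub>free_group d\<^esub> w = \<one>\<^bsub>free_group d\<^esub>"
    using assms by (auto simp: free_group_def reduced_form_append inv_word_cancel)
  thus ?thesis using assms 
    by (intro group.inv_equality[OF group_free_group])
       (auto simp: free_group_def reduced_reduced_form reduced_form_words inv_word_words)
qed

lemma free_group_mult: "u \<otimes>\<^bsub>free_group d\<^esub> v = reduced_form (u @ v)"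
  by (simp add: free_group_def)

lemma transforms_Nil_mult:
  assumes "transforms d R u [] k" "transforms d R v [] l"
  shows "transforms d R (u @ v) [] (k + l)"
  using transforms_trans[OF assms(2) transforms_context[OF assms(1), of "[]" v, simplified]] .

lemma transforms_Nil_reduced_form:
  assumes "transforms d R u [] k" "u \<in> words d" "R \<subseteq> words d"
  shows "transforms d R (reduced_form u) [] k"
  using transforms_trans[OF assms(1)] 
    transforms_sym[OF transforms_reduced_form[of d R u] assms(2,3)] by fastforce

lemma transforms_reduced_form_Nil:
  assumes "transforms d R (reduced_form u) [] k"
  shows "transforms d R u [] k"
  using transforms_trans[OF assms transforms_reduced_form[of d R u]] by simp

lemma transforms_Nil_inv_word:
  assumes "transforms d R w [] k" "w \<in> words d" "R \<subseteq> words d"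
  shows "transforms d R (inv_word w) [] k"
proof -
  have "transforms d R [] w k" using transforms_sym assms by blast
  hence "transforms d R (inv_word w) (inv_word w @ w) k"
    using transforms_context[of d R "[]" w k "inv_word w" "[]"] by simp
  moreover have "transforms d R (inv_word w @ w) [] 0"
    using transforms_reduced_form[of d R "inv_word w @ w"] by (simp add: inv_word_cancel)
  ultimately show ?thesis using transforms_trans by fastforce
qed

lemma normal_closure_transforms:
  assumes "R \<subseteq> words d" "w \<in> normal_closure (free_group d) (reduced_form ` R)"
  shows "\<exists>k. transforms d R w [] k"
proof -
  interpret F: group "free_group d" by (rule group_free_group)
  have R: "reduced_form r \<in> carrier (free_group d)" if "r \<in> R" for r
    using that assms(1) by (auto simp: free_group_def reduced_reduced_form reduced_form_words)
  have conj: "g \<otimes>\<^bsub>free_group d\<^esub> reduced_form r \<otimes>\<^bsub>free_group d\<^esub> inv\<^bsub>free_group d\<^esub> g \<in> carrier (free_group d) \<and>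
       (\<exists>k. transforms d R (g \<otimes>\<^bsub>free_group d\<^esub> reduced_form r \<otimes>\<^bsub>free_group d\<^esub> inv\<^bsub>free_group d\<^esub> g) [] k)"
    if g: "g \<in> carrier (free_group d)" and r: "r \<in> R" for g r
  proof -
    have "transforms d R (g @ r @ inv_word g) (g @ inv_word g) 1"
      using transforms.deletion[OF transforms.refl r] by simp
    moreover have "transforms d R (g @ inv_word g) [] 0"
      using transforms_reduced_form[of d R "g @ inv_word g"] inv_word_cancel[of "inv_word g"]
      by (simp add: inv_word_def rev_map o_def)
    ultimately have "transforms d R (g @ r @ inv_word g) [] 1"
      using transforms_trans by fastforce
    moreover have "g @ r @ inv_word g \<in> words d"
      using g r assms(1) by (auto simp: free_group_def inv_word_words)
    moreover have "reduced_form (g @ reduced_form r @ inv_word g) = reduced_form (g @ r @ inv_word g)"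
      by (metis reduced_form_append)
    moreover have "g \<otimes>\<^bsub>free_group d\<^esub> reduced_form r \<otimes>\<^bsub>free_group d\<^esub> inv\<^bsub>free_group d\<^esub> g =
                     reduced_form (g @ reduced_form r @ inv_word g)"
      using g by (simp add: inv_free_group free_group_mult) (metis append.assoc reduced_form_append)
    moreover have "g \<otimes>\<^bsub>free_group d\<^esub> reduced_form r \<otimes>\<^bsub>free_group d\<^esub> inv\<^bsub>free_group d\<^esub> g
                     \<in> carrier (free_group d)"
      using g R[OF r] by (intro F.m_closed F.inv_closed)
    ultimately show ?thesis using transforms_Nil_reduced_form[OF _ _ assms(1)] by metis
  qed
  from assms(2) have "w \<in> carrier (free_group d) \<and> (\<exists>k. transforms d R w [] k)"
    unfolding normal_closure_def
  proof (induction rule: generate.induct)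
    case one
    thus ?case using transforms.refl by (auto simp: free_group_def)
  next
    case (incl h)
    thus ?case using conj by blast
  next
    case (inv h)
    then obtain k where h: "h \<in> carrier (free_group d)" "transforms d R h [] k" using conj by blast
    from h have "h \<in> words d" by (simp add: free_group_def)
    with h have "transforms d R (inv\<^bsub>free_group d\<^esub> h) [] k"
      using assms(1) by (simp add: inv_free_group transforms_Nil_inv_word 
                           transforms_Nil_reduced_form inv_word_words)
    thus ?case using h by blast
  next
    case (eng u v)
    then obtain k l where kl: "transforms d R u [] k" "transforms d R v [] l" by blast
    have "u \<in> words d" "v \<in> words d" using eng by (auto simp: free_group_def)
    hence "transforms d R (u \<otimes>\<^bsub>free_group d\<^esub> v) [] (k + l)"
      using transforms_Nil_reduced_form[OF transforms_Nil_mult[OF kl]] assms(1)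
      by (simp add: free_group_mult)
    thus ?case using eng by blast
  qed
  thus ?thesis by blast
qed

lemma word_value_closed:
  assumes "group H" "\<forall>i<d. h i \<in> carrier H" "w \<in> words d"
  shows "word_value H h w \<in> carrier H"
proof -
  interpret group H by fact
  have "letter_value H h x \<in> carrier H" if "index x < d" for x
    using that assms(2) by (cases x) auto
  thus ?thesis using assms(3) by (induction w) auto
qed

lemma word_value_reduced_form:
  assumes "group H" "\<forall>i<d. h i \<in> carrier H" "w \<in> words d"
  shows "word_value H h (reduced_form w) = word_value H h w"
  using assms(3)
proof (induction w)
  case (Cons x w)
  interpret group H by fact
  have *: "word_value H h (reduced_cons x v) = letter_value H h x \<otimes>\<^bsub>H\<^esub> word_value H h v"
    if "v \<in> words d" for v
  proof (cases "\<exists>v'. v = inv_letter x # v'")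
    case True
    then obtain v' where v: "v = inv_letter x # v'" by blast
    hence "v' \<in> words d" using that by simp
    hence "word_value H h v' \<in> carrier H" using word_value_closed assms by blast
    moreover have "index x < d" using Cons.prems by simp
    ultimately show ?thesis using v assms(2)
      by (cases x) (auto simp flip: m_assoc)
  qed (cases v; auto)
  from *[of "reduced_form w"] Cons show ?case
    by (simp add: reduced_form_words) (simp add: reduced_form_def)
qed (simp add: reduced_form_def)

text \<open>
  The minimum in \<^const>\<open>filling_area\<close> and the maximum in \<^const>\<open>dehn_function\<close> are attained.
\<close>

lemma transforms_filling_area:
  assumes "finite_presentation H d h R" "w \<in> words d" "word_value H h w = \<one>\<^bsub>H\<^esub>"
  shows "transforms d R w [] (filling_area d R w)"
proof -
  have "reduced_form w \<in> normal_closure (free_group d) (reduced_form ` R)"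
    using assms word_value_reduced_form[of H d h w] unfolding finite_presentation_def
    by (auto simp: free_group_def reduced_form_words reduced_reduced_form)
  then obtain k where "transforms d R (reduced_form w) [] k"
    using assms(1) normal_closure_transforms unfolding finite_presentation_def by blast
  hence "transforms d R w [] k" by (rule transforms_reduced_form_Nil)
  thus ?thesis unfolding filling_area_def by (rule LeastI)
qed

lemma finite_filling_areas:
  "finite {filling_area d R w | w. w \<in> words d \<and> word_value H h w = \<one>\<^bsub>H\<^esub> \<and> length w \<le> n}"
proof -
  have "{x. index x < d} \<subseteq> Gen ` {..<d} \<union> GenInv ` {..<d}"
  proof
    fix x assume "x \<in> {x. index x < d}"
    thus "x \<in> Gen ` {..<d} \<union> GenInv ` {..<d}" by (cases x) auto
  qed
  hence "finite {x. index x < d}" by (rule finite_subset) auto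
  from finite_lists_length_le[OF this, of n] 
  have "finite {w \<in> words d. length w \<le> n}"
    by (rule finite_subset[rotated]) (auto simp: words_def)
  hence "finite (filling_area d R ` {w \<in> words d. length w \<le> n})" by simp
  thus ?thesis by (rule finite_subset[rotated]) auto
qed

lemma dehn_function_attained:
  "\<exists>w \<in> words d. word_value H h w = \<one>\<^bsub>H\<^esub> \<and> length w \<le> n \<and> 
                 dehn_function H d h R n = filling_area d R w"
proof -
  let ?A = "{filling_area d R w | w. w \<in> words d \<and> word_value H h w = \<one>\<^bsub>H\<^esub> \<and> length w \<le> n}"
  have "filling_area d R [] \<in> ?A" by (auto intro!: exI[of _ "[]"])
  hence "Max ?A \<in> ?A" using finite_filling_areas by (intro Max_in) auto
  thus ?thesis by (auto simp: dehn_function_def)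
qed


section \<open>The special linear group over the integers\<close>

definition SL_int :: "nat \<Rightarrow> int mat monoid" where
  "SL_int n = \<lparr>carrier = {A \<in> carrier_mat n n. det A = 1}, monoid.mult = (*), one = 1\<^sub>m n\<rparr>"

lemma group_SL_int: "group (SL_int n)"
proof (rule groupI)
  fix A assume "A \<in> carrier (SL_int n)"
  hence A: "A \<in> carrier_mat n n" "det A = 1" by (auto simp: SL_int_def)
  have "adj_mat A \<in> carrier_mat n n" "adj_mat A * A = 1\<^sub>m n"
    using adj_mat[OF A(1)] A(2) by auto
  moreover from this have "det (adj_mat A) = 1"
    using det_mult[of "adj_mat A" n A] A by simp
  ultimately show "\<exists>B \<in> carrier (SL_int n). B \<otimes>\<^bsub>SL_int n\<^esub> A = \<one>\<^bsub>SL_int n\<^esub>"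
    by (intro bexI[of _ "adj_mat A"]) (auto simp: SL_int_def)
qed (auto simp: SL_int_def det_mult assoc_mult_mat[of _ n n _ n _ n])

end

theory Submission
  imports Defs
begin

text \<open>
  Let \<open>N\<^sub>k\<close> be the inverse of the value of the prefix of length \<open>k\<close> of a relation of length \<open>l\<close>, and
  interpolate between \<open>|v|\<close> and \<open>|N\<^sub>k v|\<close> by the norms \<open>f\<^sub>k\<^sub>t(v) = 2\<^sup>t |N\<^sub>k v| + 2\<^sup>T\<^sup>-\<^sup>t |v|\<close>, \<open>0 \<le> t \<le> T = O(l)\<close>.
  Every norm has a reduced basis of the lattice of integer vectors, that is a matrix in \<open>SL(n, Z)\<close>.
  Neighbouring norms differ by a bounded factor, so that the corresponding bases differ by a product of
  boundedly many elementary matrices whose entries are bounded by the ratios of the lengths of basis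
  vectors. For \<open>t = 0\<close> the bases are trivial and for \<open>t = T\<close> they are the prefixes, so the grid of
  these bases cuts a filling of the relation into \<open>O(l\<^sup>2)\<close> cells.  A cell is a bounded number of
  elementary matrices \<open>1 + x e\<^sub>i\<^sub>j\<close> with \<open>|x| \<le> 2\<^sup>O\<^sup>(\<^sup>l\<^sup>)\<close> whose product is 1.

  Such elementary matrices are values of words of length \<open>O(l)\<close>, obtained by conjugating with powers of a
  hyperbolic matrix in \<open>SL(2, Z)\<close>.  The Steinberg relations between these words have area \<open>O(l\<^sup>2)\<close>: they hold in
  solvable groups in which commuting hyperbolic matrices in the rows \<open>p, q\<close> and in the columns \<open>r, s\<close> act on the
  unipotent matrices with a fifth index \<open>m\<close>.  There any two eigenvectors with a common contracting direction can
  be multiplied at quadratic cost, and an eigenvector that is opposite to another one is a commutator of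
  eigenvectors that are not.  Paths in these real groups stay close to \<open>SL(n, Z)\<close> and are
  rounded to words.  Collecting with the Steinberg relations, each cell has area \<open>O(l\<^sup>2)\<close>.
\<close>


section \<open>Integer matrices as linear maps\<close>

text \<open>Rounding works only at bounded distance from SL(n, Z), and SL(n, R) has cusps. The
  solvable groups avoid them: each point is an integer matrix times a unipotent one, which can be
  reduced modulo integers. On the grid a cusp appears only as a large ratio of basis lengths. Such
  ratios cut the indices into blocks: entries of a transition matrix vanish below the blocks, are
  bounded inside them and may be exponential only above them. So after the block-diagonal part has
  been moved to the left, it takes finitely many values, and the large entries sit in a unipotent
  word that boundedly many Steinberg relations collect.

  Five indices are what the solvable group takes: two rows and two columns, so that each entry of
  their corner has one shortcut per twist and these can be compared, and a fifth index that makes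
  the corner a commutator.

  Constants attached to bounded relations are not estimated: they are maxima over finite sets of
  words.\<close>

type_synonym rmap = "(nat \<Rightarrow> real) \<Rightarrow> (nat \<Rightarrow> real)"

definition E :: "nat \<Rightarrow> nat \<Rightarrow> real \<Rightarrow> rmap" where
  "E i j x v = v(i := v i + x * v j)"

text \<open>Coordinates beyond the size of the matrix are fixed, so that integer matrices and the
  real maps \<open>E i j x\<close> lie in one monoid of functions, where identities can be checked
  coordinatewise.\<close>

definition act :: "int mat \<Rightarrow> rmap" where
  "act M v = (\<lambda>i. if i < dim_row M then \<Sum>j<dim_row M. real_of_int (M $$ (i, j)) * v j else v i)"

abbreviation SL :: "nat \<Rightarrow> int mat set" where
  "SL n \<equiv> carrier (SL_int n)"

lemma SL_D: "M \<in> SL n \<Longrightarrow> M \<in> carrier_mat n n" "M \<in> SL n \<Longrightarrow> det M = 1"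
  by (auto simp: SL_int_def)

lemma mult_SL_int [simp]: "M \<otimes>\<^bsub>SL_int n\<^esub> N = M * N" "\<one>\<^bsub>SL_int n\<^esub> = 1\<^sub>m n"
  by (auto simp: SL_int_def)

lemma one_SL [simp]: "1\<^sub>m n \<in> SL n"
  by (simp add: SL_int_def)

lemma mult_SL: "M \<in> SL n \<Longrightarrow> N \<in> SL n \<Longrightarrow> M * N \<in> SL n"
  using group.subgroup_self[OF group_SL_int[of n]] subgroup.m_closed[of "SL n" "SL_int n" M N] by simp

lemma act_mult:
  assumes "M \<in> carrier_mat n n" "N \<in> carrier_mat n n"
  shows "act (M * N) = act M \<circ> act N"
proof (intro ext)
  fix v i
  show "act (M * N) v i = (act M \<circ> act N) v i"
  proof (cases "i < n")
    case True
    have "(\<Sum>j<n. real_of_int ((M * N) $$ (i, j)) * v j) = (\<Sum>j<n. (\<Sum>k<n. real_of_int (M $$ (i, k)) * real_of_int (N $$ (k, j))) * v j)"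
      using assms True by (intro sum.cong) (auto simp: scalar_prod_def atLeast0LessThan intro!: sum.cong)
    also have "\<dots> = (\<Sum>j<n. \<Sum>k<n. real_of_int (M $$ (i, k)) * real_of_int (N $$ (k, j)) * v j)"
      by (simp add: sum_distrib_right)
    also have "\<dots> = (\<Sum>k<n. \<Sum>j<n. real_of_int (M $$ (i, k)) * real_of_int (N $$ (k, j)) * v j)"
      by (rule sum.swap)
    also have "\<dots> = (\<Sum>k<n. real_of_int (M $$ (i, k)) * (\<Sum>j<n. real_of_int (N $$ (k, j)) * v j))"
      by (simp add: sum_distrib_left mult.assoc)
    finally show ?thesis using True assms by (auto simp: act_def)
  qed (use assms in \<open>auto simp: act_def\<close>)
qed

lemma act_one [simp]: "act (1\<^sub>m n) = id"
proof (intro ext)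
  fix v i
  have "(\<Sum>j<n. real_of_int (1\<^sub>m n $$ (i, j)) * v j) = (\<Sum>j<n. if j = i then v j else 0)" if "i < n"
    using that by (intro sum.cong) auto
  moreover have "(\<Sum>j<n. if j = i then v j else 0) = v i" if "i < n"
    using that by simp
  ultimately show "act (1\<^sub>m n) v i = id v i" by (simp add: act_def)
qed

definition unitv :: "nat \<Rightarrow> nat \<Rightarrow> real" where
  "unitv j = (\<lambda>i. if i = j then 1 else 0)"

lemma act_unitv:
  assumes "M \<in> carrier_mat n n" "i < n" "j < n"
  shows "act M (unitv j) i = real_of_int (M $$ (i, j))"
proof -
  have "(\<Sum>k<n. real_of_int (M $$ (i, k)) * unitv j k) = (\<Sum>k<n. if k = j then real_of_int (M $$ (i, k)) else 0)"
    by (intro sum.cong) (auto simp: unitv_def)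
  thus ?thesis using assms by (simp add: act_def)
qed

lemma act_inj:
  assumes "M \<in> carrier_mat n n" "N \<in> carrier_mat n n" "act M = act N"
  shows "M = N"
proof (rule eq_matI)
  fix i j assume "i < dim_row N" "j < dim_col N"
  thus "M $$ (i, j) = N $$ (i, j)"
    using act_unitv[OF assms(1), of i j] act_unitv[OF assms(2), of i j] assms by auto
qed (use assms in auto)

lemma act_E:
  assumes "i < n" "j < n" "i \<noteq> j"
  shows "act (addrow_mat n x i j) = E i j (real_of_int x)"
proof (intro ext)
  fix v k
  show "act (addrow_mat n x i j) v k = E i j (real_of_int x) v k"
  proof (cases "k < n")
    case True
    have "(\<Sum>l<n. real_of_int (addrow_mat n x i j $$ (k, l)) * v l) =
            (\<Sum>l<n. (if l = j then (if k = i then real_of_int x * v j else 0) else 0) + (if l = k then v k else 0))"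
      using True assms by (intro sum.cong) auto
    also have "\<dots> = (if k = i then real_of_int x * v j else 0) + v k"
      using True assms by (simp add: sum.distrib)
    finally show ?thesis using True by (auto simp: act_def E_def)
  qed (use assms in \<open>auto simp: act_def E_def\<close>)
qed

lemma addrow_mat_SL:
  assumes "i < n" "j < n" "i \<noteq> j"
  shows "addrow_mat n x i j \<in> SL n"
  using assms by (auto simp: SL_int_def intro!: det_addrow_mat)

lemma E_in_act: "i < n \<Longrightarrow> j < n \<Longrightarrow> i \<noteq> j \<Longrightarrow> E i j (real_of_int x) \<in> act ` SL n"
  using act_E[of i n j x] addrow_mat_SL[of i n j x] by (metis image_eqI)

lemma act_SL_comp:
  assumes "f \<in> act ` SL n" "g \<in> act ` SL n"
  shows "f \<circ> g \<in> act ` SL n"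
proof -
  from assms obtain M N where "M \<in> SL n" "N \<in> SL n" "f = act M" "g = act N" by blast
  thus ?thesis using act_mult[of M n N] SL_D(1) mult_SL[of M n N] by (intro image_eqI[of _ _ "M * N"]) auto
qed

lemma id_in_act: "id \<in> act ` SL n"
  using act_one one_SL by (metis image_eqI)

abbreviation SL_inv :: "nat \<Rightarrow> int mat \<Rightarrow> int mat" where
  "SL_inv n M \<equiv> inv\<^bsub>SL_int n\<^esub> M"

lemma SL_inv:
  assumes "M \<in> SL n"
  shows "SL_inv n M \<in> SL n" "M * SL_inv n M = 1\<^sub>m n" "SL_inv n M * M = 1\<^sub>m n"
        "act M \<circ> act (SL_inv n M) = id" "act (SL_inv n M) \<circ> act M = id"
proof -
  interpret group "SL_int n" by (rule group_SL_int)
  show *: "SL_inv n M \<in> SL n" "M * SL_inv n M = 1\<^sub>m n" "SL_inv n M * M = 1\<^sub>m n"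
    using assms r_inv[of M] l_inv[of M] by auto
  show "act M \<circ> act (SL_inv n M) = id" "act (SL_inv n M) \<circ> act M = id"
    using act_mult[of M n "SL_inv n M"] act_mult[of "SL_inv n M" n M] * SL_D assms by auto
qed

subsection \<open>Operator bounds\<close>

definition bdd :: "real \<Rightarrow> rmap \<Rightarrow> bool" where
  "bdd c f \<longleftrightarrow> (\<forall>v r. (\<forall>i. \<bar>v i\<bar> \<le> r) \<longrightarrow> (\<forall>i. \<bar>f v i\<bar> \<le> c * r))"

lemma bdd_comp: "bdd c f \<Longrightarrow> bdd d g \<Longrightarrow> bdd (c * d) (f \<circ> g)"
  unfolding bdd_def by (simp add: mult.assoc)

lemma bdd_id [simp]: "bdd 1 id"
  by (simp add: bdd_def)

lemma bdd_mono: "bdd c f \<Longrightarrow> c \<le> d \<Longrightarrow> bdd d f"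
  unfolding bdd_def by (meson abs_ge_zero mult_right_mono order_trans)

lemma bdd_E: "bdd (1 + \<bar>x\<bar>) (E i j x)"
  unfolding bdd_def
proof (intro allI impI)
  fix v :: "nat \<Rightarrow> real" and r k assume v: "\<forall>i. \<bar>v i\<bar> \<le> r"
  have "\<bar>v i + x * v j\<bar> \<le> (1 + \<bar>x\<bar>) * r"
    using v mult_left_mono[of "\<bar>v j\<bar>" r "\<bar>x\<bar>"] abs_triangle_ineq[of "v i" "x * v j"]
    by (simp add: abs_mult algebra_simps) (smt (verit))
  moreover have "\<bar>v k\<bar> \<le> (1 + \<bar>x\<bar>) * r"
  proof -
    have "\<bar>v k\<bar> \<le> r" using v by blast
    moreover have "0 \<le> \<bar>x\<bar> * r" using abs_ge_zero[of "v k"] calculation by (intro mult_nonneg_nonneg) linarith+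
    ultimately show ?thesis unfolding distrib_right by linarith
  qed
  ultimately show "\<bar>E i j x v k\<bar> \<le> (1 + \<bar>x\<bar>) * r" by (simp add: E_def)
qed

lemma bdd_entry:
  assumes "bdd c (act M)" "M \<in> carrier_mat n n" "i < n" "j < n"
  shows "\<bar>real_of_int (M $$ (i, j))\<bar> \<le> c"
  using assms(1)[unfolded bdd_def, rule_format, of "unitv j" 1 i] act_unitv[OF assms(2-4)]
  by (auto simp: unitv_def)

lemma finite_mats: "finite {M :: int mat. M \<in> carrier_mat n n \<and> (\<forall>i<n. \<forall>j<n. \<bar>real_of_int (M $$ (i, j))\<bar> \<le> c)}"
proof -
  let ?I = "{..<n} \<times> {..<n}"
  let ?A = "{- \<lfloor>c\<rfloor>..\<lfloor>c\<rfloor>}"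
  let ?S = "{M :: int mat. M \<in> carrier_mat n n \<and> (\<forall>i<n. \<forall>j<n. \<bar>real_of_int (M $$ (i, j))\<bar> \<le> c)}"
  have "?S \<subseteq> (\<lambda>f. mat n n f) ` (PiE ?I (\<lambda>_. ?A))"
  proof
    fix M assume M: "M \<in> ?S"
    have "M = mat n n (restrict (\<lambda>ij. M $$ ij) ?I)" using M by (intro eq_matI) auto
    moreover have "restrict (\<lambda>ij. M $$ ij) ?I \<in> PiE ?I (\<lambda>_. ?A)"
    proof (intro PiE_I)
      fix ij assume "ij \<in> ?I"
      hence "\<bar>real_of_int (M $$ ij)\<bar> \<le> c" using M by (cases ij) auto
      hence "M $$ ij \<le> \<lfloor>c\<rfloor>" "- (M $$ ij) \<le> \<lfloor>c\<rfloor>" by (auto simp: le_floor_iff)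
      thus "restrict (\<lambda>ij. M $$ ij) ?I ij \<in> ?A" using \<open>ij \<in> ?I\<close> by simp
    qed auto
    ultimately show "M \<in> (\<lambda>f. mat n n f) ` (PiE ?I (\<lambda>_. ?A))" by blast
  qed
  moreover have "finite (PiE ?I (\<lambda>_. ?A))" by (intro finite_PiE) auto
  ultimately show ?thesis using finite_surj by blast
qed

text \<open>Discreteness of SL(n, Z). It makes the sets of words over which the constants are taken
  finite.\<close>

lemma finite_bdd_SL: "finite {M \<in> SL n. bdd c (act M)}"
  by (rule finite_subset[OF _ finite_mats[of n c]]) (auto dest: SL_D intro: bdd_entry)

section \<open>Areas in a finite presentation\<close>

locale SL_presentation =
  fixes n d :: nat and h :: "nat \<Rightarrow> int mat" and R :: "word set"
  assumes n5: "n \<ge> 5"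
    and fp: "finite_presentation (SL_int n) d h R"
begin

abbreviation val :: "word \<Rightarrow> int mat" where
  "val \<equiv> word_value (SL_int n) h"

text \<open>The count comes first so that \<open>\<dots>\<close> denotes the right-hand word in
  calculations. Membership in \<open>words d\<close> is included because reversing a transformation
  requires it.\<close>

definition area_le :: "nat \<Rightarrow> word \<Rightarrow> word \<Rightarrow> bool" where
  ar_def: "area_le k u v \<longleftrightarrow> u \<in> words d \<and> v \<in> words d \<and> (\<exists>k'\<le>k. transforms d R u v k')"

abbreviation ar :: "word \<Rightarrow> word \<Rightarrow> nat \<Rightarrow> bool" where
  "ar u v k \<equiv> area_le k u v"

lemma R_words: "R \<subseteq> words d"
  using fp by (simp add: finite_presentation_def)

lemma h_SL: "i < d \<Longrightarrow> h i \<in> SL n"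
  using fp by (simp add: finite_presentation_def)

lemma val_closed: "w \<in> words d \<Longrightarrow> val w \<in> SL n"
  using word_value_closed[of "SL_int n" d h w] fp by (simp add: finite_presentation_def)

lemma val_append: "u \<in> words d \<Longrightarrow> v \<in> words d \<Longrightarrow> val (u @ v) = val u * val v"
proof (induction u)
  case Nil
  thus ?case using val_closed[of v] SL_D(1) by fastforce
next
  case (Cons x u)
  have x: "letter_value (SL_int n) h x \<in> SL n"
    using Cons.prems val_closed[of "[x]"] word_value_closed[of "SL_int n"] h_SL SL_inv(1) by (cases x) auto
  show ?case using Cons x val_closed[of u] val_closed[of v] SL_D(1)
    by (auto simp: assoc_mult_mat[of _ n n _ n _ n])
qed

lemma ar_refl [simp]: "u \<in> words d \<Longrightarrow> ar u u k"
  by (auto simp: ar_def intro: transforms.refl)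

lemma ar_mono: "ar u v k \<Longrightarrow> k \<le> l \<Longrightarrow> ar u v l"
  unfolding ar_def by (meson order_trans)

lemma ar_sym: "ar u v k \<Longrightarrow> ar v u k"
  unfolding ar_def using transforms_sym R_words by blast

lemma ar_trans [trans]: "ar u v k \<Longrightarrow> ar v w l \<Longrightarrow> ar u w (k + l)"
  unfolding ar_def using transforms_trans by (metis add_mono)

lemma ar_append: "ar u v k \<Longrightarrow> ar u' v' l \<Longrightarrow> ar (u @ u') (v @ v') (k + l)"
proof -
  assume a: "ar u v k" "ar u' v' l"
  then obtain i j where ij: "i \<le> k" "j \<le> l" "transforms d R u v i" "transforms d R u' v' j"
    by (auto simp: ar_def)
  have "transforms d R (u @ u') (v @ v') (i + j)"
    using transforms_trans[of d R "v @ u'" "v @ v'" j "u @ u'" i]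
      transforms_context[OF ij(4), of v "[]"] transforms_context[OF ij(3), of "[]" u'] by simp
  thus ?thesis using a ij by (auto simp: ar_def intro!: exI[of _ "i + j"])
qed

lemma ar_words: "ar u v k \<Longrightarrow> u \<in> words d" "ar u v k \<Longrightarrow> v \<in> words d"
  by (auto simp: ar_def)

lemma ar_appendL: "ar u v k \<Longrightarrow> w \<in> words d \<Longrightarrow> ar (w @ u) (w @ v) k"
  using ar_append[of 0 w w k u v] by simp

lemma ar_appendR: "ar u v k \<Longrightarrow> w \<in> words d \<Longrightarrow> ar (u @ w) (v @ w) k"
  using ar_append[of k u v 0 w w] by simp

lemma ar_inv_left: "w \<in> words d \<Longrightarrow> ar (inv_word w @ w) [] 0"
  unfolding ar_def using transforms_reduced_form[of d R "inv_word w @ w"]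
  by (auto simp: inv_word_cancel inv_word_words)

lemma inv_word_inv_word [simp]: "inv_word (inv_word w) = w"
  by (simp add: inv_word_def rev_map o_def)

lemma val_inv_word:
  assumes "w \<in> words d"
  shows "val w * val (inv_word w) = 1\<^sub>m n"
proof -
  have "val (w @ inv_word w) = val (reduced_form (w @ inv_word w))"
    using word_value_reduced_form[of "SL_int n" d h "w @ inv_word w"] fp assms inv_word_words
    by (simp add: finite_presentation_def)
  also have "reduced_form (w @ inv_word w) = []" using inv_word_cancel[of "inv_word w"] by simp
  finally show ?thesis using val_append[OF assms inv_word_words[OF assms]] by simp
qed

lemma ar_exists:
  assumes "u \<in> words d" "v \<in> words d" "val u = val v"
  shows "\<exists>k. ar u v k"
proof -
  have iv: "inv_word v \<in> words d" using assms inv_word_words by blast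
  have "val (u @ inv_word v) = 1\<^sub>m n" using val_append[OF assms(1) iv] val_inv_word assms by simp
  hence "transforms d R (u @ inv_word v) [] (filling_area d R (u @ inv_word v))"
    using transforms_filling_area[OF fp, of "u @ inv_word v"] assms iv by simp
  hence "ar (u @ inv_word v) [] (filling_area d R (u @ inv_word v))"
    using assms iv by (auto simp: ar_def)
  from ar_appendR[OF this assms(2)] have 1: "\<exists>k. ar (u @ inv_word v @ v) v k" by auto
  have "ar (u @ inv_word v @ v) u 0" using ar_appendL[OF ar_inv_left[OF assms(2)] assms(1)] by simp
  from ar_sym[OF this] 1 show ?thesis using ar_trans by blast
qed

text \<open>Each pair with equal values has some finite area because the relators present the group;
  finitely many pairs have a common bound.\<close>

lemma ar_finite:
  assumes "finite W" "W \<subseteq> words d"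
  shows "\<exists>K. \<forall>u\<in>W. \<forall>v\<in>W. val u = val v \<longrightarrow> ar u v K"
proof -
  have "\<exists>k. val u = val v \<longrightarrow> ar u v k" if "u \<in> W" "v \<in> W" for u v
    using ar_exists that assms(2) by blast
  then obtain k where k: "\<And>u v. u \<in> W \<Longrightarrow> v \<in> W \<Longrightarrow> val u = val v \<longrightarrow> ar u v (k u v)" by metis
  define K where "K = (\<Sum>u\<in>W. \<Sum>v\<in>W. k u v)"
  have "k u v \<le> K" if "u \<in> W" "v \<in> W" for u v
    unfolding K_def using that assms(1)
      member_le_sum[of v W "k u"] member_le_sum[of u W "\<lambda>u. \<Sum>v\<in>W. k u v"] by simp
  thus ?thesis using k ar_mono by blast
qed

text \<open>The length of this word is not controlled. Bounds arise by applying \<open>om\<close> to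
  matrices from a finite set.\<close>

definition om :: "int mat \<Rightarrow> word" where
  "om M = (SOME w. w \<in> words d \<and> val w = M)"

lemma om:
  assumes "M \<in> SL n"
  shows "om M \<in> words d" "val (om M) = M"
proof -
  have "M \<in> val ` carrier (free_group d)" using assms fp by (simp add: finite_presentation_def)
  then obtain w where "w \<in> words d \<and> val w = M" by (auto simp: free_group_def)
  from someI[of "\<lambda>w. w \<in> words d \<and> val w = M", OF this] show "om M \<in> words d" "val (om M) = M"
    unfolding om_def by auto
qed

end

section \<open>Rounding real paths to words\<close>

text \<open>The bound 4 is the one that \<open>good_Nn\<close> reaches for unipotent matrices with
  entries in [0, 1] and their inverses.\<close>

definition good :: "rmap \<Rightarrow> bool" where
  "good f \<longleftrightarrow> bdd 4 f \<and> (\<exists>g. f \<circ> g = id \<and> g \<circ> f = id \<and> bdd 4 g)"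

lemma good_id [simp]: "good id"
  unfolding good_def using bdd_mono[OF bdd_id, of 4] by auto

definition cprod :: "rmap list \<Rightarrow> rmap" where
  "cprod u = foldr (\<circ>) u id"

lemma cprod_simps [simp]: "cprod [] = id" "cprod (z # u) = z \<circ> cprod u"
  by (auto simp: cprod_def)

lemma cprod_append [simp]: "cprod (u @ v) = cprod u \<circ> cprod v"
  by (induction u) (auto simp: o_assoc)

lemma SL_assoc: "A \<in> SL n \<Longrightarrow> B \<in> SL n \<Longrightarrow> C \<in> SL n \<Longrightarrow> A * B * C = A * (B * C)"
  using SL_D(1) assoc_mult_mat by blast

lemma SL_one: "A \<in> SL n \<Longrightarrow> 1\<^sub>m n * A = A" "A \<in> SL n \<Longrightarrow> A * 1\<^sub>m n = A"
  using SL_D(1) left_mult_one_mat right_mult_one_mat by blast+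

context SL_presentation
begin

text \<open>Bounded distance from SL(n, Z). Integer matrices act from the left, while paths are
  extended from the right.\<close>

definition thick :: "rmap \<Rightarrow> bool" where
  "thick x \<longleftrightarrow> (\<exists>M\<in>SL n. \<exists>f. good f \<and> x = act M \<circ> f)"

text \<open>
  \<open>x = act (gam x) \<circ> rep x\<close> is rounded to \<open>gam x\<close>.  The choice of \<open>rep x\<close> depends only on the coset of \<open>x\<close>, so that
  \<open>gam\<close> is equivariant.
\<close>

definition rep :: "rmap \<Rightarrow> rmap" where
  "rep x = (if x \<in> act ` SL n then id else SOME f. good f \<and> (\<exists>M\<in>SL n. x = act M \<circ> f))"

definition gam :: "rmap \<Rightarrow> int mat" where
  "gam x = (SOME M. M \<in> SL n \<and> x = act M \<circ> rep x)"

lemma rep: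
  assumes "thick x"
  shows "good (rep x)" "\<exists>M\<in>SL n. x = act M \<circ> rep x"
proof -
  have "good (rep x) \<and> (\<exists>M\<in>SL n. x = act M \<circ> rep x)"
  proof (cases "x \<in> act ` SL n")
    case True
    thus ?thesis by (auto simp: rep_def)
  next
    case False
    have "\<exists>f. good f \<and> (\<exists>M\<in>SL n. x = act M \<circ> f)" using assms by (auto simp: thick_def)
    from someI_ex[OF this] False show ?thesis by (simp add: rep_def)
  qed
  thus "good (rep x)" "\<exists>M\<in>SL n. x = act M \<circ> rep x" by auto
qed

lemma gam:
  assumes "thick x"
  shows "gam x \<in> SL n" "x = act (gam x) \<circ> rep x"
  using someI_ex[of "\<lambda>M. M \<in> SL n \<and> x = act M \<circ> rep x"] rep(2)[OF assms]
  unfolding gam_def by blast+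

lemma gam_unique:
  assumes "thick x" "M \<in> SL n" "x = act M \<circ> rep x"
  shows "gam x = M"
proof -
  obtain g where g: "rep x \<circ> g = id" using rep(1)[OF assms(1)] by (auto simp: good_def)
  have "act (gam x) \<circ> (rep x \<circ> g) = act M \<circ> (rep x \<circ> g)"
    using gam(2)[OF assms(1)] assms(3) by (metis o_assoc)
  hence "act (gam x) = act M" by (simp add: g)
  thus ?thesis using act_inj gam(1)[OF assms(1)] assms(2) SL_D(1) by blast
qed

lemma act_shift:
  assumes "M \<in> SL n"
  shows "(\<exists>N\<in>SL n. act M \<circ> x = act N \<circ> f) \<longleftrightarrow> (\<exists>N\<in>SL n. x = act N \<circ> f)"
proof
  assume "\<exists>N\<in>SL n. act M \<circ> x = act N \<circ> f"
  then obtain N where N: "N \<in> SL n" "act M \<circ> x = act N \<circ> f" by blast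
  have "x = (act (SL_inv n M) \<circ> act M) \<circ> x" using SL_inv(5)[OF assms] by simp
  also have "\<dots> = act (SL_inv n M) \<circ> (act N \<circ> f)" using N(2) by (simp add: comp_assoc)
  also have "\<dots> = act (SL_inv n M * N) \<circ> f"
    using act_mult[of "SL_inv n M" n N] SL_inv(1)[OF assms] N(1) SL_D(1) by (auto simp: comp_assoc)
  finally show "\<exists>N\<in>SL n. x = act N \<circ> f" using mult_SL SL_inv(1)[OF assms] N(1) by blast
next
  assume "\<exists>N\<in>SL n. x = act N \<circ> f"
  then obtain N where N: "N \<in> SL n" "x = act N \<circ> f" by blast
  have "act M \<circ> x = act (M * N) \<circ> f"
    using act_mult[of M n N] assms N SL_D(1) by (auto simp: comp_assoc)
  thus "\<exists>N\<in>SL n. act M \<circ> x = act N \<circ> f" using mult_SL assms N(1) by blast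
qed

lemma in_act_iff: "x \<in> act ` SL n \<longleftrightarrow> (\<exists>N\<in>SL n. x = act N \<circ> id)"
  by auto

lemma rep_act: "M \<in> SL n \<Longrightarrow> rep (act M \<circ> x) = rep x"
  unfolding rep_def in_act_iff using act_shift[of M x] by (simp only:)

lemma thick_act: "M \<in> SL n \<Longrightarrow> thick (act M \<circ> x) \<longleftrightarrow> thick x"
  unfolding thick_def using act_shift[of M x] by blast

lemma gam_act:
  assumes "M \<in> SL n" "thick x"
  shows "gam (act M \<circ> x) = M * gam x"
proof (rule gam_unique)
  have "act M \<circ> x = act M \<circ> (act (gam x) \<circ> rep x)" using gam(2)[OF assms(2)] by simp
  also have "\<dots> = act (M * gam x) \<circ> rep x"
    using act_mult[of M n "gam x"] assms(1) gam(1)[OF assms(2)] SL_D(1) by (simp add: comp_assoc)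
  finally show "act M \<circ> x = act (M * gam x) \<circ> rep (act M \<circ> x)" unfolding rep_act[OF assms(1)] .
qed (use assms thick_act mult_SL gam in auto)

lemma thick_id: "thick id"
  unfolding thick_def by (intro bexI[of _ "1\<^sub>m n"] exI[of _ id]) auto

text \<open>The special case in \<open>rep\<close> is made for this: with \<open>gam_act\<close>,
  rounding is exact on integer matrices, so that words read along paths between integer matrices
  have the expected values.\<close>

lemma gam_id: "gam id = 1\<^sub>m n"
  by (rule gam_unique[OF thick_id]) (auto simp: rep_def intro: id_in_act)

definition step :: "rmap \<Rightarrow> rmap \<Rightarrow> word" where
  "step x z = om (SL_inv n (gam x) * gam (x \<circ> z))"

fun rho :: "rmap \<Rightarrow> rmap list \<Rightarrow> word" where
  "rho x [] = []"
| "rho x (z # u) = step x z @ rho (x \<circ> z) u"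

fun thick_path :: "rmap \<Rightarrow> rmap list \<Rightarrow> bool" where
  "thick_path x [] \<longleftrightarrow> thick x"
| "thick_path x (z # u) \<longleftrightarrow> thick x \<and> thick_path (x \<circ> z) u"

lemma thick_path_start: "thick_path x u \<Longrightarrow> thick x"
  by (cases u) auto

lemma thick_path_append: "thick_path x (u @ v) \<longleftrightarrow> thick_path x u \<and> thick_path (x \<circ> cprod u) v"
  by (induction u arbitrary: x) (auto simp: o_assoc dest: thick_path_start)

lemma rho_append: "rho x (u @ v) = rho x u @ rho (x \<circ> cprod u) v"
  by (induction u arbitrary: x) (auto simp: o_assoc)

lemma step_matrix:
  assumes "thick x" "thick (x \<circ> z)"
  shows "SL_inv n (gam x) * gam (x \<circ> z) \<in> SL n"
  using mult_SL SL_inv(1) gam(1) assms by blast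

lemma rho_words: "thick_path x u \<Longrightarrow> rho x u \<in> words d"
  by (induction u arbitrary: x) (auto simp: step_def dest: thick_path_start intro!: om step_matrix)

lemma val_rho: "thick_path x u \<Longrightarrow> val (rho x u) = SL_inv n (gam x) * gam (x \<circ> cprod u)"
proof (induction u arbitrary: x)
  case Nil
  thus ?case using SL_inv(3) gam(1) by simp
next
  case (Cons z u)
  hence t: "thick x" "thick (x \<circ> z)" "thick_path (x \<circ> z) u" by (auto dest: thick_path_start)
  have g: "gam x \<in> SL n" "gam (x \<circ> z) \<in> SL n" "SL_inv n (gam x) \<in> SL n" "SL_inv n (gam (x \<circ> z)) \<in> SL n"
    using t gam(1) SL_inv(1) by auto
  have "thick (x \<circ> z \<circ> cprod u)" using t(3) thick_path_append[of "x \<circ> z" u "[]"] by auto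
  hence g': "gam (x \<circ> z \<circ> cprod u) \<in> SL n" by (rule gam)
  have "val (rho x (z # u)) = val (step x z) * val (rho (x \<circ> z) u)"
    using val_append[of "step x z" "rho (x \<circ> z) u"] rho_words[OF t(3)] om(1)[OF step_matrix[OF t(1,2)]]
    by (simp only: rho.simps step_def)
  also have "val (step x z) = SL_inv n (gam x) * gam (x \<circ> z)"
    unfolding step_def by (rule om(2)[OF step_matrix[OF t(1,2)]])
  also have "val (rho (x \<circ> z) u) = SL_inv n (gam (x \<circ> z)) * gam (x \<circ> z \<circ> cprod u)"
    by (rule Cons.IH[OF t(3)])
  also have "SL_inv n (gam x) * gam (x \<circ> z) * (SL_inv n (gam (x \<circ> z)) * gam (x \<circ> z \<circ> cprod u)) =
       SL_inv n (gam x) * ((gam (x \<circ> z) * SL_inv n (gam (x \<circ> z))) * gam (x \<circ> z \<circ> cprod u))"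
    using g g' by (simp only: SL_assoc mult_SL)
  also have "\<dots> = SL_inv n (gam x) * gam (x \<circ> z \<circ> cprod u)"
    unfolding SL_inv(2)[OF g(2)] SL_one(1)[OF g'] ..
  finally show ?case by (simp only: cprod_simps o_assoc)
qed

text \<open>A step sees only the quotient of two rounded values, and by equivariance a common left
  factor cancels in it.\<close>

lemma rho_act: "M \<in> SL n \<Longrightarrow> thick_path x u \<Longrightarrow> rho (act M \<circ> x) u = rho x u"
proof (induction u arbitrary: x)
  case (Cons z u)
  hence t: "thick x" "thick (x \<circ> z)" "thick_path (x \<circ> z) u" by (auto dest: thick_path_start)
  interpret group "SL_int n" by (rule group_SL_int)
  have "SL_inv n (M * gam x) = SL_inv n (gam x) * SL_inv n M"
    using inv_mult_group[of M "gam x"] Cons.prems(1) gam(1)[OF t(1)] by simp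
  hence "SL_inv n (M * gam x) * (M * gam (x \<circ> z)) = SL_inv n (gam x) * ((SL_inv n M * M) * gam (x \<circ> z))"
    using Cons.prems(1) gam(1)[OF t(1)] gam(1)[OF t(2)] SL_inv(1)[OF Cons.prems(1)] SL_inv(1)[OF gam(1)[OF t(1)]]
    by (simp only: SL_assoc mult_SL)
  also have "\<dots> = SL_inv n (gam x) * gam (x \<circ> z)"
    unfolding SL_inv(3)[OF Cons.prems(1)] SL_one(1)[OF gam(1)[OF t(2)]] ..
  finally have "step (act M \<circ> x) z = step x z"
    unfolding step_def comp_assoc gam_act[OF Cons.prems(1) t(1)] gam_act[OF Cons.prems(1) t(2)] by simp
  thus ?case using Cons.IH[OF Cons.prems(1) t(3)] by (simp only: rho.simps comp_assoc)
qed simp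

text \<open>The matrix of the step equals \<open>rep x\<close>, then \<open>z\<close>, then the
  inverse of \<open>rep (x \<circ> z)\<close>; the outer two have norm at most 4, wherever
  \<open>x\<close> is.\<close>

lemma step_bdd:
  assumes "thick x" "thick (x \<circ> z)" "bdd c z"
  shows "bdd (16 * c) (act (SL_inv n (gam x) * gam (x \<circ> z)))"
proof -
  obtain g where g: "rep (x \<circ> z) \<circ> g = id" "bdd 4 g" using rep(1)[OF assms(2)] by (auto simp: good_def)
  have m: "gam x \<in> SL n" "gam (x \<circ> z) \<in> SL n" "SL_inv n (gam x) \<in> SL n"
    using assms gam(1) SL_inv(1) by auto
  have "act (gam (x \<circ> z)) = act (gam (x \<circ> z)) \<circ> (rep (x \<circ> z) \<circ> g)" using g by simp
  also have "\<dots> = (x \<circ> z) \<circ> g" using gam(2)[OF assms(2)] by (simp add: o_assoc)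
  also have "\<dots> = act (gam x) \<circ> rep x \<circ> z \<circ> g" using gam(2)[OF assms(1)] by (simp add: o_assoc)
  finally have "act (SL_inv n (gam x)) \<circ> act (gam (x \<circ> z)) = (act (SL_inv n (gam x)) \<circ> act (gam x)) \<circ> rep x \<circ> z \<circ> g"
    by (simp only: o_assoc)
  hence "act (SL_inv n (gam x) * gam (x \<circ> z)) = rep x \<circ> z \<circ> g"
    using act_mult[of "SL_inv n (gam x)" n "gam (x \<circ> z)"] m SL_D(1) SL_inv(5)[OF m(1)] by simp
  moreover have "bdd (4 * c * 4) (rep x \<circ> z \<circ> g)"
    using bdd_comp g(2) assms(3) rep(1)[OF assms(1)] unfolding good_def by blast
  ultimately show ?thesis by (simp add: mult.commute)
qed

text \<open>By \<open>step_bdd\<close> a bounded letter is rounded to one of finitely many words,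
  independently of the starting point.\<close>

lemma rho_finite:
  "\<exists>W. finite W \<and> W \<subseteq> words d \<and> (\<forall>x u. thick_path x u \<longrightarrow> length u \<le> N \<longrightarrow> (\<forall>z\<in>set u. bdd c z) \<longrightarrow> rho x u \<in> W)"
proof -
  let ?S = "om ` {M \<in> SL n. bdd (16 * c) (act M)}"
  let ?W = "concat ` {us. set us \<subseteq> ?S \<and> length us \<le> N}"
  have "finite ?S" using finite_bdd_SL by blast
  hence fin: "finite ?W" using finite_lists_length_le by blast
  have rho: "\<exists>us. rho x u = concat us \<and> set us \<subseteq> ?S \<and> length us = length u"
    if "thick_path x u" "\<forall>z\<in>set u. bdd c z" for x u
    using that
  proof (induction u arbitrary: x)
    case (Cons z u)
    from Cons.prems have "thick_path (x \<circ> z) u" "\<forall>z\<in>set u. bdd c z" by auto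
    from Cons.IH[OF this] obtain us where us: "rho (x \<circ> z) u = concat us \<and> set us \<subseteq> ?S \<and> length us = length u" by blast
    have "step x z \<in> ?S" unfolding step_def using Cons.prems step_bdd step_matrix
      by (intro imageI) (auto dest: thick_path_start)
    thus ?case using us by (intro exI[of _ "step x z # us"]) auto
  qed auto
  have "rho x u \<in> ?W" if "thick_path x u" "length u \<le> N" "\<forall>z\<in>set u. bdd c z" for x u
    using rho[OF that(1,3)] that(2) by auto
  moreover have "?W \<subseteq> words d"
  proof -
    have "concat us \<in> words d" if "set us \<subseteq> words d" for us using that by (induction us) auto
    moreover have "?S \<subseteq> words d" using om by auto
    ultimately show ?thesis by blast
  qed
  ultimately show ?thesis using fin by blast
qed

text \<open>The value of \<open>rho x u\<close> depends only on the end points of the path, so the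
  two words have equal values and come from one finite set.\<close>

lemma rho_bounded_relation:
  "\<exists>K. \<forall>x u v. thick_path x u \<longrightarrow> thick_path x v \<longrightarrow> length u \<le> N \<longrightarrow> length v \<le> N \<longrightarrow>
     (\<forall>z\<in>set u \<union> set v. bdd c z) \<longrightarrow> cprod u = cprod v \<longrightarrow> ar (rho x u) (rho x v) K"
proof -
  obtain W where W: "finite W" "W \<subseteq> words d"
    "\<And>x u. thick_path x u \<Longrightarrow> length u \<le> N \<Longrightarrow> (\<forall>z\<in>set u. bdd c z) \<Longrightarrow> rho x u \<in> W"
    using rho_finite[of N c] by blast
  from ar_finite[OF W(1,2)] obtain K where K: "\<And>u v. u \<in> W \<Longrightarrow> v \<in> W \<Longrightarrow> val u = val v \<Longrightarrow> ar u v K" by blast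
  show ?thesis
    by (intro exI[of _ K] allI impI K W(3)) (auto simp: val_rho)
qed

text \<open>The bounds 100 on the norms of letters and 8 on the lengths of relations suffice for the solvable groups below.\<close>

definition K0 :: nat where
  "K0 = (SOME K. \<forall>x u v. thick_path x u \<longrightarrow> thick_path x v \<longrightarrow> length u \<le> 8 \<longrightarrow> length v \<le> 8 \<longrightarrow>
     (\<forall>z\<in>set u \<union> set v. bdd 100 z) \<longrightarrow> cprod u = cprod v \<longrightarrow> ar (rho x u) (rho x v) K)"

lemma K0:
  assumes "thick_path x u" "thick_path x v" "length u \<le> 8" "length v \<le> 8"
     "\<And>z. z \<in> set u \<union> set v \<Longrightarrow> bdd 100 z" "cprod u = cprod v"
   shows "ar (rho x u) (rho x v) K0"
  using someI_ex[OF rho_bounded_relation[of 8 100], folded K0_def] assms by blast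

section \<open>Equality of paths, uniform over starting points\<close>

definition letter_system :: "rmap set \<Rightarrow> rmap set \<Rightarrow> bool" where
  "letter_system P \<Lambda> \<longleftrightarrow> (\<forall>x\<in>P. thick x) \<and> (\<forall>z\<in>\<Lambda>. bdd 100 z) \<and> (\<forall>x\<in>P. \<forall>z\<in>\<Lambda>. x \<circ> z \<in> P)"

text \<open>The area bound is demanded for every starting point in \<open>P\<close>, since a subword
  that is replaced starts where its prefix has led.\<close>

definition eqr :: "rmap set \<Rightarrow> rmap set \<Rightarrow> rmap list \<Rightarrow> rmap list \<Rightarrow> nat \<Rightarrow> bool" where
  "eqr P \<Lambda> u v k \<longleftrightarrow> set u \<subseteq> \<Lambda> \<and> set v \<subseteq> \<Lambda> \<and> cprod u = cprod v \<and> (\<forall>x\<in>P. ar (rho x u) (rho x v) k)"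

lemma letter_system_path: "letter_system P \<Lambda> \<Longrightarrow> x \<in> P \<Longrightarrow> set u \<subseteq> \<Lambda> \<Longrightarrow> thick_path x u \<and> x \<circ> cprod u \<in> P"
  by (induction u arbitrary: x) (auto simp: letter_system_def o_assoc)

lemma eqr_base:
  assumes "letter_system P \<Lambda>" "set u \<subseteq> \<Lambda>" "set v \<subseteq> \<Lambda>" "length u \<le> 8" "length v \<le> 8" "cprod u = cprod v"
  shows "eqr P \<Lambda> u v K0"
  unfolding eqr_def using assms
  by (auto intro!: K0 simp: letter_system_path) (auto simp: letter_system_def)

lemma eqr_refl: "letter_system P \<Lambda> \<Longrightarrow> set u \<subseteq> \<Lambda> \<Longrightarrow> eqr P \<Lambda> u u k"
  unfolding eqr_def by (auto intro!: ar_refl rho_words simp: letter_system_path)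

lemma eqr_sym: "eqr P \<Lambda> u v k \<Longrightarrow> eqr P \<Lambda> v u k"
  unfolding eqr_def by (auto intro: ar_sym)

lemma eqr_trans [trans]: "eqr P \<Lambda> u v k \<Longrightarrow> eqr P \<Lambda> v w l \<Longrightarrow> eqr P \<Lambda> u w (k + l)"
  unfolding eqr_def by (auto intro: ar_trans)

lemma eqr_mono: "eqr P \<Lambda> u v k \<Longrightarrow> k \<le> l \<Longrightarrow> eqr P \<Lambda> u v l"
  unfolding eqr_def using ar_mono by blast

lemma eqr_append:
  assumes "letter_system P \<Lambda>" "eqr P \<Lambda> u v k" "eqr P \<Lambda> u' v' l"
  shows "eqr P \<Lambda> (u @ u') (v @ v') (k + l)"
  unfolding eqr_def
proof (intro conjI ballI)
  fix x assume "x \<in> P"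
  hence "x \<circ> cprod v \<in> P" using assms(1,2) letter_system_path by (auto simp: eqr_def)
  thus "ar (rho x (u @ u')) (rho x (v @ v')) (k + l)"
    using assms(2,3) \<open>x \<in> P\<close> unfolding rho_append eqr_def by (auto intro!: ar_append)
qed (use assms in \<open>auto simp: eqr_def\<close>)

lemma eqr_context:
  assumes "letter_system P \<Lambda>" "eqr P \<Lambda> u v k" "set a \<subseteq> \<Lambda>" "set b \<subseteq> \<Lambda>"
  shows "eqr P \<Lambda> (a @ u @ b) (a @ v @ b) k"
proof -
  have "eqr P \<Lambda> (a @ (u @ b)) (a @ (v @ b)) (0 + (k + 0))"
    by (intro eqr_append eqr_refl assms)
  thus ?thesis by simp
qed

end

section \<open>A solvable group with quadratic fillings\<close>

definition phi :: real where "phi = (1 + sqrt 5) / 2"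

text \<open>The square of the golden ratio; it is the larger eigenvalue of the matrix with rows (2,
  1) and (1, 1), by which \<open>twist\<close> acts on its two coordinates.\<close>

definition lam :: real where "lam = phi + 1"

lemma phi_square: "phi * phi = phi + 1"
  by (simp add: phi_def field_simps)

lemma phi_bounds: "1.6 < phi" "phi < 1.7"
proof -
  have "2.2 < sqrt 5" by (rule real_less_rsqrt) (simp add: power2_eq_square)
  moreover have "sqrt 5 < 2.4" by (rule real_less_lsqrt) (simp_all add: power2_eq_square)
  ultimately show "1.6 < phi" "phi < 1.7" by (simp_all add: phi_def)
qed

lemma lam_gt: "2 < lam" using phi_bounds by (simp add: lam_def)

lemma lam_inverse: "inverse lam = 2 - phi"
proof (rule inverse_unique)
  show "lam * (2 - phi) = 1" using phi_square by (simp add: lam_def algebra_simps)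
qed

lemma pow2_le_lam: "2 ^ L \<le> lam ^ L"
  using lam_gt by (intro power_mono) auto

text \<open>The eigenvectors (\<open>phi\<close>, 1) and (1, -\<open>phi\<close>) of that matrix;
  their eigenvalues are \<open>lam\<close> and its inverse, so that \<open>sg\<close> is the
  exponent.\<close>

definition ev1 :: "bool \<Rightarrow> real" where "ev1 e = (if e then phi else 1)"
definition ev2 :: "bool \<Rightarrow> real" where "ev2 e = (if e then 1 else - phi)"
definition sg :: "bool \<Rightarrow> int" where "sg e = (if e then 1 else -1)"

lemma lam_powi_sg:
  "lam powi sg e = (if e then phi + 1 else 2 - phi)" "lam powi (- sg e) = (if e then 2 - phi else phi + 1)"
  by (cases e; simp add: sg_def power_int_minus lam_inverse; simp add: lam_def)+

lemma ev_eigen: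
  "2 * ev1 e + ev2 e = lam powi sg e * ev1 e" "ev1 e + ev2 e = lam powi sg e * ev2 e"
  "ev1 e - ev2 e = lam powi (- sg e) * ev1 e" "2 * ev2 e - ev1 e = lam powi (- sg e) * ev2 e"
  using phi_square unfolding lam_powi_sg by (auto simp: ev1_def ev2_def algebra_simps)

text \<open>The coordinates of \<open>(y, z)\<close> in the basis of eigenvectors \<open>(ev1 e, ev2 e)\<close> of the twist.\<close>

definition pr :: "bool \<Rightarrow> real \<Rightarrow> real \<Rightarrow> real" where
  "pr e y z = (ev1 e * y + ev2 e * z) / (phi + 2)"

text \<open>The two eigenvectors are orthogonal and both have squared length
  \<open>phi * phi + 1 = phi + 2\<close>, the denominator in \<open>pr\<close>.\<close>

lemma pr_sum: "ev1 True * pr True y z + ev1 False * pr False y z = y"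
   "ev2 True * pr True y z + ev2 False * pr False y z = z"
proof -
  have *: "phi + 2 \<noteq> 0" using phi_bounds by simp
  have p: "phi * (phi * x) = (phi + 1) * x" for x
    using phi_square by (simp flip: mult.assoc)
  have "ev1 True * pr True y z + ev1 False * pr False y z = (phi + 2) * y / (phi + 2)"
    unfolding pr_def times_divide_eq_right add_divide_distrib[symmetric]
    by (simp add: ev1_def ev2_def algebra_simps p)
  thus "ev1 True * pr True y z + ev1 False * pr False y z = y" using * by simp
  have "ev2 True * pr True y z + ev2 False * pr False y z = (phi + 2) * z / (phi + 2)"
    unfolding pr_def times_divide_eq_right add_divide_distrib[symmetric]
    by (simp add: ev1_def ev2_def algebra_simps p)
  thus "ev2 True * pr True y z + ev2 False * pr False y z = z" using * by simp
qed

lemma pr_linear: "pr e (y + y') (z + z') = pr e y z + pr e y' z'" "pr e (c * y) (c * z) = c * pr e y z"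
  "pr e 0 0 = 0" "pr e (y * c) (z * c) = pr e y z * c"
  by (simp_all add: pr_def add_divide_distrib algebra_simps)

text \<open>The absolute values of the entries of an eigenvector add up to \<open>phi + 1\<close>,
  less than the denominator; so passing to eigencoordinates does not enlarge the scale.\<close>

lemma pr_bound:
  assumes "\<bar>y\<bar> \<le> b" "\<bar>z\<bar> \<le> b"
  shows "\<bar>pr e y z\<bar> \<le> b"
proof -
  have "\<bar>ev1 e * y + ev2 e * z\<bar> \<le> \<bar>ev1 e\<bar> * \<bar>y\<bar> + \<bar>ev2 e\<bar> * \<bar>z\<bar>"
    using abs_triangle_ineq[of "ev1 e * y" "ev2 e * z"] by (simp add: abs_mult)
  also have "\<dots> \<le> \<bar>ev1 e\<bar> * b + \<bar>ev2 e\<bar> * b" using assms by (intro add_mono mult_left_mono) auto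
  also have "\<dots> = (phi + 1) * b" using phi_bounds by (auto simp: ev1_def ev2_def algebra_simps)
  also have "\<dots> \<le> (phi + 2) * b" using assms by (intro mult_right_mono) auto
  finally have "\<bar>ev1 e * y + ev2 e * z\<bar> \<le> (phi + 2) * b" .
  thus ?thesis using phi_bounds unfolding pr_def by (simp add: divide_simps mult.commute)
qed

definition twist :: "nat \<Rightarrow> nat \<Rightarrow> rmap" where "twist i j = E i j 1 \<circ> E j i 1"
definition twist' :: "nat \<Rightarrow> nat \<Rightarrow> rmap" where "twist' i j = E j i (-1) \<circ> E i j (-1)"

text \<open>An eigenvector placed in rows \<open>i\<close>, \<open>k\<close> of column
  \<open>j\<close>, or for \<open>rowE\<close> in columns \<open>j\<close>, \<open>k\<close> of row
  \<open>i\<close>; conjugation by the twist of these two indices only rescales it.\<close>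

definition colE :: "nat \<Rightarrow> nat \<Rightarrow> nat \<Rightarrow> bool \<Rightarrow> real \<Rightarrow> rmap" where
  "colE i k j e x = E i j (ev1 e * x) \<circ> E k j (ev2 e * x)"
definition rowE :: "nat \<Rightarrow> nat \<Rightarrow> nat \<Rightarrow> bool \<Rightarrow> real \<Rightarrow> rmap" where
  "rowE i j k e x = E i j (ev1 e * x) \<circ> E i k (ev2 e * x)"

definition pw :: "'a \<Rightarrow> 'a \<Rightarrow> int \<Rightarrow> 'a list" where
  "pw g g' k = (if k \<ge> 0 then replicate (nat k) g else replicate (nat (- k)) g')"

text \<open>
  \<open>colv i k j L y z\<close> and \<open>rowv i j k L y z\<close> are words of length linear in \<open>L\<close> for
  \<open>E i j y \<circ> E k j z\<close> and \<open>E i j y \<circ> E i k z\<close>.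
\<close>

definition colv :: "nat \<Rightarrow> nat \<Rightarrow> nat \<Rightarrow> nat \<Rightarrow> real \<Rightarrow> real \<Rightarrow> rmap list" where
  "colv i k j L y z =
     pw (twist i k) (twist' i k) (int L) @ [colE i k j True (pr True y z * lam powi (- int L))] @ pw (twist i k) (twist' i k) (- int L) @
     pw (twist i k) (twist' i k) (- int L) @ [colE i k j False (pr False y z * lam powi (- int L))] @ pw (twist i k) (twist' i k) (int L)"

definition rowv :: "nat \<Rightarrow> nat \<Rightarrow> nat \<Rightarrow> nat \<Rightarrow> real \<Rightarrow> real \<Rightarrow> rmap list" where
  "rowv i j k L y z =
     pw (twist j k) (twist' j k) (- int L) @ [rowE i j k True (pr True y z * lam powi (- int L))] @ pw (twist j k) (twist' j k) (int L) @
     pw (twist j k) (twist' j k) (int L) @ [rowE i j k False (pr False y z * lam powi (- int L))] @ pw (twist j k) (twist' j k) (- int L)"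

text \<open>
  Eigenvectors of the unipotent group for the action of the torus; the element \<open>(k, l)\<close> of the torus scales the root
  \<open>\<rho>\<close> by the power of \<open>lam\<close> with exponent \<open>ca \<rho> * k + cb \<rho> * l\<close>.
\<close>

datatype root = Ra bool | Rb bool | Rc bool bool

fun ca :: "root \<Rightarrow> int" where
  "ca (Ra e) = sg e" | "ca (Rb f) = 0" | "ca (Rc e f) = sg e"

fun cb :: "root \<Rightarrow> int" where
  "cb (Ra e) = 0" | "cb (Rb f) = - sg f" | "cb (Rc e f) = - sg f"

lemma ca_cb: "ca \<rho> \<in> {-1, 0, 1}" "cb \<rho> \<in> {-1, 0, 1}" "ca \<rho> \<noteq> 0 \<or> cb \<rho> \<noteq> 0"
  by (cases \<rho>; simp add: sg_def)+

section \<open>The unipotent group on five indices and its torus\<close>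

locale sol_group = SL_presentation +
  fixes p q m r s :: nat
  assumes dist: "distinct [p, q, m, r, s]" and lt: "p < n" "q < n" "m < n" "r < n" "s < n"
begin

lemma ne [simp]: "p \<noteq> q" "p \<noteq> m" "p \<noteq> r" "p \<noteq> s" "q \<noteq> p" "q \<noteq> m" "q \<noteq> r" "q \<noteq> s"
    "m \<noteq> p" "m \<noteq> q" "m \<noteq> r" "m \<noteq> s" "r \<noteq> p" "r \<noteq> q" "r \<noteq> m" "r \<noteq> s" "s \<noteq> p" "s \<noteq> q" "s \<noteq> m" "s \<noteq> r"
  using dist by auto

text \<open>Block unitriangular matrices for the index blocks {p, q}, {m}, {r, s}: the
  \<open>a\<close> form the column above m, the \<open>b\<close> the row to the right of m and the
  \<open>c\<close> the corner.\<close>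

definition Nn :: "real \<Rightarrow> real \<Rightarrow> real \<Rightarrow> real \<Rightarrow> real \<Rightarrow> real \<Rightarrow> real \<Rightarrow> real \<Rightarrow> rmap" where
  "Nn a1 a2 b1 b2 c11 c12 c21 c22 v =
     v(p := v p + a1 * v m + c11 * v r + c12 * v s, q := v q + a2 * v m + c21 * v r + c22 * v s,
       m := v m + b1 * v r + b2 * v s)"

lemma Nn_comp: "Nn a1 a2 b1 b2 c11 c12 c21 c22 \<circ> Nn a1' a2' b1' b2' c11' c12' c21' c22' =
   Nn (a1 + a1') (a2 + a2') (b1 + b1') (b2 + b2') (c11 + c11' + a1 * b1') (c12 + c12' + a1 * b2')
      (c21 + c21' + a2 * b1') (c22 + c22' + a2 * b2')"
  by (rule ext)+ (simp add: Nn_def algebra_simps)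

lemma Nn_zero: "Nn 0 0 0 0 0 0 0 0 = id"
  by (rule ext)+ (simp add: Nn_def)

abbreviation "A \<equiv> twist p q"
abbreviation "A' \<equiv> twist' p q"
abbreviation "B \<equiv> twist r s"
abbreviation "B' \<equiv> twist' r s"

lemma AB_inv: "A \<circ> A' = id" "A' \<circ> A = id" "B \<circ> B' = id" "B' \<circ> B = id"
  by (rule ext, rule ext, simp add: twist_def twist'_def E_def)+

lemma AB_comm: "A \<circ> B = B \<circ> A" "A \<circ> B' = B' \<circ> A" "A' \<circ> B = B \<circ> A'" "A' \<circ> B' = B' \<circ> A'"
  by (rule ext, rule ext, simp add: twist_def twist'_def E_def)+

lemma Nn_A: "Nn a1 a2 b1 b2 c11 c12 c21 c22 \<circ> A = A \<circ> Nn (a1 - a2) (2 * a2 - a1) b1 b2 (c11 - c21) (c12 - c22) (2 * c21 - c11) (2 * c22 - c12)"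
  "Nn a1 a2 b1 b2 c11 c12 c21 c22 \<circ> A' = A' \<circ> Nn (2 * a1 + a2) (a1 + a2) b1 b2 (2 * c11 + c21) (2 * c12 + c22) (c11 + c21) (c12 + c22)"
  by (rule ext, rule ext, simp add: twist_def twist'_def E_def Nn_def algebra_simps)+

lemma Nn_B: "Nn a1 a2 b1 b2 c11 c12 c21 c22 \<circ> B = B \<circ> Nn a1 a2 (2 * b1 + b2) (b1 + b2) (2 * c11 + c12) (c11 + c12) (2 * c21 + c22) (c21 + c22)"
  "Nn a1 a2 b1 b2 c11 c12 c21 c22 \<circ> B' = B' \<circ> Nn a1 a2 (b1 - b2) (2 * b2 - b1) (c11 - c12) (2 * c12 - c11) (c21 - c22) (2 * c22 - c21)"
  by (rule ext, rule ext, simp add: twist_def twist'_def E_def Nn_def algebra_simps)+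

lemma bdd_Nn:
  assumes "\<bar>a1\<bar> \<le> c" "\<bar>a2\<bar> \<le> c" "\<bar>b1\<bar> \<le> c" "\<bar>b2\<bar> \<le> c" "\<bar>c11\<bar> \<le> c" "\<bar>c12\<bar> \<le> c" "\<bar>c21\<bar> \<le> c" "\<bar>c22\<bar> \<le> c"
  shows "bdd (1 + 3 * c) (Nn a1 a2 b1 b2 c11 c12 c21 c22)"
  unfolding bdd_def
proof (intro allI impI)
  fix v :: "nat \<Rightarrow> real" and t i assume v: "\<forall>i. \<bar>v i\<bar> \<le> t"
  hence t: "0 \<le> t" using abs_ge_zero order_trans by blast
  have c: "0 \<le> c" using assms(1) abs_ge_zero order_trans by blast
  have *: "\<bar>x * v k\<bar> \<le> c * t" if "\<bar>x\<bar> \<le> c" for x k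
    using that v c t by (simp add: abs_mult mult_mono)
  have l: "\<bar>x1 + y1\<bar> \<le> e1 + e2" if "\<bar>x1\<bar> \<le> e1" "\<bar>y1\<bar> \<le> e2" for x1 y1 e1 e2 :: real
    using that by linarith
  have "\<bar>v p + a1 * v m + c11 * v r + c12 * v s\<bar> \<le> t + c * t + c * t + c * t"
       "\<bar>v q + a2 * v m + c21 * v r + c22 * v s\<bar> \<le> t + c * t + c * t + c * t"
       "\<bar>v m + b1 * v r + b2 * v s\<bar> \<le> t + c * t + c * t"
    by (intro l * assms; use v in blast)+
  moreover have "0 \<le> c * t" using c t by simp
  moreover have "(1 + 3 * c) * t = t + c * t + c * t + c * t" by (simp add: algebra_simps)
  ultimately show "\<bar>Nn a1 a2 b1 b2 c11 c12 c21 c22 v i\<bar> \<le> (1 + 3 * c) * t"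
    using v[rule_format, of i] by (auto simp: Nn_def)
qed

lemma Nn_E: "Nn a1 a2 b1 b2 c11 c12 c21 c22 =
    E p r c11 \<circ> (E p s c12 \<circ> (E q r c21 \<circ> (E q s c22 \<circ> (E m r b1 \<circ> (E m s b2 \<circ> (E p m a1 \<circ> E q m a2))))))"
  by (rule ext)+ (simp add: E_def Nn_def algebra_simps)

lemma Nn_int:
  "Nn (of_int a1) (of_int a2) (of_int b1) (of_int b2) (of_int c11) (of_int c12) (of_int c21) (of_int c22) \<in> act ` SL n"
  unfolding Nn_E by (intro act_SL_comp E_in_act lt ne)

lemma A_in_act: "A \<in> act ` SL n" "A' \<in> act ` SL n" "B \<in> act ` SL n" "B' \<in> act ` SL n"
  unfolding twist_def twist'_def
  using lt E_in_act[of _ n _ 1] E_in_act[of _ n _ "-1"] by (auto intro!: act_SL_comp)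

text \<open>The inverse has the entries -a, -b and a b - c, which lie in [-1, 1]; either map then
  has norm at most 1 + 3.\<close>

lemma good_Nn:
  assumes "\<And>x. x \<in> {a1, a2, b1, b2, c11, c12, c21, c22} \<Longrightarrow> 0 \<le> x \<and> x \<le> 1"
  shows "good (Nn a1 a2 b1 b2 c11 c12 c21 c22)"
proof -
  have ab: "\<bar>x * y - z\<bar> \<le> 1" if "x \<in> {a1, a2}" "y \<in> {b1, b2}" "z \<in> {c11, c12, c21, c22}" for x y z
  proof -
    have "0 \<le> x * y" "x * y \<le> 1" "0 \<le> z" "z \<le> 1" using that assms by (auto intro!: mult_nonneg_nonneg mult_le_one)
    thus ?thesis by linarith
  qed
  let ?g = "Nn (- a1) (- a2) (- b1) (- b2) (a1 * b1 - c11) (a1 * b2 - c12) (a2 * b1 - c21) (a2 * b2 - c22)"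
  have "bdd (1 + 3 * 1) (Nn a1 a2 b1 b2 c11 c12 c21 c22)"
    using assms by (intro bdd_Nn) auto
  moreover have "bdd (1 + 3 * 1) ?g"
    using assms by (intro bdd_Nn ab) auto
  moreover have "Nn a1 a2 b1 b2 c11 c12 c21 c22 \<circ> ?g = id" "?g \<circ> Nn a1 a2 b1 b2 c11 c12 c21 c22 = id"
    by (simp_all add: Nn_comp Nn_zero)
  ultimately show ?thesis unfolding good_def by auto
qed

lemma thick_Nn: "thick (Nn a1 a2 b1 b2 c11 c12 c21 c22)"
proof -
  define fa1 fa2 fb1 fb2 where "fa1 = \<lfloor>a1\<rfloor>" and "fa2 = \<lfloor>a2\<rfloor>" and "fb1 = \<lfloor>b1\<rfloor>" and "fb2 = \<lfloor>b2\<rfloor>"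
  note f1 = fa1_def fa2_def fb1_def fb2_def
  \<comment> \<open>An integral left factor with rounded \<open>a\<close> adds the product of this
    integer with the fractional part of \<open>b\<close> to the corner; it is subtracted before the
    corner is rounded.\<close>
  define g11 g12 g21 g22 where "g11 = c11 - fa1 * (b1 - fb1)" and "g12 = c12 - fa1 * (b2 - fb2)"
    and "g21 = c21 - fa2 * (b1 - fb1)" and "g22 = c22 - fa2 * (b2 - fb2)"
  note g = g11_def g12_def g21_def g22_def
  have "Nn a1 a2 b1 b2 c11 c12 c21 c22 =
      Nn fa1 fa2 fb1 fb2 (of_int \<lfloor>g11\<rfloor>) (of_int \<lfloor>g12\<rfloor>) (of_int \<lfloor>g21\<rfloor>) (of_int \<lfloor>g22\<rfloor>) \<circ>
      Nn (a1 - fa1) (a2 - fa2) (b1 - fb1) (b2 - fb2) (g11 - of_int \<lfloor>g11\<rfloor>) (g12 - of_int \<lfloor>g12\<rfloor>)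
         (g21 - of_int \<lfloor>g21\<rfloor>) (g22 - of_int \<lfloor>g22\<rfloor>)"
    by (simp add: Nn_comp) (simp add: g)
  moreover have "good (Nn (a1 - fa1) (a2 - fa2) (b1 - fb1) (b2 - fb2) (g11 - of_int \<lfloor>g11\<rfloor>) (g12 - of_int \<lfloor>g12\<rfloor>)
         (g21 - of_int \<lfloor>g21\<rfloor>) (g22 - of_int \<lfloor>g22\<rfloor>))"
  proof (rule good_Nn)
    fix x assume x: "x \<in> {a1 - fa1, a2 - fa2, b1 - fb1, b2 - fb2, g11 - of_int \<lfloor>g11\<rfloor>, g12 - of_int \<lfloor>g12\<rfloor>,
         g21 - of_int \<lfloor>g21\<rfloor>, g22 - of_int \<lfloor>g22\<rfloor>}"
    have "0 \<le> y - of_int \<lfloor>y\<rfloor> \<and> y - of_int \<lfloor>y\<rfloor> \<le> 1" for y :: real by linarith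
    thus "0 \<le> x \<and> x \<le> 1" using x unfolding f1 by blast
  qed
  moreover obtain M where "M \<in> SL n" "Nn fa1 fa2 fb1 fb2 (of_int \<lfloor>g11\<rfloor>) (of_int \<lfloor>g12\<rfloor>) (of_int \<lfloor>g21\<rfloor>) (of_int \<lfloor>g22\<rfloor>) = act M"
    using Nn_int[of fa1 fa2 fb1 fb2 "\<lfloor>g11\<rfloor>" "\<lfloor>g12\<rfloor>" "\<lfloor>g21\<rfloor>" "\<lfloor>g22\<rfloor>"] by blast
  ultimately show ?thesis unfolding thick_def by auto
qed

text \<open>SL(n, Z) times the unipotent group. Torus letters are integral and normalize the
  unipotent group, so they pass to the left of it and are absorbed.\<close>

definition P :: "rmap set" where
  "P = {act M \<circ> Nn a1 a2 b1 b2 c11 c12 c21 c22 | M a1 a2 b1 b2 c11 c12 c21 c22. M \<in> SL n}"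

text \<open>The bound 8 = 2 * 2 * 2 admits corner roots \<open>rl (Rc e f) x\<close> with |x| at
  most 2, eigenvector entries being at most 2. Such letters have norm at most 1 + 3 * 8, below the
  100 in \<open>letter_system\<close>.\<close>

definition \<Lambda> :: "rmap set" where
  "\<Lambda> = {A, A', B, B'} \<union> {Nn a1 a2 b1 b2 c11 c12 c21 c22 | a1 a2 b1 b2 c11 c12 c21 c22.
     \<forall>x\<in>{a1, a2, b1, b2, c11, c12, c21, c22}. \<bar>x\<bar> \<le> 8}"

lemma PI: "f \<in> act ` SL n \<Longrightarrow> f \<circ> Nn a1 a2 b1 b2 c11 c12 c21 c22 \<in> P"
  unfolding P_def by blast

lemma P_id: "id \<in> P"
  using PI[OF id_in_act, of 0 0 0 0 0 0 0 0] by (simp add: Nn_zero)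

lemma letters: "letter_system P \<Lambda>"
  unfolding letter_system_def
proof (intro conjI ballI)
  fix x assume "x \<in> P"
  thus "thick x" using thick_Nn thick_act by (auto simp: P_def)
next
  fix z assume z: "z \<in> \<Lambda>"
  have "bdd ((1 + \<bar>1\<bar>) * (1 + \<bar>1\<bar>)) (twist i j)" "bdd ((1 + \<bar>-1\<bar>) * (1 + \<bar>-1\<bar>)) (twist' i j)" for i j
    unfolding twist_def twist'_def by (intro bdd_comp bdd_E)+
  hence "bdd 100 (twist i j) \<and> bdd 100 (twist' i j)" for i j using bdd_mono[of _ _ 100] by force
  hence t: "bdd 100 (twist i j)" "bdd 100 (twist' i j)" for i j by auto
  have "bdd 100 (Nn a1 a2 b1 b2 c11 c12 c21 c22)"
    if "\<forall>x\<in>{a1, a2, b1, b2, c11, c12, c21, c22}. \<bar>x\<bar> \<le> 8" for a1 a2 b1 b2 c11 c12 c21 c22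
    using that by (intro bdd_mono[OF bdd_Nn[of _ 8]]) auto
  thus "bdd 100 z" using t z unfolding \<Lambda>_def by blast
next
  fix x z assume "x \<in> P" and z: "z \<in> \<Lambda>"
  then obtain f a1 a2 b1 b2 c11 c12 c21 c22 where f: "f \<in> act ` SL n" "x = f \<circ> Nn a1 a2 b1 b2 c11 c12 c21 c22"
    unfolding P_def by blast
  note i = PI[OF act_SL_comp[OF f(1) A_in_act(1)]] PI[OF act_SL_comp[OF f(1) A_in_act(2)]]
    PI[OF act_SL_comp[OF f(1) A_in_act(3)]] PI[OF act_SL_comp[OF f(1) A_in_act(4)]]
  have "x \<circ> A \<in> P" "x \<circ> A' \<in> P" "x \<circ> B \<in> P" "x \<circ> B' \<in> P"
    unfolding f(2) comp_assoc Nn_A Nn_B using i by (simp_all only: comp_assoc)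
  moreover have "x \<circ> Nn a1' a2' b1' b2' c11' c12' c21' c22' \<in> P" for a1' a2' b1' b2' c11' c12' c21' c22'
    unfolding f(2) comp_assoc Nn_comp by (rule PI[OF f(1)])
  ultimately show "x \<circ> z \<in> P" using z unfolding \<Lambda>_def by blast
qed

text \<open>Areas are counted in units of \<open>K0\<close>, the cost of one relation between paths
  of length at most 8.\<close>

definition eqK :: "nat \<Rightarrow> rmap list \<Rightarrow> rmap list \<Rightarrow> bool" where
  eq_def: "eqK k u v \<longleftrightarrow> eqr P \<Lambda> u v (k * K0)"

abbreviation eq :: "rmap list \<Rightarrow> rmap list \<Rightarrow> nat \<Rightarrow> bool" where
  "eq u v k \<equiv> eqK k u v"

lemma eq_base: "set u \<subseteq> \<Lambda> \<Longrightarrow> set v \<subseteq> \<Lambda> \<Longrightarrow> length u \<le> 8 \<Longrightarrow> length v \<le> 8 \<Longrightarrow> cprod u = cprod v \<Longrightarrow> eq u v 1"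
  unfolding eq_def using eqr_base[OF letters] by simp

lemma eq_refl: "set u \<subseteq> \<Lambda> \<Longrightarrow> eq u u k"
  unfolding eq_def using eqr_refl[OF letters] by simp

lemma eq_sym: "eq u v k \<Longrightarrow> eq v u k"
  unfolding eq_def by (rule eqr_sym)

lemma eq_trans [trans]: "eq u v k \<Longrightarrow> eq v w l \<Longrightarrow> eq u w (k + l)"
  unfolding eq_def using eqr_trans[of P \<Lambda> u v "k * K0" w "l * K0"] by (simp add: algebra_simps)

lemma eq_mono: "eq u v k \<Longrightarrow> k \<le> l \<Longrightarrow> eq u v l"
  unfolding eq_def using eqr_mono mult_le_mono1 by blast

lemma eq_append: "eq u v k \<Longrightarrow> eq u' v' l \<Longrightarrow> eq (u @ u') (v @ v') (k + l)"
  unfolding eq_def using eqr_append[OF letters, of u v "k * K0" u' v' "l * K0"] by (simp add: algebra_simps)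

lemma eq_context: "eq u v k \<Longrightarrow> set a \<subseteq> \<Lambda> \<Longrightarrow> set b \<subseteq> \<Lambda> \<Longrightarrow> eq (a @ u @ b) (a @ v @ b) k"
  unfolding eq_def by (rule eqr_context[OF letters])

lemma eq_left: "eq u v k \<Longrightarrow> set a \<subseteq> \<Lambda> \<Longrightarrow> eq (a @ u) (a @ v) k"
  using eq_context[of k u v a "[]"] by simp

lemma eq_right: "eq u v k \<Longrightarrow> set b \<subseteq> \<Lambda> \<Longrightarrow> eq (u @ b) (v @ b) k"
  using eq_context[of k u v "[]" b] by simp

lemma AB_letters [simp]: "A \<in> \<Lambda>" "A' \<in> \<Lambda>" "B \<in> \<Lambda>" "B' \<in> \<Lambda>"
  by (auto simp: \<Lambda>_def)

lemma Nn_letter: "(\<And>x. x \<in> {a1, a2, b1, b2, c11, c12, c21, c22} \<Longrightarrow> \<bar>x\<bar> \<le> 8) \<Longrightarrow> Nn a1 a2 b1 b2 c11 c12 c21 c22 \<in> \<Lambda>"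
  unfolding \<Lambda>_def by blast

subsection \<open>Torus words\<close>

lemma eq_commute1:
  assumes "\<And>b. b \<in> set v \<Longrightarrow> a \<circ> b = b \<circ> a" "a \<in> \<Lambda>" "set v \<subseteq> \<Lambda>"
  shows "eq (a # v) (v @ [a]) (length v)"
  using assms(1,3)
proof (induction v)
  case (Cons b v)
  have "eq ([] @ [a, b] @ v) ([] @ [b, a] @ v) 1"
  proof (intro eq_context eq_base)
    show "cprod [a, b] = cprod [b, a]" using Cons.prems(1)[of b] by (simp only: cprod_simps comp_id list.set_intros)
  qed (use Cons.prems(2) assms(2) in auto)
  moreover have "eq ([b] @ (a # v)) ([b] @ (v @ [a])) (length v)"
    using Cons.prems(2) by (intro eq_left Cons.IH Cons.prems(1)) auto
  ultimately have "eq (a # b # v) ((b # v) @ [a]) (1 + length v)" using eq_trans by fastforce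
  thus ?case by simp
qed (use assms(2) in \<open>auto intro: eq_refl\<close>)

lemma eq_commute:
  assumes "\<And>a b. a \<in> set u \<Longrightarrow> b \<in> set v \<Longrightarrow> a \<circ> b = b \<circ> a" "set u \<subseteq> \<Lambda>" "set v \<subseteq> \<Lambda>"
  shows "eq (u @ v) (v @ u) (length u * length v)"
  using assms(1,2)
proof (induction u)
  case (Cons a u)
  have "eq ([a] @ (u @ v)) ([a] @ (v @ u)) (length u * length v)"
    using Cons.prems(2) by (intro eq_left Cons.IH Cons.prems(1)) auto
  moreover have "eq ((a # v) @ u) ((v @ [a]) @ u) (length v)"
    using Cons.prems(2) assms(3) by (intro eq_right eq_commute1 Cons.prems(1)) auto
  ultimately have "eq (a # u @ v) (v @ a # u) (length u * length v + length v)" using eq_trans by fastforce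
  thus ?case by (simp add: add.commute)
qed (use assms(3) in \<open>auto intro: eq_refl\<close>)

lemma eq_cancel:
  assumes "g \<circ> g' = id" "g \<in> \<Lambda>" "g' \<in> \<Lambda>"
  shows "eq (replicate i g @ replicate j g') (pw g g' (int i - int j)) i"
proof (induction i arbitrary: j)
  case 0
  show ?case using assms by (auto simp: pw_def intro!: eq_refl)
next
  case (Suc i)
  show ?case
  proof (cases j)
    case 0
    thus ?thesis using assms by (auto simp: pw_def nat_add_distrib intro!: eq_refl)
  next
    case (Suc k)
    have "eq (replicate i g @ [g, g'] @ replicate k g') (replicate i g @ [] @ replicate k g') 1"
      using assms by (intro eq_context eq_base) auto
    moreover have "replicate (Suc i) g @ replicate j g' = replicate i g @ [g, g'] @ replicate k g'"
      using Suc by (simp add: replicate_app_Cons_same)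
    ultimately have "eq (replicate (Suc i) g @ replicate j g') (replicate i g @ replicate k g') 1" by simp
    from eq_trans[OF this Suc.IH] show ?thesis using Suc by simp
  qed
qed

lemma pw_letters [simp]: "g \<in> \<Lambda> \<Longrightarrow> g' \<in> \<Lambda> \<Longrightarrow> set (pw g g' k) \<subseteq> \<Lambda>"
  by (auto simp: pw_def)

lemma set_pw: "set (pw g g' k) \<subseteq> {g, g'}"
  by (auto simp: pw_def)

lemma length_pw [simp]: "length (pw g g' k) = nat \<bar>k\<bar>"
  by (auto simp: pw_def)

lemma pw_swap: "pw g' g k = pw g g' (- k)"
  by (auto simp: pw_def)

lemma eq_pw_add:
  assumes "g \<circ> g' = id" "g' \<circ> g = id" "g \<in> \<Lambda>" "g' \<in> \<Lambda>"
  shows "eq (pw g g' k @ pw g g' l) (pw g g' (k + l)) (nat \<bar>k\<bar>)"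
proof -
  consider "k \<ge> 0" "l \<ge> 0" | "k < 0" "l < 0" | "k \<ge> 0" "l < 0" | "k < 0" "l \<ge> 0" by linarith
  thus ?thesis
  proof cases
    case 1
    hence "pw g g' k @ pw g g' l = pw g g' (k + l)" by (simp add: pw_def nat_add_distrib replicate_add)
    thus ?thesis using pw_letters[OF assms(3,4)] by (auto intro!: eq_refl simp del: pw_letters)
  next
    case 2
    hence "nat (- k - l) = nat (- k) + nat (- l)" by simp
    hence "pw g g' k @ pw g g' l = pw g g' (k + l)" using 2 by (simp add: pw_def replicate_add)
    thus ?thesis using pw_letters[OF assms(3,4)] by (auto intro!: eq_refl simp del: pw_letters)
  next
    case 3
    hence "pw g g' k @ pw g g' l = replicate (nat k) g @ replicate (nat (- l)) g'" by (simp add: pw_def)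
    moreover have "int (nat k) - int (nat (- l)) = k + l" "nat \<bar>k\<bar> = nat k" using 3 by auto
    ultimately show ?thesis using eq_cancel[OF assms(1,3,4), of "nat k" "nat (- l)"] by simp
  next
    case 4
    hence "pw g g' k @ pw g g' l = replicate (nat (- k)) g' @ replicate (nat l) g" by (simp add: pw_def)
    moreover have "int (nat (- k)) - int (nat l) = - (k + l)" "nat \<bar>k\<bar> = nat (- k)" using 4 by auto
    ultimately show ?thesis using eq_cancel[OF assms(2,4,3), of "nat (- k)" "nat l"] pw_swap[of g' g "- (k + l)"]
      by (simp only: minus_minus)
  qed
qed

definition Tw :: "int \<Rightarrow> int \<Rightarrow> rmap list" where "Tw k l = pw A A' k @ pw B B' l"
definition Ti :: "int \<Rightarrow> int \<Rightarrow> rmap list" where "Ti k l = pw B B' (- l) @ pw A A' (- k)"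

lemma Tw_letters [simp]: "set (Tw k l) \<subseteq> \<Lambda>" "set (Ti k l) \<subseteq> \<Lambda>"
  using pw_letters[of A A'] pw_letters[of B B'] by (simp_all add: Tw_def Ti_def)

abbreviation Q :: "nat \<Rightarrow> nat" where "Q x \<equiv> (x + 1)\<^sup>2"

text \<open>This rectangle of commutations is where the quadratic cost comes from; the conjugations
  below cost linearly many units.\<close>

lemma eq_pw_AB: "eq (pw A A' k @ pw B B' l) (pw B B' l @ pw A A' k) (nat \<bar>k\<bar> * nat \<bar>l\<bar>)"
proof -
  have "a \<circ> b = b \<circ> a" if "a \<in> set (pw A A' k)" "b \<in> set (pw B B' l)" for a b
  proof -
    have "a = A \<or> a = A'" "b = B \<or> b = B'"
      using that set_pw[of A A' k] set_pw[of B B' l] by blast+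
    thus ?thesis using AB_comm by (elim disjE) (simp_all only:)
  qed
  from eq_commute[OF this, of "pw A A' k" "pw B B' l"] show ?thesis by simp
qed

lemma Q_bound:
  assumes "a \<le> x" "b \<le> x" "c \<le> x" "e \<le> x"
  shows "a * b + (c + e) \<le> 4 * Q x"
proof -
  have "a * b \<le> x * x" using assms by (intro mult_le_mono)
  thus ?thesis using assms by (simp add: power2_eq_square)
qed

lemma eq_Tw_add:
  assumes "nat \<bar>k\<bar> \<le> x" "nat \<bar>l\<bar> \<le> x" "nat \<bar>k'\<bar> \<le> x" "nat \<bar>l'\<bar> \<le> x"
  shows "eq (Tw k l @ Tw k' l') (Tw (k + k') (l + l')) (4 * Q x)"
    "eq (Ti k' l' @ Ti k l) (Ti (k + k') (l + l')) (4 * Q x)"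
proof -
  have "eq (pw A A' k @ (pw B B' l @ pw A A' k') @ pw B B' l') (pw A A' k @ (pw A A' k' @ pw B B' l) @ pw B B' l') (nat \<bar>k'\<bar> * nat \<bar>l\<bar>)"
    by (intro eq_context eq_sym[OF eq_pw_AB]) simp_all
  also have "eq \<dots> (Tw (k + k') (l + l')) (nat \<bar>k\<bar> + nat \<bar>l\<bar>)"
    using eq_append[OF eq_pw_add[OF AB_inv(1,2) AB_letters(1,2), of k k'] eq_pw_add[OF AB_inv(3,4) AB_letters(3,4), of l l']]
    by (simp only: Tw_def append.assoc)
  finally have "eq (Tw k l @ Tw k' l') (Tw (k + k') (l + l')) (nat \<bar>k'\<bar> * nat \<bar>l\<bar> + (nat \<bar>k\<bar> + nat \<bar>l\<bar>))"
    by (simp only: Tw_def append.assoc)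
  thus "eq (Tw k l @ Tw k' l') (Tw (k + k') (l + l')) (4 * Q x)"
    by (rule eq_mono) (intro Q_bound assms)
  have "eq (pw B B' (- l') @ (pw A A' (- k') @ pw B B' (- l)) @ pw A A' (- k)) (pw B B' (- l') @ (pw B B' (- l) @ pw A A' (- k')) @ pw A A' (- k)) (nat \<bar>k'\<bar> * nat \<bar>l\<bar>)"
    using eq_pw_AB[of "- k'" "- l"] by (intro eq_context) simp_all
  also have "eq \<dots> (Ti (k + k') (l + l')) (nat \<bar>l'\<bar> + nat \<bar>k'\<bar>)"
    using eq_append[OF eq_pw_add[OF AB_inv(3,4) AB_letters(3,4), of "- l'" "- l"] eq_pw_add[OF AB_inv(1,2) AB_letters(1,2), of "- k'" "- k"]]
    by (simp only: Ti_def append.assoc abs_minus_cancel minus_add_distrib add.commute[of "- k'"] add.commute[of "- l'"])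
  finally have "eq (Ti k' l' @ Ti k l) (Ti (k + k') (l + l')) (nat \<bar>k'\<bar> * nat \<bar>l\<bar> + (nat \<bar>l'\<bar> + nat \<bar>k'\<bar>))"
    by (simp only: Ti_def append.assoc)
  thus "eq (Ti k' l' @ Ti k l) (Ti (k + k') (l + l')) (4 * Q x)"
    by (rule eq_mono) (intro Q_bound assms)
qed

lemma eq_pw_inv:
  assumes "g \<circ> g' = id" "g' \<circ> g = id" "g \<in> \<Lambda>" "g' \<in> \<Lambda>"
  shows "eq (pw g g' k @ pw g g' (- k)) [] (nat \<bar>k\<bar>)" "eq (pw g g' (- k) @ pw g g' k) [] (nat \<bar>k\<bar>)"
proof -
  have 0: "pw g g' 0 = []" by (simp add: pw_def)
  show "eq (pw g g' k @ pw g g' (- k)) [] (nat \<bar>k\<bar>)"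
    using eq_pw_add[OF assms, of k "- k"] unfolding add.right_inverse 0 .
  show "eq (pw g g' (- k) @ pw g g' k) [] (nat \<bar>k\<bar>)"
    using eq_pw_add[OF assms, of "- k" k] unfolding add.left_inverse 0 abs_minus_cancel .
qed

lemmas eq_A_inv = eq_pw_inv[OF AB_inv(1,2) AB_letters(1,2)]
lemmas eq_B_inv = eq_pw_inv[OF AB_inv(3,4) AB_letters(3,4)]

lemma eq_Tw_inv:
  shows "eq (Tw k l @ Ti k l) [] (nat \<bar>l\<bar> + nat \<bar>k\<bar>)" "eq (Ti k l @ Tw k l) [] (nat \<bar>k\<bar> + nat \<bar>l\<bar>)"
proof -
  have "eq (pw A A' k @ (pw B B' l @ pw B B' (- l)) @ pw A A' (- k)) (pw A A' k @ [] @ pw A A' (- k)) (nat \<bar>l\<bar>)"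
    by (intro eq_context eq_B_inv) simp_all
  also have "eq \<dots> [] (nat \<bar>k\<bar>)" using eq_A_inv(1) by simp
  finally show "eq (Tw k l @ Ti k l) [] (nat \<bar>l\<bar> + nat \<bar>k\<bar>)" by (simp only: Tw_def Ti_def append.assoc)
  have "eq (pw B B' (- l) @ (pw A A' (- k) @ pw A A' k) @ pw B B' l) (pw B B' (- l) @ [] @ pw B B' l) (nat \<bar>k\<bar>)"
    by (intro eq_context eq_A_inv) simp_all
  also have "eq \<dots> [] (nat \<bar>l\<bar>)" using eq_B_inv(2) by simp
  finally show "eq (Ti k l @ Tw k l) [] (nat \<bar>k\<bar> + nat \<bar>l\<bar>)" by (simp only: Tw_def Ti_def append.assoc)
qed

end

lemma ev_eig:
  "2 * (ev1 e * x) + ev2 e * x = ev1 e * (lam powi sg e * x)" "ev1 e * x + ev2 e * x = ev2 e * (lam powi sg e * x)"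
  "ev1 e * x - ev2 e * x = ev1 e * (lam powi (- sg e) * x)" "2 * (ev2 e * x) - ev1 e * x = ev2 e * (lam powi (- sg e) * x)"
proof -
  have "2 * (ev1 e * x) + ev2 e * x = (2 * ev1 e + ev2 e) * x" "ev1 e * x + ev2 e * x = (ev1 e + ev2 e) * x"
    "ev1 e * x - ev2 e * x = (ev1 e - ev2 e) * x" "2 * (ev2 e * x) - ev1 e * x = (2 * ev2 e - ev1 e) * x"
    by (simp_all add: algebra_simps)
  thus "2 * (ev1 e * x) + ev2 e * x = ev1 e * (lam powi sg e * x)" "ev1 e * x + ev2 e * x = ev2 e * (lam powi sg e * x)"
  "ev1 e * x - ev2 e * x = ev1 e * (lam powi (- sg e) * x)" "2 * (ev2 e * x) - ev1 e * x = ev2 e * (lam powi (- sg e) * x)"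
    unfolding ev_eigen by simp_all
qed

lemma ev_le: "\<bar>ev1 e\<bar> \<le> 2" "\<bar>ev2 e\<bar> \<le> 2"
  using phi_bounds by (auto simp: ev1_def ev2_def)

lemma lam_neq0 [simp]: "lam \<noteq> 0" using lam_gt by simp

lemma lam_powi_pos [simp]: "0 < lam powi k" using lam_gt by (simp add: zero_less_power_int)

lemma lam_powi_le1: "k \<le> 0 \<Longrightarrow> lam powi k \<le> 1"
proof -
  assume "k \<le> 0"
  hence "lam powi k = inverse (lam ^ nat (- k))" by (simp add: power_int_def power_inverse)
  moreover have "1 \<le> lam ^ nat (- k)" using lam_gt by (intro one_le_power) auto
  ultimately show ?thesis by (simp add: inverse_le_1_iff)
qed

lemma lam_powi_scale:
  assumes "\<bar>x\<bar> \<le> lam ^ L" "int L \<le> k"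
  shows "\<bar>lam powi (- k) * x\<bar> \<le> 1"
proof -
  have "\<bar>lam powi (- k) * x\<bar> = lam powi (- k) * \<bar>x\<bar>" by (simp add: abs_mult abs_of_pos)
  also have "\<dots> \<le> lam powi (- k) * lam powi (int L)" using assms by (intro mult_left_mono) (auto intro: less_imp_le)
  also have "\<dots> = lam powi (- k + int L)" by (rule power_int_add[symmetric]) simp
  also have "\<dots> \<le> 1" using assms by (intro lam_powi_le1) auto
  finally show ?thesis .
qed

lemma lam_powi_mult: "lam powi i * (lam powi j * x) = lam powi (i + j) * x"
  by (simp add: power_int_add)

context sol_group
begin

fun rl :: "root \<Rightarrow> real \<Rightarrow> rmap" where
  "rl (Ra e) x = Nn (ev1 e * x) (ev2 e * x) 0 0 0 0 0 0"
| "rl (Rb f) x = Nn 0 0 (ev1 f * x) (ev2 f * x) 0 0 0 0"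
| "rl (Rc e f) x = Nn 0 0 0 0 (ev1 e * (ev1 f * x)) (ev1 e * (ev2 f * x)) (ev2 e * (ev1 f * x)) (ev2 e * (ev2 f * x))"

lemma rl_letter [simp]: "\<bar>x\<bar> \<le> 2 \<Longrightarrow> rl \<rho> x \<in> \<Lambda>"
proof -
  assume x: "\<bar>x\<bar> \<le> 2"
  have 1: "\<bar>ev1 e * x\<bar> \<le> 2 * 2" "\<bar>ev2 e * x\<bar> \<le> 2 * 2" for e
    unfolding abs_mult by (intro mult_mono ev_le x; simp)+
  have 2: "\<bar>ev1 f * (ev1 e * x)\<bar> \<le> 2 * (2 * 2)" "\<bar>ev2 f * (ev1 e * x)\<bar> \<le> 2 * (2 * 2)"
    "\<bar>ev1 f * (ev2 e * x)\<bar> \<le> 2 * (2 * 2)" "\<bar>ev2 f * (ev2 e * x)\<bar> \<le> 2 * (2 * 2)" for e f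
    unfolding abs_mult[of "ev1 f"] abs_mult[of "ev2 f"] by (intro mult_mono ev_le 1; simp)+
  have "\<bar>ev1 e * x\<bar> \<le> 8" "\<bar>ev2 e * x\<bar> \<le> 8" for e using 1[of e] by linarith+
  moreover have "\<bar>ev1 f * (ev1 e * x)\<bar> \<le> 8" "\<bar>ev2 f * (ev1 e * x)\<bar> \<le> 8"
    "\<bar>ev1 f * (ev2 e * x)\<bar> \<le> 8" "\<bar>ev2 f * (ev2 e * x)\<bar> \<le> 8" for e f using 2[of f e] by linarith+
  ultimately show ?thesis by (cases \<rho>) (auto intro!: Nn_letter)
qed

lemma rl_letter1 [simp]: "\<bar>x\<bar> \<le> 1 \<Longrightarrow> rl \<rho> x \<in> \<Lambda>"
  by (rule rl_letter) linarith

lemma rl_add: "rl \<rho> x \<circ> rl \<rho> y = rl \<rho> (x + y)"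
  by (cases \<rho>) (simp_all add: Nn_comp distrib_left)

lemma rl_0: "rl \<rho> 0 = id"
  by (cases \<rho>) (simp_all add: Nn_zero)

text \<open>The matrix of \<open>B\<close> acts on rows through its inverse from the right, whence
  the minus sign in \<open>cb\<close>.\<close>

lemma rl_conj:
  "A \<circ> rl \<rho> x \<circ> A' = rl \<rho> (lam powi ca \<rho> * x)" "A' \<circ> rl \<rho> x \<circ> A = rl \<rho> (lam powi (- ca \<rho>) * x)"
  "B \<circ> rl \<rho> x \<circ> B' = rl \<rho> (lam powi cb \<rho> * x)" "B' \<circ> rl \<rho> x \<circ> B = rl \<rho> (lam powi (- cb \<rho>) * x)"
proof -
  have lc: "lam powi k * (ev1 f * x) = ev1 f * (lam powi k * x)" "lam powi k * (ev2 f * x) = ev2 f * (lam powi k * x)" for f k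
    by simp_all
  have *: "rl \<rho> x \<circ> A' = A' \<circ> rl \<rho> (lam powi ca \<rho> * x)"
    by (cases \<rho>) (simp_all add: Nn_A ev_eig lc)
  have "A \<circ> (rl \<rho> x \<circ> A') = (A \<circ> A') \<circ> rl \<rho> (lam powi ca \<rho> * x)" unfolding * by (simp only: comp_assoc)
  thus "A \<circ> rl \<rho> x \<circ> A' = rl \<rho> (lam powi ca \<rho> * x)" by (simp only: AB_inv comp_assoc id_comp)
  have *: "rl \<rho> x \<circ> A = A \<circ> rl \<rho> (lam powi (- ca \<rho>) * x)"
    by (cases \<rho>) (simp_all add: Nn_A ev_eig lc)
  have "A' \<circ> (rl \<rho> x \<circ> A) = (A' \<circ> A) \<circ> rl \<rho> (lam powi (- ca \<rho>) * x)" unfolding * by (simp only: comp_assoc)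
  thus "A' \<circ> rl \<rho> x \<circ> A = rl \<rho> (lam powi (- ca \<rho>) * x)" by (simp only: AB_inv comp_assoc id_comp)
  have c: "ev1 e * (ev1 f * x) * 2 = ev1 e * (2 * (ev1 f * x))" for e f by simp
  have d: "2 * (ev1 e * y) + ev1 e * z = ev1 e * (2 * y + z)" "ev1 e * y + ev1 e * z = ev1 e * (y + z)"
     "2 * (ev2 e * y) + ev2 e * z = ev2 e * (2 * y + z)" "ev2 e * y + ev2 e * z = ev2 e * (y + z)"
     "2 * (ev1 e * y) - ev1 e * z = ev1 e * (2 * y - z)" "ev1 e * y - ev1 e * z = ev1 e * (y - z)"
     "2 * (ev2 e * y) - ev2 e * z = ev2 e * (2 * y - z)" "ev2 e * y - ev2 e * z = ev2 e * (y - z)" for e y z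
    by (simp_all add: algebra_simps)
  have *: "rl \<rho> x \<circ> B' = B' \<circ> rl \<rho> (lam powi cb \<rho> * x)"
    by (cases \<rho>) (simp_all add: Nn_B d, simp_all add: ev_eig)
  have "B \<circ> (rl \<rho> x \<circ> B') = (B \<circ> B') \<circ> rl \<rho> (lam powi cb \<rho> * x)" unfolding * by (simp only: comp_assoc)
  thus "B \<circ> rl \<rho> x \<circ> B' = rl \<rho> (lam powi cb \<rho> * x)" by (simp only: AB_inv comp_assoc id_comp)
  have *: "rl \<rho> x \<circ> B = B \<circ> rl \<rho> (lam powi (- cb \<rho>) * x)"
    by (cases \<rho>) (simp_all add: Nn_B d, simp_all add: ev_eig)
  have "B' \<circ> (rl \<rho> x \<circ> B) = (B' \<circ> B) \<circ> rl \<rho> (lam powi (- cb \<rho>) * x)" unfolding * by (simp only: comp_assoc)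
  thus "B' \<circ> rl \<rho> x \<circ> B = rl \<rho> (lam powi (- cb \<rho>) * x)" by (simp only: AB_inv comp_assoc id_comp)
qed

text \<open>The innermost pair of torus letters is absorbed first. As \<open>e\<close> is
  nonnegative, the intermediate parameters stay at most 1, and each absorption is one bounded
  relation.\<close>

lemma conj_nat:
  assumes "\<And>x. g \<circ> rl \<rho> x \<circ> g' = rl \<rho> (lam powi e * x)" "g \<in> \<Lambda>" "g' \<in> \<Lambda>" "e \<ge> 0" "\<bar>y\<bar> \<le> 1"
  shows "eq (replicate k g @ [rl \<rho> (lam powi (- (e * int k)) * y)] @ replicate k g') [rl \<rho> y] k"
proof (induction k)
  case 0
  show ?case using assms by (auto intro!: eq_refl)
next
  case (Suc k)
  let ?z = "lam powi (- (e * int (Suc k))) * y"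
  have b: "\<bar>lam powi (- (e * int i)) * y\<bar> \<le> 1" for i
    using lam_powi_le1[of "- (e * int i)"] assms(4,5) by (simp add: abs_mult abs_of_pos mult_le_one)
  have z: "lam powi e * ?z = lam powi (- (e * int k)) * y"
    unfolding lam_powi_mult by (simp add: algebra_simps)
  have "cprod [g, rl \<rho> ?z, g'] = cprod [rl \<rho> (lam powi (- (e * int k)) * y)]"
    using assms(1)[of ?z] unfolding z by (simp only: cprod_simps comp_id comp_assoc)
  hence "eq (replicate k g @ [g, rl \<rho> ?z, g'] @ replicate k g') (replicate k g @ [rl \<rho> (lam powi (- (e * int k)) * y)] @ replicate k g') 1"
    using assms(2,3) rl_letter1[OF b[of k]] rl_letter1[OF b[of "Suc k"]]
    by (intro eq_context eq_base) (auto simp: set_replicate_conv_if)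
  from eq_trans[OF this Suc.IH]
  have "eq (replicate k g @ [g, rl \<rho> ?z, g'] @ replicate k g') [rl \<rho> y] (Suc k)" by simp
  moreover have "replicate (Suc k) g @ [rl \<rho> ?z] @ replicate (Suc k) g' = replicate k g @ [g, rl \<rho> ?z, g'] @ replicate k g'"
    by (simp add: replicate_app_Cons_same)
  ultimately show ?case by metis
qed

lemma conj_int:
  assumes "\<And>x. g \<circ> rl \<rho> x \<circ> g' = rl \<rho> (lam powi e * x)" "\<And>x. g' \<circ> rl \<rho> x \<circ> g = rl \<rho> (lam powi (- e) * x)"
    "g \<in> \<Lambda>" "g' \<in> \<Lambda>" "e * k \<ge> 0" "\<bar>y\<bar> \<le> 1"
  shows "eq (pw g g' k @ [rl \<rho> (lam powi (- (e * k)) * y)] @ pw g g' (- k)) [rl \<rho> y] (nat \<bar>k\<bar>)"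
proof -
  consider "k = 0" | "k > 0" | "k < 0" by linarith
  thus ?thesis
  proof cases
    case 1
    thus ?thesis using assms(6) by (auto simp: pw_def intro!: eq_refl)
  next
    case 2
    hence "e \<ge> 0" using assms(5) by (simp add: zero_le_mult_iff)
    from conj_nat[OF assms(1,3,4) this assms(6), of "nat k"] 2 show ?thesis
      by (simp add: pw_def)
  next
    case 3
    hence "- e \<ge> 0" using assms(5) by (simp add: zero_le_mult_iff)
    from conj_nat[OF assms(2,4,3) this assms(6), of "nat (- k)"] 3 show ?thesis
      by (simp add: pw_def)
  qed
qed

lemma conj_torus:
  assumes "ca \<rho> * k \<ge> 0" "cb \<rho> * l \<ge> 0" "\<bar>y\<bar> \<le> 1"
  shows "eq (Tw k l @ [rl \<rho> (lam powi (- (ca \<rho> * k + cb \<rho> * l)) * y)] @ Ti k l) [rl \<rho> y] (nat \<bar>l\<bar> + nat \<bar>k\<bar>)"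
proof -
  let ?w = "lam powi (- (ca \<rho> * k)) * y"
  have "\<bar>?w\<bar> \<le> 1" using lam_powi_le1[of "- (ca \<rho> * k)"] assms by (simp add: abs_mult abs_of_pos mult_le_one)
  hence "eq (pw A A' k @ (pw B B' l @ [rl \<rho> (lam powi (- (cb \<rho> * l)) * ?w)] @ pw B B' (- l)) @ pw A A' (- k))
     (pw A A' k @ [rl \<rho> ?w] @ pw A A' (- k)) (nat \<bar>l\<bar>)"
    using assms by (intro eq_context conj_int rl_conj) simp_all
  also have "eq \<dots> [rl \<rho> y] (nat \<bar>k\<bar>)" using assms by (intro conj_int rl_conj) simp_all
  finally show ?thesis unfolding lam_powi_mult Tw_def Ti_def
    by (simp only: append.assoc add.commute[of "ca \<rho> * k"] minus_add_distrib)
qed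

definition cw :: "int \<Rightarrow> int \<Rightarrow> rmap \<Rightarrow> rmap list" where "cw k l z = Tw k l @ [z] @ Ti k l"

lemma cw_letters [simp]: "z \<in> \<Lambda> \<Longrightarrow> set (cw k l z) \<subseteq> \<Lambda>"
  by (simp add: cw_def)

lemma le_Q: "x \<le> Q x"
  by (simp add: power2_eq_square)

text \<open>The displacement contracts the root in each torus coordinate separately, so the middle
  letter stays bounded; the cost is that of rearranging the torus words.\<close>

lemma move:
  assumes "ca \<rho> * k' \<ge> 0" "cb \<rho> * l' \<ge> 0" "\<bar>y\<bar> \<le> 1" "nat \<bar>k\<bar> \<le> x" "nat \<bar>l\<bar> \<le> x" "nat \<bar>k'\<bar> \<le> x" "nat \<bar>l'\<bar> \<le> x"
  shows "eq (cw k l (rl \<rho> y)) (cw (k + k') (l + l') (rl \<rho> (lam powi (- (ca \<rho> * k' + cb \<rho> * l')) * y))) (10 * Q x)"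
proof -
  let ?z = "lam powi (- (ca \<rho> * k' + cb \<rho> * l')) * y"
  have z: "\<bar>?z\<bar> \<le> 1" using lam_powi_le1[of "- (ca \<rho> * k' + cb \<rho> * l')"] assms by (simp add: abs_mult abs_of_pos mult_le_one)
  have "eq ((Tw k l @ Tw k' l') @ ([rl \<rho> ?z] @ (Ti k' l' @ Ti k l))) (Tw (k + k') (l + l') @ ([rl \<rho> ?z] @ Ti (k + k') (l + l'))) (4 * Q x + (0 + 4 * Q x))"
    by (intro eq_append eq_Tw_add eq_refl assms) (use z in simp)
  from eq_sym[OF this] have 1: "eq (cw (k + k') (l + l') (rl \<rho> ?z)) (Tw k l @ (Tw k' l' @ [rl \<rho> ?z] @ Ti k' l') @ Ti k l) (8 * Q x)"
    by (simp add: cw_def)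
  have "eq (Tw k l @ (Tw k' l' @ [rl \<rho> ?z] @ Ti k' l') @ Ti k l) (Tw k l @ [rl \<rho> y] @ Ti k l) (nat \<bar>l'\<bar> + nat \<bar>k'\<bar>)"
    using assms by (intro eq_context conj_torus) simp_all
  from eq_sym[OF eq_trans[OF 1 this]]
  have "eq (cw k l (rl \<rho> y)) (cw (k + k') (l + l') (rl \<rho> ?z)) (8 * Q x + (nat \<bar>l'\<bar> + nat \<bar>k'\<bar>))" by (simp only: cw_def)
  moreover have "8 * Q x + (nat \<bar>l'\<bar> + nat \<bar>k'\<bar>) \<le> 10 * Q x" using add_mono[OF assms(7,6)] le_Q[of x] by linarith
  ultimately show ?thesis by (rule eq_mono)
qed

text \<open>At this point of the torus the root is contracted with exponent \<open>L\<close>, or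
  \<open>2 * L\<close> for corner roots; this brings parameters up to \<open>lam ^ L\<close> down to
  at most 1.\<close>

definition hat :: "root \<Rightarrow> nat \<Rightarrow> real \<Rightarrow> rmap list" where
  "hat \<rho> L x = cw (ca \<rho> * int L) (cb \<rho> * int L) (rl \<rho> (lam powi (- (ca \<rho> * (ca \<rho> * int L) + cb \<rho> * (cb \<rho> * int L))) * x))"

lemma cacb_ge: "int L \<le> ca \<rho> * (ca \<rho> * int L) + cb \<rho> * (cb \<rho> * int L)"
  by (cases \<rho>) (auto simp: sg_def)

lemma cacb_le: "nat \<bar>ca \<rho> * int L\<bar> \<le> L" "nat \<bar>cb \<rho> * int L\<bar> \<le> L"
  by (cases \<rho>; simp add: sg_def)+

lemma hat_letters [simp]: "\<bar>x\<bar> \<le> lam ^ L \<Longrightarrow> set (hat \<rho> L x) \<subseteq> \<Lambda>"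
  unfolding hat_def by (intro cw_letters rl_letter1 lam_powi_scale[OF _ cacb_ge])

lemma Q4: "10 * Q (4 * L) \<le> 160 * Q L"
  by (simp add: power2_eq_square)

text \<open>\<open>move\<close> only goes in contracting directions, so the two torus points are not
  compared with each other but both with a point further out.\<close>

lemma any_hat:
  assumes "\<bar>x\<bar> \<le> lam ^ L" "int L \<le> ca \<rho> * k + cb \<rho> * l" "\<bar>k\<bar> \<le> 3 * int L" "\<bar>l\<bar> \<le> 3 * int L"
  shows "eq (cw k l (rl \<rho> (lam powi (- (ca \<rho> * k + cb \<rho> * l)) * x))) (hat \<rho> L x) (320 * Q L)"
proof -
  \<comment> \<open>In a coordinate of nonzero weight the common point lies beyond both points. In a
    coordinate of weight 0 the root is unaffected by moves, and that of the given point is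
    kept.\<close>
  define k2 where "k2 = (if ca \<rho> = 0 then k else ca \<rho> * max (ca \<rho> * k) (int L))"
  define l2 where "l2 = (if cb \<rho> = 0 then l else cb \<rho> * max (cb \<rho> * l) (int L))"
  define w where "w = rl \<rho> (lam powi (- (ca \<rho> * k2 + cb \<rho> * l2)) * x)"
  have k2: "ca \<rho> * (k2 - k) \<ge> 0" "\<bar>k2 - k\<bar> \<le> 4 * int L" "ca \<rho> * (k2 - ca \<rho> * int L) \<ge> 0" "\<bar>k2 - ca \<rho> * int L\<bar> \<le> 4 * int L"
    "\<bar>ca \<rho> * int L\<bar> \<le> 4 * int L"
    using ca_cb(1)[of \<rho>] assms(3) by (auto simp: k2_def max_def)
  have l2: "cb \<rho> * (l2 - l) \<ge> 0" "\<bar>l2 - l\<bar> \<le> 4 * int L" "cb \<rho> * (l2 - cb \<rho> * int L) \<ge> 0" "\<bar>l2 - cb \<rho> * int L\<bar> \<le> 4 * int L"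
    "\<bar>cb \<rho> * int L\<bar> \<le> 4 * int L"
    using ca_cb(2)[of \<rho>] assms(4) by (auto simp: l2_def max_def)
  have "eq (cw k l (rl \<rho> (lam powi (- (ca \<rho> * k + cb \<rho> * l)) * x)))
     (cw (k + (k2 - k)) (l + (l2 - l)) (rl \<rho> (lam powi (- (ca \<rho> * (k2 - k) + cb \<rho> * (l2 - l))) * (lam powi (- (ca \<rho> * k + cb \<rho> * l)) * x)))) (10 * Q (4 * L))"
    using assms(3,4) k2(1,2) l2(1,2)
    by (intro move lam_powi_scale[OF assms(1,2)]) (simp_all add: nat_le_iff)
  hence 1: "eq (cw k l (rl \<rho> (lam powi (- (ca \<rho> * k + cb \<rho> * l)) * x))) (cw k2 l2 w) (160 * Q L)"
    unfolding lam_powi_mult w_def by (intro eq_mono[OF _ Q4]) (simp add: algebra_simps)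
  have "eq (hat \<rho> L x)
     (cw (ca \<rho> * int L + (k2 - ca \<rho> * int L)) (cb \<rho> * int L + (l2 - cb \<rho> * int L)) (rl \<rho> (lam powi (- (ca \<rho> * (k2 - ca \<rho> * int L) + cb \<rho> * (l2 - cb \<rho> * int L))) * (lam powi (- (ca \<rho> * (ca \<rho> * int L) + cb \<rho> * (cb \<rho> * int L))) * x)))) (10 * Q (4 * L))"
    unfolding hat_def using k2(3-5) l2(3-5) assms(3,4)
    by (intro move lam_powi_scale[OF assms(1) cacb_ge]) (simp_all add: nat_le_iff)
  hence 2: "eq (hat \<rho> L x) (cw k2 l2 w) (160 * Q L)"
    unfolding lam_powi_mult w_def by (intro eq_mono[OF _ Q4]) (simp add: algebra_simps)
  from eq_trans[OF 1 eq_sym[OF 2]] show ?thesis by simp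
qed

lemma eq_cw_append:
  assumes "set u \<subseteq> \<Lambda>" "set v \<subseteq> \<Lambda>"
  shows "eq ((Tw k l @ u @ Ti k l) @ (Tw k l @ v @ Ti k l)) (Tw k l @ (u @ v) @ Ti k l) (nat \<bar>k\<bar> + nat \<bar>l\<bar>)"
proof -
  have "eq ((Tw k l @ u) @ (Ti k l @ Tw k l) @ (v @ Ti k l)) ((Tw k l @ u) @ [] @ (v @ Ti k l)) (nat \<bar>k\<bar> + nat \<bar>l\<bar>)"
    using assms by (intro eq_context eq_Tw_inv) auto
  thus ?thesis by simp
qed

text \<open>Two roots with a common contracting direction \<open>(k, l)\<close> can be multiplied at that point of the torus.\<close>

lemma hat_pair:
  assumes "\<bar>x\<bar> \<le> lam ^ L" "\<bar>y\<bar> \<le> lam ^ L" "int L \<le> ca \<rho> * k + cb \<rho> * l" "int L \<le> ca \<sigma> * k + cb \<sigma> * l"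
    "\<bar>k\<bar> \<le> 3 * int L" "\<bar>l\<bar> \<le> 3 * int L"
  shows "eq (hat \<rho> L x @ hat \<sigma> L y)
    (Tw k l @ [rl \<rho> (lam powi (- (ca \<rho> * k + cb \<rho> * l)) * x), rl \<sigma> (lam powi (- (ca \<sigma> * k + cb \<sigma> * l)) * y)] @ Ti k l) (646 * Q L)"
proof -
  let ?x = "rl \<rho> (lam powi (- (ca \<rho> * k + cb \<rho> * l)) * x)" and ?y = "rl \<sigma> (lam powi (- (ca \<sigma> * k + cb \<sigma> * l)) * y)"
  have "?x \<in> \<Lambda>" "?y \<in> \<Lambda>" by (intro rl_letter1 lam_powi_scale[of _ L] assms)+
  hence "eq (cw k l ?x @ cw k l ?y) (Tw k l @ ([?x] @ [?y]) @ Ti k l) (nat \<bar>k\<bar> + nat \<bar>l\<bar>)"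
    unfolding cw_def by (intro eq_cw_append) auto
  moreover have "eq (hat \<rho> L x @ hat \<sigma> L y) (cw k l ?x @ cw k l ?y) (320 * Q L + 320 * Q L)"
    by (intro eq_append eq_sym[OF any_hat] assms)
  ultimately have "eq (hat \<rho> L x @ hat \<sigma> L y) (Tw k l @ ([?x] @ [?y]) @ Ti k l) (320 * Q L + 320 * Q L + (nat \<bar>k\<bar> + nat \<bar>l\<bar>))"
    using eq_trans by blast
  moreover have "nat \<bar>k\<bar> + nat \<bar>l\<bar> \<le> 6 * Q L" using assms(5,6) le_Q[of L] by linarith
  ultimately show ?thesis by (auto intro: eq_mono)
qed

lemma Q_ge1: "1 \<le> Q L" by (simp add: power2_eq_square)

lemma hat_commute:
  assumes "\<bar>x\<bar> \<le> lam ^ L" "\<bar>y\<bar> \<le> lam ^ L" "int L \<le> ca \<rho> * k + cb \<rho> * l" "int L \<le> ca \<sigma> * k + cb \<sigma> * l"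
    "\<bar>k\<bar> \<le> 3 * int L" "\<bar>l\<bar> \<le> 3 * int L" "\<And>x y. rl \<rho> x \<circ> rl \<sigma> y = rl \<sigma> y \<circ> rl \<rho> x"
  shows "eq (hat \<rho> L x @ hat \<sigma> L y) (hat \<sigma> L y @ hat \<rho> L x) (1300 * Q L)"
proof -
  let ?x = "rl \<rho> (lam powi (- (ca \<rho> * k + cb \<rho> * l)) * x)" and ?y = "rl \<sigma> (lam powi (- (ca \<sigma> * k + cb \<sigma> * l)) * y)"
  have "?x \<in> \<Lambda>" "?y \<in> \<Lambda>" by (intro rl_letter1 lam_powi_scale[of _ L] assms)+
  moreover have "cprod [?x, ?y] = cprod [?y, ?x]" by (simp only: cprod_simps comp_id assms(7))
  ultimately have "eq (Tw k l @ [?x, ?y] @ Ti k l) (Tw k l @ [?y, ?x] @ Ti k l) 1"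
    by (intro eq_context eq_base) auto
  from eq_trans[OF eq_trans[OF hat_pair[OF assms(1-6)] this] eq_sym[OF hat_pair[OF assms(2,1,4,3,5,6)]]]
  show ?thesis by (rule eq_mono) (use Q_ge1[of L] in linarith)
qed

lemma sg_mult [simp]: "sg e * sg e = 1" "sg e * (sg e * x) = x"
  by (auto simp: sg_def)

lemma abs_sg [simp]: "\<bar>sg e * x\<bar> = \<bar>x\<bar>" "\<bar>sg e\<bar> = 1"
  by (auto simp: sg_def)

text \<open>With the second torus coordinate twice the first, its contraction of the corner root
  outweighs a possible expansion by the first when \<open>e'\<close> differs from
  \<open>e\<close>.\<close>

lemma hat_commute_ac:
  assumes "\<bar>x\<bar> \<le> lam ^ L" "\<bar>y\<bar> \<le> lam ^ L"
  shows "eq (hat (Ra e) L x @ hat (Rc e' f) L y) (hat (Rc e' f) L y @ hat (Ra e) L x) (1300 * Q L)"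
proof (rule hat_commute[OF assms, where k = "sg e * int L" and l = "- sg f * (2 * int L)"])
  show "rl (Ra e) x \<circ> rl (Rc e' f) y = rl (Rc e' f) y \<circ> rl (Ra e) x" for x y
    by (simp add: Nn_comp)
  show "int L \<le> ca (Rc e' f) * (sg e * int L) + cb (Rc e' f) * (- sg f * (2 * int L))"
    by (cases e; cases e'; cases f) (simp_all add: sg_def)
qed auto

lemma hat_commute_bc:
  assumes "\<bar>x\<bar> \<le> lam ^ L" "\<bar>y\<bar> \<le> lam ^ L"
  shows "eq (hat (Rb f) L x @ hat (Rc e f') L y) (hat (Rc e f') L y @ hat (Rb f) L x) (1300 * Q L)"
proof (rule hat_commute[OF assms, where k = "sg e * (2 * int L)" and l = "- sg f * int L"])
  show "rl (Rb f) x \<circ> rl (Rc e f') y = rl (Rc e f') y \<circ> rl (Rb f) x" for x y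
    by (simp add: Nn_comp)
  show "int L \<le> ca (Rc e f') * (sg e * (2 * int L)) + cb (Rc e f') * (- sg f * int L)"
    by (cases e; cases f'; cases f) (simp_all add: sg_def)
qed auto

text \<open>At the torus point chosen here both factors are contracted by \<open>L\<close> and their
  commutator by \<open>2 * L\<close>; so the commutator relation becomes one between bounded
  letters.\<close>

lemma hat_ab:
  assumes "\<bar>x\<bar> \<le> lam ^ L" "\<bar>y\<bar> \<le> lam ^ L" "\<bar>x * y\<bar> \<le> lam ^ L"
  shows "eq (hat (Ra e) L x @ hat (Rb f) L y) (hat (Rc e f) L (x * y) @ hat (Rb f) L y @ hat (Ra e) L x) (1700 * Q L)"
proof -
  let ?k = "sg e * int L" and ?l = "- sg f * int L"
  define x' y' z' where "x' = lam powi (- int L) * x" and "y' = lam powi (- int L) * y" and "z' = lam powi (- (2 * int L)) * (x * y)"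
  have le: "\<bar>x'\<bar> \<le> 1" "\<bar>y'\<bar> \<le> 1" "\<bar>z'\<bar> \<le> 1" unfolding x'_def y'_def z'_def
    using assms lam_powi_scale by auto
  have "lam powi (- (2 * int L)) = lam powi (- int L + - int L)" by simp
  also have "\<dots> = lam powi (- int L) * lam powi (- int L)" by (rule power_int_add) simp
  finally have z': "z' = x' * y'" unfolding x'_def y'_def z'_def by (simp only: mult_ac)
  have 1: "eq (hat (Ra e) L x @ hat (Rb f) L y) (Tw ?k ?l @ [rl (Ra e) x', rl (Rb f) y'] @ Ti ?k ?l) (646 * Q L)"
    using hat_pair[OF assms(1,2), of "Ra e" ?k ?l "Rb f"] by (simp add: x'_def y'_def)
  have "cprod [rl (Ra e) x', rl (Rb f) y'] = cprod [rl (Rc e f) z', rl (Rb f) y', rl (Ra e) x']"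
    by (simp add: Nn_comp z' mult_ac)
  hence 2: "eq (Tw ?k ?l @ [rl (Ra e) x', rl (Rb f) y'] @ Ti ?k ?l) (Tw ?k ?l @ ([rl (Rc e f) z'] @ [rl (Rb f) y', rl (Ra e) x']) @ Ti ?k ?l) 1"
    using le by (intro eq_context eq_base) (auto simp del: rl.simps)
  have 3: "eq (hat (Rb f) L y @ hat (Ra e) L x) (Tw ?k ?l @ [rl (Rb f) y', rl (Ra e) x'] @ Ti ?k ?l) (646 * Q L)"
    using hat_pair[OF assms(2,1), of "Rb f" ?k ?l "Ra e"] by (simp add: x'_def y'_def)
  have 4: "eq (hat (Rc e f) L (x * y)) (Tw ?k ?l @ [rl (Rc e f) z'] @ Ti ?k ?l) (320 * Q L)"
    using eq_sym[OF any_hat[OF assms(3), of "Rc e f" ?k ?l]] by (simp add: z'_def cw_def)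
  have 5: "eq ((Tw ?k ?l @ [rl (Rc e f) z'] @ Ti ?k ?l) @ (Tw ?k ?l @ [rl (Rb f) y', rl (Ra e) x'] @ Ti ?k ?l))
    (Tw ?k ?l @ ([rl (Rc e f) z'] @ [rl (Rb f) y', rl (Ra e) x']) @ Ti ?k ?l) (nat \<bar>?k\<bar> + nat \<bar>?l\<bar>)"
    using le by (intro eq_cw_append) (auto simp del: rl.simps)
  from eq_trans[OF eq_trans[OF 1 2] eq_sym[OF eq_trans[OF eq_append[OF 4 3] 5]]]
  show ?thesis
  proof (rule eq_mono)
    have "nat \<bar>?k\<bar> \<le> L" "nat \<bar>?l\<bar> \<le> L" by simp_all
    thus "646 * Q L + 1 + (320 * Q L + 646 * Q L + (nat \<bar>?k\<bar> + nat \<bar>?l\<bar>)) \<le> 1700 * Q L"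
      using Q_ge1[of L] le_Q[of L] by linarith
  qed
qed

lemma hat_add:
  assumes "\<bar>x\<bar> \<le> lam ^ L" "\<bar>y\<bar> \<le> lam ^ L" "\<bar>x + y\<bar> \<le> lam ^ L"
  shows "eq (hat \<rho> L x @ hat \<rho> L y) (hat \<rho> L (x + y)) (3 * Q L)"
proof -
  let ?k = "ca \<rho> * int L" and ?l = "cb \<rho> * int L"
  let ?c = "lam powi (- (ca \<rho> * ?k + cb \<rho> * ?l))"
  have le: "\<bar>?c * x\<bar> \<le> 1" "\<bar>?c * y\<bar> \<le> 1" "\<bar>?c * (x + y)\<bar> \<le> 1"
    using assms by (intro lam_powi_scale[OF _ cacb_ge]; simp)+
  have "eq ((Tw ?k ?l @ [rl \<rho> (?c * x)] @ Ti ?k ?l) @ (Tw ?k ?l @ [rl \<rho> (?c * y)] @ Ti ?k ?l)) (Tw ?k ?l @ ([rl \<rho> (?c * x)] @ [rl \<rho> (?c * y)]) @ Ti ?k ?l) (nat \<bar>?k\<bar> + nat \<bar>?l\<bar>)"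
    using le by (intro eq_cw_append) auto
  moreover have "eq (Tw ?k ?l @ ([rl \<rho> (?c * x)] @ [rl \<rho> (?c * y)]) @ Ti ?k ?l) (Tw ?k ?l @ [rl \<rho> (?c * (x + y))] @ Ti ?k ?l) 1"
    using le by (intro eq_context eq_base) (auto simp: rl_add distrib_left)
  ultimately have "eq (hat \<rho> L x @ hat \<rho> L y) (hat \<rho> L (x + y)) (nat \<bar>?k\<bar> + nat \<bar>?l\<bar> + 1)"
    unfolding hat_def cw_def by (rule eq_trans)
  moreover have "nat \<bar>?k\<bar> + nat \<bar>?l\<bar> + 1 \<le> 3 * Q L"
    using cacb_le[of \<rho> L] le_Q[of L] Q_ge1[of L] by linarith
  ultimately show ?thesis by (rule eq_mono)
qed

lemma hat_zero: "eq (hat \<rho> L 0) [] (3 * Q L)"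
proof -
  let ?k = "ca \<rho> * int L" and ?l = "cb \<rho> * int L"
  have "rl \<rho> 0 \<in> \<Lambda>" by simp
  hence i: "id \<in> \<Lambda>" unfolding rl_0 .
  have "eq (Tw ?k ?l @ [id] @ Ti ?k ?l) (Tw ?k ?l @ [] @ Ti ?k ?l) 1"
    using i by (intro eq_context eq_base) auto
  moreover have "eq (Tw ?k ?l @ [] @ Ti ?k ?l) [] (nat \<bar>?l\<bar> + nat \<bar>?k\<bar>)"
    using eq_Tw_inv(1)[where k = ?k and l = ?l] by simp
  ultimately have "eq (hat \<rho> L 0) [] (1 + (nat \<bar>?l\<bar> + nat \<bar>?k\<bar>))" unfolding hat_def cw_def mult_zero_right rl_0 by (rule eq_trans)
  moreover have "1 + (nat \<bar>?l\<bar> + nat \<bar>?k\<bar>) \<le> 3 * Q L"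
    using cacb_le[of \<rho> L] le_Q[of L] Q_ge1[of L] by linarith
  ultimately show ?thesis by (rule eq_mono)
qed

lemma hat_inv:
  assumes "\<bar>x\<bar> \<le> lam ^ L"
  shows "eq (hat \<rho> L x @ hat \<rho> L (- x)) [] (6 * Q L)"
proof -
  have "eq (hat \<rho> L x @ hat \<rho> L (- x)) (hat \<rho> L (x + - x)) (3 * Q L)"
    using assms lam_gt by (intro hat_add) auto
  from eq_trans[OF this, of "3 * Q L" "[]"] show ?thesis using hat_zero[of L \<rho>] by simp
qed

end

context sol_group
begin

text \<open>
  Opposite roots \<open>c\<^sub>1\<^sub>1, c\<^sub>2\<^sub>2\<close> have no common contracting direction; writing one of them as a commutator
  of roots \<open>a\<close>, \<open>b\<close> reduces to pairs that are not opposite.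
\<close>

lemma hat_c_commutator:
  assumes "\<bar>x\<bar> \<le> lam ^ L"
  shows "eq (hat (Ra e) L x @ hat (Rb f) L 1 @ hat (Ra e) L (- x) @ hat (Rb f) L (- 1)) (hat (Rc e f) L x) (1712 * Q L)"
proof -
  have 1: "\<bar>1\<bar> \<le> lam ^ L" using lam_gt by simp
  let ?a = "hat (Ra e) L x" and ?b = "hat (Rb f) L 1" and ?c = "hat (Rc e f) L x"
  let ?a' = "hat (Ra e) L (- x)" and ?b' = "hat (Rb f) L (- 1)"
  have l: "set ?a \<subseteq> \<Lambda>" "set ?b \<subseteq> \<Lambda>" "set ?c \<subseteq> \<Lambda>" "set ?a' \<subseteq> \<Lambda>" "set ?b' \<subseteq> \<Lambda>" using assms 1 by auto
  have "eq (?a @ ?b @ ?a' @ ?b') (?c @ ?b @ ?a @ ?a' @ ?b') (1700 * Q L)"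
    using eq_right[OF hat_ab[OF assms 1, of e f], of "?a' @ ?b'"] assms l by simp
  also have "eq \<dots> (?c @ ?b @ ?b') (6 * Q L)"
    using eq_context[OF hat_inv[OF assms], of "?c @ ?b" ?b'] l by simp
  also have "eq \<dots> ?c (6 * Q L)"
    using eq_left[OF hat_inv[OF 1], of ?c] l by simp
  finally show ?thesis by simp
qed

lemma hat_commute_cc:
  assumes "\<bar>x\<bar> \<le> lam ^ L" "\<bar>y\<bar> \<le> lam ^ L"
  shows "eq (hat (Rc e f) L x @ hat (Rc e' f') L y) (hat (Rc e' f') L y @ hat (Rc e f) L x) (9000 * Q L)"
proof -
  have 1: "\<bar>1\<bar> \<le> lam ^ L" "\<bar>-1\<bar> \<le> lam ^ L" "\<bar>- x\<bar> \<le> lam ^ L" using lam_gt assms by simp_all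
  let ?a = "hat (Ra e) L x" and ?b = "hat (Rb f) L 1" and ?c = "hat (Rc e f) L x" and ?d = "hat (Rc e' f') L y"
  let ?a' = "hat (Ra e) L (- x)" and ?b' = "hat (Rb f) L (- 1)"
  have l: "set ?a \<subseteq> \<Lambda>" "set ?b \<subseteq> \<Lambda>" "set ?c \<subseteq> \<Lambda>" "set ?a' \<subseteq> \<Lambda>" "set ?b' \<subseteq> \<Lambda>" "set ?d \<subseteq> \<Lambda>" using assms 1 by auto
  have "eq (?c @ ?d) (?a @ ?b @ ?a' @ ?b' @ ?d) (1712 * Q L)"
    using eq_right[OF eq_sym[OF hat_c_commutator[OF assms(1), of e f]], of ?d] l by simp
  also have "eq \<dots> (?a @ ?b @ ?a' @ ?d @ ?b') (1300 * Q L)"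
    using eq_left[OF hat_commute_bc[OF 1(2) assms(2), of f e' f'], of "?a @ ?b @ ?a'"] l by simp
  also have "eq \<dots> (?a @ ?b @ ?d @ ?a' @ ?b') (1300 * Q L)"
    using eq_context[OF hat_commute_ac[OF 1(3) assms(2), of e e' f'], of "?a @ ?b" ?b'] l by simp
  also have "eq \<dots> (?a @ ?d @ ?b @ ?a' @ ?b') (1300 * Q L)"
    using eq_context[OF hat_commute_bc[OF 1(1) assms(2), of f e' f'], of "?a" "?a' @ ?b'"] l by simp
  also have "eq \<dots> (?d @ ?a @ ?b @ ?a' @ ?b') (1300 * Q L)"
    using eq_right[OF hat_commute_ac[OF assms, of e e' f'], of "?b @ ?a' @ ?b'"] l by simp
  also have "eq \<dots> (?d @ ?c) (1712 * Q L)"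
    using eq_left[OF hat_c_commutator[OF assms(1), of e f], of ?d] l by simp
  finally show ?thesis by (rule eq_mono) simp
qed

text \<open>A coordinate of the 2 x 2 corner matrix in the tensor product of the two
  eigenbases.\<close>

definition cz :: "bool \<Rightarrow> bool \<Rightarrow> real \<Rightarrow> real \<Rightarrow> real \<Rightarrow> real \<Rightarrow> real" where
  "cz e f x11 x12 x21 x22 = pr f (pr e x11 x21) (pr e x12 x22)"

lemma cz_alt: "cz e f x11 x12 x21 x22 = pr e (pr f x11 x12) (pr f x21 x22)"
  by (simp add: cz_def pr_def add_divide_distrib algebra_simps)

lemma cz_add: "cz e f (x11 + y11) (x12 + y12) (x21 + y21) (x22 + y22) = cz e f x11 x12 x21 x22 + cz e f y11 y12 y21 y22"
  by (simp add: cz_def pr_linear)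

lemma cz_bound:
  assumes "\<bar>x11\<bar> \<le> 2 ^ L" "\<bar>x12\<bar> \<le> 2 ^ L" "\<bar>x21\<bar> \<le> 2 ^ L" "\<bar>x22\<bar> \<le> 2 ^ L"
  shows "\<bar>cz e f x11 x12 x21 x22\<bar> \<le> lam ^ L"
proof -
  have "\<bar>cz e f x11 x12 x21 x22\<bar> \<le> 2 ^ L" unfolding cz_def by (intro pr_bound assms)
  thus ?thesis using pow2_le_lam[of L] by linarith
qed

definition Ch :: "nat \<Rightarrow> real \<Rightarrow> real \<Rightarrow> real \<Rightarrow> real \<Rightarrow> rmap list" where
  "Ch L x11 x12 x21 x22 = hat (Rc True True) L (cz True True x11 x12 x21 x22) @ hat (Rc True False) L (cz True False x11 x12 x21 x22) @
     hat (Rc False True) L (cz False True x11 x12 x21 x22) @ hat (Rc False False) L (cz False False x11 x12 x21 x22)"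

text \<open>Interleaving takes 3 + 2 + 1 transpositions, and \<open>c1\<close> and \<open>d4\<close>
  never move past a factor of the other word.\<close>

lemma shuffle4:
  assumes "\<And>c d. c \<in> {c2, c3, c4} \<Longrightarrow> d \<in> {d1, d2, d3} \<Longrightarrow> eq (c @ d) (d @ c) X"
    "set c1 \<subseteq> \<Lambda>" "set c2 \<subseteq> \<Lambda>" "set c3 \<subseteq> \<Lambda>" "set c4 \<subseteq> \<Lambda>" "set d1 \<subseteq> \<Lambda>" "set d2 \<subseteq> \<Lambda>" "set d3 \<subseteq> \<Lambda>" "set d4 \<subseteq> \<Lambda>"
  shows "eq (c1 @ c2 @ c3 @ c4 @ d1 @ d2 @ d3 @ d4) (c1 @ d1 @ c2 @ d2 @ c3 @ d3 @ c4 @ d4) (6 * X)"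
proof -
  have "eq (c1 @ c2 @ c3 @ c4 @ d1 @ d2 @ d3 @ d4) (c1 @ c2 @ c3 @ d1 @ c4 @ d2 @ d3 @ d4) X"
    using eq_context[OF assms(1)[of c4 d1], of "c1 @ c2 @ c3" "d2 @ d3 @ d4"] assms(2-) by simp
  also have "eq \<dots> (c1 @ c2 @ d1 @ c3 @ c4 @ d2 @ d3 @ d4) X"
    using eq_context[OF assms(1)[of c3 d1], of "c1 @ c2" "c4 @ d2 @ d3 @ d4"] assms(2-) by simp
  also have "eq \<dots> (c1 @ d1 @ c2 @ c3 @ c4 @ d2 @ d3 @ d4) X"
    using eq_context[OF assms(1)[of c2 d1], of "c1" "c3 @ c4 @ d2 @ d3 @ d4"] assms(2-) by simp
  also have "eq \<dots> (c1 @ d1 @ c2 @ c3 @ d2 @ c4 @ d3 @ d4) X"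
    using eq_context[OF assms(1)[of c4 d2], of "c1 @ d1 @ c2 @ c3" "d3 @ d4"] assms(2-) by simp
  also have "eq \<dots> (c1 @ d1 @ c2 @ d2 @ c3 @ c4 @ d3 @ d4) X"
    using eq_context[OF assms(1)[of c3 d2], of "c1 @ d1 @ c2" "c4 @ d3 @ d4"] assms(2-) by simp
  also have "eq \<dots> (c1 @ d1 @ c2 @ d2 @ c3 @ d3 @ c4 @ d4) X"
    using eq_context[OF assms(1)[of c4 d3], of "c1 @ d1 @ c2 @ d2 @ c3" "d4"] assms(2-) by simp
  finally show ?thesis by (rule eq_mono) simp
qed

lemma Ch_add:
  assumes x: "\<bar>x11\<bar> \<le> 2 ^ L" "\<bar>x12\<bar> \<le> 2 ^ L" "\<bar>x21\<bar> \<le> 2 ^ L" "\<bar>x22\<bar> \<le> 2 ^ L"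
    and y: "\<bar>y11\<bar> \<le> 2 ^ L" "\<bar>y12\<bar> \<le> 2 ^ L" "\<bar>y21\<bar> \<le> 2 ^ L" "\<bar>y22\<bar> \<le> 2 ^ L"
    and xy: "\<bar>x11 + y11\<bar> \<le> 2 ^ L" "\<bar>x12 + y12\<bar> \<le> 2 ^ L" "\<bar>x21 + y21\<bar> \<le> 2 ^ L" "\<bar>x22 + y22\<bar> \<le> 2 ^ L"
  shows "eq (Ch L x11 x12 x21 x22 @ Ch L y11 y12 y21 y22) (Ch L (x11 + y11) (x12 + y12) (x21 + y21) (x22 + y22)) (60000 * Q L)"
proof -
  note bx = cz_bound[OF x] and b_y = cz_bound[OF y]
  let ?c = "\<lambda>e f. hat (Rc e f) L (cz e f x11 x12 x21 x22)"
  let ?d = "\<lambda>e f. hat (Rc e f) L (cz e f y11 y12 y21 y22)"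
  let ?s = "\<lambda>e f. hat (Rc e f) L (cz e f (x11 + y11) (x12 + y12) (x21 + y21) (x22 + y22))"
  have 1: "eq (?c True True @ ?c True False @ ?c False True @ ?c False False @ ?d True True @ ?d True False @ ?d False True @ ?d False False)
     (?c True True @ ?d True True @ ?c True False @ ?d True False @ ?c False True @ ?d False True @ ?c False False @ ?d False False) (6 * (9000 * Q L))"
  proof (rule shuffle4)
    fix c d assume "c \<in> {?c True False, ?c False True, ?c False False}" "d \<in> {?d True True, ?d True False, ?d False True}"
    thus "eq (c @ d) (d @ c) (9000 * Q L)"
      by (elim insertE emptyE; hypsubst) (rule hat_commute_cc[OF bx b_y])+
  qed (intro hat_letters bx b_y)+
  have s: "eq (?c e f @ ?d e f) (?s e f) (3 * Q L)" for e f
    unfolding cz_add using bx b_y cz_bound[OF xy] by (intro hat_add) (auto simp: cz_add)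
  have 2: "eq ((?c True True @ ?d True True) @ (?c True False @ ?d True False) @ (?c False True @ ?d False True) @ (?c False False @ ?d False False))
     (?s True True @ ?s True False @ ?s False True @ ?s False False) (3 * Q L + (3 * Q L + (3 * Q L + 3 * Q L)))"
    by (intro eq_append s)
  show ?thesis unfolding Ch_def append.assoc
    by (rule eq_mono[OF eq_trans[OF 1 2[unfolded append.assoc]]]) simp
qed

lemma hat_Ra: "hat (Ra e) L x = cw (sg e * int L) 0 (rl (Ra e) (x * lam powi (- int L)))"
  unfolding hat_def ca.simps cb.simps sg_mult mult_zero_left add_0_right mult.commute[of x] ..

lemma hat_Rb: "hat (Rb f) L x = cw 0 (- sg f * int L) (rl (Rb f) (x * lam powi (- int L)))"
  unfolding hat_def ca.simps cb.simps mult_minus_left mult_minus_right minus_minus sg_mult mult_zero_left add_0_left mult.commute[of x] ..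

lemma pw_0 [simp]: "pw g g' 0 = []" by (simp add: pw_def)

lemma colv_cw: "colv p q j L y z = cw (sg True * int L) 0 (colE p q j True (pr True y z * lam powi (- int L))) @
    cw (sg False * int L) 0 (colE p q j False (pr False y z * lam powi (- int L)))"
  by (simp add: colv_def cw_def Tw_def Ti_def sg_def)

lemma rowv_cw: "rowv i r s L y z = cw 0 (- sg True * int L) (rowE i r s True (pr True y z * lam powi (- int L))) @
    cw 0 (- sg False * int L) (rowE i r s False (pr False y z * lam powi (- int L)))"
  by (simp add: rowv_def cw_def Tw_def Ti_def sg_def)

lemma colE_m: "colE p q m e x = rl (Ra e) x"
  by (rule ext)+ (simp add: colE_def E_def Nn_def)

lemma rowE_m: "rowE m r s e x = rl (Rb e) x"
  by (rule ext)+ (simp add: rowE_def E_def Nn_def algebra_simps)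

lemma colv_m: "colv p q m L y z = hat (Ra True) L (pr True y z) @ hat (Ra False) L (pr False y z)"
  unfolding colv_cw colE_m hat_Ra ..

lemma rowv_m: "rowv m r s L y z = hat (Rb True) L (pr True y z) @ hat (Rb False) L (pr False y z)"
  unfolding rowv_cw rowE_m hat_Rb ..

text \<open>A rank one corner matrix with an eigenvector as one tensor factor becomes a product of
  two corner roots when the other factor is expanded in its eigenbasis.\<close>

lemma Nn_c_split:
  "Nn 0 0 0 0 (ev1 e * (x * u)) (ev1 e * (x * w)) (ev2 e * (x * u)) (ev2 e * (x * w)) =
     rl (Rc e True) (x * pr True u w) \<circ> rl (Rc e False) (x * pr False u w)" (is ?thesis1)
  "Nn 0 0 0 0 (u * (ev1 e * x)) (u * (ev2 e * x)) (w * (ev1 e * x)) (w * (ev2 e * x)) =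
     rl (Rc True e) (x * pr True u w) \<circ> rl (Rc False e) (x * pr False u w)" (is ?thesis2)
proof -
  have p: "c * (ev1 True * (x * pr True u w)) + c * (ev1 False * (x * pr False u w)) = c * (x * u)"
    "c * (ev2 True * (x * pr True u w)) + c * (ev2 False * (x * pr False u w)) = c * (x * w)" for c
  proof -
    have "c * (ev1 True * (x * pr True u w)) + c * (ev1 False * (x * pr False u w)) = c * x * (ev1 True * pr True u w + ev1 False * pr False u w)"
      by (simp add: algebra_simps)
    thus "c * (ev1 True * (x * pr True u w)) + c * (ev1 False * (x * pr False u w)) = c * (x * u)" by (simp only: pr_sum mult.assoc)
    have "c * (ev2 True * (x * pr True u w)) + c * (ev2 False * (x * pr False u w)) = c * x * (ev2 True * pr True u w + ev2 False * pr False u w)"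
      by (simp add: algebra_simps)
    thus "c * (ev2 True * (x * pr True u w)) + c * (ev2 False * (x * pr False u w)) = c * (x * w)" by (simp only: pr_sum mult.assoc)
  qed
  show ?thesis1 by (simp add: Nn_comp p)
  have l: "ev1 True * (ev1 e * (x * pr True u w)) + ev1 False * (ev1 e * (x * pr False u w)) = u * (ev1 e * x)"
    "ev1 True * (ev2 e * (x * pr True u w)) + ev1 False * (ev2 e * (x * pr False u w)) = u * (ev2 e * x)"
    "ev2 True * (ev1 e * (x * pr True u w)) + ev2 False * (ev1 e * (x * pr False u w)) = w * (ev1 e * x)"
    "ev2 True * (ev2 e * (x * pr True u w)) + ev2 False * (ev2 e * (x * pr False u w)) = w * (ev2 e * x)"
    using p[of "ev1 e"] p[of "ev2 e"] by (simp_all only: mult_ac)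
  show ?thesis2 by (simp add: Nn_comp l)
qed

text \<open>In \<open>colv\<close> and \<open>rowv\<close> a single twist does the conjugation. It
  contracts two corner roots at once, each with exponent exactly \<open>L\<close>, and their product
  is one letter.\<close>

lemma block:
  assumes "\<bar>x\<bar> \<le> lam ^ L" "\<bar>u1\<bar> \<le> 1" "\<bar>u2\<bar> \<le> 1" "z = rl \<rho> (x * lam powi (- int L) * u1) \<circ> rl \<sigma> (x * lam powi (- int L) * u2)" "z \<in> \<Lambda>"
    "ca \<rho> * k + cb \<rho> * l = int L" "ca \<sigma> * k + cb \<sigma> * l = int L" "\<bar>k\<bar> \<le> 3 * int L" "\<bar>l\<bar> \<le> 3 * int L"
  shows "eq (cw k l z) (hat \<rho> L (x * u1) @ hat \<sigma> L (x * u2)) (650 * Q L)"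
proof -
  have b: "\<bar>x * u1\<bar> \<le> lam ^ L" "\<bar>x * u2\<bar> \<le> lam ^ L"
    using assms(1-3) mult_mono[of "\<bar>x\<bar>" "lam ^ L" "\<bar>u1\<bar>" 1] mult_mono[of "\<bar>x\<bar>" "lam ^ L" "\<bar>u2\<bar>" 1] lam_gt
    by (auto simp: abs_mult)
  have e: "lam powi (- int L) * (x * u) = x * lam powi (- int L) * u" for u by simp
  have "eq (Tw k l @ [z] @ Ti k l) (Tw k l @ [rl \<rho> (x * lam powi (- int L) * u1), rl \<sigma> (x * lam powi (- int L) * u2)] @ Ti k l) 1"
  proof (intro eq_context eq_base)
    show "set [rl \<rho> (x * lam powi (- int L) * u1), rl \<sigma> (x * lam powi (- int L) * u2)] \<subseteq> \<Lambda>"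
      using lam_powi_scale[OF b(1), of "int L"] lam_powi_scale[OF b(2), of "int L"] unfolding e by simp
  qed (use assms(4,5) in auto)
  moreover have "eq (hat \<rho> L (x * u1) @ hat \<sigma> L (x * u2)) (Tw k l @ [rl \<rho> (x * lam powi (- int L) * u1), rl \<sigma> (x * lam powi (- int L) * u2)] @ Ti k l) (646 * Q L)"
    using hat_pair[OF b, of \<rho> k l \<sigma>, unfolded assms(6,7) e] assms(8,9) by simp
  ultimately have "eq (cw k l z) (hat \<rho> L (x * u1) @ hat \<sigma> L (x * u2)) (1 + 646 * Q L)"
    unfolding cw_def using eq_trans eq_sym by blast
  thus ?thesis by (rule eq_mono) (use Q_ge1[of L] in linarith)
qed

lemma ev_scale_letter:
  assumes "\<bar>x\<bar> \<le> 1" "\<bar>u\<bar> \<le> 1"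
  shows "\<bar>ev1 e * (x * u)\<bar> \<le> 8" "\<bar>ev2 e * (x * u)\<bar> \<le> 8" "\<bar>u * (ev1 e * x)\<bar> \<le> 8" "\<bar>u * (ev2 e * x)\<bar> \<le> 8"
proof -
  have "\<bar>x * u\<bar> \<le> 1" unfolding abs_mult using assms by (intro mult_le_one) auto
  hence *: "\<bar>ev1 e * (x * u)\<bar> \<le> 2 * 1" "\<bar>ev2 e * (x * u)\<bar> \<le> 2 * 1"
    unfolding abs_mult[of "ev1 e"] abs_mult[of "ev2 e"] by (intro mult_mono ev_le; simp)+
  thus "\<bar>ev1 e * (x * u)\<bar> \<le> 8" "\<bar>ev2 e * (x * u)\<bar> \<le> 8" by linarith+
  have "u * (ev1 e * x) = ev1 e * (x * u)" "u * (ev2 e * x) = ev2 e * (x * u)" by simp_all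
  thus "\<bar>u * (ev1 e * x)\<bar> \<le> 8" "\<bar>u * (ev2 e * x)\<bar> \<le> 8" using * by linarith+
qed

text \<open>The columns r and s are the cases (1, 0) and (0, 1) of (u, w). Since row words reduce to
  \<open>Ch\<close> as well, shortcuts for one entry that use different twists can be
  compared.\<close>

lemma colv_Ch_aux:
  assumes "\<bar>y\<bar> \<le> 2 ^ L" "\<bar>z\<bar> \<le> 2 ^ L" "\<bar>u\<bar> \<le> 1" "\<bar>w\<bar> \<le> 1"
    "\<And>e x. colE p q j e x = Nn 0 0 0 0 (ev1 e * (x * u)) (ev1 e * (x * w)) (ev2 e * (x * u)) (ev2 e * (x * w))"
  shows "eq (colv p q j L y z) (Ch L (y * u) (y * w) (z * u) (z * w)) (1300 * Q L)"
proof -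
  have b: "\<bar>pr e y z\<bar> \<le> lam ^ L" for e
    using pr_bound[OF assms(1,2), of e] pow2_le_lam[of L] by linarith
  have "eq (cw (sg e * int L) 0 (colE p q j e (pr e y z * lam powi (- int L))))
     (hat (Rc e True) L (pr e y z * pr True u w) @ hat (Rc e False) L (pr e y z * pr False u w)) (650 * Q L)" for e
  proof (rule block[OF b])
    show "colE p q j e (pr e y z * lam powi (- int L)) = rl (Rc e True) (pr e y z * lam powi (- int L) * pr True u w) \<circ>
      rl (Rc e False) (pr e y z * lam powi (- int L) * pr False u w)"
      unfolding assms(5) by (rule Nn_c_split)
    have "\<bar>pr e y z * lam powi (- int L)\<bar> \<le> 1" using lam_powi_scale[OF b, of "int L"] by (simp add: mult.commute)
    from ev_scale_letter[OF this assms(3), of e] ev_scale_letter[OF this assms(4), of e]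
    show "colE p q j e (pr e y z * lam powi (- int L)) \<in> \<Lambda>"
      unfolding assms(5) by (intro Nn_letter) auto
  qed (use assms pr_bound in auto)
  from eq_append[OF this[of True] this[of False]]
  show ?thesis unfolding colv_cw Ch_def cz_def pr_linear(4) pr_linear(2) by simp
qed

lemma colv_r:
  assumes "\<bar>y\<bar> \<le> 2 ^ L" "\<bar>z\<bar> \<le> 2 ^ L"
  shows "eq (colv p q r L y z) (Ch L y 0 z 0) (1300 * Q L)"
proof -
  have "colE p q r e x = Nn 0 0 0 0 (ev1 e * (x * 1)) (ev1 e * (x * 0)) (ev2 e * (x * 1)) (ev2 e * (x * 0))" for e x
    by (rule ext)+ (simp add: colE_def E_def Nn_def)
  from colv_Ch_aux[OF assms _ _ this] show ?thesis by simp
qed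

lemma colv_s:
  assumes "\<bar>y\<bar> \<le> 2 ^ L" "\<bar>z\<bar> \<le> 2 ^ L"
  shows "eq (colv p q s L y z) (Ch L 0 y 0 z) (1300 * Q L)"
proof -
  have "colE p q s e x = Nn 0 0 0 0 (ev1 e * (x * 0)) (ev1 e * (x * 1)) (ev2 e * (x * 0)) (ev2 e * (x * 1))" for e x
    by (rule ext)+ (simp add: colE_def E_def Nn_def)
  from colv_Ch_aux[OF assms _ _ this] show ?thesis by simp
qed

lemma rowv_Ch_aux:
  assumes "\<bar>y\<bar> \<le> 2 ^ L" "\<bar>z\<bar> \<le> 2 ^ L" "\<bar>u\<bar> \<le> 1" "\<bar>w\<bar> \<le> 1"
    "\<And>e x. rowE j r s e x = Nn 0 0 0 0 (u * (ev1 e * x)) (u * (ev2 e * x)) (w * (ev1 e * x)) (w * (ev2 e * x))"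
  shows "eq (rowv j r s L y z) (Ch L (u * y) (u * z) (w * y) (w * z)) (11000 * Q L)"
proof -
  have b: "\<bar>pr e y z\<bar> \<le> lam ^ L" for e
    using pr_bound[OF assms(1,2), of e] pow2_le_lam[of L] by linarith
  let ?h = "\<lambda>e f. hat (Rc e f) L (pr f y z * pr e u w)"
  have "eq (cw 0 (- sg e * int L) (rowE j r s e (pr e y z * lam powi (- int L)))) (?h True e @ ?h False e) (650 * Q L)" for e
  proof (rule block[OF b])
    show "rowE j r s e (pr e y z * lam powi (- int L)) = rl (Rc True e) (pr e y z * lam powi (- int L) * pr True u w) \<circ>
      rl (Rc False e) (pr e y z * lam powi (- int L) * pr False u w)"
      unfolding assms(5) by (rule Nn_c_split)
    have "\<bar>pr e y z * lam powi (- int L)\<bar> \<le> 1" using lam_powi_scale[OF b, of "int L"] by (simp add: mult.commute)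
    from ev_scale_letter[OF this assms(3), of e] ev_scale_letter[OF this assms(4), of e]
    show "rowE j r s e (pr e y z * lam powi (- int L)) \<in> \<Lambda>"
      unfolding assms(5) by (intro Nn_letter) auto
  qed (use assms pr_bound in auto)
  from eq_append[OF this[of True] this[of False]]
  have 1: "eq (rowv j r s L y z) (?h True True @ ?h False True @ ?h True False @ ?h False False) (1300 * Q L)"
    unfolding rowv_cw by simp
  have h: "\<bar>pr f y z * pr e u w\<bar> \<le> lam ^ L" for e f
    using b[of f] pr_bound[OF assms(3,4), of e] mult_mono[of "\<bar>pr f y z\<bar>" "lam ^ L" "\<bar>pr e u w\<bar>" 1] lam_gt
    by (auto simp: abs_mult)
  \<comment> \<open>Row words list the corner roots with the column eigenvector varying slowest;
    exchanging the two middle ones gives the order of \<open>Ch\<close>.\<close>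
  have "eq (?h True True @ (?h False True @ ?h True False) @ ?h False False) (?h True True @ (?h True False @ ?h False True) @ ?h False False) (9000 * Q L)"
    using h by (intro eq_context hat_commute_cc) auto
  hence 2: "eq (?h True True @ ?h False True @ ?h True False @ ?h False False) (?h True True @ ?h True False @ ?h False True @ ?h False False) (9000 * Q L)"
    by simp
  have "pr f y z * pr e u w = cz e f (u * y) (u * z) (w * y) (w * z)" for e f
    unfolding cz_alt pr_linear(2) pr_linear(4) by simp
  with eq_trans[OF 1 2] have "eq (rowv j r s L y z) (Ch L (u * y) (u * z) (w * y) (w * z)) (1300 * Q L + 9000 * Q L)"
    unfolding Ch_def by simp
  thus ?thesis by (rule eq_mono) simp
qed

lemma rowv_p:
  assumes "\<bar>y\<bar> \<le> 2 ^ L" "\<bar>z\<bar> \<le> 2 ^ L"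
  shows "eq (rowv p r s L y z) (Ch L y z 0 0) (11000 * Q L)"
proof -
  have "rowE p r s e x = Nn 0 0 0 0 (1 * (ev1 e * x)) (1 * (ev2 e * x)) (0 * (ev1 e * x)) (0 * (ev2 e * x))" for e x
    by (rule ext)+ (simp add: rowE_def E_def Nn_def)
  from rowv_Ch_aux[OF assms _ _ this] show ?thesis by simp
qed

lemma rowv_q:
  assumes "\<bar>y\<bar> \<le> 2 ^ L" "\<bar>z\<bar> \<le> 2 ^ L"
  shows "eq (rowv q r s L y z) (Ch L 0 0 y z) (11000 * Q L)"
proof -
  have "rowE q r s e x = Nn 0 0 0 0 (0 * (ev1 e * x)) (0 * (ev2 e * x)) (1 * (ev1 e * x)) (1 * (ev2 e * x))" for e x
    by (rule ext)+ (simp add: rowE_def E_def Nn_def)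
  from rowv_Ch_aux[OF assms _ _ this] show ?thesis by simp
qed

lemma colv_rowv_commutator:
  assumes "\<bar>y\<bar> \<le> 2 ^ L" "\<bar>z\<bar> \<le> 2 ^ L" "\<bar>u\<bar> \<le> 2 ^ L" "\<bar>w\<bar> \<le> 2 ^ L"
    "\<bar>y * u\<bar> \<le> 2 ^ L" "\<bar>y * w\<bar> \<le> 2 ^ L" "\<bar>z * u\<bar> \<le> 2 ^ L" "\<bar>z * w\<bar> \<le> 2 ^ L"
  shows "eq (colv p q m L y z @ rowv m r s L u w) (Ch L (y * u) (y * w) (z * u) (z * w) @ rowv m r s L u w @ colv p q m L y z) (50000 * Q L)"
proof -
  let ?a = "\<lambda>e. hat (Ra e) L (pr e y z)" and ?b = "\<lambda>f. hat (Rb f) L (pr f u w)"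
  let ?c = "\<lambda>e f. hat (Rc e f) L (pr e y z * pr f u w)"
  have b: "\<bar>pr e y z\<bar> \<le> lam ^ L" "\<bar>pr e u w\<bar> \<le> lam ^ L" for e
    using pr_bound[OF assms(1,2), of e] pr_bound[OF assms(3,4), of e] pow2_le_lam[of L] by linarith+
  have cz: "pr e y z * pr f u w = cz e f (y * u) (y * w) (z * u) (z * w)" for e f
    unfolding cz_def pr_linear(2) pr_linear(4) by simp
  have bc: "\<bar>pr e y z * pr f u w\<bar> \<le> lam ^ L" for e f unfolding cz by (intro cz_bound assms)
  have l: "set (?a e) \<subseteq> \<Lambda>" "set (?b f) \<subseteq> \<Lambda>" "set (?c e f) \<subseteq> \<Lambda>" for e f using b bc by auto
  have ab: "eq (?a e @ ?b f) (?c e f @ ?b f @ ?a e) (1700 * Q L)" for e f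
    by (rule hat_ab[OF b(1,2) bc])
  have ac: "eq (?a e @ ?c e' f) (?c e' f @ ?a e) (1300 * Q L)" for e e' f
    by (rule hat_commute_ac[OF b(1) bc])
  have b_c: "eq (?b f @ ?c e f') (?c e f' @ ?b f) (1300 * Q L)" for e f f'
    by (rule hat_commute_bc[OF b(2) bc])
  have cc: "eq (?c e f @ ?c e' f') (?c e' f' @ ?c e f) (9000 * Q L)" for e f e' f'
    by (rule hat_commute_cc[OF bc bc])
  have "eq (?a True @ ?a False @ ?b True @ ?b False) (?a True @ ?c False True @ ?b True @ ?a False @ ?b False) (1700 * Q L)"
    using eq_context[OF ab[of False True], of "?a True" "?b False"] l by simp
  also have "eq \<dots> (?c False True @ ?a True @ ?b True @ ?a False @ ?b False) (1300 * Q L)"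
    using eq_right[OF ac[of True False True], of "?b True @ ?a False @ ?b False"] l by simp
  also have "eq \<dots> (?c False True @ ?c True True @ ?b True @ ?a True @ ?a False @ ?b False) (1700 * Q L)"
    using eq_context[OF ab[of True True], of "?c False True" "?a False @ ?b False"] l by simp
  also have "eq \<dots> (?c False True @ ?c True True @ ?b True @ ?a True @ ?c False False @ ?b False @ ?a False) (1700 * Q L)"
    using eq_left[OF ab[of False False], of "?c False True @ ?c True True @ ?b True @ ?a True"] l by simp
  also have "eq \<dots> (?c False True @ ?c True True @ ?b True @ ?c False False @ ?a True @ ?b False @ ?a False) (1300 * Q L)"
    using eq_context[OF ac[of True False False], of "?c False True @ ?c True True @ ?b True" "?b False @ ?a False"] l by simp
  also have "eq \<dots> (?c False True @ ?c True True @ ?b True @ ?c False False @ ?c True False @ ?b False @ ?a True @ ?a False) (1700 * Q L)"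
    using eq_context[OF ab[of True False], of "?c False True @ ?c True True @ ?b True @ ?c False False" "?a False"] l by simp
  also have "eq \<dots> (?c False True @ ?c True True @ ?c False False @ ?b True @ ?c True False @ ?b False @ ?a True @ ?a False) (1300 * Q L)"
    using eq_context[OF b_c[of True False False], of "?c False True @ ?c True True" "?c True False @ ?b False @ ?a True @ ?a False"] l by simp
  also have "eq \<dots> (?c False True @ ?c True True @ ?c False False @ ?c True False @ ?b True @ ?b False @ ?a True @ ?a False) (1300 * Q L)"
    using eq_context[OF b_c[of True True False], of "?c False True @ ?c True True @ ?c False False" "?b False @ ?a True @ ?a False"] l by simp
  \<comment> \<open>All corner roots have been collected on the left; three transpositions sort them
    into the order of \<open>Ch\<close>.\<close>
  also have "eq \<dots> (?c True True @ ?c False True @ ?c False False @ ?c True False @ ?b True @ ?b False @ ?a True @ ?a False) (9000 * Q L)"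
    using eq_right[OF cc[of False True True True], of "?c False False @ ?c True False @ ?b True @ ?b False @ ?a True @ ?a False"] l by simp
  also have "eq \<dots> (?c True True @ ?c False True @ ?c True False @ ?c False False @ ?b True @ ?b False @ ?a True @ ?a False) (9000 * Q L)"
    using eq_context[OF cc[of False False True False], of "?c True True @ ?c False True" "?b True @ ?b False @ ?a True @ ?a False"] l by simp
  also have "eq \<dots> (?c True True @ ?c True False @ ?c False True @ ?c False False @ ?b True @ ?b False @ ?a True @ ?a False) (9000 * Q L)"
    using eq_context[OF cc[of False True True False], of "?c True True" "?c False False @ ?b True @ ?b False @ ?a True @ ?a False"] l by simp
  finally show ?thesis unfolding colv_m rowv_m Ch_def cz[symmetric] append.assoc by (rule eq_mono) simp
qed

end

section \<open>Values of the words and change of scale\<close>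

context sol_group
begin

lemma cprod_conj_replicate:
  assumes "\<And>x. g \<circ> rl \<rho> x \<circ> g' = rl \<rho> (lam powi e * x)"
  shows "cprod (replicate k g) \<circ> rl \<rho> x \<circ> cprod (replicate k g') = rl \<rho> (lam powi (e * int k) * x)"
proof (induction k arbitrary: x)
  case (Suc k)
  have "cprod (replicate (Suc k) g) \<circ> rl \<rho> x \<circ> cprod (replicate (Suc k) g') =
    cprod (replicate k g @ [g]) \<circ> rl \<rho> x \<circ> cprod (replicate (Suc k) g')" by (simp add: replicate_append_same)
  also have "\<dots> = cprod (replicate k g) \<circ> (g \<circ> rl \<rho> x \<circ> g') \<circ> cprod (replicate k g')"
    by (simp only: cprod_append cprod_simps replicate_Suc comp_id comp_assoc)
  also have "\<dots> = rl \<rho> (lam powi (e * int k) * (lam powi e * x))" unfolding assms by (rule Suc.IH)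
  also have "\<dots> = rl \<rho> (lam powi (e * int (Suc k)) * x)" unfolding lam_powi_mult by (simp add: algebra_simps)
  finally show ?case .
qed simp

lemma cprod_conj_pw:
  assumes "\<And>x. g \<circ> rl \<rho> x \<circ> g' = rl \<rho> (lam powi e * x)" "\<And>x. g' \<circ> rl \<rho> x \<circ> g = rl \<rho> (lam powi (- e) * x)"
  shows "cprod (pw g g' k) \<circ> rl \<rho> x \<circ> cprod (pw g g' (- k)) = rl \<rho> (lam powi (e * k) * x)"
  using cprod_conj_replicate[of g \<rho> g' e "nat k" x, OF assms(1)]
    cprod_conj_replicate[of g' \<rho> g "- e" "nat (- k)" x, OF assms(2)]
  by (cases "k \<ge> 0") (auto simp: pw_def)

lemma cprod_hat: "cprod (hat \<rho> L x) = rl \<rho> x"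
proof -
  let ?k = "ca \<rho> * int L" and ?l = "cb \<rho> * int L"
  let ?c = "\<lambda>j. lam powi (- j) * x"
  have "cprod (hat \<rho> L x) = cprod (pw A A' ?k) \<circ> (cprod (pw B B' ?l) \<circ> rl \<rho> (?c (ca \<rho> * ?k + cb \<rho> * ?l)) \<circ> cprod (pw B B' (- ?l))) \<circ> cprod (pw A A' (- ?k))"
    by (simp only: hat_def cw_def Tw_def Ti_def cprod_append cprod_simps comp_id comp_assoc)
  also have "\<dots> = rl \<rho> (lam powi (ca \<rho> * ?k) * (lam powi (cb \<rho> * ?l) * ?c (ca \<rho> * ?k + cb \<rho> * ?l)))"
    by (simp only: cprod_conj_pw[OF rl_conj(1,2)] cprod_conj_pw[OF rl_conj(3,4)])
  also have "\<dots> = rl \<rho> x" unfolding lam_powi_mult by simp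
  finally show ?thesis .
qed

lemma cprod_colv: "cprod (colv p q m L y z) = E p m y \<circ> E q m z"
proof -
  have "cprod (colv p q m L y z) = Nn y z 0 0 0 0 0 0"
    by (simp add: colv_m cprod_hat Nn_comp pr_sum)
  thus ?thesis by (intro ext) (simp add: Nn_def E_def)
qed

lemma cprod_rowv: "cprod (rowv m r s L y z) = E m r y \<circ> E m s z"
proof -
  have "cprod (rowv m r s L y z) = Nn 0 0 y z 0 0 0 0"
    by (simp add: rowv_m cprod_hat Nn_comp pr_sum)
  thus ?thesis by (intro ext) (simp add: Nn_def E_def)
qed

text \<open>\<open>colv\<close> conjugates each eigencomponent by the power of the twist that
  expands it, so its middle letter carries the factor \<open>lam powi (- int L)\<close> and is
  bounded.\<close>

lemma colv_letters: "\<bar>y\<bar> \<le> 2 ^ L \<Longrightarrow> \<bar>z\<bar> \<le> 2 ^ L \<Longrightarrow> set (colv p q m L y z) \<subseteq> \<Lambda>"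
  using pr_bound[of y "2 ^ L" z True] pr_bound[of y "2 ^ L" z False] pow2_le_lam[of L]
  by (simp add: colv_m)

lemma rowv_letters: "\<bar>y\<bar> \<le> 2 ^ L \<Longrightarrow> \<bar>z\<bar> \<le> 2 ^ L \<Longrightarrow> set (rowv m r s L y z) \<subseteq> \<Lambda>"
  using pr_bound[of y "2 ^ L" z True] pr_bound[of y "2 ^ L" z False] pow2_le_lam[of L]
  by (simp add: rowv_m)

text \<open>By \<open>Ch_add\<close> both orders equal the word for the sum.\<close>

lemma Ch_commute:
  assumes x: "\<bar>x11\<bar> \<le> 2 ^ L" "\<bar>x12\<bar> \<le> 2 ^ L" "\<bar>x21\<bar> \<le> 2 ^ L" "\<bar>x22\<bar> \<le> 2 ^ L"
    and y: "\<bar>y11\<bar> \<le> 2 ^ L" "\<bar>y12\<bar> \<le> 2 ^ L" "\<bar>y21\<bar> \<le> 2 ^ L" "\<bar>y22\<bar> \<le> 2 ^ L"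
    and xy: "\<bar>x11 + y11\<bar> \<le> 2 ^ L" "\<bar>x12 + y12\<bar> \<le> 2 ^ L" "\<bar>x21 + y21\<bar> \<le> 2 ^ L" "\<bar>x22 + y22\<bar> \<le> 2 ^ L"
  shows "eq (Ch L x11 x12 x21 x22 @ Ch L y11 y12 y21 y22) (Ch L y11 y12 y21 y22 @ Ch L x11 x12 x21 x22) (120000 * Q L)"
proof -
  have xy': "\<bar>y11 + x11\<bar> \<le> 2 ^ L" "\<bar>y12 + x12\<bar> \<le> 2 ^ L" "\<bar>y21 + x21\<bar> \<le> 2 ^ L" "\<bar>y22 + x22\<bar> \<le> 2 ^ L"
    using xy by (simp_all add: add.commute)
  have "eq (Ch L y11 y12 y21 y22 @ Ch L x11 x12 x21 x22) (Ch L (x11 + y11) (x12 + y12) (x21 + y21) (x22 + y22)) (60000 * Q L)"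
    using Ch_add[OF y x xy'] by (simp only: add.commute)
  from eq_trans[OF Ch_add[OF x y xy] eq_sym[OF this]] show ?thesis by (rule eq_mono) simp
qed

text \<open>Raising the scale means moving further out in the contracting direction of the
  root.\<close>

lemma hat_level:
  assumes "\<bar>x\<bar> \<le> lam ^ L'" "L' \<le> L"
  shows "eq (hat \<rho> L' x) (hat \<rho> L x) (10 * Q L)"
proof -
  have d: "int L' + int (L - L') = int L" using assms(2) by simp
  have c: "ca \<rho> * (ca \<rho> * i) \<ge> 0" "cb \<rho> * (cb \<rho> * i) \<ge> 0" if "i \<ge> 0" for i
    using that by (simp_all flip: mult.assoc)
  have b: "nat \<bar>ca \<rho> * int i\<bar> \<le> L" "nat \<bar>cb \<rho> * int i\<bar> \<le> L" if "i \<le> L" for i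
    using cacb_le[of \<rho> i] that by linarith+
  have "eq (hat \<rho> L' x) (cw (ca \<rho> * int L' + ca \<rho> * int (L - L')) (cb \<rho> * int L' + cb \<rho> * int (L - L'))
     (rl \<rho> (lam powi (- (ca \<rho> * (ca \<rho> * int (L - L')) + cb \<rho> * (cb \<rho> * int (L - L')))) *
       (lam powi (- (ca \<rho> * (ca \<rho> * int L') + cb \<rho> * (cb \<rho> * int L'))) * x)))) (10 * Q L)"
    unfolding hat_def using assms(2) by (intro move c b lam_powi_scale[OF assms(1) cacb_ge]) simp_all
  moreover have "- (ca \<rho> * (ca \<rho> * int (L - L')) + cb \<rho> * (cb \<rho> * int (L - L'))) + - (ca \<rho> * (ca \<rho> * int L') + cb \<rho> * (cb \<rho> * int L')) =
     - (ca \<rho> * (ca \<rho> * int L) + cb \<rho> * (cb \<rho> * int L))"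
    unfolding d[symmetric] by (simp only: distrib_left minus_add_distrib)
  ultimately show ?thesis unfolding lam_powi_mult hat_def distrib_left[symmetric] d by simp
qed

lemma colv_level:
  assumes "\<bar>y\<bar> \<le> 2 ^ L'" "\<bar>z\<bar> \<le> 2 ^ L'" "L' \<le> L"
  shows "eq (colv p q m L' y z) (colv p q m L y z) (20 * Q L)"
proof -
  have "\<bar>pr e y z\<bar> \<le> lam ^ L'" for e using pr_bound[OF assms(1,2), of e] pow2_le_lam[of L'] by linarith
  from eq_append[OF hat_level[OF this assms(3)] hat_level[OF this assms(3)], of "Ra True" True "Ra False" False]
  show ?thesis unfolding colv_m by (rule eq_mono) simp
qed

end

section \<open>Steinberg relations with logarithmic shortcuts\<close>

context SL_presentation
begin

abbreviation Q :: "nat \<Rightarrow> nat" where "Q x \<equiv> (x + 1)\<^sup>2"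

abbreviation rw :: "rmap list \<Rightarrow> word" where "rw u \<equiv> rho id u"

text \<open>Paths from the identity to an integer matrix. A path appended to such a path starts at
  an integer matrix and can be translated back, so rounding turns concatenation into
  concatenation.\<close>

definition nice :: "rmap list \<Rightarrow> bool" where
  "nice u \<longleftrightarrow> thick_path id u \<and> cprod u \<in> act ` SL n"

lemma rho_nice:
  assumes "nice u" "nice v"
  shows "thick_path id (u @ v)" "rw (u @ v) = rw u @ rw v" "nice (u @ v)"
proof -
  from assms(1) obtain M where M: "M \<in> SL n" "cprod u = act M \<circ> id" unfolding nice_def by auto
  have p: "thick_path (act M \<circ> x) v \<longleftrightarrow> thick_path x v" for x v
    by (induction v arbitrary: x) (simp_all add: thick_act[OF M(1)] comp_assoc)
  show "thick_path id (u @ v)" using assms p[of id v] M(2) unfolding thick_path_append nice_def by simp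
  moreover have "cprod (u @ v) \<in> act ` SL n" using assms act_SL_comp by (simp add: nice_def)
  ultimately show "nice (u @ v)" unfolding nice_def by blast
  show "rw (u @ v) = rw u @ rw v"
    using rho_act[OF M(1), of id v] assms(2) M(2) unfolding rho_append nice_def by simp
qed

lemma fresh:
  assumes "card F < n" "finite F"
  obtains i where "i < n" "i \<notin> F"
proof -
  have "\<not> {..<n} \<subseteq> F" using assms card_mono[of F "{..<n}"] by auto
  thus ?thesis using that by blast
qed

lemma two_fresh:
  assumes "card F \<le> 3" "finite F"
  obtains i j where "i < n" "j < n" "i \<notin> F" "j \<notin> F" "i \<noteq> j"
proof -
  obtain i where i: "i < n" "i \<notin> F" using fresh[of F] assms n5 by auto
  have "card (insert i F) < n" using assms i n5 by simp
  then obtain j where "j < n" "j \<notin> insert i F" using fresh[of "insert i F"] assms by auto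
  thus ?thesis using that i by blast
qed

text \<open>
  All words for \<open>E i j x\<close> obtained from a helper index \<open>k\<close>: using a twist of the rows \<open>i, k\<close>
  (first flag) or of the columns \<open>j, k\<close>, in either order (second flag).
\<close>

definition node :: "bool \<Rightarrow> bool \<Rightarrow> nat \<Rightarrow> nat \<Rightarrow> nat \<Rightarrow> nat \<Rightarrow> real \<Rightarrow> rmap list" where
  "node b f i j k L x = (if b then (if f then colv i k j L x 0 else colv k i j L 0 x)
      else (if f then rowv i j k L x 0 else rowv i k j L 0 x))"

lemma sol_groupI: "distinct [p, q, m, r, s] \<Longrightarrow> p < n \<Longrightarrow> q < n \<Longrightarrow> m < n \<Longrightarrow> r < n \<Longrightarrow> s < n \<Longrightarrow> sol_group n d h R p q m r s"
  by unfold_locales auto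

lemma E_0 [simp]: "E i j 0 = id"
  by (rule ext)+ (simp add: E_def)

lemma nice_node:
  assumes "distinct [i, j, k]" "i < n" "j < n" "k < n" "\<bar>real_of_int x\<bar> \<le> 2 ^ L"
  shows "nice (node b f i j k L (real_of_int x))" "cprod (node b f i j k L (real_of_int x)) = E i j (real_of_int x)"
proof -
  have "card {i, j, k} \<le> 3" by (simp add: card_insert_if)
  then obtain r s where rs: "r < n" "s < n" "r \<notin> {i, j, k}" "s \<notin> {i, j, k}" "r \<noteq> s" using two_fresh[of "{i, j, k}"] by auto
  interpret c1: sol_group n d h R i k j r s by (rule sol_groupI) (use assms rs in auto)
  interpret c2: sol_group n d h R k i j r s by (rule sol_groupI) (use assms rs in auto)
  interpret r1: sol_group n d h R r s i j k by (rule sol_groupI) (use assms rs in auto)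
  interpret r2: sol_group n d h R r s i k j by (rule sol_groupI) (use assms rs in auto)
  have z: "\<bar>0\<bar> \<le> (2::real) ^ L" by simp
  have t: "thick_path id (node b f i j k L (real_of_int x))"
    unfolding node_def
    using letter_system_path[OF c1.letters c1.P_id c1.colv_letters[OF assms(5) z]]
      letter_system_path[OF c2.letters c2.P_id c2.colv_letters[OF z assms(5)]]
      letter_system_path[OF r1.letters r1.P_id r1.rowv_letters[OF assms(5) z]]
      letter_system_path[OF r2.letters r2.P_id r2.rowv_letters[OF z assms(5)]] by simp
  show e: "cprod (node b f i j k L (real_of_int x)) = E i j (real_of_int x)"
    unfolding node_def using c1.cprod_colv c2.cprod_colv r1.cprod_rowv r2.cprod_rowv by simp
  show "nice (node b f i j k L (real_of_int x))" unfolding nice_def e using t E_in_act assms by auto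
qed

lemma eq_rw: "sol_group n d h R p q m r s \<Longrightarrow> sol_group.eqK n d h R p q m r s k u v \<Longrightarrow> ar (rw u) (rw v) (k * K0)"
  using sol_group.P_id[of n d h R p q m r s] unfolding sol_group.eq_def eqr_def by blast

text \<open>\<open>E i j x\<close> is an entry of the corner with rows i, k and columns j, l, and
  both words equal the same \<open>Ch\<close>; m is a fifth index. The two flags decide the order of
  the rows and of the columns, hence four groups.\<close>

lemma node_edge:
  assumes "distinct [i, j, k, l]" "i < n" "j < n" "k < n" "l < n" "\<bar>x\<bar> \<le> 2 ^ L"
  shows "ar (rw (node True f i j k L x)) (rw (node False g i j l L x)) (12300 * Q L * K0)"
proof -
  have "card {i, j, k, l} \<le> 4" by (simp add: card_insert_if)
  then obtain m where m: "m < n" "m \<notin> {i, j, k, l}" using fresh[of "{i, j, k, l}"] n5 by auto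
  have z: "\<bar>0\<bar> \<le> (2::real) ^ L" by simp
  have s: "1300 * Q L + 11000 * Q L = 12300 * Q L" by simp
  have 1: "sol_group n d h R i k m j l" by (rule sol_groupI) (use assms m in auto)
  have 2: "sol_group n d h R k i m j l" by (rule sol_groupI) (use assms m in auto)
  have 3: "sol_group n d h R i k m l j" by (rule sol_groupI) (use assms m in auto)
  have 4: "sol_group n d h R k i m l j" by (rule sol_groupI) (use assms m in auto)
  interpret g1: sol_group n d h R i k m j l by (rule 1)
  interpret g2: sol_group n d h R k i m j l by (rule 2)
  interpret g3: sol_group n d h R i k m l j by (rule 3)
  interpret g4: sol_group n d h R k i m l j by (rule 4)
  show ?thesis
    using eq_rw[OF 1 g1.eq_trans[OF g1.colv_r[OF assms(6) z] g1.eq_sym[OF g1.rowv_p[OF assms(6) z]]]]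
      eq_rw[OF 2 g2.eq_trans[OF g2.colv_r[OF z assms(6)] g2.eq_sym[OF g2.rowv_q[OF assms(6) z]]]]
      eq_rw[OF 3 g3.eq_trans[OF g3.colv_s[OF assms(6) z] g3.eq_sym[OF g3.rowv_p[OF z assms(6)]]]]
      eq_rw[OF 4 g4.eq_trans[OF g4.colv_s[OF z assms(6)] g4.eq_sym[OF g4.rowv_q[OF z assms(6)]]]]
    unfolding node_def s by (cases f; cases g; simp only: if_True if_False)
qed

text \<open>\<open>node_edge\<close> joins column words and row words with different helpers. As n
  is at least 5, three edges lead from a column word to any other word, and 36900 = 3 *
  12300.\<close>

lemma node_independent:
  assumes "distinct [i, j, k]" "distinct [i, j, k']" "i < n" "j < n" "k < n" "k' < n" "\<bar>x\<bar> \<le> 2 ^ L"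
  shows "ar (rw (node True f i j k L x)) (rw (node b g i j k' L x)) (36900 * Q L * K0)"
proof -
  have col: "ar (rw (node True f i j k L x)) (rw (node True g i j k' L x)) (24600 * Q L * K0)"
    if "distinct [i, j, k]" "distinct [i, j, k']" "k < n" "k' < n" for f g k k'
  proof -
    have "card {i, j, k, k'} \<le> 4" by (simp add: card_insert_if)
    then obtain l where l: "l < n" "l \<notin> {i, j, k, k'}" using fresh[of "{i, j, k, k'}"] n5 by auto
    have 1: "ar (rw (node True f i j k L x)) (rw (node False True i j l L x)) (12300 * Q L * K0)"
      using that l assms by (intro node_edge) auto
    have 2: "ar (rw (node True g i j k' L x)) (rw (node False True i j l L x)) (12300 * Q L * K0)"
      using that l assms by (intro node_edge) auto
    from ar_trans[OF 1 ar_sym[OF 2]] show ?thesis by (rule ar_mono) simp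
  qed
  show ?thesis
  proof (cases b)
    case True
    thus ?thesis using col[OF assms(1,2,5,6), of f g] by (auto elim: ar_mono)
  next
    case False
    have "card {i, j, k'} \<le> 3" by (simp add: card_insert_if)
    then obtain l where l: "l < n" "l \<notin> {i, j, k'}" using fresh[of "{i, j, k'}"] n5 by auto
    have 1: "ar (rw (node True True i j l L x)) (rw (node False g i j k' L x)) (12300 * Q L * K0)"
      using l assms by (intro node_edge) auto
    have 2: "ar (rw (node True f i j k L x)) (rw (node True True i j l L x)) (24600 * Q L * K0)"
      using l assms by (intro col) auto
    from ar_trans[OF 2 1] False show ?thesis by (auto elim!: ar_mono)
  qed
qed

section \<open>Canonical short words for elementary matrices\<close>

definition lg :: "int \<Rightarrow> nat" where "lg x = (LEAST L. \<bar>x\<bar> \<le> 2 ^ L)"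

lemma lg: "\<bar>x\<bar> \<le> 2 ^ lg x" "\<bar>x\<bar> \<le> 2 ^ L \<Longrightarrow> lg x \<le> L"
proof -
  have "\<bar>x\<bar> \<le> 2 ^ nat \<bar>x\<bar>" using less_exp[of "nat \<bar>x\<bar>"]
    by (metis abs_ge_zero int_nat_eq less_imp_le nat_less_le of_nat_le_iff of_nat_numeral of_nat_power)
  thus "\<bar>x\<bar> \<le> 2 ^ lg x" unfolding lg_def by (rule LeastI)
  show "\<bar>x\<bar> \<le> 2 ^ L \<Longrightarrow> lg x \<le> L" unfolding lg_def by (rule Least_le)
qed

definition helper :: "nat \<Rightarrow> nat \<Rightarrow> nat" where
  "helper i j = (SOME k. k < n \<and> k \<notin> {i, j})"

lemma helper: "helper i j < n" "helper i j \<noteq> i" "helper i j \<noteq> j"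
proof -
  have "card {i, j} < n" using n5 by (simp add: card_insert_if)
  then obtain k where "k < n \<and> k \<notin> {i, j}" using fresh[of "{i, j}"] by auto
  from someI[of "\<lambda>k. k < n \<and> k \<notin> {i, j}", OF this] show "helper i j < n" "helper i j \<noteq> i" "helper i j \<noteq> j"
    unfolding helper_def by auto
qed

definition eh :: "nat \<Rightarrow> nat \<Rightarrow> int \<Rightarrow> word" where
  "eh i j x = rw (node True True i j (helper i j) (lg x) (real_of_int x))"

definition rt :: "nat \<Rightarrow> nat \<Rightarrow> bool" where "rt i j \<longleftrightarrow> i < n \<and> j < n \<and> i \<noteq> j"

lemma real_le_pow2: "\<bar>x\<bar> \<le> 2 ^ L \<Longrightarrow> \<bar>real_of_int x\<bar> \<le> 2 ^ L"
  by (metis of_int_abs of_int_le_iff of_int_numeral of_int_power)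

lemma nice_eh: "rt i j \<Longrightarrow> nice (node True True i j (helper i j) (lg x) (real_of_int x))"
  using nice_node[of i j "helper i j" x "lg x"] helper[of i j] real_le_pow2[OF lg(1)[of x]] by (auto simp: rt_def)

lemma eh_words: "rt i j \<Longrightarrow> eh i j x \<in> words d"
  using nice_eh unfolding eh_def nice_def by (blast intro: rho_words)

lemma val_eh:
  assumes "rt i j"
  shows "val (eh i j x) = addrow_mat n x i j"
proof -
  let ?M = "addrow_mat n x i j"
  have M: "?M \<in> SL n" using assms by (auto simp: rt_def intro: addrow_mat_SL)
  have c: "cprod (node True True i j (helper i j) (lg x) (real_of_int x)) = act ?M \<circ> id"
    using nice_node(2)[of i j "helper i j" x "lg x" True True] helper[of i j] real_le_pow2[OF lg(1)[of x]] assms act_E[of i n j x]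
    by (auto simp: rt_def)
  have "gam (act ?M \<circ> id) = ?M" unfolding gam_act[OF M thick_id] gam_id SL_one(2)[OF M] ..
  moreover have "SL_inv n (1\<^sub>m n) = 1\<^sub>m n" using SL_inv(2)[OF one_SL] SL_one(1) SL_inv(1)[OF one_SL] by metis
  ultimately show ?thesis unfolding eh_def using val_rho[of id] nice_eh[OF assms, of x] c SL_one(1)[OF M]
    unfolding nice_def by (simp add: gam_id)
qed

text \<open>This lets each Steinberg relation be proved with the helper, the twist and the common
  scale that suit it.\<close>

lemma eh_node:
  assumes "rt i j" "k < n" "k \<noteq> i" "k \<noteq> j" "\<bar>x\<bar> \<le> 2 ^ L"
  shows "ar (eh i j x) (rw (node b f i j k L (real_of_int x))) (37000 * Q L * K0)"
proof -
  let ?k = "helper i j"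
  have ij: "i < n" "j < n" "i \<noteq> j" using assms by (auto simp: rt_def)
  have "card {i, j, ?k} \<le> 3" by (simp add: card_insert_if)
  then obtain r s where rs: "r < n" "s < n" "r \<notin> {i, j, ?k}" "s \<notin> {i, j, ?k}" "r \<noteq> s" using two_fresh[of "{i, j, ?k}"] by auto
  have 1: "sol_group n d h R i ?k j r s" by (rule sol_groupI) (use ij rs helper[of i j] in auto)
  interpret c1: sol_group n d h R i ?k j r s by (rule 1)
  have z: "\<bar>0\<bar> \<le> (2::real) ^ L" for L by simp
  have "ar (rw (node True True i j ?k (lg x) (real_of_int x))) (rw (node True True i j ?k L (real_of_int x))) (20 * Q L * K0)"
    using eq_rw[OF 1 c1.colv_level[OF real_le_pow2[OF lg(1)] z lg(2)[OF assms(5)]]] by (simp add: node_def)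
  moreover have "ar (rw (node True True i j ?k L (real_of_int x))) (rw (node b f i j k L (real_of_int x))) (36900 * Q L * K0)"
    using ij assms helper[of i j] by (intro node_independent real_le_pow2) auto
  ultimately have "ar (eh i j x) (rw (node b f i j k L (real_of_int x))) (20 * Q L * K0 + 36900 * Q L * K0)"
    unfolding eh_def by (rule ar_trans)
  thus ?thesis by (rule ar_mono) simp
qed

text \<open>The largest count below is 4 * 274000 in \<open>eh_commute\<close>.\<close>

definition CS :: nat where "CS = 2000000 * K0"

lemma eh_pair:
  assumes "ar (eh i j x) (rw u) a" "ar (eh k l y) (rw v) a" "nice u" "nice v"
  shows "ar (eh i j x @ eh k l y) (rw (u @ v)) (2 * a)"
  unfolding rho_nice(2)[OF assms(3,4)] using ar_append[OF assms(1,2)] by (simp add: mult_2)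

lemma eh_commute_aux:
  assumes "sol_group n d h R p q m r s" "sol_group.eqK n d h R p q m r s b (u @ v) (v @ u)"
    "ar (eh i j x) (rw u) a" "ar (eh k l y) (rw v) a" "nice u" "nice v"
  shows "ar (eh i j x @ eh k l y) (eh k l y @ eh i j x) (4 * a + b * K0)"
  using ar_trans[OF ar_trans[OF eh_pair[OF assms(3-6)] eq_rw[OF assms(1,2)]] ar_sym[OF eh_pair[OF assms(4,3,6,5)]]]
  by (rule ar_mono) simp

end

context sol_group
begin

lemma Ch_commute_words:
  assumes "eq u (Ch L x11 x12 x21 x22) (1300 * Q L)" "eq v (Ch L y11 y12 y21 y22) (1300 * Q L)"
    and x: "\<bar>x11\<bar> \<le> 2 ^ L" "\<bar>x12\<bar> \<le> 2 ^ L" "\<bar>x21\<bar> \<le> 2 ^ L" "\<bar>x22\<bar> \<le> 2 ^ L"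
    and y: "\<bar>y11\<bar> \<le> 2 ^ L" "\<bar>y12\<bar> \<le> 2 ^ L" "\<bar>y21\<bar> \<le> 2 ^ L" "\<bar>y22\<bar> \<le> 2 ^ L"
    and xy: "\<bar>x11 + y11\<bar> \<le> 2 ^ L" "\<bar>x12 + y12\<bar> \<le> 2 ^ L" "\<bar>x21 + y21\<bar> \<le> 2 ^ L" "\<bar>x22 + y22\<bar> \<le> 2 ^ L"
  shows "eq (u @ v) (v @ u) (126000 * Q L)"
  using eq_trans[OF eq_trans[OF eq_append[OF assms(1,2)] Ch_commute[OF x y xy]] eq_sym[OF eq_append[OF assms(2,1)]]]
  by (rule eq_mono) simp

lemma Ch_add_words:
  assumes "eq u (Ch L x 0 0 0) (1300 * Q L)" "eq v (Ch L y 0 0 0) (1300 * Q L)" "eq w (Ch L (x + y) 0 0 0) (1300 * Q L)"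
    "\<bar>x\<bar> \<le> 2 ^ L" "\<bar>y\<bar> \<le> 2 ^ L" "\<bar>x + y\<bar> \<le> 2 ^ L"
  shows "eq (u @ v) w (64000 * Q L)"
proof -
  have "eq (Ch L x 0 0 0 @ Ch L y 0 0 0) (Ch L (x + y) 0 0 0) (60000 * Q L)"
    using Ch_add[of x L 0 0 0 y 0 0 0] assms(4-6) by simp
  from eq_trans[OF eq_trans[OF eq_append[OF assms(1,2)] this] eq_sym[OF assms(3)]]
  show ?thesis by (rule eq_mono) simp
qed

end

context SL_presentation
begin

lemma Q_Suc: "Q (Suc L) \<le> 4 * Q L"
  by (simp add: power2_eq_square)

text \<open>In each case both roots are entries of the corner of one five-index group. The cases
  tell which rows or columns coincide; the free places are filled with other indices.\<close>

lemma eh_commute: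
  assumes "rt i j" "rt k l" "i \<noteq> l" "j \<noteq> k" "\<bar>x\<bar> \<le> 2 ^ L" "\<bar>y\<bar> \<le> 2 ^ L"
  shows "ar (eh i j x @ eh k l y) (eh k l y @ eh i j x) (CS * Q L)"
proof -
  have ij: "i < n" "j < n" "i \<noteq> j" "k < n" "l < n" "k \<noteq> l" using assms by (auto simp: rt_def)
  \<comment> \<open>At the scale \<open>L + 1\<close> the sum of the two parameters fits as well,
    which commuting via \<open>Ch_add\<close> demands when the roots coincide.\<close>
  define L' where "L' = Suc L"
  have x: "\<bar>x\<bar> \<le> 2 ^ L'" and y: "\<bar>y\<bar> \<le> 2 ^ L'" using assms(5,6) by (auto simp: L'_def)
  have xy: "\<bar>real_of_int x + real_of_int y\<bar> \<le> 2 ^ L'"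
    using real_le_pow2[OF assms(5)] real_le_pow2[OF assms(6)] by (simp add: L'_def)
  note rx = real_le_pow2[OF x] and ry = real_le_pow2[OF y]
  have z: "\<bar>0\<bar> \<le> (2::real) ^ L'" by simp
  have "ar (eh i j x @ eh k l y) (eh k l y @ eh i j x) (4 * (37000 * Q L' * K0) + 126000 * Q L' * K0)"
  proof (cases "i = k")
    case False
    note ik = this
    show ?thesis
    proof (cases "j = l")
      case False
      have "card {i, k, j, l} \<le> 4" by (simp add: card_insert_if)
      then obtain m where m: "m < n" "m \<notin> {i, k, j, l}" using fresh[of "{i, k, j, l}"] n5 by auto
      have 1: "sol_group n d h R i k m j l" by (rule sol_groupI) (use ij m ik False assms in auto)
      interpret g: sol_group n d h R i k m j l by (rule 1)
      have "g.eq (node True True i j k L' x @ node True False k l i L' y) (node True False k l i L' y @ node True True i j k L' x) (126000 * Q L')"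
        using g.Ch_commute_words[OF g.colv_r[OF rx z] g.colv_s[OF z ry] rx z z z z z z ry] rx ry z
        by (simp add: node_def)
      thus ?thesis
        by (rule eh_commute_aux[OF 1]; intro eh_node nice_node real_le_pow2; use ij ik assms x y in \<open>auto simp: rt_def\<close>)
    next
      case True
      have "card {i, k, j} \<le> 3" by (simp add: card_insert_if)
      then obtain m s where m: "m < n" "m \<notin> {i, k, j}" "s < n" "s \<notin> {i, k, j}" "m \<noteq> s" by (rule two_fresh) auto
      have 1: "sol_group n d h R i k m j s" by (rule sol_groupI) (use ij m ik assms in auto)
      interpret g: sol_group n d h R i k m j s by (rule 1)
      have "g.eq (node True True i j k L' x @ node True False k l i L' y) (node True False k l i L' y @ node True True i j k L' x) (126000 * Q L')"
        using g.Ch_commute_words[OF g.colv_r[OF rx z] g.colv_r[OF z ry] rx z z z z z ry z] rx ry z True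
        by (simp add: node_def)
      thus ?thesis
        by (rule eh_commute_aux[OF 1]; intro eh_node nice_node real_le_pow2; use ij ik assms x y True in \<open>auto simp: rt_def\<close>)
    qed
  next
    case True
    note ik = this
    show ?thesis
    proof (cases "j = l")
      case False
      have "card {i, j, l} \<le> 3" by (simp add: card_insert_if)
      then obtain m q where m: "m < n" "m \<notin> {i, j, l}" "q < n" "q \<notin> {i, j, l}" "m \<noteq> q" by (rule two_fresh) auto
      have 1: "sol_group n d h R i q m j l" by (rule sol_groupI) (use ij m ik False assms in auto)
      interpret g: sol_group n d h R i q m j l by (rule 1)
      have "g.eq (node True True i j q L' x @ node True True k l q L' y) (node True True k l q L' y @ node True True i j q L' x) (126000 * Q L')"
        using g.Ch_commute_words[OF g.colv_r[OF rx z] g.colv_s[OF ry z] rx z z z z ry z z] rx ry z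
        by (simp add: node_def ik[symmetric])
      thus ?thesis
        by (rule eh_commute_aux[OF 1]; intro eh_node nice_node real_le_pow2; use ij ik assms x y m in \<open>auto simp: rt_def\<close>)
    next
      case True
      have "card {i, j} \<le> 3" by (simp add: card_insert_if)
      then obtain m q where m: "m < n" "m \<notin> {i, j}" "q < n" "q \<notin> {i, j}" "m \<noteq> q" by (rule two_fresh) auto
      have "card {i, j, m, q} \<le> 4" by (simp add: card_insert_if)
      then obtain s where s: "s < n" "s \<notin> {i, j, m, q}" using fresh[of "{i, j, m, q}"] n5 by auto
      have 1: "sol_group n d h R i q m j s" by (rule sol_groupI) (use ij m s in auto)
      interpret g: sol_group n d h R i q m j s by (rule 1)
      have "g.eq (node True True i j q L' x @ node True True k l q L' y) (node True True k l q L' y @ node True True i j q L' x) (126000 * Q L')"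
        using g.Ch_commute_words[OF g.colv_r[OF rx z] g.colv_r[OF ry z] rx z z z ry z z z xy] z
        by (simp add: node_def ik[symmetric] True[symmetric])
      thus ?thesis
        by (rule eh_commute_aux[OF 1]; intro eh_node nice_node real_le_pow2; use ij ik assms x y True m in \<open>auto simp: rt_def\<close>)
    qed
  qed
  moreover have "4 * (37000 * Q L' * K0) + 126000 * Q L' * K0 \<le> CS * Q L"
  proof -
    have "4 * (37000 * Q L' * K0) + 126000 * Q L' * K0 = (274000 * K0) * Q L'" by simp
    also have "\<dots> \<le> (274000 * K0) * (4 * Q L)" using Q_Suc[of L] unfolding L'_def by (intro mult_le_mono2)
    also have "\<dots> \<le> CS * Q L" by (simp add: CS_def)
    finally show ?thesis .
  qed
  ultimately show ?thesis by (rule ar_mono)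
qed

lemma eh_add:
  assumes "rt i j" "\<bar>x\<bar> \<le> 2 ^ L" "\<bar>y\<bar> \<le> 2 ^ L" "\<bar>x + y\<bar> \<le> 2 ^ L"
  shows "ar (eh i j x @ eh i j y) (eh i j (x + y)) (CS * Q L)"
proof -
  have ij: "i < n" "j < n" "i \<noteq> j" using assms by (auto simp: rt_def)
  have "card {i, j} \<le> 3" by (simp add: card_insert_if)
  then obtain m q where m: "m < n" "m \<notin> {i, j}" "q < n" "q \<notin> {i, j}" "m \<noteq> q" by (rule two_fresh) auto
  have "card {i, j, m, q} \<le> 4" by (simp add: card_insert_if)
  then obtain s where s: "s < n" "s \<notin> {i, j, m, q}" using fresh[of "{i, j, m, q}"] n5 by auto
  have 1: "sol_group n d h R i q m j s" by (rule sol_groupI) (use ij m s in auto)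
  interpret g: sol_group n d h R i q m j s by (rule 1)
  have z: "\<bar>0\<bar> \<le> (2::real) ^ L" by simp
  note b = real_le_pow2[OF assms(2)] real_le_pow2[OF assms(3)] real_le_pow2[OF assms(4), unfolded of_int_add]
  let ?u = "\<lambda>x. node True True i j q L (real_of_int x)"
  have "g.eq (?u x @ ?u y) (?u (x + y)) (64000 * Q L)"
    using g.Ch_add_words[OF g.colv_r[OF b(1) z] g.colv_r[OF b(2) z] g.colv_r[OF b(3) z] b] by (simp add: node_def)
  from eq_rw[OF 1 this] have 2: "ar (rw (?u x @ ?u y)) (rw (?u (x + y))) (64000 * Q L * K0)" .
  have e: "ar (eh i j c) (rw (?u c)) (37000 * Q L * K0)" "nice (?u c)" if "\<bar>c\<bar> \<le> 2 ^ L" for c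
    by (intro eh_node nice_node real_le_pow2; use ij m assms that in \<open>auto simp: rt_def\<close>)+
  from ar_trans[OF ar_trans[OF eh_pair[OF e(1)[OF assms(2)] e(1)[OF assms(3)] e(2)[OF assms(2)] e(2)[OF assms(3)]] 2] ar_sym[OF e(1)[OF assms(4)]]]
  show ?thesis by (rule ar_mono) (simp add: CS_def)
qed

text \<open>The shared index j takes the place of m, so that the two factors lie in the column above
  m and in the row to the right of it.\<close>

lemma eh_commutator:
  assumes "rt i j" "rt j k" "i \<noteq> k" "\<bar>x\<bar> \<le> 2 ^ L" "\<bar>y\<bar> \<le> 2 ^ L" "\<bar>x * y\<bar> \<le> 2 ^ L"
  shows "ar (eh i j x @ eh j k y) (eh i k (x * y) @ eh j k y @ eh i j x) (CS * Q L)"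
proof -
  have ij: "i < n" "j < n" "i \<noteq> j" "k < n" "j \<noteq> k" using assms by (auto simp: rt_def)
  have "card {i, j, k} \<le> 3" by (simp add: card_insert_if)
  then obtain q s where m: "q < n" "q \<notin> {i, j, k}" "s < n" "s \<notin> {i, j, k}" "q \<noteq> s" by (rule two_fresh) auto
  have 1: "sol_group n d h R i q j k s" by (rule sol_groupI) (use ij m assms in auto)
  interpret g: sol_group n d h R i q j k s by (rule 1)
  have z: "\<bar>0\<bar> \<le> (2::real) ^ L" by simp
  note b = real_le_pow2[OF assms(4)] real_le_pow2[OF assms(5)] real_le_pow2[OF assms(6), unfolded of_int_mult]
  let ?u = "node True True i j q L (real_of_int x)" and ?v = "node False True j k s L (real_of_int y)"
  let ?w = "node True True i k q L (real_of_int (x * y))"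
  have l: "set ?v \<subseteq> g.\<Lambda>" "set ?u \<subseteq> g.\<Lambda>" using g.colv_letters[OF b(1) z] g.rowv_letters[OF b(2) z] by (auto simp: node_def)
  have c: "g.eq (?u @ ?v) (g.Ch L (real_of_int x * real_of_int y) 0 0 0 @ ?v @ ?u) (50000 * Q L)"
    using g.colv_rowv_commutator[OF b(1) z b(2) z b(3)] by (simp add: node_def)
  have w: "g.eq ?w (g.Ch L (real_of_int x * real_of_int y) 0 0 0) (1300 * Q L)"
    using g.colv_r[OF b(3) z] by (simp add: node_def)
  have "g.eq (?u @ ?v) (?w @ ?v @ ?u) (50000 * Q L + 1300 * Q L)"
    using g.eq_trans[OF c g.eq_right[OF g.eq_sym[OF w]]] l by simp
  from eq_rw[OF 1 this] have 2: "ar (rw (?u @ ?v)) (rw (?w @ ?v @ ?u)) ((50000 * Q L + 1300 * Q L) * K0)" .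
  have e: "ar (eh i j x) (rw ?u) (37000 * Q L * K0)" "nice ?u" "ar (eh j k y) (rw ?v) (37000 * Q L * K0)" "nice ?v"
      "ar (eh i k (x * y)) (rw ?w) (37000 * Q L * K0)" "nice ?w"
    by (intro eh_node nice_node real_le_pow2; use ij m assms in \<open>auto simp: rt_def\<close>)+
  have 3: "ar (eh i k (x * y) @ (eh j k y @ eh i j x)) (rw (?w @ (?v @ ?u))) (37000 * Q L * K0 + 2 * (37000 * Q L * K0))"
    unfolding rho_nice(2)[OF e(6) rho_nice(3)[OF e(4,2)]]
    by (rule ar_append[OF e(5) eh_pair[OF e(3,1,4,2)]])
  from ar_trans[OF ar_trans[OF eh_pair[OF e(1,3,2,4)] 2] ar_sym[OF 3]]
  show ?thesis by (rule ar_mono) (simp add: CS_def algebra_simps)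
qed

end

section \<open>Filling words of bounded combinatorial length\<close>

text \<open>Sign changes of two coordinates are generators of their own: i and j may lie in
  different blocks, each of which then has determinant -1.\<close>

datatype elem = EL nat nat int | SG nat nat

definition Sg :: "nat \<Rightarrow> nat \<Rightarrow> rmap" where
  "Sg i j v = v(i := - v i, j := - v j)"

fun emap :: "elem \<Rightarrow> rmap" where
  "emap (EL i j x) = E i j (real_of_int x)"
| "emap (SG i j) = Sg i j"

fun coef :: "elem \<Rightarrow> int" where
  "coef (EL i j x) = x"
| "coef (SG i j) = 1"

fun eidx :: "elem \<Rightarrow> nat set" where
  "eidx (EL i j x) = {i, j}"
| "eidx (SG i j) = {i, j}"

abbreviation eprod :: "elem list \<Rightarrow> rmap" where "eprod l \<equiv> cprod (map emap l)"

text \<open>A sign change is diagonal and hence respects any partition into blocks, even if its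
  indices lie in different ones.\<close>

fun within_block :: "(nat \<Rightarrow> nat) \<Rightarrow> elem \<Rightarrow> bool" where
  "within_block \<beta> (EL i j x) \<longleftrightarrow> \<beta> i = \<beta> j"
| "within_block \<beta> (SG i j) \<longleftrightarrow> True"

fun above_block :: "(nat \<Rightarrow> nat) \<Rightarrow> elem \<Rightarrow> bool" where
  "above_block \<beta> (EL i j x) \<longleftrightarrow> \<beta> i < \<beta> j"
| "above_block \<beta> (SG i j) \<longleftrightarrow> False"

text \<open>On a vector supported in one block the strictly upper factor changes no coordinate of
  this block. Hence the diagonal factor alone must fix these coordinates.\<close>

lemma block_split:
  assumes "\<forall>g\<in>set l. within_block \<beta> g" "\<forall>g\<in>set us. above_block \<beta> g" "eprod l \<circ> eprod us = id"
  shows "eprod l = id" "eprod us = id"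
proof -
  have D: "eprod l v i = eprod l v' i" if "\<And>j. \<beta> j = \<beta> i \<or> j = i \<Longrightarrow> v j = v' j" for v v' i
    using assms(1) that
  proof (induction l arbitrary: i)
    case (Cons g l)
    show ?case
    proof (cases g)
      case (EL a b x)
      hence ab: "\<beta> a = \<beta> b" using Cons.prems by auto
      have 1: "eprod l v i = eprod l v' i" using Cons by auto
      have "eprod l v b = eprod l v' b" if "i = a"
        using Cons.prems that ab by (intro Cons.IH) auto
      thus ?thesis using 1 EL by (auto simp: E_def)
    next
      case (SG a b)
      have 1: "eprod l v i = eprod l v' i" using Cons by auto
      thus ?thesis using SG by (auto simp: Sg_def)
    qed
  qed auto
  have U: "eprod us v i = v i" if "\<And>j. \<beta> j > \<beta> i \<Longrightarrow> v j = 0" for v i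
    using assms(2) that
  proof (induction us arbitrary: i)
    case (Cons g us)
    then obtain a b x where g: "g = EL a b x" "\<beta> a < \<beta> b" by (cases g) auto
    have 1: "eprod us v i = v i" using Cons by auto
    have "eprod us v b = v b" if "i = a"
      using Cons.prems that g(2) by (intro Cons.IH) auto
    thus ?case using 1 g Cons.prems(2)[of b] by (auto simp: E_def)
  qed auto
  have "eprod l v i = v i" for v i
  proof -
    define w where "w = (\<lambda>j. if \<beta> j = \<beta> i then v j else 0)"
    have "eprod l v i = eprod l w i" by (rule D) (auto simp: w_def)
    also have "\<dots> = eprod l (eprod us w) i"
    proof (rule D)
      fix j assume "\<beta> j = \<beta> i \<or> j = i"
      hence "eprod us w j = w j" by (intro U) (auto simp: w_def)
      thus "w j = eprod us w j" by simp
    qed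
    also have "\<dots> = w i" using assms(3) by (metis comp_apply id_apply)
    finally show ?thesis by (simp add: w_def)
  qed
  thus l: "eprod l = id" by (intro ext) simp
  show "eprod us = id" using assms(3) unfolding l by simp
qed

context SL_presentation
begin

text \<open>The square of a Weyl element, which is -1 on the plane of the coordinates i and
  j.\<close>

definition tau :: "nat \<Rightarrow> nat \<Rightarrow> word" where
  "tau i j = (eh i j 1 @ eh j i (-1) @ eh i j 1) @ (eh i j 1 @ eh j i (-1) @ eh i j 1)"

fun eword :: "elem \<Rightarrow> word" where
  "eword (EL i j x) = eh i j x"
| "eword (SG i j) = tau i j"

fun ewf :: "elem \<Rightarrow> bool" where
  "ewf (EL i j x) \<longleftrightarrow> rt i j"
| "ewf (SG i j) \<longleftrightarrow> rt i j"

definition ev :: "elem list \<Rightarrow> word" where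
  "ev l = concat (map eword l)"

lemma ev_simps [simp]: "ev [] = []" "ev (g # l) = eword g @ ev l" "ev (l @ l') = ev l @ ev l'"
  by (auto simp: ev_def)

lemma rt_sym: "rt i j \<Longrightarrow> rt j i" by (auto simp: rt_def)

lemma eword_words: "ewf g \<Longrightarrow> eword g \<in> words d"
  by (cases g) (auto simp: tau_def eh_words rt_sym)

lemma ev_words: "\<forall>g\<in>set l. ewf g \<Longrightarrow> ev l \<in> words d"
  by (induction l) (auto simp: eword_words)

lemma act_val_append:
  assumes "u \<in> words d" "v \<in> words d"
  shows "act (val (u @ v)) = act (val u) \<circ> act (val v)"
  unfolding val_append[OF assms] using act_mult val_closed assms SL_D(1) by blast

lemma act_val_eh: "rt i j \<Longrightarrow> act (val (eh i j x)) = E i j (real_of_int x)"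
  unfolding val_eh by (rule act_E) (auto simp: rt_def)

lemma act_val_eword: "ewf g \<Longrightarrow> act (val (eword g)) = emap g"
proof (cases g)
  case (SG i j)
  moreover assume "ewf g"
  ultimately have r: "rt i j" by simp
  hence ij: "i \<noteq> j" by (simp add: rt_def)
  have "act (val (tau i j)) = (E i j 1 \<circ> (E j i (-1) \<circ> E i j 1)) \<circ> (E i j 1 \<circ> (E j i (-1) \<circ> E i j 1))"
    unfolding tau_def using r rt_sym[OF r] by (simp add: act_val_append eh_words act_val_eh comp_assoc)
  also have "\<dots> = Sg i j" using ij by (intro ext) (simp add: E_def Sg_def)
  finally show ?thesis using SG by simp
qed (simp add: act_val_eh)

lemma act_val_ev: "\<forall>g\<in>set l. ewf g \<Longrightarrow> act (val (ev l)) = eprod l"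
  by (induction l) (simp_all add: act_val_append eword_words ev_words act_val_eword)

lemma val_ev_eq:
  assumes "\<forall>g\<in>set l. ewf g" "\<forall>g\<in>set l'. ewf g" "eprod l = eprod l'"
  shows "val (ev l) = val (ev l')"
  using act_inj[of "val (ev l)" n "val (ev l')"] act_val_ev assms val_closed ev_words SL_D(1) by metis

lemma finite_elem_lists: "finite {l. (\<forall>g\<in>set l. ewf g \<and> \<bar>coef g\<bar> \<le> C) \<and> length l \<le> M}"
proof -
  let ?S = "(\<lambda>(i, j, x). EL i j x) ` ({..<n} \<times> {..<n} \<times> {-C..C}) \<union> (\<lambda>(i, j). SG i j) ` ({..<n} \<times> {..<n})"
  have "g \<in> ?S" if "ewf g" "\<bar>coef g\<bar> \<le> C" for g
    using that by (cases g) (force simp: rt_def)+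
  hence "{l. (\<forall>g\<in>set l. ewf g \<and> \<bar>coef g\<bar> \<le> C) \<and> length l \<le> M} \<subseteq> {l. set l \<subseteq> ?S \<and> length l \<le> M}" by blast
  moreover have "finite {l. set l \<subseteq> ?S \<and> length l \<le> M}" by (rule finite_lists_length_le) auto
  ultimately show ?thesis by (rule finite_subset)
qed

lemma bounded_relations:
  "\<exists>K. \<forall>l l'. (\<forall>g\<in>set l \<union> set l'. ewf g \<and> \<bar>coef g\<bar> \<le> C) \<longrightarrow> length l \<le> M \<longrightarrow> length l' \<le> M \<longrightarrow> eprod l = eprod l' \<longrightarrow>
     ar (ev l) (ev l') K"
proof -
  let ?T = "{l. (\<forall>g\<in>set l. ewf g \<and> \<bar>coef g\<bar> \<le> C) \<and> length l \<le> M}"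
  have "finite (ev ` ?T)" "ev ` ?T \<subseteq> words d" using finite_elem_lists ev_words by blast+
  from ar_finite[OF this] obtain K where K: "\<And>u v. u \<in> ev ` ?T \<Longrightarrow> v \<in> ev ` ?T \<Longrightarrow> val u = val v \<Longrightarrow> ar u v K" by blast
  show ?thesis
  proof (intro exI[of _ K] allI impI)
    fix l l' assume *: "\<forall>g\<in>set l \<union> set l'. ewf g \<and> \<bar>coef g\<bar> \<le> C" "length l \<le> M" "length l' \<le> M" "eprod l = eprod l'"
    hence "l \<in> ?T" "l' \<in> ?T" by auto
    thus "ar (ev l) (ev l') K" using * val_ev_eq[of l l'] by (intro K) auto
  qed
qed

text \<open>One constant for the Steinberg relations and for the short relations with coefficients
  at most 1, such as removing \<open>eh i j 0\<close> or writing one sign change as a product of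
  two.\<close>

definition KB :: nat where
  "KB = CS + (SOME K. \<forall>l l'. (\<forall>g\<in>set l \<union> set l'. ewf g \<and> \<bar>coef g\<bar> \<le> 1) \<longrightarrow> length l \<le> 2 \<longrightarrow> length l' \<le> 2 \<longrightarrow> eprod l = eprod l' \<longrightarrow>
     ar (ev l) (ev l') K)"

lemma KB:
  assumes "\<And>g. g \<in> set l \<union> set l' \<Longrightarrow> ewf g \<and> \<bar>coef g\<bar> \<le> 1" "length l \<le> 2" "length l' \<le> 2" "eprod l = eprod l'"
  shows "ar (ev l) (ev l') KB"
  using someI_ex[OF bounded_relations[of 1 2]] assms ar_mono unfolding KB_def by (meson le_add2)

abbreviation Z :: "nat \<Rightarrow> nat" where "Z L \<equiv> KB * Q L"

lemma CS_le_Z: "CS * Q L \<le> Z L"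
  by (rule mult_le_mono1) (simp add: KB_def)

lemma KB_le_Z: "KB \<le> Z L"
  by (simp add: power2_eq_square)

lemma eh_zero: "rt i j \<Longrightarrow> ar (eh i j 0) [] (Z L)"
  using KB[of "[EL i j 0]" "[]"] ar_mono[OF _ KB_le_Z] by simp

lemma eh_commuteZ:
  "rt i j \<Longrightarrow> rt k l \<Longrightarrow> i \<noteq> l \<Longrightarrow> j \<noteq> k \<Longrightarrow> \<bar>x\<bar> \<le> 2 ^ L \<Longrightarrow> \<bar>y\<bar> \<le> 2 ^ L \<Longrightarrow> ar (eh i j x @ eh k l y) (eh k l y @ eh i j x) (Z L)"
  using eh_commute ar_mono CS_le_Z by blast

lemma eh_addZ:
  "rt i j \<Longrightarrow> \<bar>x\<bar> \<le> 2 ^ L \<Longrightarrow> \<bar>y\<bar> \<le> 2 ^ L \<Longrightarrow> \<bar>x + y\<bar> \<le> 2 ^ L \<Longrightarrow> ar (eh i j x @ eh i j y) (eh i j (x + y)) (Z L)"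
  using eh_add ar_mono CS_le_Z by blast

lemma eh_commutatorZ:
  "rt i j \<Longrightarrow> rt j k \<Longrightarrow> i \<noteq> k \<Longrightarrow> \<bar>x\<bar> \<le> 2 ^ L \<Longrightarrow> \<bar>y\<bar> \<le> 2 ^ L \<Longrightarrow> \<bar>x * y\<bar> \<le> 2 ^ L \<Longrightarrow>
     ar (eh i j x @ eh j k y) (eh i k (x * y) @ eh j k y @ eh i j x) (Z L)"
  using eh_commutator ar_mono CS_le_Z by blast

lemma eh_inverse:
  assumes "rt i j" "\<bar>x\<bar> \<le> 2 ^ L"
  shows "ar (eh i j x @ eh i j (- x)) [] (2 * Z L)" "ar (eh i j (- x) @ eh i j x) [] (2 * Z L)"
proof -
  have "ar (eh i j x @ eh i j (- x)) (eh i j 0) (Z L)" "ar (eh i j (- x) @ eh i j x) (eh i j 0) (Z L)"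
    using eh_addZ[OF assms, of "- x"] eh_addZ[OF assms(1), of "- x" L x] assms(2) by simp_all
  from this[THEN ar_trans, OF eh_zero[OF assms(1)]]
  show "ar (eh i j x @ eh i j (- x)) [] (2 * Z L)" "ar (eh i j (- x) @ eh i j x) [] (2 * Z L)"
    unfolding mult_2 by blast+
qed

lemma ar_context: "ar u v k \<Longrightarrow> a \<in> words d \<Longrightarrow> b \<in> words d \<Longrightarrow> ar (a @ u @ b) (a @ v @ b) k"
  by (intro ar_appendL ar_appendR)

text \<open>
  The Weyl element \<open>a b a\<close> acting on the plane spanned by the root subgroups \<open>X\<close>, \<open>Y\<close>.
\<close>

lemma weyl_abstract:
  assumes "\<And>x. \<bar>x\<bar> \<le> (2::int) ^ L \<Longrightarrow> ar (a @ X x) (X x @ a) c" "\<And>x. \<bar>x\<bar> \<le> (2::int) ^ L \<Longrightarrow> ar (b @ Y x) (Y x @ b) c"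
    "\<And>x. \<bar>x\<bar> \<le> (2::int) ^ L \<Longrightarrow> ar (b @ X x) (Y (- x) @ X x @ b) c" "\<And>x. \<bar>x\<bar> \<le> (2::int) ^ L \<Longrightarrow> ar (a @ Y x) (X x @ Y x @ a) c"
    "\<And>x y. \<bar>x\<bar> \<le> (2::int) ^ L \<Longrightarrow> \<bar>y\<bar> \<le> (2::int) ^ L \<Longrightarrow> ar (X x @ Y y) (Y y @ X x) c"
    "\<And>x. \<bar>x\<bar> \<le> (2::int) ^ L \<Longrightarrow> ar (X (- x) @ X x) [] c" "\<And>x. \<bar>x\<bar> \<le> (2::int) ^ L \<Longrightarrow> ar (Y (- x) @ Y x) [] c"
    "a \<in> words d" "b \<in> words d" "\<And>x. X x \<in> words d" "\<And>x. Y x \<in> words d" "\<bar>x\<bar> \<le> 2 ^ L"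
  shows "ar ((a @ b @ a) @ X x) (Y (- x) @ (a @ b @ a)) (6 * c) \<and> ar ((a @ b @ a) @ Y x) (X x @ (a @ b @ a)) (6 * c)"
proof (rule conjI)
  note w = assms(8-11)
  have m: "\<bar>- x\<bar> \<le> 2 ^ L" using assms(12) by simp
  note x = assms(12)
  have "ar (a @ b @ a @ X x) (a @ b @ X x @ a) c"
    using ar_context[OF assms(1)[OF x], of "a @ b" "[]"] w by simp
  also have "ar \<dots> (a @ Y (- x) @ X x @ b @ a) c"
    using ar_context[OF assms(3)[OF x], of "a" "a"] w by simp
  also have "ar \<dots> (X (- x) @ Y (- x) @ a @ X x @ b @ a) c"
    using ar_context[OF assms(4)[OF m], of "[]" "X x @ b @ a"] w by simp
  also have "ar \<dots> (X (- x) @ Y (- x) @ X x @ a @ b @ a) c"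
    using ar_context[OF assms(1)[OF x], of "X (- x) @ Y (- x)" "b @ a"] w by simp
  also have "ar \<dots> (X (- x) @ X x @ Y (- x) @ a @ b @ a) c"
    using ar_context[OF ar_sym[OF assms(5)[OF x m]], of "X (- x)" "a @ b @ a"] w by simp
  also have "ar \<dots> (Y (- x) @ a @ b @ a) c"
    using ar_context[OF assms(6)[OF x], of "[]" "Y (- x) @ a @ b @ a"] w by simp
  finally show "ar ((a @ b @ a) @ X x) (Y (- x) @ (a @ b @ a)) (6 * c)" by (auto elim!: ar_mono)
  have "ar (a @ b @ a @ Y x) (a @ b @ X x @ Y x @ a) c"
    using ar_context[OF assms(4)[OF x], of "a @ b" "[]"] w by simp
  also have "ar \<dots> (a @ Y (- x) @ X x @ b @ Y x @ a) c"
    using ar_context[OF assms(3)[OF x], of "a" "Y x @ a"] w by simp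
  also have "ar \<dots> (a @ Y (- x) @ X x @ Y x @ b @ a) c"
    using ar_context[OF assms(2)[OF x], of "a @ Y (- x) @ X x" "a"] w by simp
  also have "ar \<dots> (a @ Y (- x) @ Y x @ X x @ b @ a) c"
    using ar_context[OF assms(5)[OF x x], of "a @ Y (- x)" "b @ a"] w by simp
  also have "ar \<dots> (a @ X x @ b @ a) c"
    using ar_context[OF assms(7)[OF x], of "a" "X x @ b @ a"] w by simp
  also have "ar \<dots> (X x @ a @ b @ a) c"
    using ar_context[OF assms(1)[OF x], of "[]" "b @ a"] w by simp
  finally show "ar ((a @ b @ a) @ Y x) (X x @ (a @ b @ a)) (6 * c)" by (auto elim!: ar_mono)
qed

text \<open>The Weyl element exchanges the two roots of column l and introduces a sign in one
  direction; its square therefore negates both.\<close>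

lemma tau_col:
  assumes "rt i j" "rt i l" "rt j l" "\<bar>x\<bar> \<le> 2 ^ L"
  shows "ar (tau i j @ eh i l x) (eh i l (- x) @ tau i j) (24 * Z L)" "ar (tau i j @ eh j l x) (eh j l (- x) @ tau i j) (24 * Z L)"
proof -
  let ?a = "eh i j 1" and ?b = "eh j i (-1)" and ?X = "eh i l" and ?Y = "eh j l"
  let ?w = "?a @ ?b @ ?a"
  have ij: "i < n" "j < n" "i \<noteq> j" "l < n" "i \<noteq> l" "j \<noteq> l" using assms by (auto simp: rt_def)
  have w: "eh i j y \<in> words d" "eh j i y \<in> words d" "?X y \<in> words d" "?Y y \<in> words d" for y
    using eh_words assms rt_sym by blast+
  have W: "ar (?w @ ?X x) (?Y (- x) @ ?w) (6 * (2 * Z L)) \<and> ar (?w @ ?Y x) (?X x @ ?w) (6 * (2 * Z L))" if "\<bar>x\<bar> \<le> 2 ^ L" for x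
  proof (rule weyl_abstract[where L = L and X = ?X and Y = ?Y and x = x]; (rule w that)?)
    fix x y :: int assume x: "\<bar>x\<bar> \<le> 2 ^ L"
    show "ar (?a @ ?X x) (?X x @ ?a) (2 * Z L)"
      by (rule ar_mono[OF eh_commuteZ[where L = L]]) (use ij x assms in \<open>auto simp: rt_def\<close>)
    show "ar (?b @ ?Y x) (?Y x @ ?b) (2 * Z L)"
      by (rule ar_mono[OF eh_commuteZ[where L = L]]) (use ij x assms in \<open>auto simp: rt_def\<close>)
    show "ar (?b @ ?X x) (?Y (- x) @ ?X x @ ?b) (2 * Z L)"
      using ar_mono[OF eh_commutatorZ[of j i l "-1" L x], of "2 * Z L"] ij x assms by (auto simp: rt_def)
    show "ar (?a @ ?Y x) (?X x @ ?Y x @ ?a) (2 * Z L)"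
      using ar_mono[OF eh_commutatorZ[of i j l 1 L x], of "2 * Z L"] ij x assms by (auto simp: rt_def)
    show "ar (?X (- x) @ ?X x) [] (2 * Z L)" "ar (?Y (- x) @ ?Y x) [] (2 * Z L)"
      using eh_inverse x assms by blast+
    assume y: "\<bar>y\<bar> \<le> 2 ^ L"
    show "ar (?X x @ ?Y y) (?Y y @ ?X x) (2 * Z L)"
      by (rule ar_mono[OF eh_commuteZ[where L = L]]) (use ij x y assms in \<open>auto simp: rt_def\<close>)
  qed
  note * = W[THEN conjunct1] W[THEN conjunct2]
  have m: "\<bar>- x\<bar> \<le> 2 ^ L" using assms(4) by simp
  have ww: "?w \<in> words d" using w by simp
  have "ar (?w @ (?w @ ?X x)) (?w @ (?Y (- x) @ ?w)) (12 * Z L)"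
    using ar_appendL[OF *(1)[OF assms(4)] ww] by simp
  also have "ar \<dots> ((?X (- x) @ ?w) @ ?w) (12 * Z L)"
    using ar_appendR[OF *(2)[OF m] ww] by simp
  finally show "ar (tau i j @ eh i l x) (eh i l (- x) @ tau i j) (24 * Z L)" unfolding tau_def by (auto elim!: ar_mono)
  have "ar (?w @ (?w @ ?Y x)) (?w @ (?X x @ ?w)) (12 * Z L)"
    using ar_appendL[OF *(2)[OF assms(4)] ww] by simp
  also have "ar \<dots> ((?Y (- x) @ ?w) @ ?w) (12 * Z L)"
    using ar_appendR[OF *(1)[OF assms(4)] ww] by simp
  finally show "ar (tau i j @ eh j l x) (eh j l (- x) @ tau i j) (24 * Z L)" unfolding tau_def by (auto elim!: ar_mono)
qed

lemma eh_commutator_rev: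
  assumes "rt k i" "rt i j" "k \<noteq> j" "\<bar>x\<bar> \<le> 2 ^ L" "\<bar>c\<bar> \<le> 2 ^ L" "\<bar>x * c\<bar> \<le> 2 ^ L"
  shows "ar (eh i j c @ eh k i x) (eh k j (- (x * c)) @ eh k i x @ eh i j c) (3 * Z L)"
proof -
  have w: "eh k j y \<in> words d" "eh k i y \<in> words d" "eh i j y \<in> words d" for y
    using eh_words assms by (auto simp: rt_def)
  have kj: "rt k j" using assms by (auto simp: rt_def)
  have "ar (eh k j (- (x * c)) @ eh k i x @ eh i j c) (eh k j (- (x * c)) @ eh k j (x * c) @ eh i j c @ eh k i x) (Z L)"
    using ar_appendL[OF eh_commutatorZ[OF assms], of "eh k j (- (x * c))"] w by simp
  also have "ar \<dots> (eh i j c @ eh k i x) (2 * Z L)"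
    using ar_appendR[OF eh_inverse(2)[OF kj assms(6)], of "eh i j c @ eh k i x"] w by simp
  finally show ?thesis using ar_sym by (auto elim!: ar_mono)
qed

lemma tau_row:
  assumes "rt i j" "rt k i" "rt k j" "\<bar>x\<bar> \<le> 2 ^ L"
  shows "ar (tau i j @ eh k i x) (eh k i (- x) @ tau i j) (36 * Z L)" "ar (tau i j @ eh k j x) (eh k j (- x) @ tau i j) (36 * Z L)"
proof -
  \<comment> \<open>The sign in \<open>?Y\<close> turns the row relations into the pattern of
    \<open>weyl_abstract\<close>.\<close>
  let ?a = "eh i j 1" and ?b = "eh j i (-1)" and ?X = "eh k j" and ?Y = "\<lambda>y. eh k i (- y)"
  let ?w = "?a @ ?b @ ?a"
  have ij: "i < n" "j < n" "i \<noteq> j" "k < n" "i \<noteq> k" "j \<noteq> k" using assms by (auto simp: rt_def)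
  have w: "eh i j y \<in> words d" "eh j i y \<in> words d" "?X y \<in> words d" "?Y y \<in> words d" for y
    using eh_words assms rt_sym by blast+
  have W: "ar (?w @ ?X x) (?Y (- x) @ ?w) (6 * (3 * Z L)) \<and> ar (?w @ ?Y x) (?X x @ ?w) (6 * (3 * Z L))" if "\<bar>x\<bar> \<le> 2 ^ L" for x
  proof (rule weyl_abstract[where L = L and X = ?X and Y = ?Y and x = x]; (rule w that)?)
    fix x y :: int assume x: "\<bar>x\<bar> \<le> 2 ^ L"
    show "ar (?a @ ?X x) (?X x @ ?a) (3 * Z L)"
      by (rule ar_mono[OF eh_commuteZ[where L = L]]) (use ij x assms in \<open>auto simp: rt_def\<close>)
    show "ar (?b @ ?Y x) (?Y x @ ?b) (3 * Z L)"
      by (rule ar_mono[OF eh_commuteZ[where L = L]]) (use ij x assms in \<open>auto simp: rt_def\<close>)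
    show "ar (?b @ ?X x) (?Y (- x) @ ?X x @ ?b) (3 * Z L)"
      using eh_commutator_rev[of k j i x L "-1"] ij x assms by (auto simp: rt_def)
    show "ar (?a @ ?Y x) (?X x @ ?Y x @ ?a) (3 * Z L)"
      using eh_commutator_rev[of k i j "- x" L 1] ij x assms by (auto simp: rt_def)
    show "ar (?X (- x) @ ?X x) [] (3 * Z L)" "ar (?Y (- x) @ ?Y x) [] (3 * Z L)"
      using ar_mono[OF eh_inverse(2)[of k j x L]] ar_mono[OF eh_inverse(1)[of k i x L]] x assms by simp_all
    assume y: "\<bar>y\<bar> \<le> 2 ^ L"
    show "ar (?X x @ ?Y y) (?Y y @ ?X x) (3 * Z L)"
      by (rule ar_mono[OF eh_commuteZ[where L = L]]) (use ij x y assms in \<open>auto simp: rt_def\<close>)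
  qed
  note * = W[THEN conjunct1] W[THEN conjunct2]
  have m: "\<bar>- x\<bar> \<le> 2 ^ L" using assms(4) by simp
  have ww: "?w \<in> words d" using w by simp
  have "ar (?w @ (?w @ ?X x)) (?w @ (?Y (- x) @ ?w)) (18 * Z L)"
    using ar_appendL[OF *(1)[OF assms(4)] ww] by simp
  also have "ar \<dots> ((?X (- x) @ ?w) @ ?w) (18 * Z L)"
    using ar_appendR[OF *(2)[OF m] ww] by simp
  finally show "ar (tau i j @ eh k j x) (eh k j (- x) @ tau i j) (36 * Z L)" unfolding tau_def by (auto elim!: ar_mono)
  have "ar (?w @ (?w @ ?Y (- x))) (?w @ (?X (- x) @ ?w)) (18 * Z L)"
    using ar_appendL[OF *(2)[OF m] ww] by simp
  also have "ar \<dots> ((?Y x @ ?w) @ ?w) (18 * Z L)"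
    using ar_appendR[OF *(1)[OF m] ww] by simp
  finally show "ar (tau i j @ eh k i x) (eh k i (- x) @ tau i j) (36 * Z L)" unfolding tau_def by (auto elim!: ar_mono)
qed

definition sgn_at :: "nat \<Rightarrow> nat \<Rightarrow> nat \<Rightarrow> int" where
  "sgn_at i j k = (if k \<in> {i, j} then -1 else 1)"

lemma tau_disjoint:
  assumes "rt i j" "rt k l" "{i, j} \<inter> {k, l} = {}" "\<bar>x\<bar> \<le> 2 ^ L"
  shows "ar (tau i j @ eh k l x) (eh k l x @ tau i j) (6 * Z L)"
proof -
  let ?a = "eh i j 1" and ?b = "eh j i (-1)" and ?X = "eh k l x"
  have w: "?a \<in> words d" "?b \<in> words d" "?X \<in> words d" using eh_words assms rt_sym by blast+
  have a: "ar (?a @ ?X) (?X @ ?a) (Z L)" by (rule eh_commuteZ) (use assms in auto)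
  have b: "ar (?b @ ?X) (?X @ ?b) (Z L)" by (rule eh_commuteZ) (use assms rt_sym in auto)
  have s: "ar (u @ (v @ ?X)) (?X @ (u @ v)) (c + Z L)" if "ar (u @ ?X) (?X @ u) (Z L)" "ar (v @ ?X) (?X @ v) c" "u \<in> words d" "v \<in> words d" for u v c
  proof -
    have "ar (u @ (v @ ?X)) (u @ ?X @ v) c" by (rule ar_appendL[OF that(2,3)])
    also have "ar \<dots> (?X @ (u @ v)) (Z L)" using ar_appendR[OF that(1,4)] by simp
    finally show ?thesis .
  qed
  have 1: "ar (?b @ ?a @ ?X) (?X @ ?b @ ?a) (Z L + Z L)" by (rule s[OF b a w(2,1)])
  have 2: "ar (?a @ (?b @ ?a) @ ?X) (?X @ ?a @ ?b @ ?a) (Z L + Z L + Z L)"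
    by (rule s[OF a]) (use 1 w in simp_all)
  have "ar ((?a @ ?b @ ?a) @ (?a @ ?b @ ?a) @ ?X) ((?a @ ?b @ ?a) @ ?X @ (?a @ ?b @ ?a)) (Z L + Z L + Z L)"
    using ar_appendL[OF 2, of "?a @ ?b @ ?a"] w by simp
  also have "ar \<dots> (?X @ (?a @ ?b @ ?a) @ (?a @ ?b @ ?a)) (Z L + Z L + Z L)"
    using ar_appendR[OF 2, of "?a @ ?b @ ?a"] w by simp
  finally show ?thesis unfolding tau_def by (auto elim!: ar_mono)
qed

lemma tau_eh:
  assumes "rt i j" "rt k l" "\<bar>x\<bar> \<le> 2 ^ L"
  shows "ar (tau i j @ eh k l x) (eh k l (sgn_at i j k * sgn_at i j l * x) @ tau i j) (74 * Z L)"
proof -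
  have kl: "k \<noteq> l" "i \<noteq> j" using assms by (auto simp: rt_def)
  consider "{i, j} \<inter> {k, l} = {}" | "k = i" "l \<noteq> j" | "k = j" "l \<noteq> i" | "l = i" "k \<noteq> j" | "l = j" "k \<noteq> i" | "{i, j} = {k, l}"
    using kl by blast
  thus ?thesis
  proof cases
    case 1
    thus ?thesis using ar_mono[OF tau_disjoint[OF assms(1,2) _ assms(3)], of "74 * Z L"] by (auto simp: sgn_at_def)
  next
    case 2
    thus ?thesis using ar_mono[OF tau_col(1)[OF assms(1) _ _ assms(3), of l], of "74 * Z L"] assms kl by (auto simp: sgn_at_def rt_def)
  next
    case 3
    thus ?thesis using ar_mono[OF tau_col(2)[OF assms(1) _ _ assms(3), of l], of "74 * Z L"] assms kl by (auto simp: sgn_at_def rt_def)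
  next
    case 4
    thus ?thesis using ar_mono[OF tau_row(1)[OF assms(1) _ _ assms(3), of k], of "74 * Z L"] assms kl by (auto simp: sgn_at_def rt_def)
  next
    case 5
    thus ?thesis using ar_mono[OF tau_row(2)[OF assms(1) _ _ assms(3), of k], of "74 * Z L"] assms kl by (auto simp: sgn_at_def rt_def)
  next
    case 6
    \<comment> \<open>A factor of \<open>tau i j\<close> is opposite to the root here, where no
      Steinberg relation applies. Through a third index m the sign change becomes a product of two,
      each of which shares one index with the root.\<close>
    have "card {k, l} < n" using n5 by (simp add: card_insert_if)
    then obtain m where m: "m < n" "m \<notin> {k, l}" using fresh[of "{k, l}"] by auto
    have r: "rt k m" "rt m l" "rt k l" using m assms by (auto simp: rt_def)
    have w: "tau k m \<in> words d" "tau m l \<in> words d" "eh k l y \<in> words d" for y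
      using eword_words[of "SG k m"] eword_words[of "SG m l"] eh_words r by auto
    have "i = k \<and> j = l \<or> i = l \<and> j = k" using 6 by (auto simp: doubleton_eq_iff)
    moreover have "Sg k l = Sg k m \<circ> Sg m l" "Sg l k = Sg k m \<circ> Sg m l" using m kl by (intro ext; simp add: Sg_def)+
    ultimately have "Sg i j = Sg k m \<circ> Sg m l" by metis
    hence "ar (ev [SG i j]) (ev [SG k m, SG m l]) KB"
      by (intro KB) (use r assms in auto)
    hence c: "ar (tau i j) (tau k m @ tau m l) (Z L)" using ar_mono[OF _ KB_le_Z] by simp
    have "ar (tau i j @ eh k l x) (tau k m @ tau m l @ eh k l x) (Z L)" using ar_appendR[OF c w(3)] by simp
    also have "ar \<dots> (tau k m @ eh k l (- x) @ tau m l) (36 * Z L)"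
      using ar_appendL[OF tau_row(2)[OF r(2) _ r(3) assms(3)] w(1)] r rt_sym by simp
    also have "ar \<dots> (eh k l x @ tau k m @ tau m l) (24 * Z L)"
      using ar_appendR[OF tau_col(1)[OF r(1) r(3) _ , of "- x" L] w(2)] r assms(3) rt_sym by simp
    also have "ar \<dots> (eh k l x @ tau i j) (Z L)" using ar_appendL[OF ar_sym[OF c] w(3)] by simp
    finally have "ar (tau i j @ eh k l x) (eh k l x @ tau i j) (Z L + 36 * Z L + 24 * Z L + Z L)" .
    moreover have "sgn_at i j k * sgn_at i j l * x = x" using 6 by (auto simp: sgn_at_def)
    ultimately show ?thesis by (auto elim!: ar_mono)
  qed
qed

end

section \<open>Values are invariant under relators\<close>

context SL_presentation
begin

lemma val_relator:
  assumes "r \<in> R"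
  shows "val r = 1\<^sub>m n"
proof -
  interpret F: group "free_group d" by (rule group_free_group)
  have r: "r \<in> words d" using assms R_words by blast
  hence c: "reduced_form r \<in> carrier (free_group d)"
    by (auto simp: free_group_def reduced_reduced_form reduced_form_words)
  have "\<one>\<^bsub>free_group d\<^esub> \<otimes>\<^bsub>free_group d\<^esub> reduced_form r \<otimes>\<^bsub>free_group d\<^esub> inv\<^bsub>free_group d\<^esub> \<one>\<^bsub>free_group d\<^esub> = reduced_form r"
    using c by simp
  hence "reduced_form r \<in> {g \<otimes>\<^bsub>free_group d\<^esub> s \<otimes>\<^bsub>free_group d\<^esub> inv\<^bsub>free_group d\<^esub> g | g s. g \<in> carrier (free_group d) \<and> s \<in> reduced_form ` R}"
    using assms F.one_closed by (smt (verit) image_eqI mem_Collect_eq)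
  hence "reduced_form r \<in> normal_closure (free_group d) (reduced_form ` R)"
    unfolding normal_closure_def by (rule generate.incl)
  hence "val (reduced_form r) = 1\<^sub>m n" using fp unfolding finite_presentation_def by auto
  thus ?thesis using word_value_reduced_form[of "SL_int n" d h r] fp r by (simp add: finite_presentation_def)
qed

lemma val_cancel: "index x < d \<Longrightarrow> val [x, inv_letter x] = 1\<^sub>m n"
  using word_value_reduced_form[of "SL_int n" d h "[x, inv_letter x]"] fp
  by (simp add: finite_presentation_def reduced_form_def)

lemma transforms_val:
  assumes "transforms d R v w k" "v \<in> words d"
  shows "w \<in> words d \<and> val w = val v"
  using assms
proof (induction rule: transforms.induct)
  case (expansion u w k x)
  hence "u \<in> words d" "w \<in> words d" "[x, inv_letter x] \<in> words d" by auto
  thus ?case using expansion val_cancel[of x] val_closed[of w] SL_one(1)[of "val w"] by (simp only: val_append words_simps)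
next
  case (reduction u x w k)
  hence "u \<in> words d" "w \<in> words d" "[x, inv_letter x] \<in> words d" "index x < d" by auto
  thus ?case using reduction val_cancel[of x] val_closed[of w] SL_one(1)[of "val w"] by (simp only: val_append words_simps)
next
  case (insertion u w k r)
  hence "u \<in> words d" "w \<in> words d" "r \<in> words d" using R_words by auto
  thus ?case using insertion val_relator[of r] val_closed[of w] SL_one(1)[of "val w"] by (simp only: val_append words_simps)
next
  case (deletion u r w k)
  hence "u \<in> words d" "w \<in> words d" "r \<in> words d" using R_words by auto
  thus ?case using deletion val_relator[of r] val_closed[of w] SL_one(1)[of "val w"] by (simp only: val_append words_simps)
qed simp

lemma ar_val: "ar u v k \<Longrightarrow> val u = val v"
  unfolding ar_def using transforms_val by metis

text \<open>Rewriting a word preserves its value, so the product of a collected word is known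
  without computing with its letters.\<close>

lemma ar_eprod:
  assumes "ar (ev l) (ev l') k" "\<forall>g\<in>set l. ewf g" "\<forall>g\<in>set l'. ewf g"
  shows "eprod l = eprod l'"
  using ar_val[OF assms(1)] act_val_ev assms(2,3) by metis

subsection \<open>Moving the block-diagonal part to the left\<close>

lemma pow2_double: "\<bar>x\<bar> \<le> (2::int) ^ L \<Longrightarrow> \<bar>x\<bar> \<le> 2 ^ (2 * L)"
proof -
  assume "\<bar>x\<bar> \<le> 2 ^ L"
  also have "(2::int) ^ L \<le> 2 ^ (2 * L)" by (intro power_increasing) auto
  finally show ?thesis .
qed

lemma pow2_mult: "\<bar>x\<bar> \<le> (2::int) ^ L \<Longrightarrow> \<bar>y\<bar> \<le> 2 ^ L \<Longrightarrow> \<bar>x * y\<bar> \<le> 2 ^ (2 * L)"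
  unfolding abs_mult mult_2 power_add by (intro mult_mono) auto

text \<open>Passing an elementary \<open>g\<close> leaves a commutator that is again strictly above
  the blocks and whose coefficient is a product, whence \<open>2 * L\<close>. A sign change only
  alters the sign of the coefficient.\<close>

lemma push1:
  assumes "within_block \<beta> g" "above_block \<beta> u" "ewf g" "ewf u" "\<bar>coef g\<bar> \<le> 2 ^ L" "\<bar>coef u\<bar> \<le> 2 ^ L"
  shows "\<exists>us. (\<forall>a\<in>set us. above_block \<beta> a \<and> ewf a \<and> \<bar>coef a\<bar> \<le> 2 ^ (2 * L) \<and> eidx a \<subseteq> eidx g \<union> eidx u) \<and> length us \<le> 2 \<and>
     ar (eword u @ eword g) (eword g @ ev us) (80 * Z (2 * L))"
proof -
  obtain k l x where u: "u = EL k l x" "\<beta> k < \<beta> l" using assms(2) by (cases u) auto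
  have kl: "rt k l" and x: "\<bar>x\<bar> \<le> 2 ^ L" using assms(4,6) u by auto
  note x2 = pow2_double[OF x]
  show ?thesis
  proof (cases g)
    case (SG i j)
    hence ij: "rt i j" using assms(3) by simp
    let ?s = "sgn_at i j k * sgn_at i j l"
    have s: "?s * (?s * x) = x" "\<bar>?s * x\<bar> = \<bar>x\<bar>" by (auto simp: sgn_at_def)
    have "ar (tau i j @ eh k l (?s * x)) (eh k l x @ tau i j) (74 * Z (2 * L))"
      using tau_eh[OF ij kl, of "?s * x" "2 * L"] x2 unfolding s by simp
    from ar_mono[OF ar_sym[OF this]] show ?thesis using u SG kl x2 s(2) by (intro exI[of _ "[EL k l (?s * x)]"]) auto
  next
    case (EL i j c)
    hence ij: "rt i j" and c: "\<bar>c\<bar> \<le> 2 ^ L" and b: "\<beta> i = \<beta> j" using assms(1,3,5) by auto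
    note c2 = pow2_double[OF c] and xc = pow2_mult[OF x c] and cx = pow2_mult[OF c x]
    have w: "eh i j y \<in> words d" "eh k l y \<in> words d" for y using ij kl eh_words by auto
    consider "j = k" | "l = i" | "i \<noteq> l" "j \<noteq> k" by blast
    thus ?thesis
    proof cases
      case 1
      hence il: "i \<noteq> l" using b u(2) by auto
      hence r: "rt i l" using ij kl by (auto simp: rt_def)
      have w': "eh i l y \<in> words d" for y using r eh_words by auto
      have "ar (eh i l (- (c * x)) @ eh i j c @ eh k l x) (eh i l (- (c * x)) @ eh i l (c * x) @ eh k l x @ eh i j c) (Z (2 * L))"
        using ar_appendL[OF eh_commutatorZ[OF ij _ il c2 x2 cx], of "eh i l (- (c * x))"] kl 1 w' by simp
      also have "ar \<dots> (eh k l x @ eh i j c) (2 * Z (2 * L))"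
        using ar_appendR[OF eh_inverse(2)[OF r cx], of "eh k l x @ eh i j c"] w by simp
      finally have 2: "ar (eh k l x @ eh i j c) (eh i l (- (c * x)) @ eh i j c @ eh k l x) (Z (2 * L) + 2 * Z (2 * L))"
        by (rule ar_sym)
      have "ar (eh i l (- (c * x)) @ eh i j c) (eh i j c @ eh i l (- (c * x))) (Z (2 * L))"
        using cx c2 ij r by (intro eh_commuteZ) (auto simp: rt_def)
      from ar_trans[OF 2 ar_appendR[OF this w(2)[of x], simplified]]
      have "ar (eword u @ eword g) (eword g @ ev [EL i l (- (c * x)), EL k l x]) (80 * Z (2 * L))"
        using u EL by (auto elim!: ar_mono)
      moreover have "\<beta> i < \<beta> l" using 1 b u by simp
      ultimately show ?thesis using EL u r kl cx x2 by (intro exI[of _ "[EL i l (- (c * x)), EL k l x]"]) auto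
    next
      case 2
      hence kj: "k \<noteq> j" using b u(2) by auto
      hence r: "rt k j" using ij kl by (auto simp: rt_def)
      have w': "eh k j y \<in> words d" for y using r eh_words by auto
      have 3: "ar (eh k l x @ eh i j c) (eh k j (x * c) @ eh i j c @ eh k l x) (Z (2 * L))"
        using eh_commutatorZ[of k i j x "2 * L" c] kl ij kj x2 c2 xc 2 by simp
      have "ar (eh k j (x * c) @ eh i j c) (eh i j c @ eh k j (x * c)) (Z (2 * L))"
        using xc c2 ij r by (intro eh_commuteZ) (auto simp: rt_def)
      from ar_trans[OF 3 ar_appendR[OF this w(2)[of x], simplified]]
      have "ar (eword u @ eword g) (eword g @ ev [EL k j (x * c), EL k l x]) (80 * Z (2 * L))"
        using u EL by (auto elim!: ar_mono)
      moreover have "\<beta> k < \<beta> j" using 2 b u by simp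
      ultimately show ?thesis using EL u r kl xc x2 by (intro exI[of _ "[EL k j (x * c), EL k l x]"]) auto
    next
      case 3
      have "ar (eh k l x @ eh i j c) (eh i j c @ eh k l x) (Z (2 * L))"
        using x2 c2 ij kl 3 by (intro eh_commuteZ) auto
      hence "ar (eword u @ eword g) (eword g @ ev [EL k l x]) (80 * Z (2 * L))"
        using u EL by (auto elim!: ar_mono)
      thus ?thesis using EL u kl x2 by (intro exI[of _ "[EL k l x]"]) auto
    qed
  qed
qed

lemma push_list:
  assumes "within_block \<beta> g" "ewf g" "\<bar>coef g\<bar> \<le> 2 ^ L" "eidx g \<subseteq> S"
    "\<forall>u\<in>set us. above_block \<beta> u \<and> ewf u \<and> \<bar>coef u\<bar> \<le> 2 ^ L \<and> eidx u \<subseteq> S"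
  shows "\<exists>vs. (\<forall>a\<in>set vs. above_block \<beta> a \<and> ewf a \<and> \<bar>coef a\<bar> \<le> 2 ^ (2 * L) \<and> eidx a \<subseteq> S) \<and> length vs \<le> 2 * length us \<and>
     ar (ev us @ eword g) (eword g @ ev vs) (length us * (80 * Z (2 * L)))"
  using assms(5)
proof (induction us)
  case Nil
  thus ?case using eword_words[OF assms(2)] by (intro exI[of _ "[]"]) auto
next
  case (Cons u us)
  then obtain vs where vs: "\<forall>a\<in>set vs. above_block \<beta> a \<and> ewf a \<and> \<bar>coef a\<bar> \<le> 2 ^ (2 * L) \<and> eidx a \<subseteq> S" "length vs \<le> 2 * length us"
     "ar (ev us @ eword g) (eword g @ ev vs) (length us * (80 * Z (2 * L)))" by auto
  obtain ws where ws: "\<forall>a\<in>set ws. above_block \<beta> a \<and> ewf a \<and> \<bar>coef a\<bar> \<le> 2 ^ (2 * L) \<and> eidx a \<subseteq> eidx g \<union> eidx u" "length ws \<le> 2"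
     "ar (eword u @ eword g) (eword g @ ev ws) (80 * Z (2 * L))"
    using push1[of \<beta> g u L] assms Cons.prems by auto
  have w: "eword u \<in> words d" "ev vs \<in> words d" using Cons.prems vs(1) by (auto intro: eword_words ev_words)
  have "ar (ev (u # us) @ eword g) (eword u @ (eword g @ ev vs)) (length us * (80 * Z (2 * L)))"
    using ar_appendL[OF vs(3) w(1)] by simp
  also have "ar \<dots> (eword g @ ev (ws @ vs)) (80 * Z (2 * L))"
    using ar_appendR[OF ws(3) w(2)] by simp
  finally have "ar (ev (u # us) @ eword g) (eword g @ ev (ws @ vs)) (length (u # us) * (80 * Z (2 * L)))"
    by (rule ar_mono) simp
  moreover have "eidx g \<union> eidx u \<subseteq> S" using assms(4) Cons.prems by auto
  ultimately show ?case using vs(1,2) ws(1,2) by (intro exI[of _ "ws @ vs"]) (auto 0 3)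
qed

lemma Z_mono: "L \<le> L' \<Longrightarrow> Z L \<le> Z L'"
  by (intro mult_le_mono2 power_mono) auto

text \<open>Each letter of the diagonal part at most doubles the number of upper letters and the
  exponent of their bound. For words of bounded length these are constant factors.\<close>

lemma push_all:
  assumes "\<forall>g\<in>set l. (within_block \<beta> g \<or> above_block \<beta> g) \<and> ewf g \<and> \<bar>coef g\<bar> \<le> 2 ^ L \<and> eidx g \<subseteq> S"
  shows "\<exists>us. (\<forall>a\<in>set us. above_block \<beta> a \<and> ewf a \<and> \<bar>coef a\<bar> \<le> 2 ^ (2 ^ length l * L) \<and> eidx a \<subseteq> S) \<and> length us < 2 ^ length l \<and>
     ar (ev l) (ev (filter (within_block \<beta>) l) @ ev us) (length l * 2 ^ length l * (80 * Z (2 ^ length l * L)))"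
  using assms
proof (induction l rule: rev_induct)
  case Nil
  show ?case by (intro exI[of _ "[]"]) auto
next
  case (snoc g l)
  let ?k = "length l" and ?F = "filter (within_block \<beta>) l"
  let ?L = "2 ^ ?k * L"
  obtain us where us: "\<forall>a\<in>set us. above_block \<beta> a \<and> ewf a \<and> \<bar>coef a\<bar> \<le> 2 ^ ?L \<and> eidx a \<subseteq> S" "length us < 2 ^ ?k"
    "ar (ev l) (ev ?F @ ev us) (?k * 2 ^ ?k * (80 * Z ?L))" using snoc by auto
  have g: "within_block \<beta> g \<or> above_block \<beta> g" "ewf g" "\<bar>coef g\<bar> \<le> 2 ^ L" "eidx g \<subseteq> S" using snoc.prems by auto
  have LL: "L \<le> ?L" by simp
  have lift: "\<bar>y\<bar> \<le> 2 ^ ?L \<Longrightarrow> \<bar>y\<bar> \<le> (2::int) ^ (2 * ?L)" for y by (rule pow2_double)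
  have "(2::int) ^ L \<le> 2 ^ ?L" by (rule power_increasing[OF LL]) simp
  hence gL: "\<bar>coef g\<bar> \<le> 2 ^ ?L" using g(3) by linarith
  have w: "eword g \<in> words d" "ev ?F \<in> words d" using g snoc.prems by (auto intro!: eword_words ev_words)
  have 1: "ar (ev (l @ [g])) (ev ?F @ ev us @ eword g) (?k * 2 ^ ?k * (80 * Z ?L))"
    using ar_appendR[OF us(3) w(1)] by simp
  have zm: "Z ?L \<le> Z (2 * ?L)" by (rule Z_mono) simp
  have ex: "2 ^ Suc ?k * L = 2 * ?L" "length (l @ [g]) = Suc ?k" by simp_all
  show ?case
  proof (cases "within_block \<beta> g")
    case True
    from push_list[OF True g(2) gL g(4) us(1)] obtain vs where vs:
      "\<forall>a\<in>set vs. above_block \<beta> a \<and> ewf a \<and> \<bar>coef a\<bar> \<le> 2 ^ (2 * ?L) \<and> eidx a \<subseteq> S" "length vs \<le> 2 * length us"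
      "ar (ev us @ eword g) (eword g @ ev vs) (length us * (80 * Z (2 * ?L)))" by blast
    have "ar (ev ?F @ ev us @ eword g) (ev ?F @ eword g @ ev vs) (length us * (80 * Z (2 * ?L)))"
      by (rule ar_appendL[OF vs(3) w(2)])
    from ar_trans[OF 1 this] True have "ar (ev (l @ [g])) (ev (filter (within_block \<beta>) (l @ [g])) @ ev vs) (?k * 2 ^ ?k * (80 * Z ?L) + length us * (80 * Z (2 * ?L)))"
      by simp
    moreover have "?k * 2 ^ ?k * (80 * Z ?L) + length us * (80 * Z (2 * ?L)) \<le> ?k * 2 ^ ?k * (80 * Z (2 * ?L)) + 2 ^ ?k * (80 * Z (2 * ?L))"
      by (intro add_mono mult_le_mono zm order_refl less_imp_le us(2))
    moreover have "\<dots> \<le> Suc ?k * 2 ^ Suc ?k * (80 * Z (2 * ?L))" by (simp add: algebra_simps)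
    ultimately have a: "ar (ev (l @ [g])) (ev (filter (within_block \<beta>) (l @ [g])) @ ev vs) (Suc ?k * 2 ^ Suc ?k * (80 * Z (2 * ?L)))"
      by (meson ar_mono order_trans)
    have len: "length vs < 2 ^ Suc ?k" using vs(2) us(2) by simp
    show ?thesis unfolding ex by (intro exI[of _ vs] conjI vs(1) len a)
  next
    case False
    hence a: "above_block \<beta> g" using g by blast
    have "ar (ev (l @ [g])) (ev (filter (within_block \<beta>) (l @ [g])) @ ev (us @ [g])) (?k * 2 ^ ?k * (80 * Z ?L))"
      using 1 False by simp
    moreover have "?k * 2 ^ ?k * (80 * Z ?L) \<le> Suc ?k * 2 ^ Suc ?k * (80 * Z (2 * ?L))"
      by (intro mult_le_mono zm) auto
    ultimately have 2: "ar (ev (l @ [g])) (ev (filter (within_block \<beta>) (l @ [g])) @ ev (us @ [g])) (Suc ?k * 2 ^ Suc ?k * (80 * Z (2 * ?L)))"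
      by (rule ar_mono)
    have 3: "length (us @ [g]) < 2 ^ Suc ?k" using us(2) by simp
    have 4: "\<forall>b\<in>set (us @ [g]). above_block \<beta> b \<and> ewf b \<and> \<bar>coef b\<bar> \<le> 2 ^ (2 * ?L) \<and> eidx b \<subseteq> S"
      using us(1) lift gL g a by auto
    show ?thesis unfolding ex by (intro exI[of _ "us @ [g]"] conjI 2 3 4)
  qed
qed

lemma Q_scale: "Q (2 ^ M * L + 2 ^ M) \<le> 4 ^ Suc M * Q L"
proof -
  have "1 \<le> (2::nat) ^ M" by simp
  hence "2 ^ M * L + 2 ^ M + 1 \<le> 2 ^ Suc M * (L + 1)" by (simp only: power_Suc distrib_left mult.assoc mult_1_right)
  hence "Q (2 ^ M * L + 2 ^ M) \<le> (2 ^ Suc M * (L + 1))\<^sup>2" by (rule power_mono) simp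
  also have "\<dots> = (2\<^sup>2) ^ Suc M * Q L" by (simp only: power_mult_distrib power_mult[symmetric] mult.commute[of 2])
  also have "\<dots> = 4 ^ Suc M * Q L" by simp
  finally show ?thesis .
qed

lemma push_bounded:
  assumes "\<forall>g\<in>set l. (within_block \<beta> g \<or> above_block \<beta> g) \<and> ewf g \<and> \<bar>coef g\<bar> \<le> 2 ^ L \<and> eidx g \<subseteq> S" "length l \<le> M"
  shows "\<exists>us. (\<forall>a\<in>set us. above_block \<beta> a \<and> ewf a \<and> \<bar>coef a\<bar> \<le> 2 ^ (2 ^ M * L) \<and> eidx a \<subseteq> S) \<and> length us \<le> 2 ^ M \<and>
     ar (ev l) (ev (filter (within_block \<beta>) l) @ ev us) (M * 2 ^ M * 80 * KB * 4 ^ Suc M * Q L)"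
proof -
  let ?k = "length l"
  have p: "(2::nat) ^ ?k \<le> 2 ^ M" using assms(2) by (intro power_increasing) auto
  obtain us where us: "\<forall>a\<in>set us. above_block \<beta> a \<and> ewf a \<and> \<bar>coef a\<bar> \<le> 2 ^ (2 ^ ?k * L) \<and> eidx a \<subseteq> S" "length us < 2 ^ ?k"
     "ar (ev l) (ev (filter (within_block \<beta>) l) @ ev us) (?k * 2 ^ ?k * (80 * Z (2 ^ ?k * L)))"
    using push_all[OF assms(1)] by blast
  have "?k * 2 ^ ?k * (80 * Z (2 ^ ?k * L)) \<le> M * 2 ^ M * (80 * Z (2 ^ M * L + 2 ^ M))"
  proof -
    have "2 ^ ?k * L \<le> 2 ^ M * L + 2 ^ M" using mult_le_mono1[OF p, of L] by linarith
    from mult_le_mono[OF mult_le_mono[OF assms(2) p] mult_le_mono2[OF Z_mono[OF this]]] show ?thesis .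
  qed
  also have "\<dots> \<le> M * 2 ^ M * (80 * (KB * (4 ^ Suc M * Q L)))"
    by (intro mult_le_mono order_refl Q_scale)
  also have "\<dots> = M * 2 ^ M * 80 * KB * 4 ^ Suc M * Q L" by (simp only: mult.assoc)
  finally have "ar (ev l) (ev (filter (within_block \<beta>) l) @ ev us) (M * 2 ^ M * 80 * KB * 4 ^ Suc M * Q L)"
    by (rule ar_mono[OF us(3)])
  moreover have "\<bar>y\<bar> \<le> 2 ^ (2 ^ M * L)" if "\<bar>y\<bar> \<le> 2 ^ (2 ^ ?k * L)" for y :: int
  proof -
    have "(2::int) ^ (2 ^ ?k * L) \<le> 2 ^ (2 ^ M * L)" using p by (intro power_increasing mult_le_mono) auto
    thus ?thesis using that by linarith
  qed
  moreover have "length us \<le> 2 ^ M" using us(2) p by linarith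
  ultimately show ?thesis using us(1) by (intro exI[of _ us]) auto
qed

subsection \<open>Unipotent words\<close>

lemma column_insert:
  assumes "distinct ks" "\<forall>k\<in>set ks. rt k c" "i \<in> set ks" "\<bar>x\<bar> \<le> 2 ^ L" "\<forall>k. \<bar>s k\<bar> \<le> 2 ^ L" "\<bar>x + s i\<bar> \<le> 2 ^ L"
  shows "ar (eh i c x @ ev (map (\<lambda>k. EL k c (s k)) ks)) (ev (map (\<lambda>k. EL k c ((s(i := x + s i)) k)) ks)) (length ks * Z L)"
  using assms(1-3)
proof (induction ks)
  case (Cons k ks)
  have w: "ev (map (\<lambda>k. EL k c (f k)) ks) \<in> words d" for f using Cons.prems by (intro ev_words) auto
  show ?case
  proof (cases "k = i")
    case True
    have eqm: "map (\<lambda>k. EL k c ((s(i := x + s i)) k)) ks = map (\<lambda>k. EL k c (s k)) ks"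
      using Cons.prems True by (intro map_cong) auto
    have "ar (eh i c x @ eh i c (s i)) (eh i c (x + s i)) (Z L)"
      using Cons.prems True assms by (intro eh_addZ) auto
    from ar_appendR[OF this w[of s]]
    have "ar (eh i c x @ ev (map (\<lambda>k. EL k c (s k)) (k # ks))) (ev (map (\<lambda>k. EL k c ((s(i := x + s i)) k)) (k # ks))) (Z L)"
      unfolding list.map eqm using True by simp
    thus ?thesis by (rule ar_mono) simp
  next
    case False
    hence i: "i \<in> set ks" using Cons.prems by auto
    have r: "rt i c" "rt k c" using Cons.prems i by auto
    have "ar (eh i c x @ eh k c (s k)) (eh k c (s k) @ eh i c x) (Z L)"
      using r assms by (intro eh_commuteZ) (auto simp: rt_def)
    from ar_appendR[OF this w[of s]]
    have "ar (eh i c x @ ev (map (\<lambda>k. EL k c (s k)) (k # ks))) (eh k c (s k) @ eh i c x @ ev (map (\<lambda>k. EL k c (s k)) ks)) (Z L)" by simp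
    also have "ar \<dots> (eh k c (s k) @ ev (map (\<lambda>k. EL k c ((s(i := x + s i)) k)) ks)) (length ks * Z L)"
      using Cons i r by (intro ar_appendL Cons.IH eh_words) auto
    finally show ?thesis using False by (auto elim!: ar_mono)
  qed
qed simp

lemma column_zero:
  assumes "\<forall>k\<in>set ks. rt k c"
  shows "ar (ev (map (\<lambda>k. EL k c 0) ks)) [] (length ks * Z L)"
  using assms
proof (induction ks)
  case (Cons k ks)
  have "ar (eh k c 0 @ ev (map (\<lambda>k. EL k c 0) ks)) ([] @ []) (Z L + length ks * Z L)"
    using Cons by (intro ar_append eh_zero) auto
  thus ?case by simp
qed simp

lemma eprod_column:
  assumes "c \<notin> set ks" "distinct ks"
  shows "eprod (map (\<lambda>k. EL k c (s k)) ks) v i = (if i \<in> set ks then v i + s i * v c else v i)"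
  using assms by (induction ks arbitrary: i) (auto simp: E_def)

text \<open>Elementary matrices in one column commute, so the word is collected into one letter per
  row; its coefficients vanish as the product is trivial. At most M summands of size 2^L stay below
  2^(L+M).\<close>

lemma column_fill:
  assumes "c < n" "\<forall>g\<in>set l. \<exists>k<c. \<exists>x. g = EL k c x \<and> \<bar>x\<bar> \<le> 2 ^ L" "length l \<le> M" "eprod l = id"
  shows "ar (ev l) [] ((M + 2) * n * Z (L + M))"
proof -
  let ?w = "\<lambda>s. map (\<lambda>k. EL k c (s k)) [0..<c]"
  let ?L = "L + M"
  have r: "rt k c" if "k < c" for k using that assms(1) by (simp add: rt_def)
  have "\<exists>s. (\<forall>k. \<bar>s k\<bar> \<le> int (length l) * 2 ^ L) \<and> ar (ev l) (ev (?w s)) ((length l + 1) * n * Z ?L)"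
    using assms(2,3)
  proof (induction l)
    case Nil
    have 1: "ar (ev (?w (\<lambda>_. 0))) [] (length [0..<c] * Z ?L)" by (rule column_zero) (auto intro: r)
    have "length [0..<c] * Z ?L \<le> (length [] + 1) * n * Z ?L" using assms(1) by simp
    from ar_mono[OF ar_sym[OF 1] this] show ?case by (intro exI[of _ "\<lambda>_. 0"] conjI) auto
  next
    case (Cons g l)
    then obtain s where s: "\<forall>k. \<bar>s k\<bar> \<le> int (length l) * 2 ^ L" "ar (ev l) (ev (?w s)) ((length l + 1) * n * Z ?L)" by auto
    obtain i x where g: "g = EL i c x" "i < c" "\<bar>x\<bar> \<le> 2 ^ L" using Cons.prems by auto
    have M: "int (length l) + 1 \<le> 2 ^ M"
    proof -
      have "int (length l) + 1 \<le> int M" using Cons.prems by simp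
      also have "int M \<le> 2 ^ M" by (rule less_imp_le[OF of_nat_less_two_power])
      finally show ?thesis .
    qed
    have b: "\<bar>y\<bar> \<le> 2 ^ ?L" if "\<bar>y\<bar> \<le> (int (length l) + 1) * 2 ^ L" for y
    proof -
      have "(int (length l) + 1) * 2 ^ L \<le> 2 ^ M * 2 ^ L" using M by (intro mult_right_mono) auto
      hence "\<bar>y\<bar> \<le> 2 ^ M * 2 ^ L" using that by linarith
      thus ?thesis by (simp add: power_add mult.commute)
    qed
    have s1: "\<bar>s k\<bar> + 2 ^ L \<le> (int (length l) + 1) * 2 ^ L" for k using s(1) by (simp add: distrib_right)
    have bb: "\<bar>x\<bar> \<le> 2 ^ ?L" "\<forall>k. \<bar>s k\<bar> \<le> 2 ^ ?L" "\<bar>x + s i\<bar> \<le> 2 ^ ?L"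
    proof -
      have p: "(0::int) \<le> 2 ^ L" by simp
      show "\<bar>x\<bar> \<le> 2 ^ ?L" using g(3) s1[of i] by (intro b) linarith
      show "\<forall>k. \<bar>s k\<bar> \<le> 2 ^ ?L"
      proof (intro allI b)
        fix k show "\<bar>s k\<bar> \<le> (int (length l) + 1) * 2 ^ L" using s1[of k] p by linarith
      qed
      show "\<bar>x + s i\<bar> \<le> 2 ^ ?L" using g(3) s1[of i] by (intro b) linarith
    qed
    have "ar (eh i c x @ ev l) (eh i c x @ ev (?w s)) ((length l + 1) * n * Z ?L)"
      using s(2) r[OF g(2)] by (intro ar_appendL eh_words)
    also have "ar \<dots> (ev (?w (s(i := x + s i)))) (length [0..<c] * Z ?L)"
      by (rule column_insert) (use bb g r in auto)
    finally have "ar (ev (g # l)) (ev (?w (s(i := x + s i)))) ((length l + 1) * n * Z ?L + c * Z ?L)" using g by simp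
    moreover have "(length l + 1) * n * Z ?L + c * Z ?L \<le> (length (g # l) + 1) * n * Z ?L"
    proof -
      have "c * Z ?L \<le> n * Z ?L" using assms(1) by (intro mult_le_mono1) simp
      thus ?thesis by (simp only: length_Cons add_Suc distrib_right mult_1 add_Suc_right Suc_eq_plus1)
    qed
    ultimately have "ar (ev (g # l)) (ev (?w (s(i := x + s i)))) ((length (g # l) + 1) * n * Z ?L)" by (rule ar_mono)
    moreover have "\<bar>(s(i := x + s i)) k\<bar> \<le> int (length (g # l)) * 2 ^ L" for k
    proof -
      have "(0::int) \<le> 2 ^ L" by simp
      hence "\<bar>(s(i := x + s i)) k\<bar> \<le> (int (length l) + 1) * 2 ^ L" using s1[of k] s1[of i] g(3) by (simp only: fun_upd_apply split: if_splits) linarith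
      thus ?thesis by (simp add: add.commute)
    qed
    ultimately show ?case by blast
  qed
  then obtain s where s: "ar (ev l) (ev (?w s)) ((length l + 1) * n * Z ?L)" by blast
  have wf: "\<forall>g\<in>set l. ewf g" "\<forall>g\<in>set (?w s). ewf g" using assms(2) r by fastforce+
  have "eprod (?w s) = id" using ar_eprod[OF s wf] assms(4) by simp
  hence s0: "s k = 0" if "k < c" for k
    using eprod_column[of c "[0..<c]" s "unitv c" k] that by (auto simp: unitv_def)
  have "?w s = map (\<lambda>k. EL k c 0) [0..<c]" using s0 by (intro map_cong) auto
  moreover have "ar (ev (map (\<lambda>k. EL k c 0) [0..<c])) [] (length [0..<c] * Z ?L)" by (rule column_zero) (auto intro: r)
  ultimately have "ar (ev (?w s)) [] (length [0..<c] * Z ?L)" by (simp only:)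
  from ar_trans[OF s this] have 1: "ar (ev l) [] ((length l + 1) * n * Z ?L + length [0..<c] * Z ?L)" .
  have "(length l + 1) * n * Z ?L + length [0..<c] * Z ?L \<le> (M + 1) * n * Z ?L + n * Z ?L"
    by (rule add_mono; rule mult_le_mono1) (use assms(1,3) in auto)
  also have "\<dots> = (M + 2) * n * Z ?L" by (simp add: algebra_simps)
  finally show ?thesis by (rule ar_mono[OF 1])
qed

text \<open>Induction on the number of columns. With the last index as a block of its own, its
  column is pushed to the right; then \<open>block_split\<close> makes both parts trivial
  separately.\<close>

lemma unipotent_fill:
  assumes "c \<le> n"
  shows "\<exists>K. \<forall>L l. (\<forall>g\<in>set l. \<exists>i j x. g = EL i j x \<and> i < j \<and> j < c \<and> \<bar>x\<bar> \<le> 2 ^ L) \<longrightarrow> length l \<le> M \<longrightarrow> eprod l = id \<longrightarrow>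
     ar (ev l) [] (K * Q L)"
  using assms
proof (induction c)
  case 0
  show ?case
  proof (intro exI allI impI)
    fix L l assume "\<forall>g\<in>set l. \<exists>i j x. g = EL i j x \<and> i < j \<and> j < 0 \<and> \<bar>x\<bar> \<le> 2 ^ L"
    hence "l = []" by (cases l) auto
    thus "ar (ev l) [] (0 * Q L)" by simp
  qed
next
  case (Suc c)
  then obtain K where K: "\<And>L l. \<forall>g\<in>set l. \<exists>i j x. g = EL i j x \<and> i < j \<and> j < c \<and> \<bar>x\<bar> \<le> 2 ^ L \<Longrightarrow> length l \<le> M \<Longrightarrow> eprod l = id \<Longrightarrow> ar (ev l) [] (K * Q L)"
    by (metis Suc_leD)
  define \<beta> :: "nat \<Rightarrow> nat" where "\<beta> = (\<lambda>i. if i < c then 0 else 1)"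
  define K1 where "K1 = M * 2 ^ M * 80 * KB * 4 ^ Suc M"
  define K2 where "K2 = (2 ^ M + 2) * n * KB * 4 ^ Suc M"
  show ?case
  proof (intro exI[of _ "K1 + (K + K2)"] allI impI)
    fix L l assume l: "\<forall>g\<in>set l. \<exists>i j x. g = EL i j x \<and> i < j \<and> j < Suc c \<and> \<bar>x\<bar> \<le> 2 ^ L" and M: "length l \<le> M" and id: "eprod l = id"
    have wb: "within_block \<beta> (EL i j x) \<longleftrightarrow> j < c" "above_block \<beta> (EL i j x) \<longleftrightarrow> j = c" if "i < j" "j < Suc c" for i j x
      using that by (auto simp: \<beta>_def)
    have "\<forall>g\<in>set l. (within_block \<beta> g \<or> above_block \<beta> g) \<and> ewf g \<and> \<bar>coef g\<bar> \<le> 2 ^ L \<and> eidx g \<subseteq> {..c}"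
    proof
      fix g assume "g \<in> set l"
      then obtain i j x where g: "g = EL i j x" "i < j" "j < Suc c" "\<bar>x\<bar> \<le> 2 ^ L" using l by blast
      thus "(within_block \<beta> g \<or> above_block \<beta> g) \<and> ewf g \<and> \<bar>coef g\<bar> \<le> 2 ^ L \<and> eidx g \<subseteq> {..c}"
        using wb[OF g(2,3), of x] Suc.prems by (auto simp: rt_def simp del: within_block.simps above_block.simps)
    qed
    from push_bounded[OF this M] obtain us where us:
      "\<forall>a\<in>set us. above_block \<beta> a \<and> ewf a \<and> \<bar>coef a\<bar> \<le> 2 ^ (2 ^ M * L) \<and> eidx a \<subseteq> {..c}" "length us \<le> 2 ^ M"
      "ar (ev l) (ev (filter (within_block \<beta>) l) @ ev us) (K1 * Q L)" unfolding K1_def by blast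
    let ?F = "filter (within_block \<beta>) l"
    have wf: "\<forall>g\<in>set l. ewf g" using l Suc.prems by (force simp: rt_def)
    have "eprod (?F @ us) = eprod l"
      by (rule ar_eprod[symmetric, where k = "K1 * Q L"]) (use us wf in auto)
    hence "eprod ?F \<circ> eprod us = id" using id by simp
    from block_split[OF _ _ this] have p: "eprod ?F = id" "eprod us = id" using us(1) by auto
    have F: "ar (ev ?F) [] (K * Q L)"
    proof (rule K)
      show "\<forall>g\<in>set ?F. \<exists>i j x. g = EL i j x \<and> i < j \<and> j < c \<and> \<bar>x\<bar> \<le> 2 ^ L"
      proof
        fix g assume "g \<in> set ?F"
        hence "g \<in> set l" "within_block \<beta> g" by auto
        then obtain i j x where g: "g = EL i j x" "i < j" "j < Suc c" "\<bar>x\<bar> \<le> 2 ^ L" using l by blast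
        thus "\<exists>i j x. g = EL i j x \<and> i < j \<and> j < c \<and> \<bar>x\<bar> \<le> 2 ^ L" using wb(1)[OF g(2,3), of x] \<open>within_block \<beta> g\<close> by blast
      qed
      show "length ?F \<le> M" using M length_filter_le[of "within_block \<beta>" l] by linarith
    qed (rule p)
    have U: "ar (ev us) [] ((2 ^ M + 2) * n * Z (2 ^ M * L + 2 ^ M))"
    proof (rule column_fill)
      show "\<forall>g\<in>set us. \<exists>k<c. \<exists>x. g = EL k c x \<and> \<bar>x\<bar> \<le> 2 ^ (2 ^ M * L)"
      proof
        fix g assume g: "g \<in> set us"
        hence *: "above_block \<beta> g" "\<bar>coef g\<bar> \<le> 2 ^ (2 ^ M * L)" "eidx g \<subseteq> {..c}" using us by auto
        then obtain i j x where "g = EL i j x" by (cases g) auto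
        thus "\<exists>k<c. \<exists>x. g = EL k c x \<and> \<bar>x\<bar> \<le> 2 ^ (2 ^ M * L)" using * by (auto simp: \<beta>_def split: if_splits)
      qed
    qed (use p Suc.prems us in auto)
    have "(2 ^ M + 2) * n * Z (2 ^ M * L + 2 ^ M) \<le> (2 ^ M + 2) * n * (KB * (4 ^ Suc M * Q L))"
      by (intro mult_le_mono order_refl Q_scale)
    hence "ar (ev us) [] (K2 * Q L)" unfolding K2_def using ar_mono[OF U] by (simp add: mult.assoc)
    from ar_trans[OF us(3) ar_append[OF F this]] show "ar (ev l) [] ((K1 + (K + K2)) * Q L)"
      by (simp add: distrib_right)
  qed
qed

subsection \<open>The cell lemma\<close>

text \<open>Conjugation by the diagonal matrix with entries \<open>F\<close> turns the coefficient
  into one of absolute value at most \<open>C\<close>.\<close>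

fun wbound :: "(nat \<Rightarrow> real) \<Rightarrow> real \<Rightarrow> elem \<Rightarrow> bool" where
  "wbound F C (EL i j x) \<longleftrightarrow> \<bar>real_of_int x\<bar> * F i \<le> C * F j"
| "wbound F C (SG i j) \<longleftrightarrow> True"

text \<open>The number of the block of \<open>i\<close>, where blocks are separated by the jumps of \<open>F\<close> by more than a factor \<open>T\<close>.\<close>

definition blk :: "(nat \<Rightarrow> real) \<Rightarrow> real \<Rightarrow> nat \<Rightarrow> nat" where
  "blk F T i = card {g. 1 \<le> g \<and> g \<le> i \<and> F g > T * F (g - 1)}"

lemma blk_mono: "i \<le> j \<Longrightarrow> blk F T i \<le> blk F T j"
  unfolding blk_def by (rule card_mono) (auto intro: finite_subset[of _ "{..j}"])

lemma blk_less:
  assumes "blk F T i < blk F T j"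
  obtains g where "i < g" "g \<le> j" "F g > T * F (g - 1)"
proof -
  let ?S = "\<lambda>i. {g. 1 \<le> g \<and> g \<le> i \<and> F g > T * F (g - 1)}"
  have "\<not> ?S j \<subseteq> ?S i"
  proof
    assume "?S j \<subseteq> ?S i"
    hence "card (?S j) \<le> card (?S i)" by (rule card_mono[rotated]) (auto intro: finite_subset[of _ "{..i}"])
    thus False using assms by (simp add: blk_def)
  qed
  then obtain g where g: "g \<in> ?S j" "g \<notin> ?S i" by blast
  show ?thesis by (rule that[of g]) (use g in auto)
qed

lemma blk_eq:
  assumes "blk F T i = blk F T (i + k)" "T \<ge> 0"
  shows "F (i + k) \<le> T ^ k * F i"
  using assms(1)
proof (induction k)
  case (Suc k)
  have e: "blk F T i = blk F T (i + k)" using Suc.prems blk_mono[of i "i + k" F T] blk_mono[of "i + k" "i + Suc k" F T] by simp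
  have "\<not> F (i + Suc k) > T * F (i + k)"
  proof
    assume g: "F (i + Suc k) > T * F (i + k)"
    let ?S = "\<lambda>i. {g. 1 \<le> g \<and> g \<le> i \<and> F g > T * F (g - 1)}"
    have m: "i + Suc k \<in> ?S (i + Suc k)" "i + Suc k \<notin> ?S (i + k)" using g by auto
    have "?S (i + k) \<subseteq> ?S (i + Suc k)" by auto
    hence "?S (i + k) \<subset> ?S (i + Suc k)" using m by blast
    hence "card (?S (i + k)) < card (?S (i + Suc k))" by (rule psubset_card_mono[rotated]) (auto intro: finite_subset[of _ "{..i + Suc k}"])
    thus False using Suc.prems e by (simp add: blk_def)
  qed
  hence "F (i + Suc k) \<le> T * F (i + k)" by simp
  also have "\<dots> \<le> T * (T ^ k * F i)" using Suc.IH[OF e] assms(2) by (intro mult_left_mono)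
  finally show ?case by (simp add: mult.assoc)
qed simp

text \<open>Between j and i the weight jumps by a factor larger than T > C, which leaves |x| < 1 for
  an integer.\<close>

lemma wbound_below:
  assumes "\<And>i j. i \<le> j \<Longrightarrow> j < n \<Longrightarrow> F i \<le> F j" "0 < F 0" "0 \<le> C" "C < T"
    "i < n" "j < n" "blk F T j < blk F T i" "\<bar>real_of_int x\<bar> * F i \<le> C * F j"
  shows "x = 0"
proof -
  have pos: "0 < F i" if "i < n" for i using assms(1)[of 0 i] assms(2) that by simp
  obtain g where g: "j < g" "g \<le> i" "F g > T * F (g - 1)" using blk_less[OF assms(7)] .
  have "T * F j \<le> T * F (g - 1)" using g assms by (intro mult_left_mono) auto
  also have "\<dots> < F g" by (rule g)
  also have "\<dots> \<le> F i" using g assms by auto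
  finally have "T * F j < F i" .
  moreover have "C * F j < T * F j" using assms(4) pos[OF assms(6)] by simp
  ultimately have "\<bar>real_of_int x\<bar> * F i < 1 * F i" using assms(8) by linarith
  hence "\<bar>real_of_int x\<bar> < 1" using pos[OF assms(5)] by (simp only: mult_less_cancel_right_pos)
  thus ?thesis by linarith
qed

lemma wbound_block:
  assumes "\<And>i j. i \<le> j \<Longrightarrow> j < n \<Longrightarrow> F i \<le> F j" "0 < F 0" "1 \<le> T" "i < n" "j < n" "blk F T i = blk F T j"
  shows "F j \<le> T ^ n * F i"
proof -
  have pos: "0 < F i" using assms(1)[of 0 i] assms(2,4) by simp
  show ?thesis
  proof (cases "i \<le> j")
    case True
    hence "F (i + (j - i)) \<le> T ^ (j - i) * F i" using assms by (intro blk_eq) auto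
    also have "\<dots> \<le> T ^ n * F i" using assms pos by (intro mult_right_mono power_increasing) auto
    finally show ?thesis using True by simp
  next
    case False
    hence "F j \<le> F i" using assms by auto
    also have "\<dots> \<le> T ^ n * F i" using one_le_power[OF assms(3), of n] pos by simp
    finally show ?thesis .
  qed
qed

lemma drop_zero:
  assumes "\<forall>g\<in>set l. ewf g" "\<forall>g\<in>set l. \<not> P g \<longrightarrow> (\<exists>i j. g = EL i j 0)"
  shows "ar (ev l) (ev (filter P l)) (length l * Z L)"
  using assms
proof (induction l)
  case (Cons g l)
  have w: "eword g \<in> words d" using Cons.prems by (auto intro: eword_words)
  have IH: "ar (ev l) (ev (filter P l)) (length l * Z L)" using Cons by auto
  show ?case
  proof (cases "P g")
    case True
    thus ?thesis using ar_appendL[OF IH w] by (auto elim: ar_mono)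
  next
    case False
    then obtain i j where g: "g = EL i j 0" using Cons.prems by auto
    have "ar (eh i j 0 @ ev l) ([] @ ev (filter P l)) (Z L + length l * Z L)"
      using Cons.prems g by (intro ar_append IH eh_zero) auto
    thus ?thesis using g False by simp
  qed
qed simp

text \<open>Letters below the blocks of \<open>F\<close> are trivial, those within have bounded
  coefficients and those above at most exponential ones. After collecting, the diagonal part ranges
  over finitely many words, and the rest is unipotent.\<close>

theorem cell_fill:
  assumes "C \<ge> 0"
  shows "\<exists>K. \<forall>F L l. (\<forall>i j. i \<le> j \<longrightarrow> j < n \<longrightarrow> F i \<le> F j) \<longrightarrow> 0 < F 0 \<longrightarrow> F (n - 1) \<le> 2 ^ L * F 0 \<longrightarrow>
    (\<forall>g\<in>set l. ewf g \<and> wbound F C g) \<longrightarrow> length l \<le> M \<longrightarrow> eprod l = id \<longrightarrow> ar (ev l) [] (K * Q L)"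
proof -
  define T where "T = C + 1"
  have T: "1 \<le> T" "0 \<le> T" "C < T" using assms by (auto simp: T_def)
  define C1 where "C1 = C * T ^ n"
  have CC1: "C \<le> C1" unfolding C1_def using mult_left_mono[OF one_le_power[OF T(1), of n] assms] by simp
  define c where "c = nat \<lceil>C1\<rceil>"
  have c: "C1 \<le> 2 ^ c"
  proof -
    have "C1 \<le> real c" unfolding c_def by linarith
    also have "\<dots> \<le> 2 ^ c" by (rule less_imp_le[OF of_nat_less_two_power])
    finally show ?thesis .
  qed
  obtain Kb where Kb: "\<And>l l'. (\<forall>g\<in>set l \<union> set l'. ewf g \<and> \<bar>coef g\<bar> \<le> 2 ^ c) \<Longrightarrow> length l \<le> M \<Longrightarrow> length l' \<le> M \<Longrightarrow> eprod l = eprod l' \<Longrightarrow>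
     ar (ev l) (ev l') Kb" using bounded_relations[of "2 ^ c" M] by blast
  obtain Ku where Ku: "\<And>L l. (\<forall>g\<in>set l. \<exists>i j x. g = EL i j x \<and> i < j \<and> j < n \<and> \<bar>x\<bar> \<le> 2 ^ L) \<Longrightarrow> length l \<le> 2 ^ M \<Longrightarrow> eprod l = id \<Longrightarrow>
     ar (ev l) [] (Ku * Q L)" using unipotent_fill[of n "2 ^ M"] by blast
  define Kp where "Kp = M * 2 ^ M * 80 * KB * 4 ^ Suc M"
  have Qc: "Q (L + c) \<le> Suc c ^ 2 * Q L" for L
  proof -
    have "L + c + 1 \<le> Suc c * (L + 1)" by simp
    hence "Q (L + c) \<le> (Suc c * (L + 1))\<^sup>2" by (rule power_mono) simp
    thus ?thesis by (simp only: power_mult_distrib)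
  qed
  define K where "K = (M * KB + Kp + Ku * 4 ^ Suc M) * Suc c ^ 2 + Kb"
  show ?thesis
  proof (intro exI[of _ K] allI impI)
    fix F :: "nat \<Rightarrow> real" and L l
    assume mono: "\<forall>i j. i \<le> j \<longrightarrow> j < n \<longrightarrow> F i \<le> F j" and F0: "0 < F 0" and FL: "F (n - 1) \<le> 2 ^ L * F 0"
      and l: "\<forall>g\<in>set l. ewf g \<and> wbound F C g" and M: "length l \<le> M" and prod: "eprod l = id"
    have mono': "\<And>i j. i \<le> j \<Longrightarrow> j < n \<Longrightarrow> F i \<le> F j" using mono by blast
    have pos: "0 < F i" if "i < n" for i using mono that F0 by (meson le0 less_le_trans)
    define \<beta> where "\<beta> = blk F T"
    let ?L = "L + c"
    define P where "P = (\<lambda>g. within_block \<beta> g \<or> above_block \<beta> g)"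
    have low: "\<exists>i j. g = EL i j 0" if "g \<in> set l" "\<not> P g" for g
    proof (cases g)
      case (EL i j x)
      have ij: "i < n" "j < n" using l that(1) EL by (auto simp: rt_def)
      have "\<beta> j < \<beta> i" using that(2) EL by (auto simp: P_def)
      moreover have "\<bar>real_of_int x\<bar> * F i \<le> C * F j" using l that(1) EL by auto
      ultimately have "x = 0" unfolding \<beta>_def by (intro wbound_below[of F C T i j x, OF mono' F0 assms T(3) ij])
      thus ?thesis using EL by blast
    qed (use that in \<open>auto simp: P_def\<close>)
    have inb: "\<bar>coef g\<bar> \<le> 2 ^ c" if "g \<in> set l" "within_block \<beta> g" for g
    proof (cases g)
      case (EL i j x)
      have ij: "i < n" "j < n" using l that(1) EL by (auto simp: rt_def)
      have e: "\<beta> i = \<beta> j" using that(2) EL by simp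
      have "F j \<le> T ^ n * F i"
        by (rule wbound_block[of F T i j, OF mono' F0 T(1) ij e[unfolded \<beta>_def]])
      hence "C * F j \<le> C * (T ^ n * F i)" using assms by (rule mult_left_mono)
      moreover have "\<bar>real_of_int x\<bar> * F i \<le> C * F j" using l that(1) EL by auto
      ultimately have "\<bar>real_of_int x\<bar> * F i \<le> C1 * F i" by (simp add: C1_def mult.assoc)
      hence "\<bar>real_of_int x\<bar> \<le> C1" using pos[OF ij(1)] by simp
      hence "real_of_int \<bar>x\<bar> \<le> real_of_int (2 ^ c)" using c by simp
      thus ?thesis unfolding EL coef.simps of_int_le_iff .
    qed simp
    have all: "\<bar>coef g\<bar> \<le> 2 ^ ?L" if "g \<in> set l" for g
    proof (cases g)
      case (EL i j x)
      have ij: "i < n" "j < n" using l that(1) EL by (auto simp: rt_def)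
      have "F j \<le> F (n - 1)" "F 0 \<le> F i" using mono ij by auto
      moreover have "2 ^ L * F 0 \<le> 2 ^ L * F i" using calculation(2) by (intro mult_left_mono) auto
      ultimately have "F j \<le> 2 ^ L * F i" using FL by linarith
      hence "C * F j \<le> C1 * (2 ^ L * F i)" using CC1 assms pos[OF ij(2)] by (intro mult_mono) auto
      moreover have "\<bar>real_of_int x\<bar> * F i \<le> C * F j" using l that(1) EL by auto
      ultimately have "\<bar>real_of_int x\<bar> * F i \<le> (C1 * 2 ^ L) * F i" by (simp add: mult.assoc)
      hence "\<bar>real_of_int x\<bar> \<le> C1 * 2 ^ L" using pos[OF ij(1)] by simp
      also have "\<dots> \<le> 2 ^ c * 2 ^ L" using c by (intro mult_right_mono) auto
      finally have "real_of_int \<bar>x\<bar> \<le> real_of_int (2 ^ ?L)" by (simp add: power_add mult.commute)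
      thus ?thesis unfolding EL coef.simps of_int_le_iff .
    qed simp
    let ?l = "filter P l" and ?l1 = "filter (within_block \<beta>) (filter P l)"
    have 1: "ar (ev l) (ev ?l) (length l * Z ?L)" using l low by (intro drop_zero) auto
    have "\<forall>g\<in>set ?l. (within_block \<beta> g \<or> above_block \<beta> g) \<and> ewf g \<and> \<bar>coef g\<bar> \<le> 2 ^ ?L \<and> eidx g \<subseteq> UNIV"
      using l all by (auto simp: P_def)
    moreover have lenl: "length ?l \<le> M" using M length_filter_le[of P l] by linarith
    ultimately obtain us where us: "\<forall>a\<in>set us. above_block \<beta> a \<and> ewf a \<and> \<bar>coef a\<bar> \<le> 2 ^ (2 ^ M * ?L)" "length us \<le> 2 ^ M"
      "ar (ev ?l) (ev ?l1 @ ev us) (Kp * Q ?L)" using push_bounded[of ?l \<beta> ?L UNIV M] unfolding Kp_def by blast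
    have 2: "ar (ev l) (ev (?l1 @ us)) (length l * Z ?L + Kp * Q ?L)" using ar_trans[OF 1 us(3)] by simp
    have "eprod (?l1 @ us) = eprod l" by (rule ar_eprod[OF 2, symmetric]) (use l us in auto)
    hence "eprod ?l1 \<circ> eprod us = id" using prod by simp
    from block_split[OF _ _ this] have p: "eprod ?l1 = id" "eprod us = id" using us(1) by auto
    have lenl1: "length ?l1 \<le> M" using lenl length_filter_le[of "within_block \<beta>" ?l] by linarith
    have A: "ar (ev ?l1) [] Kb" using Kb[of ?l1 "[]"] inb l p(1) lenl1 by auto
    have B: "ar (ev us) [] (Ku * Q (2 ^ M * ?L))"
    proof (rule Ku[OF _ us(2) p(2)])
      show "\<forall>g\<in>set us. \<exists>i j x. g = EL i j x \<and> i < j \<and> j < n \<and> \<bar>x\<bar> \<le> 2 ^ (2 ^ M * ?L)"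
      proof
        fix g assume "g \<in> set us"
        hence g: "above_block \<beta> g" "ewf g" "\<bar>coef g\<bar> \<le> 2 ^ (2 ^ M * ?L)" using us(1) by auto
        then obtain i j x where e: "g = EL i j x" "\<beta> i < \<beta> j" by (cases g) auto
        hence "i < j" using blk_mono[of j i F T] unfolding \<beta>_def by (meson leD linorder_not_le)
        thus "\<exists>i j x. g = EL i j x \<and> i < j \<and> j < n \<and> \<bar>x\<bar> \<le> 2 ^ (2 ^ M * ?L)" using e g by (auto simp: rt_def)
      qed
    qed
    have "ar (ev l) [] (length l * Z ?L + Kp * Q ?L + (Kb + Ku * Q (2 ^ M * ?L)))"
      using ar_trans[OF 2] ar_append[OF A B] by simp
    moreover have "length l * Z ?L + Kp * Q ?L + (Kb + Ku * Q (2 ^ M * ?L)) \<le> K * Q L"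
    proof -
      have "Q (2 ^ M * ?L) \<le> Q (2 ^ M * ?L + 2 ^ M)" by (intro power_mono) auto
      also have "\<dots> \<le> 4 ^ Suc M * Q ?L" by (rule Q_scale)
      finally have q: "Ku * Q (2 ^ M * ?L) \<le> Ku * (4 ^ Suc M * Q ?L)" by (rule mult_le_mono2)
      have "length l * Z ?L \<le> M * Z ?L" by (rule mult_le_mono1[OF M])
      hence "length l * Z ?L + Kp * Q ?L + (Kb + Ku * Q (2 ^ M * ?L)) \<le> (M * KB + Kp + Ku * 4 ^ Suc M) * Q ?L + Kb"
        using q by (simp only: distrib_right mult.assoc)
      also have "\<dots> \<le> (M * KB + Kp + Ku * 4 ^ Suc M) * (Suc c ^ 2 * Q L) + Kb * Q L"
        by (intro add_mono mult_le_mono2 Qc) (simp add: power2_eq_square)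
      also have "\<dots> = K * Q L" by (simp only: K_def distrib_right mult.assoc)
      finally show ?thesis .
    qed
    ultimately show "ar (ev l) [] (K * Q L)" by (rule ar_mono)
  qed
qed

end

section \<open>Reduced bases for norms on integer vectors\<close>

type_synonym zvec = "nat \<Rightarrow> int"

text \<open>Integer vectors are total functions of which the first \<open>m\<close> coordinates
  count. The lower bound \<open>e\<close> expresses that the lattice is discrete for the norm; it
  takes the place of compactness.\<close>

definition znorm :: "nat \<Rightarrow> (zvec \<Rightarrow> real) \<Rightarrow> bool" where
  "znorm m f \<longleftrightarrow> (\<forall>u v. f (\<lambda>i. u i + v i) \<le> f u + f v) \<and> (\<forall>k v. f (\<lambda>i. k * v i) = \<bar>real_of_int k\<bar> * f v) \<and>
     (\<forall>u v. (\<forall>i<m. u i = v i) \<longrightarrow> f u = f v) \<and> (\<exists>e>0. \<forall>v. (\<exists>i<m. v i \<noteq> 0) \<longrightarrow> e \<le> f v)"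

lemma znormD:
  assumes "znorm m f"
  shows "f (\<lambda>i. u i + v i) \<le> f u + f v" "f (\<lambda>i. k * v i) = \<bar>real_of_int k\<bar> * f v"
    "(\<And>i. i < m \<Longrightarrow> u i = v i) \<Longrightarrow> f u = f v" "f (\<lambda>_. 0) = 0" "0 \<le> f v"
proof -
  show 1: "f (\<lambda>i. u i + v i) \<le> f u + f v" "f (\<lambda>i. k * v i) = \<bar>real_of_int k\<bar> * f v"
    "(\<And>i. i < m \<Longrightarrow> u i = v i) \<Longrightarrow> f u = f v" for u v k using assms unfolding znorm_def by blast+
  show 0: "f (\<lambda>_. 0) = 0" using 1(2)[of 0 "\<lambda>_. 0"] by simp
  show "0 \<le> f v" using 1(1)[of v "\<lambda>i. (-1) * v i"] 1(2)[of "-1" v] 0 by simp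
qed

definition comb :: "nat \<Rightarrow> (nat \<Rightarrow> zvec) \<Rightarrow> (nat \<Rightarrow> int) \<Rightarrow> zvec" where
  "comb m b x = (\<lambda>i. \<Sum>j<m. x j * b j i)"

definition zE :: "nat \<Rightarrow> nat \<Rightarrow> int \<Rightarrow> zvec \<Rightarrow> zvec" where
  "zE i j x v = v(i := v i + x * v j)"

definition zaut :: "nat \<Rightarrow> (zvec \<Rightarrow> zvec) \<Rightarrow> (zvec \<Rightarrow> zvec) \<Rightarrow> bool" where
  "zaut m g g' \<longleftrightarrow> g \<circ> g' = id \<and> g' \<circ> g = id \<and>
     (\<forall>u v a b. g (\<lambda>i. a * u i + b * v i) = (\<lambda>i. a * g u i + b * g v i)) \<and>
     (\<forall>u v a b. g' (\<lambda>i. a * u i + b * v i) = (\<lambda>i. a * g' u i + b * g' v i)) \<and>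
     (\<forall>u v. (\<forall>i<m. u i = v i) \<longrightarrow> (\<forall>i<m. g u i = g v i)) \<and> (\<forall>u v. (\<forall>i<m. u i = v i) \<longrightarrow> (\<forall>i<m. g' u i = g' v i))"

lemma zautD:
  assumes "zaut m g g'"
  shows "g (\<lambda>i. a * u i + b * v i) = (\<lambda>i. a * g u i + b * g v i)" "g' (\<lambda>i. a * u i + b * v i) = (\<lambda>i. a * g' u i + b * g' v i)"
    "g (g' v) = v" "g' (g v) = v"
    "\<forall>i<m. u i = v i \<Longrightarrow> \<forall>i<m. g u i = g v i" "\<forall>i<m. u i = v i \<Longrightarrow> \<forall>i<m. g' u i = g' v i"
proof -
  note Z = assms[unfolded zaut_def]
  note 1 = Z[THEN conjunct2, THEN conjunct2, THEN conjunct1]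
  note 2 = Z[THEN conjunct2, THEN conjunct2, THEN conjunct2, THEN conjunct1]
  note 3 = Z[THEN conjunct2, THEN conjunct2, THEN conjunct2, THEN conjunct2, THEN conjunct1]
  note 4 = Z[THEN conjunct2, THEN conjunct2, THEN conjunct2, THEN conjunct2, THEN conjunct2]
  have "g \<circ> g' = id" "g' \<circ> g = id" by (rule Z[THEN conjunct1], rule Z[THEN conjunct2, THEN conjunct1])
  thus "g (g' v) = v" "g' (g v) = v" by (metis comp_apply id_apply)+
  show "g (\<lambda>i. a * u i + b * v i) = (\<lambda>i. a * g u i + b * g v i)" by (rule 1[THEN spec, THEN spec, THEN spec, THEN spec])
  show "g' (\<lambda>i. a * u i + b * v i) = (\<lambda>i. a * g' u i + b * g' v i)" by (rule 2[THEN spec, THEN spec, THEN spec, THEN spec])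
  show "\<forall>i<m. u i = v i \<Longrightarrow> \<forall>i<m. g u i = g v i" by (rule 3[THEN spec, THEN spec, THEN mp])
  show "\<forall>i<m. u i = v i \<Longrightarrow> \<forall>i<m. g' u i = g' v i" by (rule 4[THEN spec, THEN spec, THEN mp])
qed

lemma zaut_id: "zaut m id id"
  by (simp add: zaut_def)

lemma zaut_E:
  assumes "zaut m g g'" "i < m" "j < m" "i \<noteq> j"
  shows "zaut m (zE i j x \<circ> g) (g' \<circ> zE i j (- x))"
proof -
  have 1: "zE i j x \<circ> zE i j (- x) = id" "zE i j (- x) \<circ> zE i j x = id" using assms(4) by (auto simp: zE_def fun_eq_iff)
  have 2: "(zE i j x \<circ> g) \<circ> (g' \<circ> zE i j (- x)) = zE i j x \<circ> (g \<circ> g') \<circ> zE i j (- x)"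
    "(g' \<circ> zE i j (- x)) \<circ> (zE i j x \<circ> g) = g' \<circ> (zE i j (- x) \<circ> zE i j x) \<circ> g" by (simp_all only: comp_assoc)
  have 3: "zE i j x (\<lambda>k. a * u k + b * v k) = (\<lambda>k. a * zE i j x u k + b * zE i j x v k)" for x a b u v
    by (auto simp: zE_def fun_eq_iff algebra_simps)
  have 4: "\<forall>k<m. zE i j x u k = zE i j x v k" if "\<forall>k<m. u k = v k" for x u v
    using that assms by (auto simp: zE_def)
  show ?thesis unfolding zaut_def
  proof (intro conjI allI impI)
    show "(zE i j x \<circ> g) \<circ> (g' \<circ> zE i j (- x)) = id" "(g' \<circ> zE i j (- x)) \<circ> (zE i j x \<circ> g) = id"
      unfolding 2 1 using assms(1) by (auto simp: zaut_def 1)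
  next
    fix u v :: zvec and a b
    show "(zE i j x \<circ> g) (\<lambda>i. a * u i + b * v i) = (\<lambda>k. a * (zE i j x \<circ> g) u k + b * (zE i j x \<circ> g) v k)"
      using assms(1) 3 by (simp add: zaut_def)
    show "(g' \<circ> zE i j (- x)) (\<lambda>i. a * u i + b * v i) = (\<lambda>k. a * (g' \<circ> zE i j (- x)) u k + b * (g' \<circ> zE i j (- x)) v k)"
      using assms(1) 3 by (simp add: zaut_def)
  next
    fix u v :: zvec and k assume uv: "\<forall>k<m. u k = v k" "k < m"
    show "(zE i j x \<circ> g) u k = (zE i j x \<circ> g) v k"
      using assms(1) 4[of "g u" "g v" x] uv by (auto simp: zaut_def)
    show "(g' \<circ> zE i j (- x)) u k = (g' \<circ> zE i j (- x)) v k"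
      using assms(1) 4[of u v "- x"] uv by (auto simp: zaut_def)
  qed
qed

lemma abs_sub_sgn: "a \<noteq> 0 \<Longrightarrow> \<bar>a\<bar> \<le> \<bar>b\<bar> \<Longrightarrow> \<bar>b - sgn a * sgn b * a\<bar> < \<bar>b\<bar>" for a b :: int
  by (auto simp: sgn_if abs_if split: if_splits)

text \<open>Euclid's algorithm on the coordinates: while two of them are nonzero, the sum of the
  absolute values can be decreased.\<close>

lemma zaut_euclid:
  "\<exists>g g'. zaut m g g' \<and> (\<forall>i. 1 \<le> i \<longrightarrow> i < m \<longrightarrow> g u i = 0)"
proof (induction "\<Sum>i<m. nat \<bar>u i\<bar>" arbitrary: u rule: less_induct)
  case less
  have step: "\<exists>g g'. zaut m g g' \<and> (\<forall>i. 1 \<le> i \<longrightarrow> i < m \<longrightarrow> g u i = 0)"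
    if "i < m" "j < m" "i \<noteq> j" "\<exists>g g'. zaut m g g' \<and> (\<forall>k. 1 \<le> k \<longrightarrow> k < m \<longrightarrow> g (zE i j x u) k = 0)" for i j x u
  proof -
    from that(4) obtain g g' where g: "zaut m g g'" "\<forall>k. 1 \<le> k \<longrightarrow> k < m \<longrightarrow> g (zE i j x u) k = 0" by blast
    have 1: "zE i j x \<circ> zE i j (- x) = id" "zE i j (- x) \<circ> zE i j x = id" using that(3) by (auto simp: zE_def fun_eq_iff)
    have "zaut m (g \<circ> zE i j x) (zE i j (- x) \<circ> g')"
    proof -
      have "zaut m (zE i j (- x) \<circ> id) (id \<circ> zE i j (- (- x)))" by (intro zaut_E zaut_id that)
      hence e: "zaut m (zE i j (- x)) (zE i j x)" by simp
      show ?thesis unfolding zaut_def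
      proof (intro conjI allI impI)
        have "(g \<circ> zE i j x) \<circ> (zE i j (- x) \<circ> g') = g \<circ> (zE i j x \<circ> zE i j (- x)) \<circ> g'"
          "(zE i j (- x) \<circ> g') \<circ> (g \<circ> zE i j x) = zE i j (- x) \<circ> (g' \<circ> g) \<circ> zE i j x" by (simp_all only: comp_assoc)
        thus "(g \<circ> zE i j x) \<circ> (zE i j (- x) \<circ> g') = id" "(zE i j (- x) \<circ> g') \<circ> (g \<circ> zE i j x) = id"
          using g(1) 1 by (simp_all add: zaut_def)
      qed (use g(1) e in \<open>simp_all add: zaut_def\<close>)
    qed
    thus ?thesis using g(2) by (intro exI[of _ "g \<circ> zE i j x"] exI[of _ "zE i j (- x) \<circ> g'"]) simp
  qed
  show ?case
  proof (cases "\<exists>i<m. \<exists>j<m. i \<noteq> j \<and> u i \<noteq> 0 \<and> u j \<noteq> 0")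
    case True
    then obtain i j where ij: "i < m" "j < m" "i \<noteq> j" "u j \<noteq> 0" "\<bar>u j\<bar> \<le> \<bar>u i\<bar>"
      by (metis linear)
    define x where "x = - (sgn (u j) * sgn (u i))"
    have x: "\<bar>u i + x * u j\<bar> < \<bar>u i\<bar>" using abs_sub_sgn[OF ij(4,5)] by (simp add: x_def)
    have "(\<Sum>k<m. nat \<bar>zE i j x u k\<bar>) < (\<Sum>k<m. nat \<bar>u k\<bar>)"
    proof (rule sum_strict_mono_ex1)
      show "\<exists>k\<in>{..<m}. nat \<bar>zE i j x u k\<bar> < nat \<bar>u k\<bar>" using x ij by (intro bexI[of _ i]) (auto simp: zE_def)
    qed (use x in \<open>auto simp: zE_def\<close>)
    from step[OF ij(1-3) less.hyps[OF this]] show ?thesis .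
  next
    case False
    show ?thesis
    proof (cases "\<exists>i<m. i \<noteq> 0 \<and> u i \<noteq> 0")
      case True
      then obtain i where i: "i < m" "i \<noteq> 0" "u i \<noteq> 0" by blast
      have z: "u k = 0" if "k < m" "k \<noteq> i" for k using False i that by blast
      show ?thesis
      \<comment> \<open>The single nonzero entry is moved to coordinate 0 by adding it there and
        then subtracting it from coordinate i.\<close>
      proof (rule step[of 0 i 1 u], goal_cases)
        case 4
        show ?case
        proof (rule step[of i 0 "-1"], goal_cases)
          case 4
          show ?case using z i by (intro exI[of _ id] conjI zaut_id) (auto simp: zE_def)
        qed (use i in auto)
      qed (use i in auto)
    next
      case F: False
      thus ?thesis by (intro exI[of _ id] conjI zaut_id) auto
    qed
  qed
qed

text \<open>A near minimum suffices below, but its factor must be less than 2; see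
  \<open>qnorm_ge\<close>.\<close>

lemma approx_min:
  assumes "S \<noteq> {}" "e > (0::real)" "\<And>v. v \<in> S \<Longrightarrow> e \<le> g v"
  shows "\<exists>u\<in>S. \<forall>v\<in>S. g u \<le> 3 / 2 * g v"
proof -
  let ?I = "Inf (g ` S)"
  have b: "bdd_below (g ` S)" using assms(3) by (auto simp: bdd_below_def)
  have "e \<le> ?I" using assms by (intro cInf_greatest) auto
  hence "?I < 3 / 2 * ?I" using assms(2) by linarith
  then obtain u where u: "u \<in> S" "g u < 3 / 2 * ?I" using cInf_lessD[of "g ` S"] assms(1) by blast
  have "g u \<le> 3 / 2 * g v" if "v \<in> S" for v
  proof -
    have "?I \<le> g v" using that b by (intro cInf_lower) auto
    thus ?thesis using u(2) by linarith
  qed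
  thus ?thesis using u(1) by blast
qed

definition vcons :: "int \<Rightarrow> zvec \<Rightarrow> zvec" where
  "vcons k v = (\<lambda>i. case i of 0 \<Rightarrow> k | Suc j \<Rightarrow> v j)"

lemma vcons_simps [simp]: "vcons k v 0 = k" "vcons k v (Suc j) = v j"
  by (simp_all add: vcons_def)

lemma vcons_mult: "(\<lambda>i. c * vcons k u i) = vcons (c * k) (\<lambda>i. c * u i)"
  by (auto simp: vcons_def fun_eq_iff split: nat.splits)

text \<open>
  The quotient norm modulo the line spanned by the first basis vector.  Scaling by \<open>N\<close> gives access to the rational
  points of this line.
\<close>

definition qnorm :: "(zvec \<Rightarrow> real) \<Rightarrow> zvec \<Rightarrow> real" where
  "qnorm f v = Inf {f (vcons k (\<lambda>i. int N * v i)) / real N | N k. 1 \<le> N}"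

context
  fixes m :: nat and f :: "zvec \<Rightarrow> real"
  assumes f: "znorm (Suc m) f" and short: "\<And>v. \<exists>i<Suc m. v i \<noteq> 0 \<Longrightarrow> f (vcons 1 (\<lambda>_. 0)) \<le> 3 / 2 * f v"
begin

lemma qnorm_le: "1 \<le> N \<Longrightarrow> qnorm f v \<le> f (vcons k (\<lambda>i. int N * v i)) / real N"
proof -
  assume N: "1 \<le> N"
  have "bdd_below {f (vcons k (\<lambda>i. int N * v i)) / real N | N k. 1 \<le> N}"
    using znormD(5)[OF f] by (intro bdd_belowI[of _ 0]) auto
  thus ?thesis unfolding qnorm_def using N by (intro cInf_lower) auto
qed

lemma qnorm_greatest:
  assumes "\<And>N k. 1 \<le> N \<Longrightarrow> c \<le> f (vcons k (\<lambda>i. int N * v i)) / real N"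
  shows "c \<le> qnorm f v"
  unfolding qnorm_def using assms by (intro cInf_greatest) auto

lemma qnorm_approx:
  assumes "qnorm f v < c"
  obtains N k where "1 \<le> N" "f (vcons k (\<lambda>i. int N * v i)) < c * real N"
proof -
  have "{f (vcons k (\<lambda>i. int N * v i)) / real N | N k. 1 \<le> N} \<noteq> {}" by auto
  from cInf_lessD[OF this] assms obtain N k where "1 \<le> N" "f (vcons k (\<lambda>i. int N * v i)) / real N < c"
    unfolding qnorm_def by blast
  thus ?thesis using that[of N k] by (simp add: pos_divide_less_eq)
qed

lemma qnorm_le1: "qnorm f v \<le> f (vcons k v)"
  using qnorm_le[of 1 v k] by simp

text \<open>Rounding k / N to the nearest integer changes the vector by at most half of the first
  basis vector.\<close>

lemma vcons_round:
  assumes "1 \<le> N"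
  shows "\<exists>j. f (vcons j v) \<le> f (vcons k (\<lambda>i. int N * v i)) / real N + f (vcons 1 (\<lambda>_. 0)) / 2"
proof -
  define j where "j = round (real_of_int k / real N)"
  let ?r = "f (vcons 1 (\<lambda>_. 0))"
  have "\<bar>real_of_int j - real_of_int k / real N\<bar> \<le> 1 / 2" unfolding j_def by (rule of_int_round_abs_le)
  hence "\<bar>(real_of_int j - real_of_int k / real N) * real N\<bar> \<le> 1 / 2 * real N"
    unfolding abs_mult using assms by (intro mult_mono) auto
  hence j: "\<bar>real_of_int (j * int N - k)\<bar> \<le> real N / 2" using assms by (simp add: left_diff_distrib)
  have "(\<lambda>i. int N * vcons j v i) = (\<lambda>i. vcons k (\<lambda>i. int N * v i) i + (j * int N - k) * vcons 1 (\<lambda>_. 0) i)"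
    by (rule HOL.ext) (simp add: vcons_def algebra_simps split: nat.splits)
  hence "real N * f (vcons j v) \<le> f (vcons k (\<lambda>i. int N * v i)) + \<bar>real_of_int (j * int N - k)\<bar> * ?r"
    using znormD(2)[OF f, of "int N" "vcons j v"] znormD(1)[OF f, of "vcons k (\<lambda>i. int N * v i)" "\<lambda>i. (j * int N - k) * vcons 1 (\<lambda>_. 0) i"]
      znormD(2)[OF f, of "j * int N - k" "vcons 1 (\<lambda>_. 0)"] by simp
  also have "\<dots> \<le> f (vcons k (\<lambda>i. int N * v i)) + real N / 2 * ?r"
    using j znormD(5)[OF f] by (intro add_left_mono mult_right_mono)
  finally have "real N * f (vcons j v) \<le> real N * (f (vcons k (\<lambda>i. int N * v i)) / real N + ?r / 2)"
    using assms by (simp add: distrib_left)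
  thus ?thesis using assms by (intro exI[of _ j]) simp
qed

lemma short_pos: "0 < f (vcons 1 (\<lambda>_. 0))"
proof -
  obtain e where "e > 0" "\<And>v. \<exists>i<Suc m. v i \<noteq> 0 \<Longrightarrow> e \<le> f v" using f unfolding znorm_def by blast
  moreover have "\<exists>i<Suc m. vcons 1 (\<lambda>_. 0) i \<noteq> 0" by (intro exI[of _ 0]) simp
  ultimately show ?thesis by (meson less_le_trans)
qed

text \<open>A lift has norm at least 2 / 3 of the first basis vector, which is nearly shortest, and
  rounding loses 1 / 2 of it; 2 / 3 - 1 / 2 = 1 / 6.\<close>

lemma qnorm_ge:
  assumes "\<exists>i<m. v i \<noteq> 0"
  shows "f (vcons 1 (\<lambda>_. 0)) / 6 \<le> qnorm f v"
proof (rule qnorm_greatest)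
  fix N k assume N: "1 \<le> (N::nat)"
  obtain j where j: "f (vcons j v) \<le> f (vcons k (\<lambda>i. int N * v i)) / real N + f (vcons 1 (\<lambda>_. 0)) / 2"
    using vcons_round[OF N] by blast
  obtain i where "i < m" "v i \<noteq> 0" using assms by blast
  hence "\<exists>i<Suc m. vcons j v i \<noteq> 0" by (intro exI[of _ "Suc i"]) simp
  from short[OF this] j show "f (vcons 1 (\<lambda>_. 0)) / 6 \<le> f (vcons k (\<lambda>i. int N * v i)) / real N" by linarith
qed

lemma qnorm_zero: "qnorm f (\<lambda>_. 0) = 0"
proof (rule antisym)
  have "vcons 0 (\<lambda>_. 0) = (\<lambda>_. 0)" by (auto simp: vcons_def fun_eq_iff split: nat.splits)
  thus "qnorm f (\<lambda>_. 0) \<le> 0" using qnorm_le1[of "\<lambda>_. 0" 0] znormD(4)[OF f] by simp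
  show "0 \<le> qnorm f (\<lambda>_. 0)" using znormD(5)[OF f] by (intro qnorm_greatest) auto
qed

lemma qnorm_mult: "qnorm f (\<lambda>i. c * v i) = \<bar>real_of_int c\<bar> * qnorm f v"
proof (cases "c = 0")
  case True
  thus ?thesis by (simp add: qnorm_zero)
next
  case False
  hence c: "0 < \<bar>real_of_int c\<bar>" by simp
  show ?thesis
  proof (rule antisym)
    have "qnorm f (\<lambda>i. c * v i) / \<bar>real_of_int c\<bar> \<le> qnorm f v"
    proof (rule qnorm_greatest)
      fix N k assume N: "1 \<le> (N::nat)"
      have "(\<lambda>i. int N * (c * v i)) = (\<lambda>i. c * (int N * v i))" by (simp add: mult_ac)
      hence "f (vcons (c * k) (\<lambda>i. int N * (c * v i))) = \<bar>real_of_int c\<bar> * f (vcons k (\<lambda>i. int N * v i))"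
        using znormD(2)[OF f, of c "vcons k (\<lambda>i. int N * v i)"] unfolding vcons_mult by simp
      with qnorm_le[OF N, of "\<lambda>i. c * v i" "c * k"] c
      show "qnorm f (\<lambda>i. c * v i) / \<bar>real_of_int c\<bar> \<le> f (vcons k (\<lambda>i. int N * v i)) / real N"
        by (simp add: pos_divide_le_eq mult.commute)
    qed
    thus "qnorm f (\<lambda>i. c * v i) \<le> \<bar>real_of_int c\<bar> * qnorm f v" using c by (simp add: pos_divide_le_eq mult.commute)
    show "\<bar>real_of_int c\<bar> * qnorm f v \<le> qnorm f (\<lambda>i. c * v i)"
    proof (rule qnorm_greatest)
      fix N k assume N: "1 \<le> (N::nat)"
      \<comment> \<open>A lift of \<open>c * v\<close> with denominator N is, up to the sign of c, a
        lift of \<open>v\<close> with denominator N |c|.\<close>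
      have N': "1 \<le> N * nat \<bar>c\<bar>" using N False by (simp add: Suc_le_eq)
      have "c = sgn c * \<bar>c\<bar>" by (simp add: sgn_mult_abs)
      hence "(\<lambda>i. sgn c * vcons k (\<lambda>i. int N * (c * v i)) i) = vcons (sgn c * k) (\<lambda>i. int (N * nat \<bar>c\<bar>) * v i)"
        unfolding vcons_mult by (auto simp: mult_ac abs_if sgn_if)
      moreover have "\<bar>real_of_int (sgn c)\<bar> = 1" using False by (simp add: sgn_if)
      ultimately have "f (vcons (sgn c * k) (\<lambda>i. int (N * nat \<bar>c\<bar>) * v i)) = f (vcons k (\<lambda>i. int N * (c * v i)))"
        using znormD(2)[OF f, of "sgn c" "vcons k (\<lambda>i. int N * (c * v i))"] by simp
      moreover have "real (N * nat \<bar>c\<bar>) = real N * \<bar>real_of_int c\<bar>" by simp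
      ultimately have "qnorm f v \<le> f (vcons k (\<lambda>i. int N * (c * v i))) / (real N * \<bar>real_of_int c\<bar>)"
        using qnorm_le[OF N', of v "sgn c * k"] by simp
      thus "\<bar>real_of_int c\<bar> * qnorm f v \<le> f (vcons k (\<lambda>i. int N * (c * v i))) / real N"
        using c N by (simp add: pos_le_divide_eq mult_ac)
    qed
  qed
qed

lemma qnorm_triangle: "qnorm f (\<lambda>i. u i + v i) \<le> qnorm f u + qnorm f v"
proof -
  have 1: "qnorm f (\<lambda>i. u i + v i) - f (vcons k (\<lambda>i. int N * u i)) / real N \<le> qnorm f v" if N: "1 \<le> N" for N k
  proof (rule qnorm_greatest)
    fix N' k' assume N': "1 \<le> (N'::nat)"
    \<comment> \<open>Lifts of the two summands are added over the common denominator.\<close>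
    have NN: "1 \<le> N * N'" using N N' by (simp add: Suc_le_eq)
    have "vcons (int N' * k + int N * k') (\<lambda>i. int (N * N') * (u i + v i)) =
       (\<lambda>i. int N' * vcons k (\<lambda>i. int N * u i) i + int N * vcons k' (\<lambda>i. int N' * v i) i)"
      by (rule HOL.ext) (simp add: vcons_def algebra_simps split: nat.splits)
    hence "f (vcons (int N' * k + int N * k') (\<lambda>i. int (N * N') * (u i + v i))) \<le>
       real N' * f (vcons k (\<lambda>i. int N * u i)) + real N * f (vcons k' (\<lambda>i. int N' * v i))"
      using znormD(1)[OF f, of "\<lambda>i. int N' * vcons k (\<lambda>i. int N * u i) i" "\<lambda>i. int N * vcons k' (\<lambda>i. int N' * v i) i"]
        znormD(2)[OF f, of "int N'" "vcons k (\<lambda>i. int N * u i)"] znormD(2)[OF f, of "int N" "vcons k' (\<lambda>i. int N' * v i)"] by simp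
    hence "f (vcons (int N' * k + int N * k') (\<lambda>i. int (N * N') * (u i + v i))) / real (N * N') \<le>
       (real N' * f (vcons k (\<lambda>i. int N * u i)) + real N * f (vcons k' (\<lambda>i. int N' * v i))) / real (N * N')"
      by (intro divide_right_mono) auto
    also have "\<dots> = f (vcons k (\<lambda>i. int N * u i)) / real N + f (vcons k' (\<lambda>i. int N' * v i)) / real N'"
      using N N' by (simp add: add_divide_distrib)
    finally show "qnorm f (\<lambda>i. u i + v i) - f (vcons k (\<lambda>i. int N * u i)) / real N \<le> f (vcons k' (\<lambda>i. int N' * v i)) / real N'"
      using qnorm_le[OF NN, of "\<lambda>i. u i + v i" "int N' * k + int N * k'"] by linarith
  qed
  have "qnorm f (\<lambda>i. u i + v i) - qnorm f v \<le> qnorm f u"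
    by (rule qnorm_greatest) (use 1 in \<open>smt (verit)\<close>)
  thus ?thesis by simp
qed

lemma znorm_qnorm: "znorm m (qnorm f)"
  unfolding znorm_def
proof (intro conjI allI impI)
  fix u v :: zvec assume uv: "\<forall>i<m. u i = v i"
  have "f (vcons k (\<lambda>i. int N * u i)) = f (vcons k (\<lambda>i. int N * v i))" for N k
    by (rule znormD(3)[OF f]) (use uv in \<open>auto simp: vcons_def split: nat.splits\<close>)
  thus "qnorm f u = qnorm f v" by (simp add: qnorm_def)
next
  show "\<exists>e>0. \<forall>v. (\<exists>i<m. v i \<noteq> 0) \<longrightarrow> e \<le> qnorm f v"
    using qnorm_ge short_pos by (intro exI[of _ "f (vcons 1 (\<lambda>_. 0)) / 6"]) auto
qed (simp_all add: qnorm_triangle qnorm_mult)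

text \<open>An almost optimal rational lift costs the factor 2, and rounding it adds half of the
  first vector, which is at most 3 times the quotient norm by \<open>qnorm_ge\<close>.\<close>

lemma qnorm_lift: "\<exists>j. f (vcons j v) \<le> 5 * qnorm f v"
proof (cases "\<exists>i<m. v i \<noteq> 0")
  case True
  have "0 < qnorm f v" using qnorm_ge[OF True] short_pos by linarith
  hence "qnorm f v < 2 * qnorm f v" by simp
  then obtain N k where N: "1 \<le> N" "f (vcons k (\<lambda>i. int N * v i)) < 2 * qnorm f v * real N" by (rule qnorm_approx)
  hence "f (vcons k (\<lambda>i. int N * v i)) / real N < 2 * qnorm f v" by (simp add: pos_divide_less_eq)
  moreover obtain j where "f (vcons j v) \<le> f (vcons k (\<lambda>i. int N * v i)) / real N + f (vcons 1 (\<lambda>_. 0)) / 2"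
    using vcons_round[OF N(1)] by blast
  ultimately show ?thesis using qnorm_ge[OF True] by (intro exI[of _ j]) linarith
next
  case False
  have "f (vcons 0 v) = f (\<lambda>_. 0)" by (rule znormD(3)[OF f]) (use False in \<open>auto simp: vcons_def split: nat.splits\<close>)
  moreover have "0 \<le> qnorm f v" using znormD(5)[OF f] by (intro qnorm_greatest) auto
  ultimately show ?thesis using znormD(4)[OF f] by (intro exI[of _ 0]) simp
qed

end

lemma comb_Suc: "comb (Suc m) b x = (\<lambda>i. x 0 * b 0 i + comb m (\<lambda>j. b (Suc j)) (\<lambda>j. x (Suc j)) i)"
  by (simp only: comb_def sum.lessThan_Suc_shift)

lemma zaut_comb:
  assumes "zaut m g g'"
  shows "g' (comb k b x) = comb k (\<lambda>j. g' (b j)) x"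
proof (induction k arbitrary: b x)
  case 0
  show ?case using zautD(2)[OF assms, of 0 "\<lambda>_. 0" 0 "\<lambda>_. 0"] by (simp add: comb_def)
next
  case (Suc k)
  note lin = zautD(2)[OF assms]
  have "g' (comb (Suc k) b x) = g' (\<lambda>i. x 0 * b 0 i + 1 * comb k (\<lambda>j. b (Suc j)) (\<lambda>j. x (Suc j)) i)" by (simp add: comb_Suc)
  also have "\<dots> = comb (Suc k) (\<lambda>j. g' (b j)) x" unfolding lin by (simp add: comb_Suc Suc)
  finally show ?case .
qed

text \<open>The third clause says that the basis is orthogonal up to the factor \<open>C\<close>;
  the fourth orders it by length up to \<open>C\<close>.\<close>

definition reduced_basis :: "nat \<Rightarrow> real \<Rightarrow> (zvec \<Rightarrow> real) \<Rightarrow> (nat \<Rightarrow> zvec) \<Rightarrow> bool" where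
  "reduced_basis m C f b \<longleftrightarrow> (\<forall>v. \<exists>x. \<forall>i<m. v i = comb m b x i) \<and> (\<forall>j<m. 0 < f (b j)) \<and>
     (\<forall>x. \<forall>j<m. \<bar>real_of_int (x j)\<bar> * f (b j) \<le> C * f (comb m b x)) \<and> (\<forall>i j. i \<le> j \<longrightarrow> j < m \<longrightarrow> f (b i) \<le> C * f (b j))"

lemma reduced_basisD:
  assumes "reduced_basis m C f b"
  shows "\<exists>x. \<forall>i<m. v i = comb m b x i" "j < m \<Longrightarrow> 0 < f (b j)"
    "j < m \<Longrightarrow> \<bar>real_of_int (x j)\<bar> * f (b j) \<le> C * f (comb m b x)" "i \<le> j \<Longrightarrow> j < m \<Longrightarrow> f (b i) \<le> C * f (b j)"
proof -
  note Z = assms[unfolded reduced_basis_def]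
  show "\<exists>x. \<forall>i<m. v i = comb m b x i" by (rule Z[THEN conjunct1, THEN spec])
  show "j < m \<Longrightarrow> 0 < f (b j)" by (rule Z[THEN conjunct2, THEN conjunct1, THEN spec, THEN mp])
  show "j < m \<Longrightarrow> \<bar>real_of_int (x j)\<bar> * f (b j) \<le> C * f (comb m b x)"
    by (rule Z[THEN conjunct2, THEN conjunct2, THEN conjunct1, THEN spec, THEN spec, THEN mp])
  show "i \<le> j \<Longrightarrow> j < m \<Longrightarrow> f (b i) \<le> C * f (b j)"
    by (rule Z[THEN conjunct2, THEN conjunct2, THEN conjunct2, THEN spec, THEN spec, THEN mp, THEN mp])
qed

lemma reduced_basis_zaut:
  assumes "zaut m g g'" "znorm m f" "reduced_basis m C (f \<circ> g') b"
  shows "reduced_basis m C f (\<lambda>j. g' (b j))"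
  unfolding reduced_basis_def
proof (intro conjI allI impI)
  fix v :: zvec
  from assms(3) have "\<forall>v. \<exists>x. \<forall>i<m. v i = comb m b x i" unfolding reduced_basis_def by (elim conjE)
  from this[THEN spec, of "g v"] obtain x where x: "\<forall>i<m. g v i = comb m b x i" by (elim exE)
  from zautD(6)[OF assms(1) x] show "\<exists>x. \<forall>i<m. v i = comb m (\<lambda>j. g' (b j)) x i"
    unfolding zaut_comb[OF assms(1)] zautD(4)[OF assms(1)] by (rule exI[of _ x])
qed (use assms(3) in \<open>auto simp: reduced_basis_def zaut_comb[OF assms(1), symmetric]\<close>)

text \<open>The new basis consists of the first vector and short lifts of a reduced basis of the
  quotient. The later coordinates are seen in the quotient; the first one is what remains, and the
  triangle inequality for it gives the constant.\<close>

lemma reduced_basis_step: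
  assumes f: "znorm (Suc m) f" and short: "\<And>v. \<exists>i<Suc m. v i \<noteq> 0 \<Longrightarrow> f (vcons 1 (\<lambda>_. 0)) \<le> 3 / 2 * f v"
    and b: "reduced_basis m C (qnorm f) b" "1 \<le> C"
  shows "\<exists>b'. reduced_basis (Suc m) (2 + 5 * C * real (Suc m)) f b'"
proof -
  let ?C = "2 + 5 * C * real (Suc m)"
  let ?e = "vcons 1 (\<lambda>_. 0)"
  have qn: "znorm m (qnorm f)" by (rule znorm_qnorm[OF f short])
  have lift: "\<exists>j. f (vcons j v) \<le> 5 * qnorm f v" for v by (rule qnorm_lift[OF f short])
  have le1: "qnorm f v \<le> f (vcons k v)" for v k by (rule qnorm_le1[OF f short])
  have pos: "0 < f ?e" by (rule short_pos[OF f short])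
  have "\<forall>j. \<exists>i. f (vcons i (b j)) \<le> 5 * qnorm f (b j)" using lift by (intro allI)
  from choice[OF this] obtain k where "\<forall>j. f (vcons (k j) (b j)) \<le> 5 * qnorm f (b j)" by (elim exE)
  hence k: "f (vcons (k j) (b j)) \<le> 5 * qnorm f (b j)" for j by (rule spec)
  define b' where "b' = (\<lambda>j. case j of 0 \<Rightarrow> ?e | Suc i \<Rightarrow> vcons (k i) (b i))"
  have b'_simps: "b' 0 = ?e" "\<And>i. b' (Suc i) = vcons (k i) (b i)" by (simp_all add: b'_def)
  note B = reduced_basisD[OF b(1)]
  have "?C = 2 + 5 * C + 5 * C * real m" by (simp add: algebra_simps)
  moreover have "0 \<le> 5 * C * real m" using b(2) by simp
  ultimately have C5: "5 * C \<le> ?C" by linarith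
  have C2: "2 \<le> ?C" using b(2) by simp
  have cb: "comb (Suc m) b' x = vcons (x 0 + (\<Sum>j<m. x (Suc j) * k j)) (comb m b (\<lambda>j. x (Suc j)))" for x
    unfolding comb_Suc b'_simps by (auto simp: comb_def vcons_def fun_eq_iff split: nat.splits)
  have nz: "\<exists>i<Suc m. b' j i \<noteq> 0" if "j < Suc m" for j
  proof (cases j)
    case 0
    thus ?thesis by (intro exI[of _ 0]) (simp add: b'_simps)
  next
    case (Suc l)
    have "\<exists>i<m. b l i \<noteq> 0"
    proof (rule ccontr)
      assume "\<not> (\<exists>i<m. b l i \<noteq> 0)"
      hence "qnorm f (b l) = qnorm f (\<lambda>_. 0)" by (intro znormD(3)[OF qn]) auto
      thus False using B(2)[of l] that Suc znormD(4)[OF qn] by simp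
    qed
    then obtain i where "i < m" "b l i \<noteq> 0" by blast
    thus ?thesis using Suc by (intro exI[of _ "Suc i"]) (simp add: b'_simps)
  qed
  have f0: "0 \<le> f v" for v by (rule znormD(5)[OF f])
  have fpos: "0 < f (b' j)" if "j < Suc m" for j using short[OF nz[OF that]] pos by linarith
  have main: "\<bar>real_of_int (x (Suc j))\<bar> * f (b' (Suc j)) \<le> 5 * C * f (comb (Suc m) b' x)" if "j < m" for x j
  proof -
    have "\<bar>real_of_int (x (Suc j))\<bar> * f (b' (Suc j)) \<le> \<bar>real_of_int (x (Suc j))\<bar> * (5 * qnorm f (b j))"
      unfolding b'_simps by (intro mult_left_mono k) auto
    also have "\<dots> \<le> 5 * (C * qnorm f (comb m b (\<lambda>j. x (Suc j))))"
      using B(3)[OF that, of "\<lambda>j. x (Suc j)"] by (simp add: mult.left_commute)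
    also have "\<dots> \<le> 5 * (C * f (comb (Suc m) b' x))"
      unfolding cb using b(2) le1 by (intro mult_left_mono) auto
    finally show ?thesis by simp
  qed
  have "reduced_basis (Suc m) ?C f b'"
    unfolding reduced_basis_def
  proof (intro conjI allI impI)
    fix v :: zvec
    obtain x where x: "\<forall>i<m. v (Suc i) = comb m b x i" using B(1)[of "\<lambda>i. v (Suc i)"] by (elim exE)
    define y where "y = (\<lambda>j. case j of 0 \<Rightarrow> v 0 - (\<Sum>j<m. x j * k j) | Suc i \<Rightarrow> x i)"
    have "v i = comb (Suc m) b' y i" if "i < Suc m" for i
      using x that unfolding cb by (cases i) (auto simp: y_def)
    thus "\<exists>x. \<forall>i<Suc m. v i = comb (Suc m) b' x i" by blast
  next
    fix x j assume j: "j < Suc m"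
    show "\<bar>real_of_int (x j)\<bar> * f (b' j) \<le> ?C * f (comb (Suc m) b' x)"
    proof (cases j)
      case (Suc l)
      have "5 * C * f (comb (Suc m) b' x) \<le> ?C * f (comb (Suc m) b' x)" using C5 f0 by (intro mult_right_mono)
      thus ?thesis using main[of l x] j Suc by simp
    next
      case 0
      let ?F = "f (comb (Suc m) b' x)"
      have s: "f (comb l (\<lambda>j. b' (Suc j)) (\<lambda>j. x (Suc j))) \<le> real l * (5 * C * ?F)" if "l \<le> m" for l
        using that
      proof (induction l)
        case 0
        thus ?case using znormD(4)[OF f] by (simp add: comb_def)
      next
        case (Suc l)
        have "comb (Suc l) (\<lambda>j. b' (Suc j)) (\<lambda>j. x (Suc j)) = (\<lambda>i. comb l (\<lambda>j. b' (Suc j)) (\<lambda>j. x (Suc j)) i + x (Suc l) * b' (Suc l) i)"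
          by (simp add: comb_def)
        hence "f (comb (Suc l) (\<lambda>j. b' (Suc j)) (\<lambda>j. x (Suc j))) \<le> f (comb l (\<lambda>j. b' (Suc j)) (\<lambda>j. x (Suc j))) + \<bar>real_of_int (x (Suc l))\<bar> * f (b' (Suc l))"
          using znormD(1)[OF f, of "comb l (\<lambda>j. b' (Suc j)) (\<lambda>j. x (Suc j))" "\<lambda>i. x (Suc l) * b' (Suc l) i"]
            znormD(2)[OF f, of "x (Suc l)" "b' (Suc l)"] by simp
        also have "\<dots> \<le> real l * (5 * C * ?F) + 5 * C * ?F" using Suc main[of l x] by (intro add_mono) auto
        finally show ?case by (simp add: algebra_simps)
      qed
      have "(\<lambda>i. x 0 * b' 0 i) = (\<lambda>i. comb (Suc m) b' x i + (-1) * comb m (\<lambda>j. b' (Suc j)) (\<lambda>j. x (Suc j)) i)"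
        by (simp add: comb_Suc)
      hence "\<bar>real_of_int (x 0)\<bar> * f (b' 0) \<le> ?F + f (comb m (\<lambda>j. b' (Suc j)) (\<lambda>j. x (Suc j)))"
        using znormD(1)[OF f, of "comb (Suc m) b' x" "\<lambda>i. (-1) * comb m (\<lambda>j. b' (Suc j)) (\<lambda>j. x (Suc j)) i"]
          znormD(2)[OF f, of "-1" "comb m (\<lambda>j. b' (Suc j)) (\<lambda>j. x (Suc j))"] znormD(2)[OF f, of "x 0" "b' 0"] by simp
      also have "\<dots> \<le> ?F + real m * (5 * C * ?F)" using s[of m] by simp
      also have "\<dots> \<le> ?C * ?F"
      proof -
        have "0 \<le> ?F + 5 * C * ?F" using f0 b(2) by (intro add_nonneg_nonneg mult_nonneg_nonneg) auto
        moreover have "?C * ?F = ?F + real m * (5 * C * ?F) + (?F + 5 * C * ?F)" by (simp add: algebra_simps)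
        ultimately show ?thesis by linarith
      qed
      finally show ?thesis using 0 by simp
    qed
  next
    fix i j assume ij: "i \<le> j" "j < Suc m"
    have Cf: "c * f (b' j) \<le> ?C * f (b' j)" if "c \<le> ?C" for c using that f0 by (rule mult_right_mono)
    show "f (b' i) \<le> ?C * f (b' j)"
    proof (cases i)
      case 0
      have "f (b' i) \<le> 3 / 2 * f (b' j)" using 0 short[OF nz[OF ij(2)]] by (simp add: b'_simps)
      thus ?thesis using Cf[of "3 / 2"] C2 by linarith
    next
      case (Suc i')
      then obtain j' where j': "j = Suc j'" "i' \<le> j'" "j' < m" using ij by (cases j) auto
      have "f (b' i) \<le> 5 * qnorm f (b i')" using k Suc by (simp add: b'_simps)
      also have "\<dots> \<le> 5 * (C * qnorm f (b j'))" using B(4)[OF j'(2,3)] by (intro mult_left_mono) simp_all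
      also have "\<dots> \<le> 5 * (C * f (b' j))" using le1 b(2) j'(1) by (intro mult_left_mono) (auto simp: b'_simps)
      finally show ?thesis using Cf[OF C5] by simp
    qed
  qed (rule fpos)
  thus ?thesis by blast
qed

theorem reduced_basis_exists: "\<exists>C\<ge>1. \<forall>f. znorm m f \<longrightarrow> (\<exists>b. reduced_basis m C f b)"
proof (induction m)
  case 0
  show ?case by (intro exI[of _ 1]) (auto simp: reduced_basis_def)
next
  case (Suc m)
  then obtain C where C: "C \<ge> 1" "\<And>f. znorm m f \<Longrightarrow> \<exists>b. reduced_basis m C f b" by blast
  show ?case
  proof (intro exI[of _ "2 + 5 * C * real (Suc m)"] conjI allI impI)
    show "1 \<le> 2 + 5 * C * real (Suc m)" using C(1) by simp
    fix f assume f: "znorm (Suc m) f"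
    let ?S = "{v :: zvec. \<exists>i<Suc m. v i \<noteq> 0}"
    obtain e where e: "e > 0" "\<And>v. v \<in> ?S \<Longrightarrow> e \<le> f v" using f unfolding znorm_def by blast
    have "(\<lambda>_. 1) \<in> ?S" by auto
    hence "?S \<noteq> {}" by (metis empty_iff)
    hence "\<exists>u\<in>?S. \<forall>v\<in>?S. f u \<le> 3 / 2 * f v" by (rule approx_min[where g = f, OF _ e])
    then obtain u where u: "u \<in> ?S" "\<forall>v\<in>?S. f u \<le> 3 / 2 * f v" by (elim bexE)
    obtain g g' where g: "zaut (Suc m) g g'" "\<forall>i. 1 \<le> i \<longrightarrow> i < Suc m \<longrightarrow> g u i = 0" using zaut_euclid[of "Suc m" u] by (elim exE conjE)
    note inv = zautD(4,3)[OF g(1)]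
    have loc: "\<forall>i<Suc m. g u i = g v i" "\<forall>i<Suc m. g' u i = g' v i" if "\<forall>i<Suc m. u i = v i" for u v
      using zautD(5,6)[OF g(1) that] .
    have lin: "g (\<lambda>i. a * u i + b * v i) = (\<lambda>i. a * g u i + b * g v i)" "g' (\<lambda>i. a * u i + b * v i) = (\<lambda>i. a * g' u i + b * g' v i)"
      for a b u v by (rule zautD[OF g(1)])+
    have z: "g (\<lambda>_. 0) = (\<lambda>_. 0)" "g' (\<lambda>_. 0) = (\<lambda>_. 0)" using lin[of 0 "\<lambda>_. 0" 0 "\<lambda>_. 0"] by simp_all
    have nS: "v \<notin> ?S \<longleftrightarrow> (\<forall>i<Suc m. v i = (\<lambda>_. 0) i)" for v by simp
    have zg: "g v \<notin> ?S" "g' v \<notin> ?S" if "v \<notin> ?S" for v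
    proof -
      from that have "\<forall>i<Suc m. v i = (\<lambda>_. 0) i" unfolding nS .
      from loc[OF this] show "g v \<notin> ?S" "g' v \<notin> ?S" unfolding nS z by simp_all
    qed
    have nz: "g v \<in> ?S \<longleftrightarrow> v \<in> ?S" "g' v \<in> ?S \<longleftrightarrow> v \<in> ?S" for v
      using zg(1)[of v] zg(2)[of "g v"] zg(2)[of v] zg(1)[of "g' v"] unfolding inv by argo+
    have f': "znorm (Suc m) (f \<circ> g')"
      unfolding znorm_def
    proof (intro conjI allI impI)
      fix u v :: zvec and k :: int
      have "g' (\<lambda>i. u i + v i) = (\<lambda>i. g' u i + g' v i)" using lin(2)[of 1 u 1 v] by (simp only: mult_1)
      thus "(f \<circ> g') (\<lambda>i. u i + v i) \<le> (f \<circ> g') u + (f \<circ> g') v"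
        unfolding comp_apply using znormD(1)[OF f] by (simp only:)
      have "g' (\<lambda>i. k * v i) = (\<lambda>i. k * g' v i)" using lin(2)[of k v 0 v] by (simp only: mult_zero_left add_0_right)
      thus "(f \<circ> g') (\<lambda>i. k * v i) = \<bar>real_of_int k\<bar> * (f \<circ> g') v"
        unfolding comp_apply using znormD(2)[OF f] by (simp only:)
    next
      fix u v :: zvec
      assume "\<forall>i<Suc m. u i = v i"
      from loc(2)[OF this] show "(f \<circ> g') u = (f \<circ> g') v" unfolding comp_apply by (intro znormD(3)[OF f]) blast
    next
      have "e \<le> (f \<circ> g') v" if "\<exists>i<Suc m. v i \<noteq> 0" for v
        unfolding comp_apply by (rule e(2)) (use that nz(2)[of v] in blast)
      thus "\<exists>e>0. \<forall>v. (\<exists>i<Suc m. v i \<noteq> 0) \<longrightarrow> e \<le> (f \<circ> g') v" using e(1) by blast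
    qed
    have short: "(f \<circ> g') (vcons 1 (\<lambda>_. 0)) \<le> 3 / 2 * (f \<circ> g') v" if "\<exists>i<Suc m. v i \<noteq> 0" for v
    proof -
      let ?e = "vcons 1 (\<lambda>_. 0)"
      have gu: "\<forall>i<Suc m. g u i = g u 0 * ?e i"
      proof (intro allI impI)
        fix i assume "i < Suc m"
        thus "g u i = g u 0 * ?e i" using g(2)[THEN spec, of i] by (cases i) simp_all
      qed
      have "g u 0 \<noteq> 0"
      proof
        assume 0: "g u 0 = 0"
        have "g u \<notin> ?S" unfolding nS
        proof (intro allI impI)
          fix i assume "i < Suc m"
          with gu have "g u i = g u 0 * ?e i" by blast
          thus "g u i = 0" unfolding 0 by simp
        qed
        thus False using nz(1) u(1) by blast
      qed
      \<comment> \<open>\<open>g\<close> carries u to a multiple of the first unit vector. Dividing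
        by this multiple does not increase the norm, so the primitive vector is nearly shortest as
        well.\<close>
      hence d: "1 \<le> \<bar>real_of_int (g u 0)\<bar>" by linarith
      have "f u = (f \<circ> g') (g u)" by (simp only: comp_apply inv)
      also have "\<dots> = (f \<circ> g') (\<lambda>i. g u 0 * ?e i)" by (rule znormD(3)[OF f']) (use gu in blast)
      also have "\<dots> = \<bar>real_of_int (g u 0)\<bar> * (f \<circ> g') ?e" by (rule znormD(2)[OF f'])
      finally have "(f \<circ> g') ?e \<le> f u" using mult_right_mono[OF d znormD(5)[OF f', of ?e]] by simp
      also have "\<dots> \<le> 3 / 2 * f (g' v)" by (rule u(2)[THEN bspec]) (use that nz(2)[of v] in blast)
      finally show ?thesis by simp
    qed
    have "znorm m (qnorm (f \<circ> g'))" by (rule znorm_qnorm[OF f' short])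
    from C(2)[OF this] obtain b where b: "reduced_basis m C (qnorm (f \<circ> g')) b" ..
    have "\<exists>b'. reduced_basis (Suc m) (2 + 5 * C * real (Suc m)) (f \<circ> g') b'"
      by (rule reduced_basis_step[OF f' short b C(1)])
    then obtain b' where "reduced_basis (Suc m) (2 + 5 * C * real (Suc m)) (f \<circ> g') b'" ..
    from reduced_basis_zaut[OF g(1) f this] show "\<exists>b. reduced_basis (Suc m) (2 + 5 * C * real (Suc m)) f b" by blast
  qed
qed

section \<open>Decomposition into elementary factors\<close>

lemma act_diag:
  assumes "D \<in> carrier_mat n n" "\<And>i j. i < n \<Longrightarrow> j < n \<Longrightarrow> i \<noteq> j \<Longrightarrow> D $$ (i, j) = 0" "i < n"
  shows "act D v i = real_of_int (D $$ (i, i)) * v i"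
proof -
  have "(\<Sum>j<n. real_of_int (D $$ (i, j)) * v j) = (\<Sum>j<n. if j = i then real_of_int (D $$ (i, i)) * v i else 0)"
    using assms by (intro sum.cong) auto
  thus ?thesis using assms by (simp add: act_def)
qed

lemma mat_mult_entry:
  assumes "M \<in> carrier_mat n n" "N \<in> carrier_mat n n" "i < n" "j < n"
  shows "(M * N) $$ (i, j) = (\<Sum>k<n. M $$ (i, k) * N $$ (k, j))"
  using assms by (auto simp: scalar_prod_def atLeast0LessThan intro!: sum.cong)

context SL_presentation
begin

lemma sign_word:
  assumes "finite J" "J \<subseteq> {..<n}" "even (card J)"
  shows "\<exists>l. (\<forall>g\<in>set l. ewf g \<and> within_block \<beta> g) \<and> eprod l = (\<lambda>v i. if i \<in> J then - v i else v i)"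
  using assms
proof (induction "card J" arbitrary: J rule: less_induct)
  case less
  show ?case
  proof (cases "J = {}")
    case True
    thus ?thesis by (intro exI[of _ "[]"]) auto
  next
    case False
    then obtain i where i: "i \<in> J" by blast
    have "card (J - {i}) \<noteq> 0"
    proof
      assume "card (J - {i}) = 0"
      hence "card J = 1" using card.remove[OF less.prems(1) i] by simp
      thus False using less.prems(3) by simp
    qed
    then obtain j where j: "j \<in> J" "j \<noteq> i" by (metis Diff_iff card.empty insertCI ex_in_conv)
    let ?J = "J - {i, j}"
    have c: "card ?J = card J - 2" "2 \<le> card J"
      using less.prems i j card_Diff_subset[of "{i, j}" J] card_mono[of J "{i, j}"] by auto
    obtain l where l: "\<forall>g\<in>set l. ewf g \<and> within_block \<beta> g" "eprod l = (\<lambda>v i. if i \<in> ?J then - v i else v i)"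
      using less.hyps[of ?J] c less.prems by auto
    have "eprod (SG i j # l) = (\<lambda>v k. if k \<in> J then - v k else v k)"
      using i j by (intro HOL.ext) (auto simp: l(2) Sg_def)
    moreover have "ewf (SG i j)" using i j less.prems(2) by (auto simp: rt_def)
    ultimately show ?thesis using l(1) by (intro exI[of _ "SG i j # l"]) auto
  qed
qed

section \<open>Row reduction within the blocks\<close>

definition gen_by :: "(nat \<Rightarrow> nat) \<Rightarrow> int mat \<Rightarrow> bool" where
  "gen_by \<beta> D \<longleftrightarrow> (\<exists>l. (\<forall>g\<in>set l. ewf g \<and> within_block \<beta> g) \<and> eprod l = act D)"

lemma gen_by_diag:
  assumes "D \<in> SL n" "\<And>i j. i < n \<Longrightarrow> j < n \<Longrightarrow> i \<noteq> j \<Longrightarrow> D $$ (i, j) = 0"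
  shows "gen_by \<beta> D"
proof -
  note D = SL_D[OF assms(1)]
  note N = SL_inv[OF assms(1)]
  have unit: "D $$ (i, i) = 1 \<or> D $$ (i, i) = -1" if i: "i < n" for i
  proof -
    have "(D * SL_inv n D) $$ (i, i) = (\<Sum>k<n. if k = i then D $$ (i, i) * SL_inv n D $$ (i, i) else 0)"
      unfolding mat_mult_entry[OF D(1) SL_D(1)[OF N(1)] i i] using assms(2) i by (intro sum.cong) auto
    hence "D $$ (i, i) * SL_inv n D $$ (i, i) = 1" using i N(2) by simp
    thus ?thesis by (metis zmult_eq_1_iff)
  qed
  define J where "J = {i. i < n \<and> D $$ (i, i) = -1}"
  have "det D = (\<Prod>i = 0..<n. D $$ (i, i))"
    using det_upper_triangular[OF _ D(1)] assms(2) D(1) prod_list_diag_prod[of D] by (auto simp: upper_triangular_def)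
  also have "\<dots> = (\<Prod>i\<in>{0..<n}. if i \<in> J then -1 else 1)"
    using unit by (intro prod.cong) (auto simp: J_def)
  also have "\<dots> = (-1) ^ card J"
  proof -
    have "{0..<n} \<inter> J = J" by (auto simp: J_def)
    thus ?thesis by (simp add: prod.If_cases)
  qed
  finally have "even (card J)" using D(2) by (cases "even (card J)") auto
  then obtain l where l: "\<forall>g\<in>set l. ewf g \<and> within_block \<beta> g" "eprod l = (\<lambda>v i. if i \<in> J then - v i else v i)"
    using sign_word[of J] by (auto simp: J_def)
  have "act D v i = (if i \<in> J then - v i else v i)" for v i
    using act_diag[OF D(1) assms(2)] unit[of i] D(1) by (cases "i < n") (auto simp: J_def act_def)
  hence "eprod l = act D" unfolding l(2) by (intro HOL.ext) simp
  thus ?thesis unfolding gen_by_def using l(1) by blast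
qed

lemma gen_by_addrow:
  assumes "gen_by \<beta> (addrow x k l D)" "k < n" "l < n" "k \<noteq> l" "\<beta> k = \<beta> l" "D \<in> carrier_mat n n"
  shows "gen_by \<beta> D"
proof -
  obtain w where w: "\<forall>g\<in>set w. ewf g \<and> within_block \<beta> g" "eprod w = act (addrow x k l D)"
    using assms(1) by (auto simp: gen_by_def)
  have "act (addrow x k l D) = E k l (real_of_int x) \<circ> act D"
    unfolding addrow_mat[OF assms(6,3)] using act_mult[of "addrow_mat n x k l" n D] assms act_E by simp
  hence "eprod (EL k l (- x) # w) = (E k l (- real_of_int x) \<circ> E k l (real_of_int x)) \<circ> act D"
    using w(2) comp_assoc[of "E k l (- real_of_int x)" "E k l (real_of_int x)" "act D"] by (simp add: comp_def)
  also have "E k l (- real_of_int x) \<circ> E k l (real_of_int x) = id" using assms(4) by (intro HOL.ext) (simp add: E_def)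
  finally have "eprod (EL k l (- x) # w) = act D" by (simp add: comp_def)
  thus ?thesis unfolding gen_by_def using w(1) assms by (intro exI[of _ "EL k l (- x) # w"]) (auto simp: rt_def)
qed

definition cleared :: "(nat \<Rightarrow> nat) \<Rightarrow> nat \<Rightarrow> int mat \<Rightarrow> bool" where
  "cleared \<beta> c D \<longleftrightarrow> D \<in> SL n \<and> (\<forall>i<n. \<forall>j<n. \<beta> i \<noteq> \<beta> j \<longrightarrow> D $$ (i, j) = 0) \<and> (\<forall>j<c. \<forall>i<n. i \<noteq> j \<longrightarrow> D $$ (i, j) = 0)"

lemma addrow_entry:
  assumes "D \<in> carrier_mat n n" "i < n" "j < n"
  shows "addrow x k l D $$ (i, j) = (if k = i then x * D $$ (l, j) + D $$ (i, j) else D $$ (i, j))"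
  using assms by auto

lemma cleared_addrow:
  assumes "cleared \<beta> c D" "k < n" "l < n" "k \<noteq> l" "\<beta> k = \<beta> l" "c \<le> l" "c \<le> n"
  shows "cleared \<beta> c (addrow x k l D)"
proof -
  have D: "D \<in> SL n" "D \<in> carrier_mat n n" using assms(1) SL_D by (auto simp: cleared_def)
  have "addrow x k l D \<in> SL n" unfolding addrow_mat[OF D(2) assms(3)]
    using assms D(1) by (intro mult_SL addrow_mat_SL)
  moreover have "addrow x k l D $$ (i, j) = 0" if "i < n" "j < n" "\<beta> i \<noteq> \<beta> j" for i j
    using assms that unfolding addrow_entry[OF D(2) that(1,2)] by (auto simp: cleared_def)
  moreover have "addrow x k l D $$ (i, j) = 0" if "j < c" "i < n" "i \<noteq> j" for i j
  proof -
    have "j < n" using that(1) assms(7) by simp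
    have "D $$ (i, j) = 0" "l \<noteq> j" using assms that by (auto simp: cleared_def)
    moreover have "D $$ (l, j) = 0" using assms(1,3,6) that(1) unfolding cleared_def by auto
    ultimately show ?thesis unfolding addrow_entry[OF D(2) that(2) \<open>j < n\<close>] by simp
  qed
  ultimately show ?thesis by (auto simp: cleared_def)
qed

text \<open>With a unit as pivot the entries above it are cleared one at a time; their number is the
  induction measure.\<close>

lemma pivot_step:
  assumes "\<And>D. cleared \<beta> (Suc c) D \<Longrightarrow> gen_by \<beta> D" "c < n" "cleared \<beta> c D" "\<bar>D $$ (c, c)\<bar> = 1"
    "\<And>i. c < i \<Longrightarrow> i < n \<Longrightarrow> D $$ (i, c) = 0"
  shows "gen_by \<beta> D"
  using assms(3-5)
proof (induction "card {k. k < c \<and> D $$ (k, c) \<noteq> 0}" arbitrary: D rule: less_induct)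
  case less
  have D: "D \<in> SL n" "D \<in> carrier_mat n n" using less.prems(1) SL_D by (auto simp: cleared_def)
  show ?case
  proof (cases "\<exists>k<c. D $$ (k, c) \<noteq> 0")
    case False
    have z: "D $$ (i, j) = 0" if "j < Suc c" "i < n" "i \<noteq> j" for i j
    proof (cases "j = c")
      case True
      thus ?thesis using that less.prems(3)[of i] False by (cases "i < c") auto
    next
      case f: False
      thus ?thesis using that less.prems(1) unfolding cleared_def by simp
    qed
    have "\<forall>i<n. \<forall>j<n. \<beta> i \<noteq> \<beta> j \<longrightarrow> D $$ (i, j) = 0" using less.prems(1) unfolding cleared_def by blast
    hence "cleared \<beta> (Suc c) D" unfolding cleared_def using z D(1) by simp
    thus ?thesis by (rule assms(1))
  next
    case True
    then obtain k where k: "k < c" "D $$ (k, c) \<noteq> 0" by blast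
    have kn: "k < n" using k assms(2) by simp
    have b: "\<beta> k = \<beta> c" using less.prems(1) k kn assms(2) unfolding cleared_def by blast
    let ?x = "- (D $$ (k, c) * D $$ (c, c))"
    let ?D = "addrow ?x k c D"
    have sq: "D $$ (c, c) * D $$ (c, c) = 1" using less.prems(2) by (metis abs_mult_self_eq mult_1)
    have e: "?D $$ (i, c) = (if i = k then 0 else D $$ (i, c))" if "i < n" for i
    proof -

      have "?x * D $$ (c, c) + D $$ (k, c) = D $$ (k, c) * (1 - D $$ (c, c) * D $$ (c, c))" by (simp add: algebra_simps)
      thus ?thesis using addrow_entry[OF D(2) that assms(2), of ?x k c] sq by auto
    qed
    have "{i. i < c \<and> ?D $$ (i, c) \<noteq> 0} \<subset> {i. i < c \<and> D $$ (i, c) \<noteq> 0}"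
    proof
      show "{i. i < c \<and> ?D $$ (i, c) \<noteq> 0} \<subseteq> {i. i < c \<and> D $$ (i, c) \<noteq> 0}"
      proof
        fix i assume "i \<in> {i. i < c \<and> ?D $$ (i, c) \<noteq> 0}"
        hence i: "i < c" "?D $$ (i, c) \<noteq> 0" by blast+
        have "i < n" using i(1) assms(2) by (rule less_trans)
        hence "D $$ (i, c) \<noteq> 0" using i(2) unfolding e[OF \<open>i < n\<close>] by metis
        thus "i \<in> {i. i < c \<and> D $$ (i, c) \<noteq> 0}" using i(1) by blast
      qed
      show "{i. i < c \<and> ?D $$ (i, c) \<noteq> 0} \<noteq> {i. i < c \<and> D $$ (i, c) \<noteq> 0}"
      proof -
        have "?D $$ (k, c) = 0" unfolding e[OF kn] by metis
        thus ?thesis using k by blast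
      qed
    qed
    hence "card {i. i < c \<and> ?D $$ (i, c) \<noteq> 0} < card {i. i < c \<and> D $$ (i, c) \<noteq> 0}" by (intro psubset_card_mono) auto
    moreover have "cleared \<beta> c ?D" using k kn b assms(2) less.prems(1) by (intro cleared_addrow) auto
    moreover have "\<bar>?D $$ (c, c)\<bar> = 1" unfolding e[OF assms(2)] using k(1) less.prems(2) by simp
    moreover have "?D $$ (i, c) = 0" if "c < i" "i < n" for i unfolding e[OF that(2)] using less.prems(3)[OF that] by simp
    ultimately have "gen_by \<beta> ?D" by (rule less.hyps)
    thus ?thesis by (rule gen_by_addrow) (use k kn b assms(2) D(2) in auto)
  qed
qed

text \<open>Euclid's algorithm on the rows from c on. Nonzero entries of column c share the block of
  c, so the row operations stay within blocks.\<close>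

lemma column_step:
  assumes "\<And>D. cleared \<beta> (Suc c) D \<Longrightarrow> gen_by \<beta> D" "c < n" "cleared \<beta> c D"
  shows "gen_by \<beta> D"
  using assms(3)
proof (induction "\<Sum>i\<in>{c..<n}. nat \<bar>D $$ (i, c)\<bar>" arbitrary: D rule: less_induct)
  case less
  have D: "D \<in> SL n" "D \<in> carrier_mat n n" using less.prems(1) SL_D by (auto simp: cleared_def)
  have blk: "\<beta> i = \<beta> c" if "i < n" "D $$ (i, c) \<noteq> 0" for i
    using less.prems that assms(2) unfolding cleared_def by blast
  show ?case
  proof (cases "\<exists>i k. c \<le> i \<and> c \<le> k \<and> i < n \<and> k < n \<and> i \<noteq> k \<and> D $$ (i, c) \<noteq> 0 \<and> D $$ (k, c) \<noteq> 0")
    case True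
    then obtain i k where ik: "c \<le> i" "c \<le> k" "i < n" "k < n" "i \<noteq> k" "D $$ (i, c) \<noteq> 0" "D $$ (k, c) \<noteq> 0"
       "\<bar>D $$ (i, c)\<bar> \<le> \<bar>D $$ (k, c)\<bar>" by (metis linear)
    let ?x = "- (sgn (D $$ (i, c)) * sgn (D $$ (k, c)))"
    let ?D = "addrow ?x k i D"
    have e: "?D $$ (j, c) = (if j = k then ?x * D $$ (i, c) + D $$ (k, c) else D $$ (j, c))" if "j < n" for j
      using addrow_entry[OF D(2) that assms(2), of ?x k i] by auto
    have lt: "\<bar>?x * D $$ (i, c) + D $$ (k, c)\<bar> < \<bar>D $$ (k, c)\<bar>" using abs_sub_sgn[OF ik(6,8)] by simp
    have "(\<Sum>j\<in>{c..<n}. nat \<bar>?D $$ (j, c)\<bar>) < (\<Sum>j\<in>{c..<n}. nat \<bar>D $$ (j, c)\<bar>)"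
    proof (rule sum_strict_mono_ex1)
      show "\<forall>j\<in>{c..<n}. nat \<bar>?D $$ (j, c)\<bar> \<le> nat \<bar>D $$ (j, c)\<bar>"
      proof
        fix j assume "j \<in> {c..<n}"
        hence "j < n" by simp
        thus "nat \<bar>?D $$ (j, c)\<bar> \<le> nat \<bar>D $$ (j, c)\<bar>" unfolding e[OF \<open>j < n\<close>] using lt by (cases "j = k") auto
      qed
      show "\<exists>j\<in>{c..<n}. nat \<bar>?D $$ (j, c)\<bar> < nat \<bar>D $$ (j, c)\<bar>"
      proof
        show "nat \<bar>?D $$ (k, c)\<bar> < nat \<bar>D $$ (k, c)\<bar>" unfolding e[OF ik(4)] using lt by simp
      qed (use ik in simp)
    qed (rule finite_atLeastLessThan)
    moreover have bb: "\<beta> k = \<beta> i" using blk[of i] blk[of k] ik by simp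
    have "cleared \<beta> c ?D" by (rule cleared_addrow) (use bb ik assms(2) less.prems(1) in auto)
    ultimately have "gen_by \<beta> ?D" by (rule less.hyps)
    thus ?thesis by (rule gen_by_addrow) (use ik bb D(2) in auto)
  next
    case False
    note N = SL_inv[OF D(1)]
    \<comment> \<open>Row c of the inverse vanishes before column c. So the diagonal entry of the
      product involves only rows from c on, and the one entry left there is a unit.\<close>
    have N0: "SL_inv n D $$ (c, k) = 0" if k: "k < c" for k
    proof -
      have kn: "k < n" using k assms(2) by simp
      have "(SL_inv n D * D) $$ (c, k) = (\<Sum>i<n. if i = k then SL_inv n D $$ (c, k) * D $$ (k, k) else 0)"
        unfolding mat_mult_entry[OF SL_D(1)[OF N(1)] D(2) assms(2) kn]
        using less.prems k by (intro sum.cong) (auto simp: cleared_def)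
      hence z: "SL_inv n D $$ (c, k) * D $$ (k, k) = 0" using kn assms(2) k N(3) by simp
      have "(SL_inv n D * D) $$ (k, k) = (\<Sum>i<n. if i = k then SL_inv n D $$ (k, k) * D $$ (k, k) else 0)"
        unfolding mat_mult_entry[OF SL_D(1)[OF N(1)] D(2) kn kn]
        using less.prems k by (intro sum.cong) (auto simp: cleared_def)
      hence "SL_inv n D $$ (k, k) * D $$ (k, k) = 1" using kn N(3) by simp
      thus ?thesis using z by auto
    qed
    have sum: "(\<Sum>i<n. SL_inv n D $$ (c, i) * D $$ (i, c)) = 1"
      using mat_mult_entry[OF SL_D(1)[OF N(1)] D(2) assms(2) assms(2)] N(3) assms(2) by simp
    have "\<exists>i. c \<le> i \<and> i < n \<and> D $$ (i, c) \<noteq> 0"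
    proof (rule ccontr)
      assume *: "\<not> ?thesis"
      have "(\<Sum>i<n. SL_inv n D $$ (c, i) * D $$ (i, c)) = 0"
      proof (intro sum.neutral ballI)
        fix i assume "i \<in> {..<n}"
        thus "SL_inv n D $$ (c, i) * D $$ (i, c) = 0" using N0[of i] * by (cases "i < c") auto
      qed
      thus False using sum by simp
    qed
    then obtain i where i: "c \<le> i" "i < n" "D $$ (i, c) \<noteq> 0" by blast
    have z: "D $$ (k, c) = 0" if "c \<le> k" "k < n" "k \<noteq> i" for k using False i that by blast
    have "(\<Sum>k<n. SL_inv n D $$ (c, k) * D $$ (k, c)) = (\<Sum>k<n. if k = i then SL_inv n D $$ (c, i) * D $$ (i, c) else 0)"
    proof (rule sum.cong[OF HOL.refl])
      fix k assume "k \<in> {..<n}"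
      thus "SL_inv n D $$ (c, k) * D $$ (k, c) = (if k = i then SL_inv n D $$ (c, i) * D $$ (i, c) else 0)"
        using N0[of k] z[of k] by (cases "k < c") (use i in auto)
    qed
    hence "SL_inv n D $$ (c, i) * D $$ (i, c) = 1" using sum i by simp
    hence u: "\<bar>D $$ (i, c)\<bar> = 1" by (metis abs_minus_cancel abs_one mult.commute zmult_eq_1_iff)
    show ?thesis
    proof (cases "i = c")
      case True
      show ?thesis by (rule pivot_step[OF assms(1,2) less.prems]) (use u True z in auto)
    next
      case False
      have b: "\<beta> i = \<beta> c" using blk i by blast
      \<comment> \<open>The unit stands in row i, below the diagonal: it is added to row c and then
        removed from row i.\<close>
      let ?D1 = "addrow 1 c i D"
      let ?D2 = "addrow (-1) i c ?D1"
      have c1: "cleared \<beta> c ?D1" using i b False assms(2) less.prems by (intro cleared_addrow) auto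
      have c2: "cleared \<beta> c ?D2" by (rule cleared_addrow[OF c1]) (use i b False assms(2) in auto)
      have D1: "?D1 \<in> carrier_mat n n" using D(2) by simp
      have cc: "D $$ (c, c) = 0" using z[of c] False assms(2) by simp
      have "?D2 $$ (c, c) = D $$ (i, c)"
        unfolding addrow_entry[OF D1 assms(2) assms(2)] addrow_entry[OF D(2) assms(2) assms(2)] using cc False by simp
      hence 1: "\<bar>?D2 $$ (c, c)\<bar> = 1" using u by simp
      have 2: "?D2 $$ (k, c) = 0" if k: "c < k" "k < n" for k
        unfolding addrow_entry[OF D1 k(2) assms(2)] addrow_entry[OF D(2) k(2) assms(2)] addrow_entry[OF D(2) assms(2) assms(2)]
        using z[of k] k cc by auto
      have "gen_by \<beta> ?D2" by (rule pivot_step[OF assms(1,2) c2 1 2])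
      hence "gen_by \<beta> ?D1" by (rule gen_by_addrow) (use i b False assms(2) D1 in auto)
      thus ?thesis by (rule gen_by_addrow) (use i b False assms(2) D(2) in auto)
    qed
  qed
qed

lemma gen_by_block:
  assumes "D \<in> SL n" "\<And>i j. i < n \<Longrightarrow> j < n \<Longrightarrow> \<beta> i \<noteq> \<beta> j \<Longrightarrow> D $$ (i, j) = 0"
  shows "gen_by \<beta> D"
proof -
  have "gen_by \<beta> D" if "cleared \<beta> (n - k) D" "k \<le> n" for k D
    using that
  proof (induction k arbitrary: D)
    case 0
    thus ?case by (intro gen_by_diag) (auto simp: cleared_def)
  next
    case (Suc k)
    hence e: "Suc (n - Suc k) = n - k" by simp
    show ?case
    proof (rule column_step[OF _ _ Suc.prems(1)])
      show "gen_by \<beta> D" if "cleared \<beta> (Suc (n - Suc k)) D" for D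
        using Suc.IH[of D] Suc.prems(2) that unfolding e by simp
    qed (use Suc.prems in simp)
  qed
  from this[of n D] show ?thesis using assms by (auto simp: cleared_def)
qed

text \<open>Of \<open>\<beta>\<close> only the set of pairs in a common block matters. There are
  finitely many such sets, which makes the bound in \<open>gen_by_finite\<close> independent of
  \<open>\<beta>\<close>.\<close>

fun in_pairs :: "(nat \<times> nat) set \<Rightarrow> elem \<Rightarrow> bool" where
  "in_pairs S (EL i j x) \<longleftrightarrow> (i, j) \<in> S"
| "in_pairs S (SG i j) \<longleftrightarrow> True"

lemma gen_by_finite:
  "\<exists>M. \<forall>\<beta> D. D \<in> SL n \<longrightarrow> (\<forall>i<n. \<forall>j<n. \<bar>real_of_int (D $$ (i, j))\<bar> \<le> c) \<longrightarrow> gen_by \<beta> D \<longrightarrow>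
    (\<exists>l. (\<forall>g\<in>set l. ewf g \<and> within_block \<beta> g \<and> \<bar>coef g\<bar> \<le> int M) \<and> eprod l = act D \<and> length l \<le> M)"
proof -
  let ?D = "{M :: int mat. M \<in> carrier_mat n n \<and> (\<forall>i<n. \<forall>j<n. \<bar>real_of_int (M $$ (i, j))\<bar> \<le> c)}"
  let ?I = "Pow ({..<n} \<times> {..<n}) \<times> ?D"
  define G where "G = (\<lambda>S D l. (\<forall>g\<in>set l. ewf g \<and> in_pairs S g) \<and> eprod l = act D)"
  define sel where "sel = (\<lambda>S D. SOME l. G S D l)"
  define mu :: "elem list \<Rightarrow> nat" where "mu = (\<lambda>l. length l + sum_list (map (\<lambda>g. nat \<bar>coef g\<bar>) l))"
  define M where "M = (\<Sum>(S, D)\<in>?I. mu (sel S D))"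
  have fin: "finite ?I" using finite_mats by blast
  have le: "mu (sel S D) \<le> M" if "S \<subseteq> {..<n} \<times> {..<n}" "D \<in> ?D" for S D
  proof -
    have "(S, D) \<in> ?I" using that by blast
    from member_le_sum[OF this _ fin, of "\<lambda>(S, D). mu (sel S D)"] show ?thesis by (simp add: M_def)
  qed
  show ?thesis
  proof (intro exI[of _ M] allI impI)
    fix \<beta> D assume D: "D \<in> SL n" "\<forall>i<n. \<forall>j<n. \<bar>real_of_int (D $$ (i, j))\<bar> \<le> c" "gen_by \<beta> D"
    define S where "S = {(i, j). i < n \<and> j < n \<and> \<beta> i = \<beta> j}"
    have S: "S \<subseteq> {..<n} \<times> {..<n}" by (auto simp: S_def)
    have eqv: "ewf g \<Longrightarrow> within_block \<beta> g \<longleftrightarrow> in_pairs S g" for g by (cases g) (auto simp: S_def rt_def)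
    obtain l where "\<forall>g\<in>set l. ewf g \<and> within_block \<beta> g" "eprod l = act D" using D(3) unfolding gen_by_def by blast
    hence "G S D l" unfolding G_def using eqv by blast
    hence "G S D (sel S D)" unfolding sel_def by (rule someI)
    hence sel: "\<forall>g\<in>set (sel S D). ewf g \<and> within_block \<beta> g" "eprod (sel S D) = act D" unfolding G_def using eqv by blast+
    have "mu (sel S D) \<le> M" using le[OF S] D SL_D(1) by blast
    moreover have "nat \<bar>coef g\<bar> \<le> mu (sel S D)" if "g \<in> set (sel S D)" for g
      using member_le_sum_list[of "nat \<bar>coef g\<bar>" "map (\<lambda>g. nat \<bar>coef g\<bar>) (sel S D)"] that by (force simp: mu_def)
    ultimately have "\<bar>coef g\<bar> \<le> int M" if "g \<in> set (sel S D)" for g using that by force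
    moreover have "length (sel S D) \<le> M" using \<open>mu (sel S D) \<le> M\<close> by (simp add: mu_def)
    ultimately show "\<exists>l. (\<forall>g\<in>set l. ewf g \<and> within_block \<beta> g \<and> \<bar>coef g\<bar> \<le> int M) \<and> eprod l = act D \<and> length l \<le> M"
      using sel by (intro exI[of _ "sel S D"]) auto
  qed
qed

section \<open>Factorization into a block-diagonal and a unipotent matrix\<close>

definition unip_word :: "(nat \<Rightarrow> nat \<Rightarrow> int) \<Rightarrow> nat \<Rightarrow> elem list" where
  "unip_word U c = concat (map (\<lambda>j. map (\<lambda>k. EL k j (U k j)) [0..<j]) (rev [0..<c]))"

lemma unip_word_Suc: "unip_word U (Suc c) = map (\<lambda>k. EL k c (U k c)) [0..<c] @ unip_word U c"
  by (simp add: unip_word_def)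

text \<open>The columns come in decreasing order, so the factor of column c acts after the smaller
  ones and still finds coordinate c unchanged. Hence no products of coefficients arise.\<close>

lemma eprod_unip_word: "eprod (unip_word U c) v i = v i + (\<Sum>j\<in>{i<..<c}. real_of_int (U i j) * v j)"
proof (induction c arbitrary: i)
  case 0
  show ?case by (simp add: unip_word_def)
next
  case (Suc c)
  have "eprod (unip_word U (Suc c)) v i = eprod (map (\<lambda>k. EL k c (U k c)) [0..<c]) (eprod (unip_word U c) v) i"
    by (simp add: unip_word_Suc)
  also have "\<dots> = (if i < c then eprod (unip_word U c) v i + real_of_int (U i c) * eprod (unip_word U c) v c else eprod (unip_word U c) v i)"
    by (subst eprod_column) auto
  also have "\<dots> = v i + (\<Sum>j\<in>{i<..<Suc c}. real_of_int (U i j) * v j)"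
  proof (cases "i < c")
    case True
    hence "{i<..<Suc c} = insert c {i<..<c}" by auto
    thus ?thesis using True Suc[of i] Suc[of c] by simp
  next
    case False
    hence "{i<..<Suc c} = {}" "{i<..<c} = {}" by auto
    thus ?thesis using False Suc[of i] by simp
  qed
  finally show ?case .
qed

lemma length_unip_word: "length (unip_word U c) \<le> c * c"
  by (induction c) (simp_all add: unip_word_Suc, simp add: unip_word_def)

lemma set_unip_word: "set (unip_word U c) = {EL k j (U k j) | k j. k < j \<and> j < c}"
  by (induction c) (auto simp: unip_word_Suc less_Suc_eq, simp add: unip_word_def)

text \<open>\<open>X\<close> and its inverse are block upper triangular by the weights, so their
  diagonal parts \<open>D\<close> and \<open>D'\<close> are inverse to each other and
  \<open>X = D * U\<close> with \<open>U\<close> unitriangular. \<open>D\<close> takes finitely many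
  values, and \<open>U\<close> is read off column by column.\<close>

theorem decomposition:
  assumes "0 \<le> C"
  shows "\<exists>M C'. 0 \<le> C' \<and> (\<forall>F X Y. (\<forall>i j. i \<le> j \<longrightarrow> j < n \<longrightarrow> F i \<le> F j) \<longrightarrow> 0 < F 0 \<longrightarrow> X \<in> SL n \<longrightarrow> Y \<in> SL n \<longrightarrow>
     X * Y = 1\<^sub>m n \<longrightarrow> Y * X = 1\<^sub>m n \<longrightarrow>
     (\<forall>i<n. \<forall>j<n. \<bar>real_of_int (X $$ (i, j))\<bar> * F i \<le> C * F j \<and> \<bar>real_of_int (Y $$ (i, j))\<bar> * F i \<le> C * F j) \<longrightarrow>
     (\<exists>l. (\<forall>g\<in>set l. ewf g \<and> wbound F C' g) \<and> eprod l = act X \<and> length l \<le> M))"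
proof -
  define T where "T = C + 1"
  have T: "1 \<le> T" "C < T" using assms by (auto simp: T_def)
  define C1 where "C1 = C * T ^ n"
  have Tn: "0 \<le> T ^ n" "1 \<le> T ^ n" using T by auto
  have C1: "0 \<le> C1" using assms Tn by (simp add: C1_def)
  obtain M where M: "\<And>\<beta> D. D \<in> SL n \<Longrightarrow> \<forall>i<n. \<forall>j<n. \<bar>real_of_int (D $$ (i, j))\<bar> \<le> C1 \<Longrightarrow> gen_by \<beta> D \<Longrightarrow>
    (\<exists>l. (\<forall>g\<in>set l. ewf g \<and> within_block \<beta> g \<and> \<bar>coef g\<bar> \<le> int M) \<and> eprod l = act D \<and> length l \<le> M)"
    using gen_by_finite[of C1] by blast
  \<comment> \<open>The first summand serves the letters of \<open>D\<close>: coefficients at most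
    M, weights varying by \<open>T ^ n\<close> within a block. The second bounds the entries of
    \<open>U\<close>, sums of n products.\<close>
  define C' where "C' = real M * T ^ n + real n * (C1 * T ^ n * C)"
  have C': "0 \<le> C'" "real M * T ^ n \<le> C'" "real n * (C1 * T ^ n * C) \<le> C'" using C1 Tn assms by (auto simp: C'_def)
  show ?thesis
  proof (intro exI[of _ "M + n * n"] exI[of _ C'] conjI C'(1) allI impI)
    fix F :: "nat \<Rightarrow> real" and X Y
    assume mono: "\<forall>i j. i \<le> j \<longrightarrow> j < n \<longrightarrow> F i \<le> F j" and F0: "0 < F 0" and X: "X \<in> SL n" and Y: "Y \<in> SL n"
      and XY: "X * Y = 1\<^sub>m n" and YX: "Y * X = 1\<^sub>m n"
      and w: "\<forall>i<n. \<forall>j<n. \<bar>real_of_int (X $$ (i, j))\<bar> * F i \<le> C * F j \<and> \<bar>real_of_int (Y $$ (i, j))\<bar> * F i \<le> C * F j"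
    have mono': "\<And>i j. i \<le> j \<Longrightarrow> j < n \<Longrightarrow> F i \<le> F j" using mono by blast
    have pos: "0 < F i" if "i < n" for i using mono'[of 0 i] F0 that by simp
    define \<beta> where "\<beta> = blk F T"
    have bmono: "i \<le> j \<Longrightarrow> \<beta> i \<le> \<beta> j" for i j unfolding \<beta>_def by (rule blk_mono)
    have low: "X $$ (i, j) = 0" "Y $$ (i, j) = 0" if "i < n" "j < n" "\<beta> j < \<beta> i" for i j

    proof -
      have b: "blk F T j < blk F T i" using that(3) by (simp add: \<beta>_def)
      show "X $$ (i, j) = 0" by (rule wbound_below[of F C T i j, OF mono' F0 assms T(2) that(1,2) b]) (use w that in auto)
      show "Y $$ (i, j) = 0" by (rule wbound_below[of F C T i j, OF mono' F0 assms T(2) that(1,2) b]) (use w that in auto)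
    qed
    have blkF: "F j \<le> T ^ n * F i" if "i < n" "j < n" "\<beta> i = \<beta> j" for i j

      by (rule wbound_block[of F T i j, OF mono' F0 T(1) that(1,2)]) (use that(3) in \<open>auto simp: \<beta>_def\<close>)
    have inb: "\<bar>real_of_int x\<bar> \<le> C1" if "i < n" "j < n" "\<beta> i = \<beta> j" "\<bar>real_of_int x\<bar> * F i \<le> C * F j" for i j x
    proof -
      have "C * F j \<le> C * (T ^ n * F i)" using blkF[OF that(1-3)] assms by (rule mult_left_mono)
      hence "\<bar>real_of_int x\<bar> * F i \<le> C1 * F i" using that(4) by (simp add: C1_def mult.assoc)
      thus ?thesis using pos[OF that(1)] by simp
    qed
    note Xc = SL_D(1)[OF X] and Yc = SL_D(1)[OF Y]
    define D where "D = mat n n (\<lambda>(i, j). if \<beta> i = \<beta> j then X $$ (i, j) else 0)"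
    define D' where "D' = mat n n (\<lambda>(i, j). if \<beta> i = \<beta> j then Y $$ (i, j) else 0)"
    have Dc: "D \<in> carrier_mat n n" "D' \<in> carrier_mat n n" by (simp_all add: D_def D'_def)
    have D_entry: "D $$ (i, j) = (if \<beta> i = \<beta> j then X $$ (i, j) else 0)" "D' $$ (i, j) = (if \<beta> i = \<beta> j then Y $$ (i, j) else 0)"
      if "i < n" "j < n" for i j using that by (simp_all add: D_def D'_def)
    have DD': "D * D' = 1\<^sub>m n"
    proof (rule eq_matI)
      fix i j assume "i < dim_row (1\<^sub>m n :: int mat)" "j < dim_col (1\<^sub>m n :: int mat)"
      hence ij: "i < n" "j < n" by auto
      have "(D * D') $$ (i, j) = (\<Sum>k<n. if \<beta> i = \<beta> j then X $$ (i, k) * Y $$ (k, j) else 0)"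
        unfolding mat_mult_entry[OF Dc ij]
      proof (rule sum.cong[OF HOL.refl])
        fix k assume "k \<in> {..<n}"
        hence k: "k < n" by simp
        show "D $$ (i, k) * D' $$ (k, j) = (if \<beta> i = \<beta> j then X $$ (i, k) * Y $$ (k, j) else 0)"
          unfolding D_entry[OF ij(1) k] D_entry[OF k ij(2)] using low(1)[OF ij(1) k] low(2)[OF k ij(2)]
          by (cases "\<beta> k" "\<beta> i" rule: linorder_cases) auto
      qed
      also have "\<dots> = (if \<beta> i = \<beta> j then (X * Y) $$ (i, j) else 0)"
        unfolding mat_mult_entry[OF Xc Yc ij] by simp
      also have "\<dots> = 1\<^sub>m n $$ (i, j)" using ij unfolding XY by auto
      finally show "(D * D') $$ (i, j) = 1\<^sub>m n $$ (i, j)" .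
    qed (use Dc in auto)
    define U where "U = D' * X"
    have Uc: "U \<in> carrier_mat n n" using Dc Xc by (simp add: U_def)
    have DU: "D * U = X" unfolding U_def using Dc Xc DD' by (simp add: assoc_mult_mat[symmetric, of D n n D' n X n])
    have U_entry: "U $$ (i, j) = (if i = j then 1 else 0)" if ij: "i < n" "j < n" "\<beta> j \<le> \<beta> i" for i j
    proof -
      have "U $$ (i, j) = (\<Sum>k<n. if \<beta> i = \<beta> j then Y $$ (i, k) * X $$ (k, j) else 0)"
        unfolding U_def mat_mult_entry[OF Dc(2) Xc ij(1,2)]
      proof (rule sum.cong[OF HOL.refl])
        fix k assume "k \<in> {..<n}"
        hence k: "k < n" by simp
        show "D' $$ (i, k) * X $$ (k, j) = (if \<beta> i = \<beta> j then Y $$ (i, k) * X $$ (k, j) else 0)"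
          unfolding D_entry[OF ij(1) k] using low(2)[OF ij(1) k] low(1)[OF k ij(2)] ij(3)
          by (cases "\<beta> k" "\<beta> i" rule: linorder_cases) auto
      qed
      also have "\<dots> = (if \<beta> i = \<beta> j then (Y * X) $$ (i, j) else 0)"
        unfolding mat_mult_entry[OF Yc Xc ij(1,2)] by simp
      also have "\<dots> = (if i = j then 1 else 0)" using ij unfolding YX by auto
      finally show ?thesis .
    qed
    have U_lower: "U $$ (i, j) = (if i = j then 1 else 0)" if "i < n" "j < n" "j \<le> i" for i j
      using U_entry[OF that(1,2)] bmono[OF that(3)] by blast
    have U_bound: "\<bar>real_of_int (U $$ (i, j))\<bar> * F i \<le> C' * F j" if ij: "i < n" "j < n" for i j
    proof -
      have "\<bar>real_of_int (U $$ (i, j))\<bar> = \<bar>\<Sum>k<n. real_of_int (D' $$ (i, k)) * real_of_int (X $$ (k, j))\<bar>"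
        unfolding U_def mat_mult_entry[OF Dc(2) Xc ij] by simp
      also have "\<dots> \<le> (\<Sum>k<n. \<bar>real_of_int (D' $$ (i, k)) * real_of_int (X $$ (k, j))\<bar>)" by (rule sum_abs)
      finally have "\<bar>real_of_int (U $$ (i, j))\<bar> * F i \<le> (\<Sum>k<n. \<bar>real_of_int (D' $$ (i, k)) * real_of_int (X $$ (k, j))\<bar>) * F i"
        using pos[OF ij(1)] by (intro mult_right_mono) auto
      also have "\<dots> = (\<Sum>k<n. \<bar>real_of_int (D' $$ (i, k))\<bar> * (\<bar>real_of_int (X $$ (k, j))\<bar> * F i))"
        by (simp add: sum_distrib_right abs_mult mult.assoc)
      also have "\<dots> \<le> (\<Sum>k<n. C1 * T ^ n * C * F j)"
      proof (rule sum_mono)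
        fix k assume "k \<in> {..<n}"
        hence k: "k < n" by simp
        show "\<bar>real_of_int (D' $$ (i, k))\<bar> * (\<bar>real_of_int (X $$ (k, j))\<bar> * F i) \<le> C1 * T ^ n * C * F j"
        proof (cases "\<beta> i = \<beta> k")
          case True
          have 1: "\<bar>real_of_int (D' $$ (i, k))\<bar> \<le> C1" unfolding D_entry[OF ij(1) k] using True w ij k inb[OF ij(1) k True] by simp
          have "F i \<le> T ^ n * F k" using blkF[OF k ij(1)] True by simp
          hence "\<bar>real_of_int (X $$ (k, j))\<bar> * F i \<le> \<bar>real_of_int (X $$ (k, j))\<bar> * (T ^ n * F k)" by (rule mult_left_mono) simp
          also have "\<dots> = T ^ n * (\<bar>real_of_int (X $$ (k, j))\<bar> * F k)" by simp
          also have "\<dots> \<le> T ^ n * (C * F j)" using w k ij Tn by (intro mult_left_mono) auto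
          finally have 2: "\<bar>real_of_int (X $$ (k, j))\<bar> * F i \<le> T ^ n * (C * F j)" .
          have "\<bar>real_of_int (D' $$ (i, k))\<bar> * (\<bar>real_of_int (X $$ (k, j))\<bar> * F i) \<le> C1 * (T ^ n * (C * F j))"
            using 1 2 C1 pos[OF ij(1)] by (intro mult_mono[OF 1 2]) auto
          thus ?thesis by (simp add: mult.assoc)
        next
          case False
          thus ?thesis unfolding D_entry[OF ij(1) k] using C1 Tn assms pos[OF ij(2)] by simp
        qed
      qed
      also have "\<dots> = real n * (C1 * T ^ n * C) * F j" by simp
      also have "\<dots> \<le> C' * F j" using C'(3) pos[OF ij(2)] by (intro mult_right_mono) auto
      finally show ?thesis .
    qed
    let ?u = "unip_word (\<lambda>i j. U $$ (i, j)) n"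
    have uact: "eprod ?u = act U"
    proof (intro HOL.ext)
      fix v i
      show "eprod ?u v i = act U v i"
      proof (cases "i < n")
        case True
        have "act U v i = (\<Sum>j<n. real_of_int (U $$ (i, j)) * v j)" using Uc True by (simp add: act_def)
        also have "{..<n} = {..<i} \<union> insert i {i<..<n}" using True by auto
        also have "(\<Sum>j\<in>{..<i} \<union> insert i {i<..<n}. real_of_int (U $$ (i, j)) * v j) =
          (\<Sum>j\<in>{..<i}. real_of_int (U $$ (i, j)) * v j) + (\<Sum>j\<in>insert i {i<..<n}. real_of_int (U $$ (i, j)) * v j)"
          by (rule sum.union_disjoint) auto
        also have "(\<Sum>j\<in>{..<i}. real_of_int (U $$ (i, j)) * v j) = 0"
          using U_lower[OF True] True by (intro sum.neutral) auto
        also have "(\<Sum>j\<in>insert i {i<..<n}. real_of_int (U $$ (i, j)) * v j) = v i + (\<Sum>j\<in>{i<..<n}. real_of_int (U $$ (i, j)) * v j)"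
          using U_lower[OF True True] by simp
        finally show ?thesis unfolding eprod_unip_word by simp
      next
        case False
        thus ?thesis using Uc unfolding eprod_unip_word by (simp add: act_def)
      qed
    qed
    have uwf: "\<forall>g\<in>set ?u. ewf g" unfolding set_unip_word by (auto simp: rt_def)
    \<comment> \<open>As the value of a word, \<open>U\<close> has determinant 1; thus so has
      \<open>D\<close>.\<close>
    have "val (ev ?u) \<in> SL n" by (rule val_closed[OF ev_words[OF uwf]])
    moreover have "val (ev ?u) = U" using act_inj[OF SL_D(1)[OF calculation] Uc] act_val_ev[OF uwf] uact by simp
    ultimately have "U \<in> SL n" by simp
    hence "det D = 1" using det_mult[OF Dc(1) Uc] DU SL_D(2)[OF X] SL_D(2)[of U n] by simp
    hence DSL: "D \<in> SL n" using Dc by (simp add: SL_int_def)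
    have "gen_by \<beta> D" by (rule gen_by_block[OF DSL]) (simp add: D_entry)
    moreover have "\<forall>i<n. \<forall>j<n. \<bar>real_of_int (D $$ (i, j))\<bar> \<le> C1"
    proof (intro allI impI)
      fix i j assume ij: "i < n" "j < n"
      show "\<bar>real_of_int (D $$ (i, j))\<bar> \<le> C1"
        unfolding D_entry[OF ij] using inb[OF ij] w ij C1 by auto
    qed
    ultimately obtain l where l: "\<forall>g\<in>set l. ewf g \<and> within_block \<beta> g \<and> \<bar>coef g\<bar> \<le> int M" "eprod l = act D" "length l \<le> M"
      using M[OF DSL] by blast
    have "wbound F C' g" if "g \<in> set l" for g
    proof (cases g)
      case (EL i j x)
      have ij: "i < n" "j < n" "\<beta> i = \<beta> j" "\<bar>x\<bar> \<le> int M" using l(1) that EL by (auto simp: rt_def)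
      have "\<bar>real_of_int x\<bar> \<le> real M" using ij(4) by linarith
      moreover have "F i \<le> T ^ n * F j" using blkF[OF ij(2,1)] ij(3) by simp
      ultimately have "\<bar>real_of_int x\<bar> * F i \<le> real M * (T ^ n * F j)" using pos[OF ij(1)] by (intro mult_mono) auto
      also have "\<dots> = (real M * T ^ n) * F j" by simp
      also have "\<dots> \<le> C' * F j" using C'(2) pos[OF ij(2)] by (intro mult_right_mono) auto
      finally show ?thesis using EL by simp
    qed simp
    moreover have "wbound F C' g" if "g \<in> set ?u" for g
      using that U_bound unfolding set_unip_word by auto
    moreover have "eprod (l @ ?u) = act X" using l(2) uact act_mult[OF Dc(1) Uc] DU by simp
    moreover have "length (l @ ?u) \<le> M + n * n" using l(3) length_unip_word[of "\<lambda>i j. U $$ (i, j)" n] by simp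
    ultimately show "\<exists>l. (\<forall>g\<in>set l. ewf g \<and> wbound F C' g) \<and> eprod l = act X \<and> length l \<le> M + n * n"
      using l(1) uwf by (intro exI[of _ "l @ ?u"]) auto
  qed
qed

end

section \<open>Reduced matrices for norms\<close>

definition nrm :: "nat \<Rightarrow> (nat \<Rightarrow> real) \<Rightarrow> real" where
  "nrm n u = (\<Sum>i<n. \<bar>u i\<bar>)"

abbreviation rv :: "zvec \<Rightarrow> nat \<Rightarrow> real" where
  "rv v \<equiv> (\<lambda>i. real_of_int (v i))"

definition mcol :: "int mat \<Rightarrow> nat \<Rightarrow> zvec" where
  "mcol B j = (\<lambda>i. B $$ (i, j))"

definition op_bound :: "int mat \<Rightarrow> real" where
  "op_bound M = (\<Sum>i<dim_row M. \<Sum>j<dim_row M. \<bar>real_of_int (M $$ (i, j))\<bar>)"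

lemma nrm_nonneg [simp]: "0 \<le> nrm n u"
  by (simp add: nrm_def sum_nonneg)

lemma nrm_cong: "(\<And>i. i < n \<Longrightarrow> u i = v i) \<Longrightarrow> nrm n u = nrm n v"
  unfolding nrm_def by (intro sum.cong) auto

lemma nrm_add: "nrm n (\<lambda>i. u i + v i) \<le> nrm n u + nrm n v"
  unfolding nrm_def sum.distrib[symmetric] by (intro sum_mono) auto

lemma nrm_scale: "nrm n (\<lambda>i. c * u i) = \<bar>c\<bar> * nrm n u"
  by (simp add: nrm_def abs_mult sum_distrib_left)

lemma nrm_ge: "i < n \<Longrightarrow> \<bar>u i\<bar> \<le> nrm n u"
  unfolding nrm_def by (rule member_le_sum) auto

lemma nrm_unitv: "j < n \<Longrightarrow> nrm n (unitv j) = 1"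
  by (simp add: nrm_def unitv_def if_distrib cong: if_cong)

lemma act_cong:
  assumes "M \<in> carrier_mat n n" "\<And>i. i < n \<Longrightarrow> u i = v i" "i < n"
  shows "act M u i = act M v i"
  using assms by (simp add: act_def)

lemma nrm_act_cong:
  assumes "M \<in> carrier_mat n n" "\<And>i. i < n \<Longrightarrow> u i = v i"
  shows "nrm n (act M u) = nrm n (act M v)"
  by (rule nrm_cong) (rule act_cong[OF assms])

lemma nrm_act_le:
  assumes "M \<in> carrier_mat n n"
  shows "nrm n (act M u) \<le> op_bound M * nrm n u"
proof -
  have "nrm n (act M u) \<le> (\<Sum>i<n. \<Sum>j<n. \<bar>real_of_int (M $$ (i, j))\<bar> * nrm n u)"
    unfolding nrm_def[of n "act M u"]
  proof (rule sum_mono)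
    fix i assume "i \<in> {..<n}"
    hence "act M u i = (\<Sum>j<n. real_of_int (M $$ (i, j)) * u j)" using assms by (simp add: act_def)
    hence "\<bar>act M u i\<bar> \<le> (\<Sum>j<n. \<bar>real_of_int (M $$ (i, j)) * u j\<bar>)" using sum_abs by simp
    also have "\<dots> \<le> (\<Sum>j<n. \<bar>real_of_int (M $$ (i, j))\<bar> * nrm n u)"
      by (intro sum_mono) (simp add: abs_mult mult_left_mono nrm_ge)
    finally show "\<bar>act M u i\<bar> \<le> (\<Sum>j<n. \<bar>real_of_int (M $$ (i, j))\<bar> * nrm n u)" .
  qed
  also have "\<dots> = op_bound M * nrm n u" using assms by (simp add: op_bound_def sum_distrib_right)
  finally show ?thesis .
qed

lemma nrm_act_add:
  assumes "M \<in> carrier_mat n n"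
  shows "nrm n (act M (\<lambda>i. u i + v i)) \<le> nrm n (act M u) + nrm n (act M v)"
proof -
  have "nrm n (act M (\<lambda>i. u i + v i)) = nrm n (\<lambda>i. act M u i + act M v i)"
    using assms by (intro nrm_cong) (simp add: act_def distrib_left sum.distrib)
  thus ?thesis using nrm_add[of n "act M u" "act M v"] by simp
qed

lemma nrm_act_scale:
  assumes "M \<in> carrier_mat n n"
  shows "nrm n (act M (\<lambda>i. c * u i)) = \<bar>c\<bar> * nrm n (act M u)"
proof -
  have "nrm n (act M (\<lambda>i. c * u i)) = nrm n (\<lambda>i. c * act M u i)"
    using assms by (intro nrm_cong) (simp add: act_def sum_distrib_left mult.left_commute)
  thus ?thesis by (simp add: nrm_scale)
qed

definition twonorm :: "nat \<Rightarrow> real \<Rightarrow> real \<Rightarrow> int mat \<Rightarrow> zvec \<Rightarrow> real" where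
  "twonorm n a b M v = a * nrm n (act M (rv v)) + b * nrm n (rv v)"

lemma znorm_twonorm:
  assumes "M \<in> carrier_mat n n" "0 \<le> a" "1 \<le> b"
  shows "znorm n (twonorm n a b M)"
  unfolding znorm_def
proof (intro conjI allI impI)
  fix u v :: zvec
  have "a * nrm n (act M (\<lambda>i. rv u i + rv v i)) \<le> a * (nrm n (act M (rv u)) + nrm n (act M (rv v)))"
    by (intro mult_left_mono nrm_act_add assms)
  moreover have "b * nrm n (\<lambda>i. rv u i + rv v i) \<le> b * (nrm n (rv u) + nrm n (rv v))"
    using assms by (intro mult_left_mono nrm_add) auto
  ultimately show "twonorm n a b M (\<lambda>i. u i + v i) \<le> twonorm n a b M u + twonorm n a b M v"
    unfolding twonorm_def distrib_left of_int_add by linarith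
next
  fix k :: int and v :: zvec
  show "twonorm n a b M (\<lambda>i. k * v i) = \<bar>real_of_int k\<bar> * twonorm n a b M v"
    unfolding twonorm_def of_int_mult nrm_act_scale[OF assms(1)] nrm_scale by (simp add: algebra_simps)
next
  fix u v :: zvec assume "\<forall>i<n. u i = v i"
  hence "nrm n (act M (rv u)) = nrm n (act M (rv v))" "nrm n (rv u) = nrm n (rv v)"
    by (simp_all add: nrm_act_cong[OF assms(1), of "rv u" "rv v"] nrm_cong[of n "rv u" "rv v"])
  thus "twonorm n a b M u = twonorm n a b M v" by (simp add: twonorm_def)
next
  show "\<exists>e>0. \<forall>v. (\<exists>i<n. v i \<noteq> 0) \<longrightarrow> e \<le> twonorm n a b M v"
  proof (intro exI[of _ 1] conjI allI impI)
    fix v :: zvec assume "\<exists>i<n. v i \<noteq> 0"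
    then obtain i where i: "i < n" "v i \<noteq> 0" by blast
    have "1 \<le> \<bar>rv v i\<bar>" using i(2) by linarith
    also have "\<dots> \<le> nrm n (rv v)" by (rule nrm_ge[OF i(1)])
    also have "\<dots> \<le> b * nrm n (rv v)" using mult_right_mono[OF assms(3) nrm_nonneg[of n "rv v"]] by simp
    also have "\<dots> \<le> twonorm n a b M v" unfolding twonorm_def using assms by simp
    finally show "1 \<le> twonorm n a b M v" .
  qed simp
qed

definition reduced_mat :: "nat \<Rightarrow> real \<Rightarrow> (zvec \<Rightarrow> real) \<Rightarrow> int mat \<Rightarrow> bool" where
  "reduced_mat n C f B \<longleftrightarrow> B \<in> SL n \<and> znorm n f \<and> (\<forall>j<n. 0 < f (mcol B j)) \<and>
     (\<forall>x. \<forall>j<n. \<bar>real_of_int (x j)\<bar> * f (mcol B j) \<le> C * f (comb n (mcol B) x)) \<and>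
     (\<forall>i j. i \<le> j \<longrightarrow> j < n \<longrightarrow> f (mcol B i) \<le> C * f (mcol B j))"

lemma reduced_matD:
  assumes "reduced_mat n C f B"
  shows "B \<in> SL n" "znorm n f" "j < n \<Longrightarrow> 0 < f (mcol B j)"
    "j < n \<Longrightarrow> \<bar>real_of_int (x j)\<bar> * f (mcol B j) \<le> C * f (comb n (mcol B) x)"
    "i \<le> j \<Longrightarrow> j < n \<Longrightarrow> f (mcol B i) \<le> C * f (mcol B j)"
proof -
  note Z = assms[unfolded reduced_mat_def]
  show "B \<in> SL n" by (rule Z[THEN conjunct1])
  show "znorm n f" by (rule Z[THEN conjunct2, THEN conjunct1])
  show "j < n \<Longrightarrow> 0 < f (mcol B j)" by (rule Z[THEN conjunct2, THEN conjunct2, THEN conjunct1, THEN spec, THEN mp])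
  show "j < n \<Longrightarrow> \<bar>real_of_int (x j)\<bar> * f (mcol B j) \<le> C * f (comb n (mcol B) x)"
    by (rule Z[THEN conjunct2, THEN conjunct2, THEN conjunct2, THEN conjunct1, THEN spec, THEN spec, THEN mp])
  show "i \<le> j \<Longrightarrow> j < n \<Longrightarrow> f (mcol B i) \<le> C * f (mcol B j)"
    by (rule Z[THEN conjunct2, THEN conjunct2, THEN conjunct2, THEN conjunct2, THEN spec, THEN spec, THEN mp, THEN mp])
qed

lemma reduced_matI:
  assumes "B \<in> SL n" "znorm n f" "\<And>j. j < n \<Longrightarrow> 0 < f (mcol B j)"
    "\<And>x j. j < n \<Longrightarrow> \<bar>real_of_int (x j)\<bar> * f (mcol B j) \<le> C * f (comb n (mcol B) x)"
    "\<And>i j. i \<le> j \<Longrightarrow> j < n \<Longrightarrow> f (mcol B i) \<le> C * f (mcol B j)"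
  shows "reduced_mat n C f B"
  unfolding reduced_mat_def using assms by blast

lemma reduced_mat_mono:
  assumes "reduced_mat n C f B" "C \<le> D"
  shows "reduced_mat n D f B"
proof -
  note r = reduced_matD[OF assms(1)]
  have le: "C * f v \<le> D * f v" for v using assms(2) znormD(5)[OF r(2)] by (rule mult_right_mono)
  show ?thesis
  proof (rule reduced_matI[OF r(1,2,3)])
    fix x :: "nat \<Rightarrow> int" and j assume "j < n"
    hence "\<bar>real_of_int (x j)\<bar> * f (mcol B j) \<le> C * f (comb n (mcol B) x)" by (rule r(4))
    also note le
    finally show "\<bar>real_of_int (x j)\<bar> * f (mcol B j) \<le> D * f (comb n (mcol B) x)" .
  next
    fix i j assume "i \<le> j" "j < n"
    hence "f (mcol B i) \<le> C * f (mcol B j)" by (rule r(5))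
    also note le
    finally show "f (mcol B i) \<le> D * f (mcol B j)" .
  qed
qed

text \<open>The coordinates of the unit vectors form an integral inverse, so the determinant is 1 or
  -1. Multiplying the first vector by it corrects the sign and preserves the lengths.\<close>

lemma reduced_mat_of_basis:
  assumes "0 < n" "znorm n f" "reduced_basis n C f b"
  shows "\<exists>B. reduced_mat n C f B"
proof -
  define A where "A = mat n n (\<lambda>(i, j). b j i)"
  have A: "A \<in> carrier_mat n n" by (simp add: A_def)
  define x where "x = (\<lambda>k. SOME x. \<forall>i<n. (if i = k then 1 else 0) = comb n b x i)"
  have "\<exists>x. \<forall>i<n. (if i = k then 1 else 0) = comb n b x i" for k :: nat
    by (rule reduced_basisD(1)[OF assms(3)])
  from someI_ex[OF this] have x: "(if i = k then 1 else 0) = comb n b (x k) i" if "i < n" for i k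
    unfolding x_def using that by blast
  define X where "X = mat n n (\<lambda>(j, k). x k j)"
  have X: "X \<in> carrier_mat n n" by (simp add: X_def)
  have "A * X = 1\<^sub>m n"
  proof (rule eq_matI)
    fix i k assume "i < dim_row (1\<^sub>m n :: int mat)" "k < dim_col (1\<^sub>m n :: int mat)"
    hence ik: "i < n" "k < n" by auto
    have "(A * X) $$ (i, k) = comb n b (x k) i"
      unfolding mat_mult_entry[OF A X ik] comb_def using ik by (intro sum.cong) (auto simp: A_def X_def)
    also have "\<dots> = 1\<^sub>m n $$ (i, k)" unfolding x[OF ik(1), symmetric] using ik by simp
    finally show "(A * X) $$ (i, k) = 1\<^sub>m n $$ (i, k)" .
  qed (use A X in auto)
  hence "det A * det X = 1" using det_mult[OF A X] by simp
  hence dA: "det A = 1 \<or> det A = -1" by (metis zmult_eq_1_iff)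
  define B where "B = A * multrow_mat n 0 (det A)"
  define e where "e = (\<lambda>j::nat. if j = 0 then det A else 1)"
  have e: "\<bar>e j\<bar> = 1" for j using dA by (auto simp: e_def)
  have "det B = det A * det A" unfolding B_def using det_mult[OF A multrow_mat_carrier[of n 0 "det A"]] assms(1) by (simp add: det_multrow_mat)
  hence "det B = 1" using dA by auto
  hence BSL: "B \<in> SL n" using A by (simp add: SL_int_def B_def)
  have B_entry: "B $$ (i, j) = e j * b j i" if ij: "i < n" "j < n" for i j
  proof -
    have "B $$ (i, j) = (\<Sum>k<n. if k = j then e j * b j i else 0)"
      unfolding B_def mat_mult_entry[OF A multrow_mat_carrier ij] using ij by (intro sum.cong) (auto simp: A_def e_def)
    thus ?thesis using ij by simp
  qed
  have fB: "f (mcol B j) = f (b j)" if j: "j < n" for j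
  proof -
    have "f (mcol B j) = f (\<lambda>i. e j * b j i)" by (rule znormD(3)[OF assms(2)]) (simp add: mcol_def B_entry j)
    also have "\<dots> = \<bar>real_of_int (e j)\<bar> * f (b j)" by (rule znormD(2)[OF assms(2)])
    also have "\<bar>real_of_int (e j)\<bar> = 1" using e[of j] by linarith
    finally show ?thesis by simp
  qed
  have cB: "f (comb n (mcol B) y) = f (comb n b (\<lambda>j. e j * y j))" for y
    by (rule znormD(3)[OF assms(2)]) (auto simp: comb_def mcol_def B_entry mult_ac intro!: sum.cong)
  have "\<bar>real_of_int (y j)\<bar> * f (mcol B j) \<le> C * f (comb n (mcol B) y)" if j: "j < n" for y j
  proof -
    have "\<bar>real_of_int (e j * y j)\<bar> * f (b j) \<le> C * f (comb n b (\<lambda>j. e j * y j))"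
      by (rule reduced_basisD(3)[OF assms(3) j])
    moreover have "\<bar>real_of_int (e j * y j)\<bar> = \<bar>real_of_int (y j)\<bar>" using e[of j] by (metis abs_mult mult_1 of_int_abs)
    ultimately show ?thesis unfolding cB fB[OF j] by simp
  qed
  moreover have "f (mcol B i) \<le> C * f (mcol B j)" if "i \<le> j" "j < n" for i j
    unfolding fB[OF that(2)] fB[OF le_less_trans[OF that]] by (rule reduced_basisD(4)[OF assms(3) that])
  moreover have "0 < f (mcol B j)" if "j < n" for j unfolding fB[OF that] by (rule reduced_basisD(2)[OF assms(3) that])
  ultimately have "reduced_mat n C f B" by (intro reduced_matI[OF BSL assms(2)])
  thus ?thesis ..
qed

lemma nrm_coordinates:
  assumes "Q \<in> SL n"
  shows "nrm n (act (SL_inv n Q) (rv (comb n (mcol Q) x))) = nrm n (rv x)"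
proof -
  note Q = SL_D(1)[OF assms] and Q' = SL_inv[OF assms]
  have "nrm n (act (SL_inv n Q) (rv (comb n (mcol Q) x))) = nrm n (act (SL_inv n Q) (act Q (rv x)))"
    by (rule nrm_act_cong[OF SL_D(1)[OF Q'(1)]]) (use Q in \<open>simp add: act_def comb_def mcol_def mult.commute\<close>)
  also have "act (SL_inv n Q) (act Q (rv x)) = rv x" using fun_cong[OF Q'(5), of "rv x"] by simp
  finally show ?thesis .
qed

lemma comb_unit: "j < n \<Longrightarrow> comb n b (\<lambda>i. if i = j then 1 else 0) = b j"
  by (rule HOL.ext) (simp add: comb_def if_distrib[of "\<lambda>x. x * _"] cong: if_cong)

lemma nrm_column:
  assumes "Q \<in> SL n" "j < n"
  shows "nrm n (act (SL_inv n Q) (rv (mcol Q j))) = 1"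
proof -
  have "nrm n (act (SL_inv n Q) (rv (comb n (mcol Q) (\<lambda>i. if i = j then 1 else 0)))) = nrm n (rv (\<lambda>i. if i = j then 1 else 0))"
    by (rule nrm_coordinates[OF assms(1)])
  also have "\<dots> = nrm n (unitv j)" by (rule nrm_cong) (simp add: unitv_def)
  finally show ?thesis unfolding comb_unit[OF assms(2)] nrm_unitv[OF assms(2)] .
qed

text \<open>Here \<open>f\<close> is, up to the factor 2, a multiple of the sum norm of the
  coordinates with respect to \<open>Q\<close>. This allows the bases on the boundary of the grid to
  be prescribed.\<close>

lemma reduced_mat_conformal:
  assumes "Q \<in> SL n" "znorm n f" "0 < s"
    "\<And>v. s * nrm n (act (SL_inv n Q) (rv v)) \<le> f v" "\<And>v. f v \<le> 2 * s * nrm n (act (SL_inv n Q) (rv v))"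
  shows "reduced_mat n 2 f Q"
proof -
  have lo: "s \<le> f (mcol Q j)" and hi: "f (mcol Q j) \<le> 2 * s" if "j < n" for j
    using assms(4,5)[of "mcol Q j"] nrm_column[OF assms(1) that] by auto
  have "\<bar>real_of_int (x j)\<bar> * f (mcol Q j) \<le> 2 * f (comb n (mcol Q) x)" if j: "j < n" for x j
  proof -
    have "\<bar>real_of_int (x j)\<bar> * f (mcol Q j) \<le> nrm n (rv x) * (2 * s)"
      using nrm_ge[OF j, of "rv x"] hi[OF j] lo[OF j] assms(3) by (intro mult_mono) auto
    also have "\<dots> = 2 * (s * nrm n (act (SL_inv n Q) (rv (comb n (mcol Q) x))))" unfolding nrm_coordinates[OF assms(1)] by simp
    also have "\<dots> \<le> 2 * f (comb n (mcol Q) x)" using assms(4) by (intro mult_left_mono) auto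
    finally show ?thesis .
  qed
  moreover have "f (mcol Q i) \<le> 2 * f (mcol Q j)" if "i \<le> j" "j < n" for i j
    using hi[of i] lo[of j] that by simp
  moreover have "0 < f (mcol Q j)" if "j < n" for j using lo[OF that] assms(3) by linarith
  ultimately show ?thesis by (intro reduced_matI[OF assms(1,2)])
qed

lemma SL_inv_one: "SL_inv n (1\<^sub>m n) = 1\<^sub>m n"
proof -
  interpret group "SL_int n" by (rule group_SL_int)
  show ?thesis using inv_one by simp
qed

lemma SL_inv_mult: "A \<in> SL n \<Longrightarrow> B \<in> SL n \<Longrightarrow> SL_inv n (A * B) = SL_inv n B * SL_inv n A"
proof -
  interpret group "SL_int n" by (rule group_SL_int)
  show "A \<in> SL n \<Longrightarrow> B \<in> SL n \<Longrightarrow> SL_inv n (A * B) = SL_inv n B * SL_inv n A" using inv_mult_group[of A B] by simp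
qed

lemma SL_quotient_chain:
  assumes "X \<in> SL n" "Y \<in> SL n" "Z \<in> SL n"
  shows "(SL_inv n X * Y) * (SL_inv n Y * Z) = SL_inv n X * Z"
proof -
  note i = SL_inv[OF assms(1)] SL_inv[OF assms(2)]
  have "(SL_inv n X * Y) * (SL_inv n Y * Z) = SL_inv n X * ((Y * SL_inv n Y) * Z)"
    by (simp only: SL_assoc[where n = n] mult_SL assms i(1,6))
  thus ?thesis unfolding i(7) SL_one(1)[OF assms(3)] .
qed

lemma reduced_mat_coordinates:
  assumes "reduced_mat n C f B" "B' \<in> SL n" "i < n" "k < n"
  shows "\<bar>real_of_int ((SL_inv n B * B') $$ (i, k))\<bar> * f (mcol B i) \<le> C * f (mcol B' k)"
proof -
  note r = reduced_matD[OF assms(1)]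
  note I = SL_inv[OF r(1)]
  let ?Y = "SL_inv n B * B'"
  have Y: "?Y \<in> carrier_mat n n" using mult_SL[OF I(1) assms(2)] SL_D(1) by blast
  have "B * ?Y = B'" using SL_assoc[OF r(1) I(1) assms(2)] I(2) SL_one(1)[OF assms(2)] by simp
  hence e: "B' $$ (i, k) = (\<Sum>j<n. B $$ (i, j) * ?Y $$ (j, k))" if "i < n" for i
    using mat_mult_entry[OF SL_D(1)[OF r(1)] Y that assms(4)] by simp
  have "f (comb n (mcol B) (mcol ?Y k)) = f (mcol B' k)"
  proof (rule znormD(3)[OF r(2)])
    fix i assume "i < n"
    show "comb n (mcol B) (mcol ?Y k) i = mcol B' k i"
      unfolding comb_def mcol_def e[OF \<open>i < n\<close>] by (intro sum.cong HOL.refl mult.commute)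
  qed
  moreover have "mcol ?Y k i = ?Y $$ (i, k)" by (simp only: mcol_def)
  ultimately show ?thesis using r(4)[OF assms(3), of "mcol ?Y k"] by (simp only:)
qed

text \<open>An integer matrix with a zero block of \<open>n - j\<close> rows and \<open>j + 1\<close> columns is singular.\<close>

lemma SL_corner_entry:
  assumes "Y \<in> SL n" "j < n"
  obtains i k where "j \<le> i" "i < n" "k \<le> j" "Y $$ (i, k) \<noteq> 0"
proof -
  have "det Y \<noteq> 0" using SL_D(2)[OF assms(1)] by simp
  hence "(\<Sum>p\<in>{p. p permutes {0..<n}}. signof p * (\<Prod>i = 0..<n. Y $$ (i, p i))) \<noteq> 0"
    using det_def'[OF SL_D(1)[OF assms(1)]] by simp
  from sum.not_neutral_contains_not_neutral[OF this] obtain p where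
    "p \<in> {p. p permutes {0..<n}}" and p2: "signof p * (\<Prod>i = 0..<n. Y $$ (i, p i)) \<noteq> 0" .
  hence p: "p permutes {0..<n}" by simp
  have nz: "Y $$ (i, p i) \<noteq> 0" if "i < n" for i
  proof
    assume "Y $$ (i, p i) = 0"
    hence "(\<Prod>i = 0..<n. Y $$ (i, p i)) = 0" using that by (intro prod_zero) auto
    thus False using p2 by simp
  qed
  have "\<exists>i. j \<le> i \<and> i < n \<and> p i \<le> j"
  proof (rule ccontr)
    assume "\<not> ?thesis"
    hence "p ` {j..<n} \<subseteq> {Suc j..<n}" using permutes_in_image[OF p] by force
    hence "card (p ` {j..<n}) \<le> card {Suc j..<n}" by (intro card_mono) auto
    moreover have "card (p ` {j..<n}) = card {j..<n}"
      using permutes_inj[OF p] by (intro card_image) (auto intro: inj_on_subset)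
    ultimately show False using assms(2) by simp
  qed
  thus ?thesis using nz that by blast
qed

text \<open>As for successive minima: one of the vectors 0, ..., j of \<open>B\<close> involves one
  of the vectors j, ..., n - 1 of \<open>B'\<close>, whose length it bounds. One factor
  \<open>C\<close> comes from this and one from the order of each basis.\<close>

lemma reduced_mat_compare:
  assumes "reduced_mat n C f B" "reduced_mat n C f' B'" "0 \<le> C" "0 \<le> A" "\<And>v. f' v \<le> A * f v" "j < n"
  shows "f' (mcol B' j) \<le> C ^ 3 * A * f (mcol B j)"
proof -
  note r = reduced_matD[OF assms(1)] and r' = reduced_matD[OF assms(2)]
  obtain i k where ik: "j \<le> i" "i < n" "k \<le> j" "(SL_inv n B' * B) $$ (i, k) \<noteq> 0"
    using SL_corner_entry[OF mult_SL[OF SL_inv(1)[OF r'(1)] r(1)] assms(6)] .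
  have kn: "k < n" using ik(3) assms(6) by simp
  have "1 \<le> \<bar>real_of_int ((SL_inv n B' * B) $$ (i, k))\<bar>" using ik(4) by linarith
  hence "f' (mcol B' i) \<le> \<bar>real_of_int ((SL_inv n B' * B) $$ (i, k))\<bar> * f' (mcol B' i)"
    using r'(3)[OF ik(2)] by (simp add: mult_le_cancel_right1)
  also have "\<dots> \<le> C * f' (mcol B k)" by (rule reduced_mat_coordinates[OF assms(2) r(1) ik(2) kn])
  also have "\<dots> \<le> C * (A * f (mcol B k))" by (intro mult_left_mono assms)
  also have "\<dots> \<le> C * (A * (C * f (mcol B j)))" using ik assms by (intro mult_left_mono r(5)) auto
  finally have 1: "f' (mcol B' i) \<le> C * (A * (C * f (mcol B j)))" .
  have "f' (mcol B' j) \<le> C * f' (mcol B' i)" by (rule r'(5)[OF ik(1,2)])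
  also have "\<dots> \<le> C * (C * (A * (C * f (mcol B j))))" by (rule mult_left_mono[OF 1 assms(3)])
  finally show ?thesis by (simp add: power3_eq_cube mult_ac)
qed

text \<open>Basis lengths increase only up to the factor \<open>C\<close>. The running maximum is
  monotone, as \<open>cell_fill\<close> demands, and exceeds the length by at most
  \<open>C\<close>.\<close>

definition wt :: "(zvec \<Rightarrow> real) \<Rightarrow> int mat \<Rightarrow> nat \<Rightarrow> real" where
  "wt f B i = Max ((\<lambda>k. f (mcol B k)) ` {..i})"

lemma wt_mono: "i \<le> j \<Longrightarrow> wt f B i \<le> wt f B j"
  unfolding wt_def by (intro Max_mono image_mono) auto

lemma wt_ge: "f (mcol B i) \<le> wt f B i"
  unfolding wt_def by (rule Max_ge) auto

lemma wt_le: "reduced_mat n C f B \<Longrightarrow> i < n \<Longrightarrow> wt f B i \<le> C * f (mcol B i)"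
  unfolding wt_def by (subst Max_le_iff) (auto intro: reduced_matD(5))

lemma wt_pos: "reduced_mat n C f B \<Longrightarrow> i < n \<Longrightarrow> 0 < wt f B i"
  using wt_ge[of f B i] reduced_matD(3)[of n C f B i] by linarith

lemma wt_compare:
  assumes "reduced_mat n C f B" "reduced_mat n C f' B'" "0 \<le> C" "0 \<le> A" "\<And>v. f' v \<le> A * f v" "j < n"
  shows "wt f' B' j \<le> C ^ 4 * A * wt f B j"
proof -
  have "wt f' B' j \<le> C * f' (mcol B' j)" by (rule wt_le[OF assms(2,6)])
  also have "\<dots> \<le> C * (C ^ 3 * A * f (mcol B j))" by (intro mult_left_mono reduced_mat_compare[OF assms] assms)
  also have "\<dots> = C ^ 4 * A * f (mcol B j)" by (simp add: power_def eval_nat_numeral mult_ac)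
  also have "\<dots> \<le> C ^ 4 * A * wt f B j" using assms by (intro mult_left_mono wt_ge) auto
  finally show ?thesis .
qed

section \<open>The filling grid\<close>

fun inv_elem :: "elem \<Rightarrow> elem" where
  "inv_elem (EL i j x) = EL i j (- x)"
| "inv_elem (SG i j) = SG i j"

lemma eprod_inv_elems:
  assumes "\<forall>g\<in>set l. \<exists>i j. eidx g = {i, j} \<and> i \<noteq> j"
  shows "eprod (rev (map inv_elem l)) \<circ> eprod l = id" "eprod l \<circ> eprod (rev (map inv_elem l)) = id"
proof -
  have 1: "emap (inv_elem g) \<circ> emap g = id \<and> emap g \<circ> emap (inv_elem g) = id" if "\<exists>i j. eidx g = {i, j} \<and> i \<noteq> j" for g
    using that by (cases g) (auto simp: E_def Sg_def fun_eq_iff doubleton_eq_iff)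
  have "eprod (rev (map inv_elem l)) \<circ> eprod l = id \<and> eprod l \<circ> eprod (rev (map inv_elem l)) = id"
    using assms
  proof (induction l)
    case (Cons g l)
    let ?i = "eprod (rev (map inv_elem l))"
    have g: "emap (inv_elem g) \<circ> emap g = id" "emap g \<circ> emap (inv_elem g) = id" using 1[of g] Cons.prems by auto
    have "\<forall>g\<in>set l. \<exists>i j. eidx g = {i, j} \<and> i \<noteq> j" using Cons.prems by simp
    from Cons.IH[OF this] have l: "?i \<circ> eprod l = id" "eprod l \<circ> ?i = id" by blast+
    have "eprod (rev (map inv_elem (g # l))) \<circ> eprod (g # l) = ?i \<circ> (emap (inv_elem g) \<circ> emap g) \<circ> eprod l"
      by (simp add: comp_assoc)
    moreover have "eprod (g # l) \<circ> eprod (rev (map inv_elem (g # l))) = emap g \<circ> (eprod l \<circ> ?i) \<circ> emap (inv_elem g)"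
      by (simp add: comp_assoc)
    ultimately show ?case unfolding g l by (simp only: comp_id l g)
  qed simp
  thus "eprod (rev (map inv_elem l)) \<circ> eprod l = id" "eprod l \<circ> eprod (rev (map inv_elem l)) = id" by blast+
qed

context SL_presentation
begin

lemma cell_equal:
  assumes "0 \<le> C"
  shows "\<exists>K. \<forall>F L l l'. (\<forall>i j. i \<le> j \<longrightarrow> j < n \<longrightarrow> F i \<le> F j) \<longrightarrow> 0 < F 0 \<longrightarrow> F (n - 1) \<le> 2 ^ L * F 0 \<longrightarrow>
    (\<forall>g\<in>set l \<union> set l'. ewf g \<and> wbound F C g) \<longrightarrow> length l \<le> M \<longrightarrow> length l' \<le> M \<longrightarrow> eprod l = eprod l' \<longrightarrow>
    ar (ev l) (ev l') (K * Q L)"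
proof -
  obtain K where K: "\<And>F L l. (\<forall>i j. i \<le> j \<longrightarrow> j < n \<longrightarrow> F i \<le> F j) \<Longrightarrow> 0 < F 0 \<Longrightarrow> F (n - 1) \<le> 2 ^ L * F 0 \<Longrightarrow>
    (\<forall>g\<in>set l. ewf g \<and> wbound F C g) \<Longrightarrow> length l \<le> 2 * M \<Longrightarrow> eprod l = id \<Longrightarrow> ar (ev l) [] (K * Q L)"
    using cell_fill[OF assms, of "2 * M"] by blast
  show ?thesis
  proof (intro exI[of _ "2 * K"] allI impI)
    fix F :: "nat \<Rightarrow> real" and L l l'
    assume F: "\<forall>i j. i \<le> j \<longrightarrow> j < n \<longrightarrow> F i \<le> F j" "0 < F 0" "F (n - 1) \<le> 2 ^ L * F 0"
      and l: "\<forall>g\<in>set l \<union> set l'. ewf g \<and> wbound F C g" "length l \<le> M" "length l' \<le> M" "eprod l = eprod l'"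
    define l'' where "l'' = rev (map inv_elem l')"
    have ix: "\<exists>i j. eidx g = {i, j} \<and> i \<noteq> j" if "ewf g" for g using that by (cases g) (auto simp: rt_def)
    have i: "eprod l'' \<circ> eprod l' = id" "eprod l' \<circ> eprod l'' = id"
      unfolding l''_def by (rule eprod_inv_elems, use l(1) ix in blast)+
    have inv: "ewf (inv_elem g) \<and> wbound F C (inv_elem g)" if "ewf g \<and> wbound F C g" for g
      using that by (cases g) auto
    have g: "\<forall>g\<in>set (l @ l''). ewf g \<and> wbound F C g" "\<forall>g\<in>set (l'' @ l'). ewf g \<and> wbound F C g"
      using l(1) inv by (auto simp: l''_def)
    have len: "length (l @ l'') \<le> 2 * M" "length (l'' @ l') \<le> 2 * M" using l by (auto simp: l''_def)
    have 1: "ar (ev (l @ l'')) [] (K * Q L)" using i(2) l(4) by (intro K[OF F g(1) len(1)]) simp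
    have 2: "ar (ev (l'' @ l')) [] (K * Q L)" using i(1) by (intro K[OF F g(2) len(2)]) simp
    have w: "ev l \<in> words d" "ev l' \<in> words d" by (rule ev_words, use l(1) in blast)+
    have "ar (ev l @ ev (l'' @ l')) (ev l) (K * Q L)" using ar_appendL[OF 2 w(1)] by simp
    moreover have "ar (ev l @ ev (l'' @ l')) (ev l') (K * Q L)" using ar_appendR[OF 1 w(2)] by simp
    ultimately have "ar (ev l) (ev l') (K * Q L + K * Q L)" by (rule ar_trans[OF ar_sym])
    thus "ar (ev l) (ev l') (2 * K * Q L)" by (simp only: mult_2 distrib_right)
  qed
qed

lemma finite_letters: "finite {x. index x < d}"
proof (rule finite_subset)
  show "{x. index x < d} \<subseteq> Gen ` {..<d} \<union> GenInv ` {..<d}"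
  proof
    fix x assume "x \<in> {x. index x < d}"
    thus "x \<in> Gen ` {..<d} \<union> GenInv ` {..<d}" by (cases x) auto
  qed
qed auto

text \<open>For exchanging the letters of the relation with the top edges of the grid at constant
  cost.\<close>

lemma generator_words:
  "\<exists>K. \<forall>l x. index x < d \<longrightarrow> (\<forall>g\<in>set l. ewf g \<and> \<bar>coef g\<bar> \<le> c) \<longrightarrow> length l \<le> M \<longrightarrow> eprod l = act (val [x]) \<longrightarrow> ar [x] (ev l) K"
proof -
  let ?T = "{l. (\<forall>g\<in>set l. ewf g \<and> \<bar>coef g\<bar> \<le> c) \<and> length l \<le> M}"
  let ?X = "{x. index x < d}"
  have "finite ?X" by (rule finite_letters)
  hence "finite (ev ` ?T \<union> (\<lambda>x. [x]) ` ?X)" using finite_elem_lists by blast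
  moreover have "ev ` ?T \<union> (\<lambda>x. [x]) ` ?X \<subseteq> words d" using ev_words by auto
  ultimately obtain K where K: "\<forall>u \<in> ev ` ?T \<union> (\<lambda>x. [x]) ` ?X. \<forall>v \<in> ev ` ?T \<union> (\<lambda>x. [x]) ` ?X. val u = val v \<longrightarrow> ar u v K"
    by (rule ar_finite[THEN exE])
  show ?thesis
  proof (intro exI[of _ K] allI impI)
    fix l x assume x: "index x < d" and l: "\<forall>g\<in>set l. ewf g \<and> \<bar>coef g\<bar> \<le> c" "length l \<le> M" "eprod l = act (val [x])"
    have g: "\<forall>g\<in>set l. ewf g" using l(1) by blast
    have c: "val [x] \<in> carrier_mat n n" "val (ev l) \<in> carrier_mat n n"
      using val_closed[of "[x]"] val_closed[OF ev_words[OF g]] x SL_D(1) by auto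
    have "val [x] = val (ev l)" by (rule act_inj[OF c]) (simp only: act_val_ev[OF g] l(3))
    moreover have "[x] \<in> ev ` ?T \<union> (\<lambda>x. [x]) ` ?X" "ev l \<in> ev ` ?T \<union> (\<lambda>x. [x]) ` ?X" using x l by blast+
    ultimately show "ar [x] (ev l) K" using K by blast
  qed
qed

text \<open>The transition matrix and its inverse are both estimated with the weights of
  \<open>B\<close>. Comparing the norms and comparing the basis lengths contribute one factor
  \<open>A\<close> each.\<close>

lemma reduced_mat_step:
  assumes "1 \<le> C" "1 \<le> A"
  shows "\<exists>M C'. 0 \<le> C' \<and> (\<forall>f B f' B'. reduced_mat n C f B \<longrightarrow> reduced_mat n C f' B' \<longrightarrow> (\<forall>v. f' v \<le> A * f v) \<longrightarrow> (\<forall>v. f v \<le> A * f' v) \<longrightarrow>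
    (\<exists>l. (\<forall>g\<in>set l. ewf g \<and> wbound (wt f B) C' g) \<and> eprod l = act (SL_inv n B * B') \<and> length l \<le> M))"
proof -
  have CA: "0 \<le> C ^ 5 * A\<^sup>2" using assms by simp
  obtain M C' where M: "0 \<le> C'" "\<And>F X Y. \<forall>i j. i \<le> j \<longrightarrow> j < n \<longrightarrow> F i \<le> F j \<Longrightarrow> 0 < F 0 \<Longrightarrow> X \<in> SL n \<Longrightarrow> Y \<in> SL n \<Longrightarrow>
     X * Y = 1\<^sub>m n \<Longrightarrow> Y * X = 1\<^sub>m n \<Longrightarrow>
     \<forall>i<n. \<forall>j<n. \<bar>real_of_int (X $$ (i, j))\<bar> * F i \<le> C ^ 5 * A\<^sup>2 * F j \<and> \<bar>real_of_int (Y $$ (i, j))\<bar> * F i \<le> C ^ 5 * A\<^sup>2 * F j \<Longrightarrow>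
     \<exists>l. (\<forall>g\<in>set l. ewf g \<and> wbound F C' g) \<and> eprod l = act X \<and> length l \<le> M"
    using decomposition[OF CA] by blast
  show ?thesis
  proof (intro exI[of _ M] exI[of _ C'] conjI M(1) allI impI)
    fix f B f' B'
    assume r: "reduced_mat n C f B" and r': "reduced_mat n C f' B'" and le: "\<forall>v. f' v \<le> A * f v" "\<forall>v. f v \<le> A * f' v"
    note d = reduced_matD[OF r] and d' = reduced_matD[OF r']
    let ?X = "SL_inv n B * B'"
    let ?Y = "SL_inv n B' * B"
    have C0: "0 \<le> C" "0 \<le> A" using assms by auto
    have X: "?X \<in> SL n" "?Y \<in> SL n" using mult_SL SL_inv(1) d(1) d'(1) by blast+
    have XY: "?X * ?Y = 1\<^sub>m n" "?Y * ?X = 1\<^sub>m n"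
      using SL_quotient_chain[OF d(1) d'(1) d(1)] SL_quotient_chain[OF d'(1) d(1) d'(1)] SL_inv(3)[OF d(1)] SL_inv(3)[OF d'(1)] by simp_all
    show "\<exists>l. (\<forall>g\<in>set l. ewf g \<and> wbound (wt f B) C' g) \<and> eprod l = act ?X \<and> length l \<le> M"
    proof (rule M(2)[OF _ _ X XY], intro allI impI wt_mono, assumption)
      show "0 < wt f B 0" using wt_pos[OF r] n5 by simp
      show "\<forall>i<n. \<forall>j<n. \<bar>real_of_int (?X $$ (i, j))\<bar> * wt f B i \<le> C ^ 5 * A\<^sup>2 * wt f B j \<and> \<bar>real_of_int (?Y $$ (i, j))\<bar> * wt f B i \<le> C ^ 5 * A\<^sup>2 * wt f B j"
      proof (intro allI impI conjI)
        fix i j assume ij: "i < n" "j < n"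
        have cmp: "f' (mcol B' j) \<le> C ^ 3 * A * f (mcol B j)"
          by (rule reduced_mat_compare[OF r r' C0 _ ij(2)]) (use le in blast)
        have cmp': "f (mcol B i) \<le> C ^ 3 * A * f' (mcol B' i)"
          by (rule reduced_mat_compare[OF r' r C0 _ ij(1)]) (use le in blast)
        have "\<bar>real_of_int (?X $$ (i, j))\<bar> * wt f B i \<le> \<bar>real_of_int (?X $$ (i, j))\<bar> * (C * f (mcol B i))"
          by (intro mult_left_mono wt_le[OF r ij(1)]) auto
        also have "\<dots> = C * (\<bar>real_of_int (?X $$ (i, j))\<bar> * f (mcol B i))" by simp
        also have "\<dots> \<le> C * (C * f (mcol B' j))" by (intro mult_left_mono reduced_mat_coordinates[OF r d'(1) ij] C0)
        also have "\<dots> \<le> C * (C * (A * f' (mcol B' j)))" using le(2) C0 by (intro mult_left_mono) auto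
        also have "\<dots> \<le> C * (C * (A * (C ^ 3 * A * f (mcol B j))))" by (intro mult_left_mono cmp C0)
        also have "\<dots> \<le> C * (C * (A * (C ^ 3 * A * wt f B j)))" using C0 by (intro mult_left_mono wt_ge C0) auto
        also have "\<dots> = C ^ 5 * A\<^sup>2 * wt f B j" by (simp add: power2_eq_square eval_nat_numeral)
        finally show "\<bar>real_of_int (?X $$ (i, j))\<bar> * wt f B i \<le> C ^ 5 * A\<^sup>2 * wt f B j" .
        have "\<bar>real_of_int (?Y $$ (i, j))\<bar> * wt f B i \<le> \<bar>real_of_int (?Y $$ (i, j))\<bar> * (C * (C ^ 3 * A * f' (mcol B' i)))"
          by (intro mult_left_mono order_trans[OF wt_le[OF r ij(1)]] cmp' C0) auto
        also have "\<dots> = C ^ 4 * A * (\<bar>real_of_int (?Y $$ (i, j))\<bar> * f' (mcol B' i))" by (simp add: eval_nat_numeral)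
        also have "\<dots> \<le> C ^ 4 * A * (C * f' (mcol B j))" using C0 by (intro mult_left_mono reduced_mat_coordinates[OF r' d(1) ij]) auto
        also have "\<dots> \<le> C ^ 4 * A * (C * (A * f (mcol B j)))" using le(1) C0 by (intro mult_left_mono) auto
        also have "\<dots> \<le> C ^ 4 * A * (C * (A * wt f B j))" using C0 by (intro mult_left_mono wt_ge) auto
        also have "\<dots> = C ^ 5 * A\<^sup>2 * wt f B j" by (simp add: power2_eq_square eval_nat_numeral)
        finally show "\<bar>real_of_int (?Y $$ (i, j))\<bar> * wt f B i \<le> C ^ 5 * A\<^sup>2 * wt f B j" .
      qed
    qed
  qed
qed

text \<open>Used to measure all four edges of a cell with the weights of one corner.\<close>

lemma wbound_change:
  assumes "ewf g" "wbound F' c g" "0 \<le> c" "0 \<le> D" "\<And>i. i < n \<Longrightarrow> F i \<le> D * F' i" "\<And>i. i < n \<Longrightarrow> F' i \<le> D * F i"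
  shows "wbound F (D\<^sup>2 * c) g"
proof (cases g)
  case (EL i j x)
  have ij: "i < n" "j < n" "\<bar>real_of_int x\<bar> * F' i \<le> c * F' j" using assms(1,2) EL by (auto simp: rt_def)
  have "\<bar>real_of_int x\<bar> * F i \<le> \<bar>real_of_int x\<bar> * (D * F' i)" by (intro mult_left_mono assms ij) auto
  also have "\<dots> = D * (\<bar>real_of_int x\<bar> * F' i)" by simp
  also have "\<dots> \<le> D * (c * F' j)" by (intro mult_left_mono ij assms)
  also have "\<dots> \<le> D * (c * (D * F j))" by (intro mult_left_mono ij assms)
  finally show ?thesis using EL by (simp add: power2_eq_square mult_ac)
qed simp

text \<open>Each row is deformed to the one below by carrying a vertical edge across its m squares;
  the two sides account for the 2 in \<open>m + 2\<close>.\<close>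

lemma ar_grid:
  fixes hor ver :: "nat \<Rightarrow> nat \<Rightarrow> word"
  assumes sq: "\<And>k t. k < m \<Longrightarrow> t < T \<Longrightarrow> ar (hor k t @ ver (Suc k) t) (ver k t @ hor k (Suc t)) S"
    and left: "\<And>t. t < T \<Longrightarrow> ar (ver 0 t) [] S" and right: "\<And>t. t < T \<Longrightarrow> ar (ver m t) [] S"
    and bottom: "\<And>k. k < m \<Longrightarrow> ar (hor k 0) [] S"
    and hw: "\<And>k t. k < m \<Longrightarrow> t \<le> T \<Longrightarrow> hor k t \<in> words d"
  shows "ar (concat (map (\<lambda>k. hor k T) [0..<m])) [] (T * ((m + 2) * S) + m * S)"
proof -
  define row where "row = (\<lambda>k t. concat (map (\<lambda>k. hor k t) [0..<k]))"
  have row_words: "row k t \<in> words d" if "k \<le> m" "t \<le> T" for k t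
    using that by (induction k) (auto simp: row_def hw)
  have shift: "ar (row k t @ ver k t) (ver 0 t @ row k (Suc t)) (k * S)" if "k \<le> m" "t < T" for k t
    using that
  proof (induction k)
    case 0
    thus ?case using ar_words(1)[OF left[of t]] by (simp add: row_def)
  next
    case (Suc k)
    have "ar (row k t @ (hor k t @ ver (Suc k) t)) (row k t @ (ver k t @ hor k (Suc t))) S"
      using Suc.prems by (intro ar_appendL sq row_words) auto
    moreover have "ar ((row k t @ ver k t) @ hor k (Suc t)) ((ver 0 t @ row k (Suc t)) @ hor k (Suc t)) (k * S)"
      using Suc by (intro ar_appendR hw) auto
    ultimately have "ar (row k t @ (hor k t @ ver (Suc k) t)) ((ver 0 t @ row k (Suc t)) @ hor k (Suc t)) (S + k * S)"
      using ar_trans by simp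
    thus ?case by (simp add: row_def)
  qed
  have step: "ar (row m t) (row m (Suc t)) ((m + 2) * S)" if t: "t < T" for t
  proof -
    have "ar (row m t @ ver m t) (row m t) S" using ar_appendL[OF right[OF t] row_words[of m t]] t by simp
    note ar_sym[OF this]
    also have "ar (row m t @ ver m t) (ver 0 t @ row m (Suc t)) (m * S)" using t by (intro shift) auto
    also have "ar (ver 0 t @ row m (Suc t)) (row m (Suc t)) S" using ar_appendR[OF left[OF t] row_words[of m "Suc t"]] t by simp
    finally show ?thesis by (simp add: algebra_simps)
  qed
  have up: "ar (row m t) (row m 0) (t * ((m + 2) * S))" if "t \<le> T" for t
    using that
  proof (induction t)
    case 0
    thus ?case using row_words by simp
  next
    case (Suc t)
    from ar_trans[OF ar_sym[OF step[of t]] Suc.IH] Suc.prems show ?case by simp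
  qed
  have "ar (row k 0) [] (k * S)" if "k \<le> m" for k
    using that
  proof (induction k)
    case (Suc k)
    have "ar (row k 0 @ hor k 0) ([] @ []) (k * S + S)" using Suc by (intro ar_append bottom) auto
    thus ?case by (simp add: row_def add.commute)
  qed (simp add: row_def)
  from ar_trans[OF up[of T] this[of m]] show ?thesis by (simp add: row_def)
qed

end

section \<open>The grid of reduced bases for a relation\<close>

context SL_presentation
begin

lemma generator_bound:
  "\<exists>e\<ge>1. \<forall>x. index x < d \<longrightarrow> op_bound (val [x]) \<le> 2 ^ e \<and> op_bound (SL_inv n (val [x])) \<le> 2 ^ e"
proof -
  have op: "0 \<le> op_bound M" for M by (simp add: op_bound_def sum_nonneg)
  define b where "b = (\<lambda>x. op_bound (val [x]) + op_bound (SL_inv n (val [x])))"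
  define e where "e = Suc (nat \<lceil>\<Sum>x\<in>{x. index x < d}. b x\<rceil>)"
  have "op_bound (val [x]) \<le> 2 ^ e \<and> op_bound (SL_inv n (val [x])) \<le> 2 ^ e" if x: "index x < d" for x
  proof -
    have "b x \<le> (\<Sum>x\<in>{x. index x < d}. b x)"
      using finite_letters x op by (intro member_le_sum) (auto simp: b_def)
    also have "\<dots> \<le> real e" unfolding e_def by linarith
    also have "\<dots> \<le> 2 ^ e" by (rule less_imp_le[OF of_nat_less_two_power])
    finally have "b x \<le> 2 ^ e" .
    thus ?thesis using op[of "val [x]"] op[of "SL_inv n (val [x])"] unfolding b_def by linarith
  qed
  thus ?thesis by (intro exI[of _ e]) (simp add: e_def)
qed

lemma val_take_Suc:
  assumes "w \<in> words d" "k < length w"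
  shows "val (take (Suc k) w) = val (take k w) * val [w ! k]"
proof -
  have "take k w \<in> words d" "[w ! k] \<in> words d" using assms by (auto simp: words_def dest: in_set_takeD)
  thus ?thesis unfolding take_Suc_conv_app_nth[OF assms(2)] by (rule val_append)
qed

theorem quartic_filling: "\<exists>K. \<forall>w\<in>words d. val w = 1\<^sub>m n \<longrightarrow> ar w [] (K * (length w + 1) ^ 4)"
proof -
  obtain C0 where C0: "1 \<le> C0" "\<And>f. znorm n f \<Longrightarrow> \<exists>b. reduced_basis n C0 f b" using reduced_basis_exists[of n] by blast
  \<comment> \<open>The bases prescribed on the boundary are reduced with the constant 2.\<close>
  define C where "C = max 2 C0"
  have C: "2 \<le> C" "C0 \<le> C" "1 \<le> C" "0 \<le> C" by (auto simp: C_def)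
  have n0: "0 < n" "n - 1 < n" using n5 by auto
  have red: "\<exists>B. reduced_mat n C f B" if f: "znorm n f" for f
  proof -
    obtain b where "reduced_basis n C0 f b" using C0(2)[OF f] by blast
    then obtain B where "reduced_mat n C0 f B" using reduced_mat_of_basis[OF n0(1) f] by blast
    hence "reduced_mat n C f B" by (rule reduced_mat_mono) (rule C)
    thus ?thesis by blast
  qed
  obtain e where e: "1 \<le> e" "\<And>x. index x < d \<Longrightarrow> op_bound (val [x]) \<le> 2 ^ e" "\<And>x. index x < d \<Longrightarrow> op_bound (SL_inv n (val [x])) \<le> 2 ^ e"
    using generator_bound by blast
  \<comment> \<open>One factor for both directions of the grid: a generator changes the norms by at
    most \<open>2 ^ e\<close>, a change of t by at most 2, whence \<open>1 \<le> e\<close>.\<close>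
  define A :: real where "A = 2 ^ e"
  have "(2::real) ^ 1 \<le> 2 ^ e" using e(1) by (rule power_increasing) simp
  hence A: "2 \<le> A" "1 \<le> A" "0 \<le> A" by (auto simp: A_def)
  define good where "good = (\<lambda>M C' f B B' l. (\<forall>g\<in>set l. ewf g \<and> wbound (wt f B) C' g) \<and> eprod l = act (SL_inv n B * B') \<and> length l \<le> (M::nat))"
  obtain M C' where M: "0 \<le> C'" "\<And>f B f' B'. reduced_mat n C f B \<Longrightarrow> reduced_mat n C f' B' \<Longrightarrow> \<forall>v. f' v \<le> A * f v \<Longrightarrow> \<forall>v. f v \<le> A * f' v \<Longrightarrow>
    \<exists>l. good M C' f B B' l" using reduced_mat_step[OF C(3) A(2)] unfolding good_def by blast
  define D where "D = C ^ 4 * A"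
  have D: "0 \<le> D" using C A by (simp add: D_def)
  define C1 where "C1 = D\<^sup>2 * C'"
  have C1: "0 \<le> C1" using M(1) by (simp add: C1_def)
  obtain Kc where Kc: "\<And>F L l l'. \<forall>i j. i \<le> j \<longrightarrow> j < n \<longrightarrow> F i \<le> F j \<Longrightarrow> 0 < F 0 \<Longrightarrow> F (n - 1) \<le> 2 ^ L * F 0 \<Longrightarrow>
    \<forall>g\<in>set l \<union> set l'. ewf g \<and> wbound F C1 g \<Longrightarrow> length l \<le> 2 * M \<Longrightarrow> length l' \<le> 2 * M \<Longrightarrow> eprod l = eprod l' \<Longrightarrow>
    ar (ev l) (ev l') (Kc * Q L)" using cell_equal[OF C1, of "2 * M"] by blast
  define cc where "cc = max 1 \<lceil>C' * (2 * C)\<rceil>"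
  obtain Kg where Kg: "\<And>l x. index x < d \<Longrightarrow> \<forall>g\<in>set l. ewf g \<and> \<bar>coef g\<bar> \<le> cc \<Longrightarrow> length l \<le> M \<Longrightarrow> eprod l = act (val [x]) \<Longrightarrow> ar [x] (ev l) Kg"
    using generator_words[of cc M] by blast
  define c0 where "c0 = nat \<lceil>C ^ 7\<rceil>"
  have c0: "C ^ 7 \<le> 2 ^ c0"
  proof -
    have "C ^ 7 \<le> real c0" unfolding c0_def by linarith
    also have "\<dots> \<le> 2 ^ c0" by (rule less_imp_le[OF of_nat_less_two_power])
    finally show ?thesis .
  qed
  define q where "q = c0 + 2 * e + 2"
  define K where "K = Kg + (2 * e + 1) * (Kc * q\<^sup>2)"
  have "ar w [] (K * (length w + 1) ^ 4)" if w: "w \<in> words d" "val w = 1\<^sub>m n" for w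
  proof -
    define m where "m = length w"
    \<comment> \<open>Now \<open>2 ^ T\<close> exceeds the distortion of all prefixes and their
      inverses, so one summand of the norm dominates up to a factor 2 at t = 0 and the other at t =
      T. Taking m + 1 keeps T positive for the empty word.\<close>
    define T where "T = e * (m + 1)"
    have T0: "0 < T" using e(1) by (simp add: T_def)
    define P where "P = (\<lambda>k. val (take k w))"
    define N where "N = (\<lambda>k. SL_inv n (P k))"
    define f where "f = (\<lambda>k t. twonorm n (2 ^ t) (2 ^ (T - t)) (N k))"
    have f_eq: "f k t v = 2 ^ t * nrm n (act (N k) (rv v)) + 2 ^ (T - t) * nrm n (rv v)" for k t v
      by (simp add: f_def twonorm_def)
    have "take k w \<in> words d" for k using w(1) by (auto simp: words_def dest: in_set_takeD)
    hence P: "P k \<in> SL n" for k unfolding P_def by (rule val_closed)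
    have N: "N k \<in> SL n" for k unfolding N_def by (rule SL_inv(1)[OF P])
    note Pc = SL_D(1)[OF P] and Nc = SL_D(1)[OF N]
    have P0: "P 0 = 1\<^sub>m n" "P m = 1\<^sub>m n" using w(2) by (auto simp: P_def m_def)
    have gl: "index (w ! k) < d" if "k < m" for k using w(1) that by (auto simp: words_def m_def)
    have xSL: "val [w ! k] \<in> SL n" if "k < m" for k using gl[OF that] by (intro val_closed) simp
    note xc = SL_D(1)[OF xSL] and xi = SL_inv(1)[OF xSL] and xic = SL_D(1)[OF SL_inv(1)[OF xSL]]
    have PS: "P (Suc k) = P k * val [w ! k]" if "k < m" for k
      using val_take_Suc[OF w(1), of k] that by (simp add: P_def m_def)
    have NS: "N (Suc k) = SL_inv n (val [w ! k]) * N k" if "k < m" for k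
      unfolding N_def PS[OF that] by (rule SL_inv_mult[OF P xSL[OF that]])
    have NS': "N k = val [w ! k] * N (Suc k)" if k: "k < m" for k
    proof -
      have "val [w ! k] * N (Suc k) = (val [w ! k] * SL_inv n (val [w ! k])) * N k"
        unfolding NS[OF k] by (rule SL_assoc[OF xSL[OF k] xi[OF k] N, symmetric])
      thus ?thesis unfolding SL_inv(2)[OF xSL[OF k]] SL_one(1)[OF N] ..
    qed
    have opx: "nrm n (act (val [w ! k]) u) \<le> A * nrm n u" if k: "k < m" for k u
      using nrm_act_le[OF xc[OF k], of u] mult_right_mono[OF e(2)[OF gl[OF k]] nrm_nonneg[of n u]] by (simp add: A_def)
    have opxi: "nrm n (act (SL_inv n (val [w ! k])) u) \<le> A * nrm n u" if k: "k < m" for k u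
      using nrm_act_le[OF xic[OF k], of u] mult_right_mono[OF e(3)[OF gl[OF k]] nrm_nonneg[of n u]] by (simp add: A_def)
    have N_step: "nrm n (act (N (Suc k)) u) \<le> A * nrm n (act (N k) u)" if k: "k < m" for k u
      unfolding NS[OF k] act_mult[OF xic[OF k] Nc] comp_apply by (rule opxi[OF k])
    have N_step': "nrm n (act (N k) u) \<le> A * nrm n (act (N (Suc k)) u)" if k: "k < m" for k u
      using opx[OF k, of "act (N (Suc k)) u"] act_mult[OF xc[OF k] Nc[of "Suc k"]] NS'[OF k] by simp
    have growP: "nrm n (act (P k) u) \<le> A ^ k * nrm n u" if "k \<le> m" for k u
      using that
    proof (induction k arbitrary: u)
      case (Suc k)
      hence k: "k < m" by simp
      have "nrm n (act (P (Suc k)) u) = nrm n (act (P k) (act (val [w ! k]) u))"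
        unfolding PS[OF k] act_mult[OF Pc xc[OF k]] by simp
      also have "\<dots> \<le> A ^ k * nrm n (act (val [w ! k]) u)" using Suc by simp
      also have "\<dots> \<le> A ^ k * (A * nrm n u)" using A opx[OF k] by (intro mult_left_mono) auto
      finally show ?case by (simp add: mult_ac)
    qed (simp add: P0)
    have growN: "nrm n (act (N k) u) \<le> A ^ k * nrm n u" if "k \<le> m" for k u
      using that
    proof (induction k)
      case 0
      show ?case unfolding N_def P0 SL_inv_one by simp
    next
      case (Suc k)
      have "nrm n (act (N (Suc k)) u) \<le> A * nrm n (act (N k) u)" using Suc by (intro N_step) simp
      also have "\<dots> \<le> A * (A ^ k * nrm n u)" using Suc A by (intro mult_left_mono) auto
      finally show ?case by (simp add: mult_ac)
    qed
    have AT: "A ^ k \<le> 2 ^ T" if "k \<le> m" for k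
    proof -
      have "A ^ k = 2 ^ (e * k)" by (simp add: A_def power_mult)
      also have "\<dots> \<le> 2 ^ T" unfolding T_def using that by (intro power_increasing mult_le_mono2) auto
      finally show ?thesis .
    qed
    have leP: "nrm n (act (P k) u) \<le> 2 ^ T * nrm n u" and leN: "nrm n (act (N k) u) \<le> 2 ^ T * nrm n u" if "k \<le> m" for k u
      using growP[OF that, of u] growN[OF that, of u] mult_right_mono[OF AT[OF that] nrm_nonneg[of n u]] by linarith+
    have nPN: "nrm n v \<le> 2 ^ T * nrm n (act (N k) v)" if k: "k \<le> m" for k v
      using leP[OF k, of "act (N k) v"] fun_cong[OF SL_inv(4)[OF P[of k]], of v] by (simp add: N_def)

    \<comment> \<open>The basis is prescribed at the bottom, at the top and wherever the prefix is
      trivial, in particular for k = 0 and k = m; there the norm is conformal to the prescribed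
      matrix. Elsewhere it is chosen.\<close>
    define B where "B = (\<lambda>k t. if P k = 1\<^sub>m n \<or> t = 0 then 1\<^sub>m n else if t = T then P k else SOME B. reduced_mat n C (f k t) B)"
    have z: "znorm n (f k t)" for k t unfolding f_def by (rule znorm_twonorm[OF Nc]) simp_all
    have B: "reduced_mat n C (f k t) (B k t)" if k: "k \<le> m" for k t
    proof -
      consider "P k = 1\<^sub>m n" | "P k \<noteq> 1\<^sub>m n" "t = 0" | "P k \<noteq> 1\<^sub>m n" "t \<noteq> 0" "t = T" | "P k \<noteq> 1\<^sub>m n" "t \<noteq> 0" "t \<noteq> T" by blast
      thus ?thesis
      proof cases
        case 1
        hence N1: "N k = 1\<^sub>m n" by (simp add: N_def SL_inv_one)
        have "reduced_mat n 2 (f k t) (1\<^sub>m n)"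
          by (rule reduced_mat_conformal[OF one_SL z, of "2 ^ t + 2 ^ (T - t)"])
             (simp_all add: f_eq N1 SL_inv_one algebra_simps add_pos_pos)
        thus ?thesis using 1 C(1) by (simp add: B_def reduced_mat_mono)
      next
        case 2
        have "reduced_mat n 2 (f k t) (1\<^sub>m n)"
          by (rule reduced_mat_conformal[OF one_SL z, of "2 ^ T"]) (use leN[OF k] 2 in \<open>simp_all add: f_eq SL_inv_one\<close>)
        thus ?thesis using 2 C(1) by (simp add: B_def reduced_mat_mono)
      next
        case 3
        have "reduced_mat n 2 (f k t) (P k)"
          by (rule reduced_mat_conformal[OF P z, of "2 ^ T"]) (use nPN[OF k] 3 in \<open>simp_all add: f_eq N_def[symmetric] fun_cong[OF N_def, symmetric]\<close>)
        thus ?thesis using 3 C(1) by (simp add: B_def reduced_mat_mono)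
      next
        case 4
        have "reduced_mat n C (f k t) (SOME B. reduced_mat n C (f k t) B)" by (rule someI_ex[OF red[OF z]])
        thus ?thesis using 4 by (simp add: B_def)
      qed
    qed
    have fv: "f k (Suc t) v \<le> A * f k t v" "f k t v \<le> A * f k (Suc t) v" if t: "t < T" for k t v
    proof -
      have T2: "(2::real) ^ (T - t) = 2 * 2 ^ (T - Suc t)" using t by (metis Suc_diff_Suc power_Suc)
      define a b where "a = 2 ^ t * nrm n (act (N k) (rv v))" and "b = 2 ^ (T - Suc t) * nrm n (rv v)"
      have ab: "0 \<le> a" "0 \<le> b" by (simp_all add: a_def b_def)
      have e1: "f k (Suc t) v = 2 * a + b" and e2: "f k t v = a + 2 * b" unfolding f_eq T2 a_def b_def by simp_all
      have "2 * f k t v \<le> A * f k t v" "2 * f k (Suc t) v \<le> A * f k (Suc t) v"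
        by (rule mult_right_mono[OF A(1) znormD(5)[OF z]])+
      moreover have "f k (Suc t) v \<le> 2 * f k t v" "f k t v \<le> 2 * f k (Suc t) v" using ab by (simp_all add: e1 e2)
      ultimately show "f k (Suc t) v \<le> A * f k t v" "f k t v \<le> A * f k (Suc t) v" by linarith+
    qed
    have fh: "f (Suc k) t v \<le> A * f k t v" "f k t v \<le> A * f (Suc k) t v" if k: "k < m" for k t v
    proof -
      have b: "2 ^ (T - t) * nrm n (rv v) \<le> A * (2 ^ (T - t) * nrm n (rv v))"
        using mult_right_mono[OF A(2), of "2 ^ (T - t) * nrm n (rv v)"] by simp
      have "2 ^ t * nrm n (act (N (Suc k)) (rv v)) \<le> 2 ^ t * (A * nrm n (act (N k) (rv v)))"
        "2 ^ t * nrm n (act (N k) (rv v)) \<le> 2 ^ t * (A * nrm n (act (N (Suc k)) (rv v)))"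
        by (intro mult_left_mono N_step[OF k] N_step'[OF k]; simp)+
      thus "f (Suc k) t v \<le> A * f k t v" "f k t v \<le> A * f (Suc k) t v"
        using b unfolding f_eq distrib_left by (simp_all only: mult.left_commute[of A])
    qed
    have fr: "f k t v \<le> A * f k t v" for k t v
      using mult_right_mono[OF A(2) znormD(5)[OF z[of k t], of v]] by simp

    define lh where "lh = (\<lambda>k t. SOME l. good M C' (f k t) (B k t) (B (Suc k) t) l)"
    define lv where "lv = (\<lambda>k t. SOME l. good M C' (f k t) (B k t) (B k (Suc t)) l)"
    have lh: "good M C' (f k t) (B k t) (B (Suc k) t) (lh k t)" if k: "k < m" for k t
      unfolding lh_def by (rule someI_ex, rule M(2)[OF B B]) (use k fh[OF k] in auto)
    have lv: "good M C' (f k t) (B k t) (B k (Suc t)) (lv k t)" if k: "k \<le> m" "t < T" for k t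
      unfolding lv_def by (rule someI_ex, rule M(2)[OF B B]) (use k fv[OF k(2)] in auto)
    have wb: "\<forall>g\<in>set l. ewf g \<and> wbound (wt (f k t) (B k t)) C1 g"
      if "k \<le> m" "k' \<le> m" "\<And>v. f k' t' v \<le> A * f k t v" "\<And>v. f k t v \<le> A * f k' t' v" "good M C' (f k' t') (B k' t') B' l" for k t k' t' B' l
    proof
      fix g assume "g \<in> set l"
      hence g: "ewf g" "wbound (wt (f k' t') (B k' t')) C' g" using that(5) by (auto simp: good_def)
      have "wbound (wt (f k t) (B k t)) (D\<^sup>2 * C') g"
        by (rule wbound_change[OF g M(1) D]; unfold D_def;
            rule wt_compare[OF B[OF that(2)] B[OF that(1)] C(4) A(3) that(4)] wt_compare[OF B[OF that(1)] B[OF that(2)] C(4) A(3) that(3)])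
      thus "ewf g \<and> wbound (wt (f k t) (B k t)) C1 g" using g(1) by (simp add: C1_def)
    qed
    \<comment> \<open>The norms differ from the sum norm by a factor of at most
      \<open>2 ^ (2 * T + 1)\<close>. The weight costs one factor \<open>C\<close> and the two
      comparisons with the standard basis \<open>C ^ 3\<close> each; \<open>c0\<close> absorbs the
      product \<open>C ^ 7\<close>.\<close>
    define L where "L = c0 + (2 * T + 1)"
    have range: "wt (f k t) (B k t) (n - 1) \<le> 2 ^ L * wt (f k t) (B k t) 0" if k: "k \<le> m" "t \<le> T" for k t
    proof -
      define g where "g = (\<lambda>v. nrm n (rv v))"
      have "g = twonorm n 0 1 (1\<^sub>m n)" by (simp add: g_def twonorm_def fun_eq_iff)
      hence zg: "znorm n g" using znorm_twonorm[of "1\<^sub>m n" n 0 1] by simp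
      have "reduced_mat n 2 g (1\<^sub>m n)"
        by (rule reduced_mat_conformal[OF one_SL zg, of 1]) (simp_all add: g_def SL_inv_one)
      hence rg: "reduced_mat n C g (1\<^sub>m n)" by (rule reduced_mat_mono) (rule C)
      have g1: "g (mcol (1\<^sub>m n) j) = 1" if "j < n" for j
        using nrm_column[OF one_SL that] by (simp add: g_def SL_inv_one)
      have up: "f k t v \<le> 2 ^ (2 * T + 1) * g v" for v
      proof -
        have "2 ^ t * nrm n (act (N k) (rv v)) \<le> 2 ^ T * (2 ^ T * nrm n (rv v))"
          by (intro mult_mono power_increasing leN[OF k(1)]) (use k in simp_all)
        moreover have "2 ^ (T - t) * nrm n (rv v) \<le> (2 ^ T * 2 ^ T) * nrm n (rv v)"
        proof (rule mult_right_mono)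
          have "(2::real) ^ (T - t) \<le> 2 ^ (T + T)" by (rule power_increasing) auto
          thus "(2::real) ^ (T - t) \<le> 2 ^ T * 2 ^ T" by (simp add: power_add)
        qed simp
        ultimately have "f k t v \<le> 2 ^ T * (2 ^ T * nrm n (rv v)) + (2 ^ T * 2 ^ T) * nrm n (rv v)" unfolding f_eq by (rule add_mono)
        moreover have "2 * T + 1 = Suc (T + T)" by simp
        hence p: "(2::real) ^ (2 * T + 1) = 2 ^ T * 2 ^ T + 2 ^ T * 2 ^ T" by (simp only: power_Suc power_add mult_2)
        ultimately show ?thesis unfolding p g_def by (simp only: distrib_right mult.assoc)
      qed
      have low: "g v \<le> 1 * f k t v" for v
      proof -
        have "1 * nrm n (rv v) \<le> 2 ^ (T - t) * nrm n (rv v)" by (rule mult_right_mono) simp_all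
        hence "nrm n (rv v) \<le> f k t v" unfolding f_eq mult_1 by (intro add_increasing) simp_all
        thus ?thesis by (simp add: g_def)
      qed
      have "wt (f k t) (B k t) (n - 1) \<le> C * f k t (mcol (B k t) (n - 1))" by (rule wt_le[OF B[OF k(1)] n0(2)])
      also have "\<dots> \<le> C * (C ^ 3 * 2 ^ (2 * T + 1) * g (mcol (1\<^sub>m n) (n - 1)))"
        by (intro mult_left_mono reduced_mat_compare[OF rg B[OF k(1)] C(4) _ up n0(2)] C) simp
      also have "\<dots> = C ^ 4 * 2 ^ (2 * T + 1) * 1" unfolding g1[OF n0(2)] by (simp add: eval_nat_numeral)
      also have "\<dots> \<le> C ^ 4 * 2 ^ (2 * T + 1) * (C ^ 3 * f k t (mcol (B k t) 0))"
        using reduced_mat_compare[OF B[OF k(1)] rg C(4) _ low n0(1)] g1[OF n0(1)] C by (intro mult_left_mono) auto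
      also have "\<dots> = C ^ 7 * (2 ^ (2 * T + 1) * f k t (mcol (B k t) 0))" by (simp add: eval_nat_numeral)
      also have "\<dots> \<le> 2 ^ c0 * (2 ^ (2 * T + 1) * f k t (mcol (B k t) 0))"
        using znormD(5)[OF z] by (intro mult_right_mono c0) simp
      also have "\<dots> \<le> 2 ^ c0 * (2 ^ (2 * T + 1) * wt (f k t) (B k t) 0)" by (intro mult_left_mono wt_ge) auto
      also have "\<dots> = 2 ^ L * wt (f k t) (B k t) 0" by (simp add: L_def power_add)
      finally show ?thesis .
    qed
    define S where "S = Kc * Q L"
    have cell: "ar (ev l) (ev l') S" if "k \<le> m" "t \<le> T" "\<forall>g\<in>set l \<union> set l'. ewf g \<and> wbound (wt (f k t) (B k t)) C1 g"
      "length l \<le> 2 * M" "length l' \<le> 2 * M" "eprod l = eprod l'" for k t l l'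
      unfolding S_def by (rule Kc[OF _ wt_pos[OF B[OF that(1)] n0(1)] range[OF that(1,2)] that(3-6)]) (simp add: wt_mono)
    have BSL: "B k t \<in> SL n" if "k \<le> m" for k t by (rule reduced_matD(1)[OF B[OF that]])
    have trivial: "ar (ev l) [] S" if "k \<le> m" "t \<le> T" "good M C' (f k t) (B k t) (B k t) l" for k t l
    proof -
      have "eprod l = eprod []" using that(3) SL_inv(3)[OF BSL[OF that(1)]] by (simp add: good_def)
      from cell[OF that(1,2) _ _ _ this] wb[OF that(1,1) fr fr that(3)] that(3) show ?thesis by (simp add: good_def)
    qed
    have B_triv: "B 0 t = B 0 t'" "B m t = B m t'" "B k 0 = 1\<^sub>m n" "B k T = P k" for k t t' using P0 T0 by (auto simp: B_def)
    have "ar (concat (map (\<lambda>k. ev (lh k T)) [0..<m])) [] (T * ((m + 2) * S) + m * S)"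
    proof (rule ar_grid[where ver = "\<lambda>k t. ev (lv k t)" and hor = "\<lambda>k t. ev (lh k t)"])
      fix k t assume kt: "k < m" "t < T"
      hence k: "k \<le> m" "Suc k \<le> m" by auto
      note g1 = lh[OF kt(1), of t] and g2 = lv[OF k(2) kt(2)] and g3 = lv[OF k(1) kt(2)] and g4 = lh[OF kt(1), of "Suc t"]
      have "ar (ev (lh k t @ lv (Suc k) t)) (ev (lv k t @ lh k (Suc t))) S"
      proof (rule cell[of k t])
        show "\<forall>g\<in>set (lh k t @ lv (Suc k) t) \<union> set (lv k t @ lh k (Suc t)). ewf g \<and> wbound (wt (f k t) (B k t)) C1 g"
          using wb[OF k(1,1) fr fr g1] wb[OF k fh[OF kt(1)] g2] wb[OF k(1,1) fr fr g3] wb[OF k(1,1) fv[OF kt(2)] g4]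
          unfolding set_append by blast
        have c: "B k t \<in> SL n" "B (Suc k) t \<in> SL n" "B (Suc k) (Suc t) \<in> SL n" "B k (Suc t) \<in> SL n" using BSL k by auto
        have q: "SL_inv n X * Y \<in> carrier_mat n n" if "X \<in> SL n" "Y \<in> SL n" for X Y using mult_SL[OF SL_inv(1)] that SL_D(1) by blast
        have "eprod (lh k t @ lv (Suc k) t) = act (SL_inv n (B k t) * B (Suc k) (Suc t))"
          using g1 g2 act_mult[OF q[OF c(1,2)] q[OF c(2,3)]] SL_quotient_chain[OF c(1,2,3)] by (simp add: good_def)
        moreover have "eprod (lv k t @ lh k (Suc t)) = act (SL_inv n (B k t) * B (Suc k) (Suc t))"
          using g3 g4 act_mult[OF q[OF c(1,4)] q[OF c(4,3)]] SL_quotient_chain[OF c(1,4,3)] by (simp add: good_def)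
        ultimately show "eprod (lh k t @ lv (Suc k) t) = eprod (lv k t @ lh k (Suc t))" by simp
      qed (use k kt g1 g2 g3 g4 in \<open>auto simp: good_def\<close>)
      thus "ar (ev (lh k t) @ ev (lv (Suc k) t)) (ev (lv k t) @ ev (lh k (Suc t))) S" by simp
    next
      fix t assume t: "t < T"
      show "ar (ev (lv 0 t)) [] S" using lv[of 0 t] t B_triv(1)[of "Suc t" t] by (intro trivial[of 0 t]) auto
      show "ar (ev (lv m t)) [] S" using lv[of m t] t B_triv(2)[of "Suc t" t] by (intro trivial[of m t]) auto
    next
      fix k assume "k < m"
      thus "ar (ev (lh k 0)) [] S" using lh[of k 0] B_triv(3) by (intro trivial[of k 0]) auto
    next
      fix k t assume "k < m"
      thus "ev (lh k t) \<in> words d" using lh[of k t] by (intro ev_words) (auto simp: good_def)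
    qed
    \<comment> \<open>At t = T all weights lie between \<open>2 ^ T\<close> and
      \<open>2 * C * 2 ^ T\<close>; so the weighted bounds become absolute ones, and the words for
      the top edges are bounded.\<close>
    moreover have top: "ar [w ! k] (ev (lh k T)) Kg" if k: "k < m" for k
    proof (rule Kg[OF gl[OF k]])
      note g = lh[OF k, of T]
      have km: "k \<le> m" using k by simp
      show "length (lh k T) \<le> M" using g by (simp add: good_def)
      have "SL_inv n (P k) * P (Suc k) = val [w ! k]"
        using SL_assoc[OF SL_inv(1)[OF P] P xSL[OF k], of k k] SL_inv(3)[OF P, of k] SL_one(1)[OF xSL[OF k]] PS[OF k] by simp
      thus "eprod (lh k T) = act (val [w ! k])" using g by (simp add: good_def B_triv)
      have fT: "f k T (mcol (P k) j) = 2 ^ T + nrm n (rv (mcol (P k) j))" if "j < n" for j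
        unfolding f_eq using nrm_column[OF P that, of k] by (simp add: N_def)
      have lo: "2 ^ T \<le> wt (f k T) (B k T) j" if "j < n" for j
        using fT[OF that] wt_ge[of "f k T" "B k T" j] nrm_nonneg[of n "rv (mcol (P k) j)"] unfolding B_triv by linarith
      have hi: "wt (f k T) (B k T) j \<le> 2 * C * 2 ^ T" if j: "j < n" for j
      proof -
        have "nrm n (rv (mcol (P k) j)) \<le> 2 ^ T * nrm n (act (N k) (rv (mcol (P k) j)))" by (rule nPN[OF km])
        also have "\<dots> = 2 ^ T" using nrm_column[OF P j, of k] by (simp add: N_def)
        finally have "f k T (mcol (B k T) j) \<le> 2 * 2 ^ T" using fT[OF j] unfolding B_triv by linarith
        from mult_left_mono[OF this C(4)] wt_le[OF B[OF km] j, of T] show ?thesis by simp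
      qed
      show "\<forall>g\<in>set (lh k T). ewf g \<and> \<bar>coef g\<bar> \<le> cc"
      proof
        fix g' assume "g' \<in> set (lh k T)"
        hence g': "ewf g'" "wbound (wt (f k T) (B k T)) C' g'" using g by (auto simp: good_def)
        have "\<bar>coef g'\<bar> \<le> cc"
        proof (cases g')
          case (EL i j x)
          hence ij: "i < n" "j < n" "\<bar>real_of_int x\<bar> * wt (f k T) (B k T) i \<le> C' * wt (f k T) (B k T) j" using g' by (auto simp: rt_def)
          have "\<bar>real_of_int x\<bar> * 2 ^ T \<le> \<bar>real_of_int x\<bar> * wt (f k T) (B k T) i" by (intro mult_left_mono lo ij) simp
          also have "\<dots> \<le> C' * (2 * C * 2 ^ T)" using mult_left_mono[OF hi[OF ij(2)] M(1)] ij(3) by linarith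
          finally have "\<bar>real_of_int x\<bar> * 2 ^ T \<le> (C' * (2 * C)) * 2 ^ T" by (simp add: mult_ac)
          hence "\<bar>real_of_int x\<bar> \<le> C' * (2 * C)" by (rule mult_right_le_imp_le) simp
          hence "\<bar>x\<bar> \<le> \<lceil>C' * (2 * C)\<rceil>" by linarith
          thus ?thesis using EL by (simp add: cc_def)
        qed (simp add: cc_def)
        thus "ewf g' \<and> \<bar>coef g'\<bar> \<le> cc" using g'(1) by blast
      qed
    qed
    have "ar (take k w) (concat (map (\<lambda>k. ev (lh k T)) [0..<k])) (k * Kg)" if "k \<le> m" for k
      using that
    proof (induction k)
      case (Suc k)
      hence "ar (take k w @ [w ! k]) (concat (map (\<lambda>k. ev (lh k T)) [0..<k]) @ ev (lh k T)) (k * Kg + Kg)"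
        by (intro ar_append top) auto
      thus ?case using Suc.prems by (simp add: take_Suc_conv_app_nth m_def add.commute)
    qed simp
    from this[of m] have "ar w (concat (map (\<lambda>k. ev (lh k T)) [0..<m])) (m * Kg)" by (simp add: m_def)
    ultimately have area: "ar w [] (m * Kg + (T * ((m + 2) * S) + m * S))" by (metis ar_trans)
    \<comment> \<open>\<open>L\<close> is linear in m, so a cell costs a quadratic amount; the
      number of cells is also quadratic.\<close>
    have "L + 1 \<le> q * (m + 1)" by (simp add: L_def q_def T_def algebra_simps)
    hence "Q L \<le> (q * (m + 1))\<^sup>2" by (rule power_mono) simp
    hence "Q L \<le> q\<^sup>2 * (m + 1)\<^sup>2" unfolding power_mult_distrib .
    hence S: "S \<le> Kc * q\<^sup>2 * (m + 1)\<^sup>2" unfolding S_def mult.assoc by (rule mult_le_mono2)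
    have "T * (m + 2) + m \<le> (2 * e + 1) * (m + 1)\<^sup>2" using e(1) by (simp add: T_def power2_eq_square algebra_simps)
    from mult_le_mono[OF this S] have "(T * (m + 2) + m) * S \<le> (2 * e + 1) * (Kc * q\<^sup>2) * ((m + 1)\<^sup>2 * (m + 1)\<^sup>2)"
      by (simp only: mult_ac)
    hence "(T * (m + 2) + m) * S \<le> (2 * e + 1) * (Kc * q\<^sup>2) * (m + 1) ^ 4"
      unfolding power_add[symmetric] by simp
    moreover have "m * Kg \<le> Kg * (m + 1) ^ 4"
    proof -
      have "m \<le> (m + 1) ^ 1" by simp
      also have "\<dots> \<le> (m + 1) ^ 4" by (rule power_increasing) auto
      finally show ?thesis by (simp add: mult.commute)
    qed
    ultimately have "m * Kg + (T * (m + 2) + m) * S \<le> Kg * (m + 1) ^ 4 + (2 * e + 1) * (Kc * q\<^sup>2) * (m + 1) ^ 4"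
      by (rule add_mono[rotated])
    also have "\<dots> = K * (m + 1) ^ 4" unfolding K_def by (rule distrib_right[symmetric])
    also have "m * Kg + (T * (m + 2) + m) * S = m * Kg + (T * ((m + 2) * S) + m * S)" by (simp only: distrib_right mult.assoc)
    finally have "m * Kg + (T * ((m + 2) * S) + m * S) \<le> K * (m + 1) ^ 4" .
    with area show ?thesis unfolding m_def by (rule ar_mono)
  qed
  thus ?thesis by blast
qed

lemma dehn_quartic: "coarsely_le (dehn_function (SL_int n) d h R) (\<lambda>l. l ^ 4)"
proof -
  obtain K where K: "\<And>w. w \<in> words d \<Longrightarrow> val w = 1\<^sub>m n \<Longrightarrow> ar w [] (K * (length w + 1) ^ 4)"
    using quartic_filling by blast
  show ?thesis unfolding coarsely_le_def
  proof (intro exI[of _ "K + 1"] allI)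
    fix l
    obtain w where w: "w \<in> words d" "val w = 1\<^sub>m n" "length w \<le> l" "dehn_function (SL_int n) d h R l = filling_area d R w"
      using dehn_function_attained[of d "SL_int n" h l R] by auto
    obtain k where k: "k \<le> K * (length w + 1) ^ 4" "transforms d R w [] k" using K[OF w(1,2)] by (auto simp: ar_def)
    have "filling_area d R w \<le> k" unfolding filling_area_def using k(2) by (rule Least_le)
    also note k(1)
    also have "K * (length w + 1) ^ 4 \<le> (K + 1) * ((K + 1) * l + (K + 1)) ^ 4"
      using w(3) by (intro mult_mono power_mono) auto
    finally show "dehn_function (SL_int n) d h R l \<le> (K + 1) * ((K + 1) * l + (K + 1)) ^ 4 + (K + 1)" using w(4) by simp
  qed
qed

end

theorem theorem1:
  fixes n d :: nat and h :: "nat \<Rightarrow> int mat" and R :: "word set"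
  assumes "n \<ge> 5"
    and "finite_presentation (SL_int n) d h R"
  shows "coarsely_le (dehn_function (SL_int n) d h R) (\<lambda>l. l ^ 4)"
proof -
  interpret SL_presentation n d h R using assms by unfold_locales
  show ?thesis by (rule dehn_quartic)
qed

end
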